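(* Let $T$ be a self-adjoint restriction of $T_{\rm max}$ (i.e. $T=T^*\subset T_{\rm max}$). Then for every $x\in(a,b)$ and every $\lambda\in\varrho(T)$ there exists an ($n\times n$) matrix-valued function $G(x,\cdot,\lambda)$ on $(a,b)$ such that the columns of $G(x,\cdot,\lambda)^*$ are in $L^2(w)$ and $$(\mathcal R_\lambda[f])(x)=\int G(x,\cdot,\lambda)\,w f\qquad\text{for all }[f]\in L^2(w).$$
   Context: Let $(a,b)$ be a real (possibly unbounded) interval and $n\in\mathbb N$. Distributions of order $0$ on $(a,b)$ are distributional derivatives of functions of locally bounded variation; they are identified with (complex) measures on compact subsets of $(a,b)$. Let $J$ be a constant, invertible, skew-Hermitian $n\times n$-matrix, and let $q,w$ be $n\times n$-matrices of distributions of order $0$ on $(a,b)$ with $q$ Hermitian and $w$ non-negative. If $r$ is a distribution of order $0$ with anti-derivative $R$ put $\Delta_r(x)=R^+(x)-R^-(x)$ (the mass at $\{x\}$), where superscripts $\pm$ denote right- and left-hand limits. Put $B_\pm(x,\lambda)=J\pm\frac12(\Delta_q(x)-\lambda\Delta_w(x))$ and $\Xi_0=\{x\in(a,b):\det B_+(x,0)\det B_-(x,0)=0\}$, which is a discrete set. A function $u$ of locally bounded variation is balanced if $u=(u^++u^-)/2$; $\operatorname{BV}^\#_{\rm loc}((a,b))$ is the space of balanced functions of locally bounded variation. $\mathcal L^2(w)$ is the space of ($\mathbb C^n$-valued) functions with $\int f^*wf<\infty$, with semi-inner product $\langle f,g\rangle=\int f^*wg$; $L^2(w)$ is its Hilbert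 space quotient modulo $\{u:\|u\|^2=\int u^*wu=0\}$, and $[u]$ denotes the class of $u$. Put $$\mathcal T_{\rm max}=\{(u,f)\in\mathcal L^2(w)\times\mathcal L^2(w): u\in\operatorname{BV}^\#_{\rm loc}((a,b))^n,\ Ju'+qu=wf\}$$ (equation in the sense of distributions) and $T_{\rm max}=\{([u],[f])\in L^2(w)\times L^2(w):(u,f)\in\mathcal T_{\rm max}\}$. The adjoint of a linear relation $T\subset L^2(w)\times L^2(w)$ is $T^*=\{(v,g):\langle v,f\rangle=\langle g,u\rangle\text{ for all }(u,f)\in T\}$. The resolvent set is $\varrho(T)=\{\lambda\in\mathbb C:\ker(T-\lambda)=\{0\},\ \operatorname{ran}(T-\lambda)=L^2(w)\}$, where $T-\lambda=\{(u,f-\lambda u):(u,f)\in T\}$, and for $\lambda\in\varrho(T)$ the resolvent $R_\lambda=(T-\lambda)^{-1}$ is a bounded linear operator on $L^2(w)$. Choice of representatives. Let $\mathcal L_0=\{u\in\operatorname{BV}^\#_{\rm loc}((a,b))^n: Ju'+qu=0,\ \|u\|=0\}$. Let $(\tau_k)_{k\in\mathbb Z}$ be a strictly increasing sequence in $(a,b)$ with $a$ and $b$ as its only limit points, with $\Xi_0\subset\{\tau_k:k\in\mathbb Z\}$, and such that $B_+(\tau_0,0)=B_-(\tau_0,0)=J$ and $\Delta_w(\tau_0)=0$, so that solutions of the differential equations are continuous at $\tau_0$. Let $N_0=\{h(\tau_0):h\in\mathcal L_0\}$ and, for $k\in\mathbb N$, $N_k=\{h^+(\tau_k):h\in\mathcal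 L_0,\ \operatorname{supp}h\subset[\tau_k,b)\}$ and $N_{-k}=\{h^-(\tau_{-k}):h\in\mathcal L_0,\ \operatorname{supp}h\subset(a,\tau_{-k}]\}$. For $k\ge0$, $u\in\operatorname{BV}^\#_{\rm loc}((a,b))^n$ satisfies condition $(\pm k)$ if $u^\pm(\tau_{\pm k})$ is perpendicular to $N_{\pm k}$ (always the upper or always the lower sign). For each $([u],[f])\in T_{\rm max}$ there is a unique balanced $v\in[u]$ with $(v,f)\in\mathcal T_{\rm max}$ satisfying condition $(k)$ for every $k\in\mathbb Z$; put $E([u],[f])=v$. Finally, for $\lambda\in\varrho(T)$, $\mathcal R_\lambda:L^2(w)\to\operatorname{BV}^\#_{\rm loc}((a,b))^n$ is $\mathcal R_\lambda[f]=E\big((R_\lambda[f],\lambda R_\lambda[f]+[f])\big)$; i.e. $\mathcal R_\lambda[f]$ is the representative of $R_\lambda[f]$ that solves $Ju'+qu=w(\lambda u+f)$ and satisfies condition $(k)$ for every $k\in\mathbb Z$. *)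

theory Defs
  imports "HOL-Analysis.Analysis"
begin

text \<open>
  Throughout, \<open>I\<close> is the open interval \<open>(a,b)\<close>.  Functions on \<open>I\<close> are represented by total
  functions on the real line, and the spectral parameter is called \<open>\<zeta>\<close>.
\<close>

subsection \<open>Complex vectors and matrices\<close>

definition cdot :: "complex^'n \<Rightarrow> complex^'n \<Rightarrow> complex" where
  "cdot x y = (\<Sum>i\<in>UNIV. cnj (x $ i) * y $ i)"

definition adj :: "complex^'n^'m \<Rightarrow> complex^'m^'n" where
  "adj A = (\<chi> i j. cnj (A $ j $ i))"

subsection \<open>Distributions of order zero\<close>

text \<open>
  A matrix of distributions of order \<open>0\<close> on \<open>I\<close> is identified with a set function \<open>r\<close> which
  is a (complex-matrix-valued) measure on the Borel subsets of each compact subset of \<open>I\<close>.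
  Values of \<open>r\<close> on other sets are irrelevant.
\<close>

definition local_borel :: "real set \<Rightarrow> real set set" where
  "local_borel I = {A \<in> sets borel. \<exists>K. compact K \<and> K \<subseteq> I \<and> A \<subseteq> K}"

definition order0_distr :: "real set \<Rightarrow> (real set \<Rightarrow> complex^'n^'n) \<Rightarrow> bool" where
  "order0_distr I r \<longleftrightarrow>
     (\<forall>K. compact K \<and> K \<subseteq> I \<longrightarrow>
       (\<forall>A :: nat \<Rightarrow> real set. range A \<subseteq> sets borel \<and> disjoint_family A \<and> (\<Union>i. A i) \<subseteq> K \<longrightarrow>
          (\<lambda>i. r (A i)) sums r (\<Union>i. A i)))"

definition hermitian_distr :: "real set \<Rightarrow> (real set \<Rightarrow> complex^'n^'n) \<Rightarrow> bool" where
  "hermitian_distr I r \<longleftrightarrow> (\<forall>A\<in>local_borel I. adj (r A) = r A)"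

definition nonneg_distr :: "real set \<Rightarrow> (real set \<Rightarrow> complex^'n^'n) \<Rightarrow> bool" where
  "nonneg_distr I r \<longleftrightarrow> (\<forall>A\<in>local_borel I. \<forall>z. cdot z (r A *v z) \<in> \<real>\<^sub>\<ge>\<^sub>0)"

definition jump :: "(real set \<Rightarrow> complex^'n^'n) \<Rightarrow> real \<Rightarrow> complex^'n^'n" where
  "jump r x = r {x}"

text \<open>
  Integration with respect to \<open>r\<close> goes through a density \<open>H\<close> of \<open>r\<close> with respect to a positive,
  locally finite measure \<open>\<mu>\<close> (for instance the total variation of \<open>r\<close>).  Such a pair exists by
  the Radon-Nikodym theorem, and the integrals below do not depend on its choice, since two
  densities agree almost everywhere after passing to a common dominating measure.
\<close>

definition represents ::
  "real set \<Rightarrow> (real set \<Rightarrow> complex^'n^'n) \<Rightarrow> real measure \<Rightarrow> (real \<Rightarrow> complex^'n^'n) \<Rightarrow> bool" where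
  "represents I r \<mu> H \<longleftrightarrow>
     sets \<mu> = sets borel \<and> H \<in> borel_measurable borel \<and>
     (\<forall>K. compact K \<and> K \<subseteq> I \<longrightarrow> emeasure \<mu> K < \<infinity> \<and> set_integrable \<mu> K H) \<and>
     (\<forall>A\<in>local_borel I. r A = (LINT x:A|\<mu>. H x))"

definition representation ::
  "real set \<Rightarrow> (real set \<Rightarrow> complex^'n^'n) \<Rightarrow> real measure \<times> (real \<Rightarrow> complex^'n^'n)" where
  "representation I r = (SOME p. represents I r (fst p) (snd p))"

definition base_measure :: "real set \<Rightarrow> (real set \<Rightarrow> complex^'n^'n) \<Rightarrow> real measure" where
  "base_measure I r = fst (representation I r)"

definition density_mat :: "real set \<Rightarrow> (real set \<Rightarrow> complex^'n^'n) \<Rightarrow> real \<Rightarrow> complex^'n^'n" where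
  "density_mat I r = snd (representation I r)"

subsection \<open>Balanced functions of locally bounded variation\<close>

definition bounded_variation_on :: "real set \<Rightarrow> (real \<Rightarrow> complex^'n) \<Rightarrow> bool" where
  "bounded_variation_on S u \<longleftrightarrow>
     (\<exists>M. \<forall>(t :: nat \<Rightarrow> real) N. mono_on {..N} t \<and> t ` {..N} \<subseteq> S \<longrightarrow>
        (\<Sum>i<N. norm (u (t (Suc i)) - u (t i))) \<le> M)"

definition right_lim :: "(real \<Rightarrow> complex^'n) \<Rightarrow> real \<Rightarrow> complex^'n" where
  "right_lim u x = Lim (at_right x) u"

definition left_lim :: "(real \<Rightarrow> complex^'n) \<Rightarrow> real \<Rightarrow> complex^'n" where
  "left_lim u x = Lim (at_left x) u"

text \<open>Extending by zero outside \<open>I\<close> makes a function on \<open>I\<close> a unique total function.\<close>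

definition BV_sharp :: "real set \<Rightarrow> (real \<Rightarrow> complex^'n) set" where
  "BV_sharp I =
     {u. (\<forall>c d. {c..d} \<subseteq> I \<longrightarrow> bounded_variation_on {c..d} u) \<and>
         (\<forall>x\<in>I. u x = (1/2) *\<^sub>R (right_lim u x + left_lim u x)) \<and>
         (\<forall>x. x \<notin> I \<longrightarrow> u x = 0)}"

subsection \<open>The space \<open>L\<^sup>2(w)\<close>\<close>

definition L2_sqnorm :: "real set \<Rightarrow> (real set \<Rightarrow> complex^'n^'n) \<Rightarrow> (real \<Rightarrow> complex^'n) \<Rightarrow> ennreal" where
  "L2_sqnorm I w f =
     (\<integral>\<^sup>+x\<in>I. ennreal (Re (cdot (f x) (density_mat I w x *v f x))) \<partial>base_measure I w)"

definition L2_fun :: "real set \<Rightarrow> (real set \<Rightarrow> complex^'n^'n) \<Rightarrow> (real \<Rightarrow> complex^'n) set" where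
  "L2_fun I w = {f. set_borel_measurable borel I f \<and> L2_sqnorm I w f < \<infinity>}"

definition L2_inner ::
  "real set \<Rightarrow> (real set \<Rightarrow> complex^'n^'n) \<Rightarrow> (real \<Rightarrow> complex^'n) \<Rightarrow> (real \<Rightarrow> complex^'n) \<Rightarrow> complex" where
  "L2_inner I w f g = (LINT x:I|base_measure I w. cdot (f x) (density_mat I w x *v g x))"

text \<open>The quotient: elements are equivalence classes, and operations act on representatives.\<close>

type_synonym 'n l2 = "(real \<Rightarrow> complex^'n) set"

definition L2_class :: "real set \<Rightarrow> (real set \<Rightarrow> complex^'n^'n) \<Rightarrow> (real \<Rightarrow> complex^'n) \<Rightarrow> 'n l2" where
  "L2_class I w u = {v \<in> L2_fun I w. L2_sqnorm I w (\<lambda>x. v x - u x) = 0}"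

definition L2_space :: "real set \<Rightarrow> (real set \<Rightarrow> complex^'n^'n) \<Rightarrow> 'n l2 set" where
  "L2_space I w = L2_class I w ` L2_fun I w"

definition L2_rep :: "'n l2 \<Rightarrow> real \<Rightarrow> complex^'n" where
  "L2_rep U = (SOME u. u \<in> U)"

definition L2_zero :: "real set \<Rightarrow> (real set \<Rightarrow> complex^'n^'n) \<Rightarrow> 'n l2" where
  "L2_zero I w = L2_class I w (\<lambda>x. 0)"

definition L2_add :: "real set \<Rightarrow> (real set \<Rightarrow> complex^'n^'n) \<Rightarrow> 'n l2 \<Rightarrow> 'n l2 \<Rightarrow> 'n l2" where
  "L2_add I w U V = L2_class I w (\<lambda>x. L2_rep U x + L2_rep V x)"

definition L2_scale :: "real set \<Rightarrow> (real set \<Rightarrow> complex^'n^'n) \<Rightarrow> complex \<Rightarrow> 'n l2 \<Rightarrow> 'n l2" where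
  "L2_scale I w c U = L2_class I w (\<lambda>x. c *s L2_rep U x)"

definition L2_cinner :: "real set \<Rightarrow> (real set \<Rightarrow> complex^'n^'n) \<Rightarrow> 'n l2 \<Rightarrow> 'n l2 \<Rightarrow> complex" where
  "L2_cinner I w U V = L2_inner I w (L2_rep U) (L2_rep V)"

subsection \<open>The differential equation\<close>

definition test_function :: "real set \<Rightarrow> (real \<Rightarrow> real) \<Rightarrow> bool" where
  "test_function I \<phi> \<longleftrightarrow>
     (\<forall>k. (deriv ^^ k) \<phi> differentiable_on UNIV) \<and>
     compact (closure {x. \<phi> x \<noteq> 0}) \<and> closure {x. \<phi> x \<noteq> 0} \<subseteq> I"

definition distr_deriv :: "real set \<Rightarrow> (real \<Rightarrow> complex^'n) \<Rightarrow> (real \<Rightarrow> real) \<Rightarrow> complex^'n" where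
  "distr_deriv I u \<phi> = - (LINT x:I|lborel. deriv \<phi> x *\<^sub>R u x)"

definition distr_mult ::
  "real set \<Rightarrow> (real set \<Rightarrow> complex^'n^'n) \<Rightarrow> (real \<Rightarrow> complex^'n) \<Rightarrow> (real \<Rightarrow> real) \<Rightarrow> complex^'n" where
  "distr_mult I r u \<phi> = (LINT x:I|base_measure I r. \<phi> x *\<^sub>R (density_mat I r x *v u x))"

text \<open>\<open>J u' + q u = w f\<close> in the sense of distributions.\<close>

definition solves ::
  "real set \<Rightarrow> complex^'n^'n \<Rightarrow> (real set \<Rightarrow> complex^'n^'n) \<Rightarrow> (real set \<Rightarrow> complex^'n^'n)
     \<Rightarrow> (real \<Rightarrow> complex^'n) \<Rightarrow> (real \<Rightarrow> complex^'n) \<Rightarrow> bool" where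
  "solves I J q w u f \<longleftrightarrow>
     (\<forall>\<phi>. test_function I \<phi> \<longrightarrow> J *v distr_deriv I u \<phi> + distr_mult I q u \<phi> = distr_mult I w f \<phi>)"

definition Tmax_fun ::
  "real set \<Rightarrow> complex^'n^'n \<Rightarrow> (real set \<Rightarrow> complex^'n^'n) \<Rightarrow> (real set \<Rightarrow> complex^'n^'n)
     \<Rightarrow> ((real \<Rightarrow> complex^'n) \<times> (real \<Rightarrow> complex^'n)) set" where
  "Tmax_fun I J q w =
     {(u, f). u \<in> L2_fun I w \<and> f \<in> L2_fun I w \<and> u \<in> BV_sharp I \<and> solves I J q w u f}"

definition Tmax ::
  "real set \<Rightarrow> complex^'n^'n \<Rightarrow> (real set \<Rightarrow> complex^'n^'n) \<Rightarrow> (real set \<Rightarrow> complex^'n^'n)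
     \<Rightarrow> ('n l2 \<times> 'n l2) set" where
  "Tmax I J q w = (\<lambda>(u, f). (L2_class I w u, L2_class I w f)) ` Tmax_fun I J q w"

definition B_plus ::
  "complex^'n^'n \<Rightarrow> (real set \<Rightarrow> complex^'n^'n) \<Rightarrow> (real set \<Rightarrow> complex^'n^'n)
     \<Rightarrow> real \<Rightarrow> complex \<Rightarrow> complex^'n^'n" where
  "B_plus J q w x \<zeta> = J + (1/2) *\<^sub>R (jump q x - mat \<zeta> ** jump w x)"

definition B_minus ::
  "complex^'n^'n \<Rightarrow> (real set \<Rightarrow> complex^'n^'n) \<Rightarrow> (real set \<Rightarrow> complex^'n^'n)
     \<Rightarrow> real \<Rightarrow> complex \<Rightarrow> complex^'n^'n" where
  "B_minus J q w x \<zeta> = J - (1/2) *\<^sub>R (jump q x - mat \<zeta> ** jump w x)"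

definition Xi0 ::
  "real set \<Rightarrow> complex^'n^'n \<Rightarrow> (real set \<Rightarrow> complex^'n^'n) \<Rightarrow> (real set \<Rightarrow> complex^'n^'n)
     \<Rightarrow> real set" where
  "Xi0 I J q w = {x \<in> I. det (B_plus J q w x 0) * det (B_minus J q w x 0) = 0}"

subsection \<open>Linear relations in \<open>L\<^sup>2(w)\<close>\<close>

definition adjoint_rel ::
  "real set \<Rightarrow> (real set \<Rightarrow> complex^'n^'n) \<Rightarrow> ('n l2 \<times> 'n l2) set \<Rightarrow> ('n l2 \<times> 'n l2) set" where
  "adjoint_rel I w T =
     {(V, G). V \<in> L2_space I w \<and> G \<in> L2_space I w \<and>
        (\<forall>(U, F)\<in>T. L2_cinner I w V F = L2_cinner I w G U)}"

definition shift_rel ::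
  "real set \<Rightarrow> (real set \<Rightarrow> complex^'n^'n) \<Rightarrow> ('n l2 \<times> 'n l2) set \<Rightarrow> complex \<Rightarrow> ('n l2 \<times> 'n l2) set" where
  "shift_rel I w T \<zeta> = (\<lambda>(U, F). (U, L2_add I w F (L2_scale I w (- \<zeta>) U))) ` T"

definition resolvent_set ::
  "real set \<Rightarrow> (real set \<Rightarrow> complex^'n^'n) \<Rightarrow> ('n l2 \<times> 'n l2) set \<Rightarrow> complex set" where
  "resolvent_set I w T =
     {\<zeta>. {U. (U, L2_zero I w) \<in> shift_rel I w T \<zeta>} = {L2_zero I w} \<and>
         Range (shift_rel I w T \<zeta>) = L2_space I w}"

definition resolvent ::
  "real set \<Rightarrow> (real set \<Rightarrow> complex^'n^'n) \<Rightarrow> ('n l2 \<times> 'n l2) set \<Rightarrow> complex \<Rightarrow> 'n l2 \<Rightarrow> 'n l2" where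
  "resolvent I w T \<zeta> F = (THE U. (U, F) \<in> shift_rel I w T \<zeta>)"

subsection \<open>Choice of representatives\<close>

definition L0 ::
  "real set \<Rightarrow> complex^'n^'n \<Rightarrow> (real set \<Rightarrow> complex^'n^'n) \<Rightarrow> (real set \<Rightarrow> complex^'n^'n)
     \<Rightarrow> (real \<Rightarrow> complex^'n) set" where
  "L0 I J q w = {u \<in> BV_sharp I. solves I J q w u (\<lambda>x. 0) \<and> L2_sqnorm I w u = 0}"

definition supp_in :: "real set \<Rightarrow> (real \<Rightarrow> complex^'n) \<Rightarrow> real set" where
  "supp_in I h = I \<inter> closure {x \<in> I. h x \<noteq> 0}"

definition Nspace ::
  "real set \<Rightarrow> complex^'n^'n \<Rightarrow> (real set \<Rightarrow> complex^'n^'n) \<Rightarrow> (real set \<Rightarrow> complex^'n^'n)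
     \<Rightarrow> (int \<Rightarrow> real) \<Rightarrow> int \<Rightarrow> (complex^'n) set" where
  "Nspace I J q w \<tau> k =
     (if k = 0 then {h (\<tau> 0) |h. h \<in> L0 I J q w}
      else if k > 0 then {right_lim h (\<tau> k) |h. h \<in> L0 I J q w \<and> supp_in I h \<subseteq> I \<inter> {\<tau> k..}}
      else {left_lim h (\<tau> k) |h. h \<in> L0 I J q w \<and> supp_in I h \<subseteq> I \<inter> {..\<tau> k}})"

text \<open>
  At \<open>k = 0\<close> both one-sided limits are required to be perpendicular; they coincide for
  solutions of the differential equation, which are continuous at \<open>\<tau> 0\<close>.
\<close>

definition rep_condition ::
  "real set \<Rightarrow> complex^'n^'n \<Rightarrow> (real set \<Rightarrow> complex^'n^'n) \<Rightarrow> (real set \<Rightarrow> complex^'n^'n)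
     \<Rightarrow> (int \<Rightarrow> real) \<Rightarrow> int \<Rightarrow> (real \<Rightarrow> complex^'n) \<Rightarrow> bool" where
  "rep_condition I J q w \<tau> k u \<longleftrightarrow>
     (k \<ge> 0 \<longrightarrow> (\<forall>z\<in>Nspace I J q w \<tau> k. cdot z (right_lim u (\<tau> k)) = 0)) \<and>
     (k \<le> 0 \<longrightarrow> (\<forall>z\<in>Nspace I J q w \<tau> k. cdot z (left_lim u (\<tau> k)) = 0))"

definition Erep ::
  "real set \<Rightarrow> complex^'n^'n \<Rightarrow> (real set \<Rightarrow> complex^'n^'n) \<Rightarrow> (real set \<Rightarrow> complex^'n^'n)
     \<Rightarrow> (int \<Rightarrow> real) \<Rightarrow> 'n l2 \<Rightarrow> 'n l2 \<Rightarrow> real \<Rightarrow> complex^'n" where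
  "Erep I J q w \<tau> U F =
     (THE v. v \<in> U \<and> (\<exists>f\<in>F. (v, f) \<in> Tmax_fun I J q w) \<and> (\<forall>k. rep_condition I J q w \<tau> k v))"

definition resolvent_rep ::
  "real set \<Rightarrow> complex^'n^'n \<Rightarrow> (real set \<Rightarrow> complex^'n^'n) \<Rightarrow> (real set \<Rightarrow> complex^'n^'n)
     \<Rightarrow> (int \<Rightarrow> real) \<Rightarrow> ('n l2 \<times> 'n l2) set \<Rightarrow> complex \<Rightarrow> 'n l2 \<Rightarrow> real \<Rightarrow> complex^'n" where
  "resolvent_rep I J q w \<tau> T \<zeta> F =
     Erep I J q w \<tau> (resolvent I w T \<zeta> F) (L2_add I w (L2_scale I w \<zeta> (resolvent I w T \<zeta> F)) F)"

end

theory Submission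
  imports Defs
begin

text \<open>
  Point evaluation of the chosen representatives is a bounded functional, and a bounded functional on a
  Hilbert space is an inner product with a fixed element. The columns of the adjoint of \<open>G\<close> are these
  elements.

  The differential equation is first turned into the balanced integral equation \<open>solves_integral\<close>: the
  increment of \<open>J u\<close> from \<open>s\<close> to \<open>t\<close> is the mass of \<open>w f - q u\<close> between them, the masses at the end
  points being counted by half. For balanced functions of locally bounded variation this is equivalent
  to the distributional equation, by integration by parts in one direction and by the lemma of du
  Bois-Reymond in the other (\<open>solves_integral_imp_solves\<close>, \<open>solves_imp_solves_integral\<close>).

  The values of a solution are not determined by its norm, since there may be null solutions, those of
  norm \<open>0\<close>, nor by an initial value, since \<open>B_plus\<close> and \<open>B_minus\<close> may be singular. However, next to
  each point, and apart from the point itself, the mass of \<open>q\<close> is small, so that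
  on a compact interval a solution is controlled by its values at finitely many points and the norm of
  the inhomogeneity (\<open>solution_sampling\<close>). Compactness then shows that the distance of a solution
  \<open>(u, f)\<close> on an interval to the null solutions there is at most a constant times
  \<open>\<parallel>u\<parallel> + \<parallel>f\<parallel>\<close> (\<open>distance_to_nullsol\<close>). A null solution on a large interval coincides on a smaller one
  with a null solution on all of \<open>I\<close>, since the restrictions of the null solutions on increasing
  intervals form a decreasing sequence of finite-dimensional spaces; the Mittag-Leffler argument
  applies (\<open>nullsol_extension\<close>).

  The conditions at the points \<open>\<tau> k\<close> remove the ambiguity of null solutions: none but \<open>0\<close> satisfies
  all of them (\<open>nullsol_eq_0\<close>), and subtracting null solutions that start at one \<open>\<tau> k\<close> after another
  makes a solution satisfy all of them, with a bound on each compact interval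
  (\<open>exists_representative\<close>). Together these facts bound \<open>u x\<close> for the chosen representative by a
  multiple of \<open>\<parallel>u\<parallel> + \<parallel>f\<parallel>\<close> (\<open>representative_bound\<close>).

  It remains to apply the Riesz representation theorem, which rests on the completeness of \<open>L\<^sup>2(w)\<close>
  (\<open>L2_complete\<close>). For non-real \<open>\<zeta>\<close> the resolvent is bounded with constant \<open>1 / \<bar>Im \<zeta>\<bar>\<close>, so the theorem
  applies to \<open>f \<mapsto> (\<R>\<^sub>\<zeta> f)(x)\<close> on \<open>L\<^sup>2(w)\<close>. For real \<open>\<zeta>\<close> it is applied to \<open>(u, f) \<mapsto> u(x)\<close> on the graph
  of \<open>T\<close>, and the symmetry of the resolvent turns the resulting representation into one in terms of \<open>f\<close>
  alone (\<open>resolvent_functional\<close>).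
\<close>

section \<open>Densities of distributions of order zero\<close>

definition countably_additive_real :: "'a measure \<Rightarrow> ('a set \<Rightarrow> real) \<Rightarrow> bool" where
  "countably_additive_real M s \<longleftrightarrow>
     (\<forall>A :: nat \<Rightarrow> 'a set. range A \<subseteq> sets M \<longrightarrow> disjoint_family A \<longrightarrow> (\<lambda>i. s (A i)) sums s (\<Union>i. A i))"

lemma countably_additive_realD:
  "countably_additive_real M s \<Longrightarrow> (\<And>i::nat. A i \<in> sets M) \<Longrightarrow> disjoint_family A \<Longrightarrow>
     (\<lambda>i. s (A i)) sums s (\<Union>i. A i)"
  by (auto simp: countably_additive_real_def image_subset_iff)

lemma countably_additive_real_empty:
  assumes "countably_additive_real M s" shows "s {} = 0"
proof -
  have "(\<lambda>i::nat. s {}) sums s (\<Union>i::nat. {})"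
    using countably_additive_realD[OF assms, of "\<lambda>i. {}"] by (simp add: disjoint_family_on_def)
  then have "(\<lambda>i::nat. s {}) \<longlonglongrightarrow> 0" by (intro summable_LIMSEQ_zero) (auto simp: sums_iff)
  then show ?thesis using LIMSEQ_unique tendsto_const by blast
qed

lemma countably_additive_real_Un:
  assumes s: "countably_additive_real M s" and A: "A \<in> sets M" and B: "B \<in> sets M" "A \<inter> B = {}"
  shows "s (A \<union> B) = s A + s B"
proof -
  have e: "(\<Union>i. binaryset A B i) = A \<union> B" by (rule UN_binaryset_eq)
  have "(\<lambda>i. s (binaryset A B i)) sums s (\<Union>i. binaryset A B i)"
    using assms by (intro countably_additive_realD[OF s])
       (auto simp: binaryset_def disjoint_family_on_def)
  moreover have "(\<lambda>i. s (binaryset A B i)) sums (s A + s B)"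
    by (rule binaryset_sums) (rule countably_additive_real_empty[OF s])
  ultimately show ?thesis using e sums_unique2 by metis
qed

lemma countably_additive_real_Diff:
  assumes s: "countably_additive_real M s" and "A \<in> sets M" "B \<in> sets M" "B \<subseteq> A"
  shows "s (A - B) = s A - s B"
  using countably_additive_real_Un[OF s, of B "A - B"] assms by (auto simp: Un_absorb1 Un_Diff_cancel)

text \<open>If the values were unbounded on \<open>E\<close>, one could split off a piece of mass at least one from
  \<open>E\<close> leaving a set on which they are still unbounded; the pieces obtained by iteration would be
  disjoint, and their masses would not tend to zero.\<close>

lemma countably_additive_real_bounded:
  assumes s: "countably_additive_real M s"
  shows "\<exists>K. \<forall>A\<in>sets M. \<bar>s A\<bar> \<le> K"
proof (rule ccontr)
  assume contr: "\<not> ?thesis"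
  define unb where "unb E \<longleftrightarrow> E \<in> sets M \<and> (\<forall>K. \<exists>B\<in>sets M. B \<subseteq> E \<and> \<bar>s B\<bar> > K)" for E
  have step: "\<exists>F. unb F \<and> F \<subseteq> E \<and> \<bar>s (E - F)\<bar> \<ge> 1" if E: "unb E" for E
  proof -
    \<comment> \<open>Then \<open>B\<close> and \<open>E - B\<close> both have mass at least one, and the values on one of them are unbounded.\<close>
    obtain B where B: "B \<in> sets M" "B \<subseteq> E" "\<bar>s B\<bar> > \<bar>s E\<bar> + 1"
      using E unfolding unb_def by blast
    have d: "s (E - B) = s E - s B" using E B by (intro countably_additive_real_Diff[OF s]) (auto simp: unb_def)
    show ?thesis
    proof (cases "unb B")
      case True then show ?thesis using B d by (intro exI[of _ B]) auto
    next
      case False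
      then obtain K where K: "\<And>C. C \<in> sets M \<Longrightarrow> C \<subseteq> B \<Longrightarrow> \<bar>s C\<bar> \<le> K"
        using B(1) False unfolding unb_def by (meson not_le)
      have "unb (E - B)" unfolding unb_def
      proof (intro conjI allI)
        show "E - B \<in> sets M" using E B by (auto simp: unb_def)
        fix L
        obtain C where C: "C \<in> sets M" "C \<subseteq> E" "\<bar>s C\<bar> > L + K" using E unfolding unb_def by blast
        have "s C = s (C \<inter> B) + s (C - B)" using countably_additive_real_Un[OF s, of "C \<inter> B" "C - B"] C B
          by (auto simp: Int_Diff_Un)
        moreover have "\<bar>s (C \<inter> B)\<bar> \<le> K" using C B by (intro K) auto
        ultimately show "\<exists>D\<in>sets M. D \<subseteq> E - B \<and> L < \<bar>s D\<bar>"
          using C B by (intro bexI[of _ "C - B"]) auto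
      qed
      moreover have "E - (E - B) = B" using B by auto
      ultimately show ?thesis using B by (intro exI[of _ "E - B"]) auto
    qed
  qed
  have "unb (space M)" using contr sets.sets_into_space unfolding unb_def by (meson not_le sets.top)
  then obtain E where E: "\<And>n::nat. unb (E n)" "\<And>n. E (Suc n) \<subseteq> E n \<and> \<bar>s (E n - E (Suc n))\<bar> \<ge> 1"
    using dependent_nat_choice[of "\<lambda>n E. unb E" "\<lambda>n E F. F \<subseteq> E \<and> \<bar>s (E - F)\<bar> \<ge> 1"] step by metis
  have dec: "E m \<subseteq> E n" if "n \<le> m" for m n
    using that by (rule lift_Suc_antimono_le[rotated]) (use E in auto)
  have "disjoint_family (\<lambda>n. E n - E (Suc n))"
  proof (unfold disjoint_family_on_def, intro ballI impI)
    fix m n :: nat assume "m \<noteq> n"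
    then show "(E m - E (Suc m)) \<inter> (E n - E (Suc n)) = {}"
      using dec[of "Suc m" n] dec[of "Suc n" m] by (cases m n rule: linorder_cases) auto
  qed
  moreover have "E n - E (Suc n) \<in> sets M" for n using E unfolding unb_def by auto
  ultimately have "(\<lambda>n. s (E n - E (Suc n))) sums s (\<Union>n. E n - E (Suc n))"
    by (intro countably_additive_realD[OF s]) auto
  then have "(\<lambda>n. s (E n - E (Suc n))) \<longlonglongrightarrow> 0" by (intro summable_LIMSEQ_zero) (auto simp: sums_iff)
  then have "eventually (\<lambda>n. \<bar>s (E n - E (Suc n))\<bar> < 1) sequentially"
    by (intro order_tendstoD(2)[OF tendsto_rabs_zero]) auto
  then show False using E(2) by (auto simp: eventually_sequentially not_less[symmetric])
qed

lemma nonneg_countably_additive_real_measure: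
  assumes s: "countably_additive_real M s" and pos: "\<And>A. A \<in> sets M \<Longrightarrow> 0 \<le> s A"
  shows "\<exists>N. finite_measure N \<and> sets N = sets M \<and> (\<forall>A\<in>sets M. measure N A = s A)"
proof -
  define N where "N = measure_of (space M) (sets M) (\<lambda>A. ennreal (s A))"
  have em: "emeasure N A = ennreal (s A)" if "A \<in> sets M" for A
  proof (rule emeasure_measure_of[OF N_def])
    show "sets M \<subseteq> Pow (space M)" by (rule sets.space_closed)
    show "A \<in> sets N" using that by (simp add: N_def)
    show "positive (sets N) (\<lambda>A. ennreal (s A))" by (simp add: positive_def countably_additive_real_empty[OF s])
    show "countably_additive (sets N) (\<lambda>A. ennreal (s A))"
    proof (rule countably_additiveI)
      fix A :: "nat \<Rightarrow> 'a set" assume A: "range A \<subseteq> sets N" "disjoint_family A"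
      then have "(\<lambda>i. s (A i)) sums s (\<Union>i. A i)"
        by (intro countably_additive_realD[OF s]) (auto simp: N_def)
      then show "(\<Sum>i. ennreal (s (A i))) = ennreal (s (\<Union>i. A i))"
        using A pos by (subst suminf_ennreal2) (auto simp: sums_iff N_def image_subset_iff)
    qed
  qed
  have "space N = space M" by (simp add: N_def)
  then have "finite_measure N" by (intro finite_measureI) (simp add: em)
  then show ?thesis using em pos by (intro exI[of _ N]) (auto simp: N_def measure_def)
qed

text \<open>The positive part assigns to \<open>A\<close> the supremum of the values on the measurable subsets of \<open>A\<close>.
  It is superadditive on disjoint sets by its very definition, and countably subadditive because a
  subset of a disjoint union is cut into pieces.\<close>

lemma jordan_decomposition_real:
  assumes s: "countably_additive_real M s"
  obtains N1 N2 where "finite_measure N1" "finite_measure N2" "sets N1 = sets M" "sets N2 = sets M"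
    "\<And>A. A \<in> sets M \<Longrightarrow> s A = measure N1 A - measure N2 A"
proof -
  obtain K where K: "\<And>A. A \<in> sets M \<Longrightarrow> \<bar>s A\<bar> \<le> K"
    using countably_additive_real_bounded[OF s] by blast
  define P where "P A = Sup (s ` {B \<in> sets M. B \<subseteq> A})" for A
  have bdd: "bdd_above (s ` {B \<in> sets M. B \<subseteq> A})" for A
    using K by (intro bdd_aboveI[of _ K]) (auto simp: abs_le_iff)
  have up: "s B \<le> P A" if "B \<in> sets M" "B \<subseteq> A" for A B
    unfolding P_def using that bdd by (intro cSup_upper) auto
  have lub: "P A \<le> L" if "\<And>B. B \<in> sets M \<Longrightarrow> B \<subseteq> A \<Longrightarrow> s B \<le> L" for A L
    unfolding P_def using that by (intro cSup_least) auto
  have approx: "\<exists>B\<in>sets M. B \<subseteq> A \<and> P A - e < s B" if "e > 0" for A e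
    using less_cSup_iff[of "s ` {B \<in> sets M. B \<subseteq> A}" "P A - e"] that bdd unfolding P_def by auto
  have P0: "0 \<le> P A" for A using up[of "{}" A] countably_additive_real_empty[OF s] by simp
  have sup: "P A + P B \<le> P (A \<union> B)" if "A \<inter> B = {}" for A B
  proof (rule field_le_epsilon)
    fix e :: real assume "e > 0"
    obtain C where C: "C \<in> sets M" "C \<subseteq> A" "P A - e/2 < s C" using approx[of "e/2"] \<open>e > 0\<close> by auto
    obtain D where D: "D \<in> sets M" "D \<subseteq> B" "P B - e/2 < s D" using approx[of "e/2"] \<open>e > 0\<close> by auto
    have "s C + s D = s (C \<union> D)" using C D that by (intro countably_additive_real_Un[OF s, symmetric]) auto
    also have "\<dots> \<le> P (A \<union> B)" using C D by (intro up) auto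
    finally show "P A + P B \<le> P (A \<union> B) + e" using C D by linarith
  qed
  have "countably_additive_real M P" unfolding countably_additive_real_def
  proof (intro allI impI)
    fix A :: "nat \<Rightarrow> 'a set" assume A: "range A \<subseteq> sets M" "disjoint_family A"
    have fin: "(\<Sum>i<n. P (A i)) \<le> P (\<Union>i<n. A i)" for n
    proof (induction n)
      case 0 then show ?case using P0 by simp
    next
      case (Suc n)
      have "P (\<Union>i<n. A i) + P (A n) \<le> P ((\<Union>i<n. A i) \<union> A n)"
      proof (rule sup)
        have "A i \<inter> A n = {}" if "i < n" for i using A(2) that by (auto simp: disjoint_family_on_def)
        then show "(\<Union>i<n. A i) \<inter> A n = {}" by blast
      qed
      then show ?case using Suc by (simp add: lessThan_Suc Un_commute)
    qed
    have le: "(\<Sum>i<n. P (A i)) \<le> P (\<Union>i. A i)" for n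
      using fin[of n] by (rule order_trans) (intro lub up, auto)
    have summ: "summable (\<lambda>i. P (A i))" by (rule summableI_nonneg_bounded[OF P0 le])
    have "(\<Sum>i. P (A i)) = P (\<Union>i. A i)"
    proof (rule antisym)
      show "(\<Sum>i. P (A i)) \<le> P (\<Union>i. A i)" using summ le by (rule suminf_le_const)
      show "P (\<Union>i. A i) \<le> (\<Sum>i. P (A i))"
      proof (rule lub)
        fix B assume B: "B \<in> sets M" "B \<subseteq> (\<Union>i. A i)"
        have "(\<lambda>i. s (B \<inter> A i)) sums s (\<Union>i. B \<inter> A i)"
          using A B by (intro countably_additive_realD[OF s]) (auto simp: disjoint_family_on_def)
        moreover have "(\<Union>i. B \<inter> A i) = B" using B by auto
        ultimately have "summable (\<lambda>i. s (B \<inter> A i))" "s B = (\<Sum>i. s (B \<inter> A i))"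
          by (auto simp: sums_iff)
        moreover have "s (B \<inter> A i) \<le> P (A i)" for i using A B by (intro up) auto
        ultimately show "s B \<le> (\<Sum>i. P (A i))" using summ by (auto intro: suminf_le)
      qed
    qed
    then show "(\<lambda>i. P (A i)) sums P (\<Union>i. A i)" using summ by (simp add: sums_iff)
  qed
  note P = this
  obtain N1 where N1: "finite_measure N1" "sets N1 = sets M" "\<And>A. A \<in> sets M \<Longrightarrow> measure N1 A = P A"
    using nonneg_countably_additive_real_measure[OF P] P0 by auto
  have "countably_additive_real M (\<lambda>A. P A - s A)"
    using P s unfolding countably_additive_real_def by (auto intro: sums_diff)
  then obtain N2 where N2: "finite_measure N2" "sets N2 = sets M"
     "\<And>A. A \<in> sets M \<Longrightarrow> measure N2 A = P A - s A"
    using nonneg_countably_additive_real_measure[of M "\<lambda>A. P A - s A"] up by auto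
  show thesis using N1 N2 by (intro that[of N1 N2]) auto
qed

text \<open>A weighted sum of the measures, with weights that make the total mass finite.\<close>

lemma countable_family_dominating_measure:
  fixes N :: "'i::countable \<Rightarrow> 'a measure"
  assumes fin: "\<And>i. finite_measure (N i)" and N: "\<And>i. sets (N i) = sets M"
  obtains \<mu> where "finite_measure \<mu>" "sets \<mu> = sets M" "\<And>i. absolutely_continuous \<mu> (N i)"
proof -
  define c where "c i = (1/2)^to_nat i / (1 + measure (N i) (space M))" for i
  have c: "0 < c i" for i by (auto simp: c_def intro!: divide_pos_pos add_pos_nonneg)
  define m where "m A = (\<integral>\<^sup>+i. ennreal (c i) * emeasure (N i) A \<partial>count_space UNIV)" for A
  define \<mu> where "\<mu> = measure_of (space M) (sets M) m"
  have em: "emeasure \<mu> A = m A" if "A \<in> sets M" for A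
  proof (rule emeasure_measure_of[OF \<mu>_def])
    show "sets M \<subseteq> Pow (space M)" by (rule sets.space_closed)
    show "A \<in> sets \<mu>" using that by (simp add: \<mu>_def)
    show "positive (sets \<mu>) m" by (simp add: positive_def m_def)
    show "countably_additive (sets \<mu>) m"
    proof (rule countably_additiveI)
      fix A :: "nat \<Rightarrow> 'a set" assume A: "range A \<subseteq> sets \<mu>" "disjoint_family A"
      have "(\<Sum>n. m (A n)) = (\<integral>\<^sup>+i. (\<Sum>n. ennreal (c i) * emeasure (N i) (A n)) \<partial>count_space UNIV)"
        unfolding m_def by (rule nn_integral_suminf[symmetric]) auto
      also have "\<dots> = m (\<Union>n. A n)" unfolding m_def
        using A N by (intro nn_integral_cong) (auto simp: suminf_emeasure \<mu>_def)
      finally show "(\<Sum>n. m (A n)) = m (\<Union>n. A n)" .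
    qed
  qed
  have bound: "c i * measure (N i) (space M) \<le> (1/2)^to_nat i" for i
  proof -
    have "measure (N i) (space M) / (1 + measure (N i) (space M)) \<le> 1"
      by (simp add: divide_le_eq add_pos_nonneg measure_nonneg)
    then have "(1/2)^to_nat i * (measure (N i) (space M) / (1 + measure (N i) (space M))) \<le> (1/2::real)^to_nat i * 1"
      by (intro mult_left_mono) auto
    then show ?thesis by (simp add: c_def)
  qed
  have "m (space M) \<le> (\<integral>\<^sup>+i. ennreal ((1/2)^to_nat i) \<partial>count_space (UNIV::'i set))"
    unfolding m_def
  proof (rule nn_integral_mono)
    fix i :: 'i
    interpret finite_measure "N i" by (rule fin)
    show "ennreal (c i) * emeasure (N i) (space M) \<le> ennreal ((1/2)^to_nat i)"
      using bound[of i] c[of i] by (simp add: emeasure_eq_measure ennreal_mult[symmetric] ennreal_leI less_imp_le)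
  qed
  also have "\<dots> = (\<integral>\<^sup>+n. ennreal ((1/2)^n) \<partial>count_space (range (to_nat::'i\<Rightarrow>nat)))"
    by (rule nn_integral_bij_count_space) (simp add: inj_on_imp_bij_betw)
  also have "\<dots> \<le> (\<integral>\<^sup>+n. ennreal ((1/2)^n) \<partial>count_space (UNIV::nat set))"
    by (subst nn_integral_count_space_indicator) (auto intro!: nn_integral_mono simp: indicator_def)
  also have "\<dots> = (\<Sum>n. ennreal ((1/2)^n))" by (rule nn_integral_count_space_nat)
  also have "\<dots> < \<infinity>" by (subst suminf_ennreal2) (auto intro: summable_geometric)
  finally have "m (space M) < \<infinity>" .
  moreover have "space \<mu> = space M" by (simp add: \<mu>_def)
  ultimately have "finite_measure \<mu>" by (intro finite_measureI) (simp add: em)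
  moreover have "absolutely_continuous \<mu> (N i)" for i unfolding absolutely_continuous_def
  proof
    fix A assume "A \<in> null_sets \<mu>"
    then have A: "A \<in> sets M" "m A = 0" using em by (auto simp: null_sets_def \<mu>_def)
    then have "AE i in count_space UNIV. ennreal (c i) * emeasure (N i) A = 0"
      unfolding m_def by (subst (asm) nn_integral_0_iff_AE) auto
    then have "ennreal (c i) * emeasure (N i) A = 0" by (simp add: AE_count_space)
    then show "A \<in> null_sets (N i)" using A c[of i] N by (auto simp: null_sets_def ennreal_zero_less_mult_iff)
  qed
  ultimately show thesis by (intro that[of \<mu>]) (auto simp: \<mu>_def)
qed


text \<open>The Radon-Nikodym density is finite almost everywhere, so it can be taken real-valued.\<close>

lemma finite_measure_real_density:
  assumes mu: "finite_measure \<mu>" and N: "finite_measure N" "sets N = sets \<mu>" "absolutely_continuous \<mu> N"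
  obtains g :: "'a \<Rightarrow> real" where "g \<in> borel_measurable \<mu>" "integrable \<mu> g"
    "\<And>A. A \<in> sets \<mu> \<Longrightarrow> measure N A = (LINT x:A|\<mu>. g x)"
proof -
  interpret finite_measure \<mu> by fact
  interpret N: finite_measure N by fact
  obtain D where D: "D \<in> borel_measurable \<mu>" "AE x in \<mu>. RN_deriv \<mu> N x = ennreal (D x)" "\<And>x. 0 \<le> D x"
    using real_RN_deriv[OF N(1,3,2)] by blast
  have dens: "density \<mu> D = N"
    using density_RN_deriv[OF N(3,2)] density_cong[of "RN_deriv \<mu> N" \<mu> "\<lambda>x. ennreal (D x)"] D by simp
  have em: "emeasure N A = (\<integral>\<^sup>+x. ennreal (indicator A x * D x) \<partial>\<mu>)" if "A \<in> sets \<mu>" for A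
    unfolding dens[symmetric] using that D by (subst emeasure_density) (auto intro!: nn_integral_cong simp: indicator_def)
  have "measure N A = (LINT x:A|\<mu>. D x)" if "A \<in> sets \<mu>" for A
    using em[OF that] that D unfolding set_lebesgue_integral_def measure_def
    by (subst integral_eq_nn_integral) (auto intro!: borel_measurable_times)
  moreover have "integrable \<mu> D"
  proof (rule integrableI_nonneg)
    have "(\<integral>\<^sup>+x. ennreal (D x) \<partial>\<mu>) = emeasure N (space \<mu>)"
      by (subst em) (auto intro!: nn_integral_cong)
    then show "(\<integral>\<^sup>+x. ennreal (D x) \<partial>\<mu>) < \<infinity>"
      using N.emeasure_finite[of "space \<mu>"] by (simp add: less_top[symmetric])
  qed (use D in auto)
  ultimately show thesis using D by (intro that[of D]) auto
qed

text \<open>Intervals that absorb every compact set let statements about compact subsets of \<open>I\<close> be proved along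
  a sequence.\<close>

lemma einterval_exhaustion:
  fixes a b :: ereal assumes "a < b"
  obtains l u :: "nat \<Rightarrow> real" where "incseq u" "decseq l" "\<And>i. {l i..u i} \<subseteq> einterval a b"
    "\<And>K. compact K \<Longrightarrow> K \<subseteq> einterval a b \<Longrightarrow> \<exists>i. K \<subseteq> {l i..u i}"
proof -
  obtain u l :: "nat \<Rightarrow> real" where ul: "einterval a b = (\<Union>i. {l i..u i})" "incseq u" "decseq l"
    using einterval_Icc_approximation[OF assms] by metis
  have "\<exists>i. K \<subseteq> {l i..u i}" if K: "compact K" "K \<subseteq> einterval a b" for K
  proof (cases "K = {}")
    case False
    obtain x where x: "x \<in> K" "\<And>y. y \<in> K \<Longrightarrow> x \<le> y" using compact_attains_inf[OF K(1) False] by blast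
    obtain z where z: "z \<in> K" "\<And>y. y \<in> K \<Longrightarrow> y \<le> z" using compact_attains_sup[OF K(1) False] by blast
    obtain i j where "x \<in> {l i..u i}" "z \<in> {l j..u j}" using x(1) z(1) K(2) unfolding ul(1) by blast
    then have "l (max i j) \<le> x" "z \<le> u (max i j)"
      using incseqD[OF ul(2), of j "max i j"] decseqD[OF ul(3), of i "max i j"] by auto
    then have "K \<subseteq> {l (max i j)..u (max i j)}" using x(2) z(2) order_trans by fastforce
    then show ?thesis by blast
  qed auto
  then show thesis using that[of u l] ul by auto
qed

definition matrix_unit :: "'n \<Rightarrow> 'm \<Rightarrow> complex \<Rightarrow> complex^'m^'n" where
  "matrix_unit i j c = axis i (axis j c)"

lemma matrix_unit_nth: "matrix_unit i j c $ k $ l = (if k = i \<and> l = j then c else 0)"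
  by (auto simp: matrix_unit_def axis_def)

lemma matrix_decomposition:
  fixes X :: "complex^'m^'n"
  shows "X = (\<Sum>i\<in>UNIV. \<Sum>j\<in>UNIV. Re (X $ i $ j) *\<^sub>R matrix_unit i j 1 + Im (X $ i $ j) *\<^sub>R matrix_unit i j \<i>)"
proof -
  have "(\<Sum>i\<in>UNIV. \<Sum>j\<in>UNIV. Re (X $ i $ j) *\<^sub>R matrix_unit i j 1 + Im (X $ i $ j) *\<^sub>R matrix_unit i j \<i>) $ k $ l
     = (\<Sum>i\<in>UNIV. \<Sum>j\<in>UNIV. if i = k \<and> j = l then X $ i $ j else 0)" for k l
    by (auto simp: matrix_unit_nth complex_eq_iff intro!: sum.cong)
  also have "\<dots> k l = X $ k $ l" for k l
  proof -
    have "(\<Sum>i\<in>UNIV. \<Sum>j\<in>UNIV. if i = k \<and> j = l then X $ i $ j else 0)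
      = (\<Sum>i\<in>UNIV. if i = k then (\<Sum>j\<in>UNIV. if j = l then X $ i $ j else 0) else 0)"
      by (intro sum.cong) auto
    then show ?thesis by (simp add: sum.delta)
  qed
  finally show ?thesis by (simp add: vec_eq_iff)
qed

text \<open>On each of countably many disjoint pieces \<open>D m\<close> that exhaust \<open>I\<close>, the real and imaginary parts of
  the matrix entries are finite signed measures. One finite measure dominates all their positive and
  negative parts, and the densities on the pieces are put together.\<close>

lemma order0_distr_represents:
  fixes r :: "real set \<Rightarrow> complex^'n^'n"
  assumes ab: "a < b" and I: "I = einterval a b" and r: "order0_distr I r"
  shows "\<exists>\<mu> H. represents I r \<mu> H"
proof -
  obtain l u where ul: "incseq u" "decseq l" "\<And>i::nat. {l i..u i} \<subseteq> I"
    "\<And>K. compact K \<Longrightarrow> K \<subseteq> I \<Longrightarrow> \<exists>i. K \<subseteq> {l i..u i}"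
    using einterval_exhaustion[OF ab] unfolding I by metis
  define K where "K i = {l i..u i}" for i
  have Kmono: "K i \<subseteq> K j" if "i \<le> j" for i j
    using incseqD[OF ul(1) that] decseqD[OF ul(2) that] by (auto simp: K_def)
  define D where "D = disjointed K"
  have D: "D i \<in> sets borel" "D i \<subseteq> K i" "disjoint_family D" for i
    unfolding D_def using disjoint_family_disjointed[of K] disjointed_subset[of K i] by (auto simp: disjointed_def K_def)
  have Ddisj: "D i \<inter> D j = {}" if "i \<noteq> j" for i j using D(3) that by (auto simp: disjoint_family_on_def)
  have rsums: "(\<lambda>i. r (A i)) sums r (\<Union>i. A i)"
    if "\<And>i::nat. A i \<in> sets borel" "disjoint_family A" "(\<Union>i. A i) \<subseteq> K m" for A m
    using r that ul(3)[of m] unfolding order0_distr_def by (auto simp: K_def image_subset_iff)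
  define part where "part p = (if p then Re else Im)" for p
  have bl: "bounded_linear (\<lambda>X::complex^'n^'n. part p (X $ i $ j))" for p i j
    using bounded_linear_compose[OF bounded_linear_Re bounded_linear_compose[OF bounded_linear_vec_nth bounded_linear_vec_nth]]
      bounded_linear_compose[OF bounded_linear_Im bounded_linear_compose[OF bounded_linear_vec_nth bounded_linear_vec_nth]]
    by (cases p) (auto simp: part_def)
  define s where "s = (\<lambda>(m, i, j, p) A. part p (r (A \<inter> D m) $ i $ j))"
  have csa: "countably_additive_real borel (s c)" for c
  proof (cases c)
    case (fields m i j p)
    show ?thesis unfolding countably_additive_real_def
    proof (intro allI impI)
      fix A :: "nat \<Rightarrow> real set" assume A: "range A \<subseteq> sets borel" "disjoint_family A"
      have "(\<lambda>n. r (A n \<inter> D m)) sums r (\<Union>n. A n \<inter> D m)"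
        using A D(1,3) D(2)[THEN subsetD] by (intro rsums[of _ m]) (auto simp: disjoint_family_on_def)
      from bounded_linear.sums[OF bl[of p i j] this]
      show "(\<lambda>n. s c (A n)) sums s c (\<Union>n. A n)" by (simp add: s_def fields Int_UN_distrib2)
    qed
  qed
  have "\<exists>N1 N2. finite_measure N1 \<and> finite_measure N2 \<and> sets N1 = sets borel \<and> sets N2 = sets borel \<and>
     (\<forall>A\<in>sets borel. s c A = measure N1 A - measure N2 A)" for c
    by (rule jordan_decomposition_real[OF csa[of c]]) blast
  then obtain N1 N2 where N12: "\<And>c. finite_measure (N1 c)" "\<And>c. finite_measure (N2 c)"
     "\<And>c. sets (N1 c) = sets borel" "\<And>c. sets (N2 c) = sets borel"
     "\<And>c A. A \<in> sets borel \<Longrightarrow> s c A = measure (N1 c) A - measure (N2 c) A" by metis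
  define N where "N e = (if fst e then N1 (snd e) else N2 (snd e))" for e
  have "finite_measure (N e)" "sets (N e) = sets borel" for e by (auto simp: N_def N12)
  then obtain \<mu> where mu: "finite_measure \<mu>" "sets \<mu> = sets borel" "\<And>e. absolutely_continuous \<mu> (N e)"
    using countable_family_dominating_measure[of N borel] by metis
  have "\<exists>h. h \<in> borel_measurable borel \<and> integrable \<mu> h \<and> (\<forall>A\<in>sets borel. s c A = (LINT x:A|\<mu>. h x))" for c
  proof -
    obtain g1 where g1: "g1 \<in> borel_measurable \<mu>" "integrable \<mu> g1"
      "\<And>A. A \<in> sets \<mu> \<Longrightarrow> measure (N1 c) A = (LINT x:A|\<mu>. g1 x)"
      using finite_measure_real_density[OF mu(1) N12(1)[of c]] mu(2) N12(3) mu(3)[of "(True, c)"] by (auto simp: N_def)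
    obtain g2 where g2: "g2 \<in> borel_measurable \<mu>" "integrable \<mu> g2"
      "\<And>A. A \<in> sets \<mu> \<Longrightarrow> measure (N2 c) A = (LINT x:A|\<mu>. g2 x)"
      using finite_measure_real_density[OF mu(1) N12(2)[of c]] mu(2) N12(4) mu(3)[of "(False, c)"] by (auto simp: N_def)
    have "set_integrable \<mu> A g1" "set_integrable \<mu> A g2" if "A \<in> sets borel" for A
      using g1 g2 that mu(2) unfolding set_integrable_def by (intro integrable_mult_indicator; simp)+
    then show ?thesis using g1 g2 mu(2) N12(5)[of _ c]
      by (intro exI[of _ "\<lambda>x. g1 x - g2 x"]) (auto simp: measurable_cong_sets[OF mu(2) refl] intro!: borel_measurable_diff)
  qed
  then obtain h where h: "\<And>c. h c \<in> borel_measurable borel" "\<And>c. integrable \<mu> (h c)"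
    "\<And>c A. A \<in> sets borel \<Longrightarrow> s c A = (LINT x:A|\<mu>. h c x)" by metis
  define Hm :: "nat \<Rightarrow> real \<Rightarrow> complex^'n^'n" where "Hm m x = (\<Sum>i\<in>UNIV. \<Sum>j\<in>UNIV.
    h (m, i, j, True) x *\<^sub>R matrix_unit i j 1 + h (m, i, j, False) x *\<^sub>R matrix_unit i j \<i>)" for m x
  have Hm: "Hm m \<in> borel_measurable borel" "integrable \<mu> (Hm m)" for m
    unfolding Hm_def using h by (auto intro!: borel_measurable_sum borel_measurable_add borel_measurable_scaleR)
  have rH: "r (A \<inter> D m) = (LINT x:A|\<mu>. Hm m x)" if A: "A \<in> sets borel" for A m
  proof -
    have int: "integrable \<mu> (\<lambda>x. indicator A x *\<^sub>R (h c x *\<^sub>R X))" for c and X :: "complex^'n^'n"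
      using h(2) A mu(2) by (intro integrable_mult_indicator) auto
    have "(LINT x:A|\<mu>. Hm m x) = (\<Sum>i\<in>UNIV. \<Sum>j\<in>UNIV.
      (LINT x|\<mu>. indicator A x *\<^sub>R (h (m, i, j, True) x *\<^sub>R matrix_unit i j 1))
       + (LINT x|\<mu>. indicator A x *\<^sub>R (h (m, i, j, False) x *\<^sub>R matrix_unit i j \<i>)))"
      unfolding set_lebesgue_integral_def Hm_def scaleR_sum_right scaleR_add_right using int
      by (simp add: Bochner_Integration.integral_sum Bochner_Integration.integral_add)
    also have "\<dots> = (\<Sum>i\<in>UNIV. \<Sum>j\<in>UNIV. s (m, i, j, True) A *\<^sub>R matrix_unit i j 1
       + s (m, i, j, False) A *\<^sub>R matrix_unit i j \<i>)"
    proof -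
      have "(LINT x|\<mu>. indicator A x *\<^sub>R (h c x *\<^sub>R X)) = s c A *\<^sub>R X" for c and X :: "complex^'n^'n"
        using integrable_mult_indicator[of A \<mu> "h c"] h(2)[of c] A mu(2)
        by (simp add: h(3)[OF A] set_lebesgue_integral_def)
      then show ?thesis by simp
    qed
    also have "\<dots> = r (A \<inter> D m)"
      using matrix_decomposition[of "r (A \<inter> D m)"] by (simp add: s_def part_def)
    finally show ?thesis by simp
  qed
  define idx where "idx x = (LEAST m. x \<in> K m)" for x
  have idx_eq: "idx = (\<lambda>x. LEAST m. x \<in> K m)" by (simp add: idx_def fun_eq_iff)
  define H where "H = (\<lambda>x. Hm (idx x) x)"
  have idxD: "idx x = m" if "x \<in> D m" for x m using that unfolding idx_def D_def disjointed_def
    by (intro Least_equality) (auto simp: not_less[symmetric])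
  have "{x \<in> space borel. x \<in> K i} = K i" "K i \<in> sets borel" for i by (auto simp: K_def)
  then have "Measurable.pred borel (\<lambda>x. x \<in> K i)" for i by (simp only: pred_def)
  then have "idx \<in> borel \<rightarrow>\<^sub>M count_space UNIV" unfolding idx_eq by (rule measurable_Least)
  then have Hmeas: "H \<in> borel_measurable borel"
    unfolding H_def by (rule measurable_compose_countable[where f = Hm and g = idx, OF Hm(1)])
  have HD: "indicator (A \<inter> D m) x *\<^sub>R H x = indicator (A \<inter> D m) x *\<^sub>R Hm m x" for A m x
    using idxD[of x m] by (auto simp: indicator_def H_def)
  have int: "set_integrable \<mu> (A \<inter> D m) H" if "A \<in> sets borel" for A m
    unfolding set_integrable_def HD using that D mu(2) Hm by (intro integrable_mult_indicator) auto
  have cover: "A = (\<Union>i\<in>{..m}. A \<inter> D i)" if "A \<subseteq> K m" for A m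
  proof -
    have "x \<in> (\<Union>i\<in>{..m}. D i)" if "x \<in> K m" for x
    proof -
      have "x \<in> K (idx x)" "idx x \<le> m" "\<And>i. i < idx x \<Longrightarrow> x \<notin> K i" unfolding idx_def using that
        by (auto intro: LeastI Least_le dest: not_less_Least)
      then show ?thesis by (auto simp: D_def disjointed_def intro!: bexI[of _ "idx x"])
    qed
    then show ?thesis using that by blast
  qed
  have rep: "r A = (LINT x:A|\<mu>. H x)" "set_integrable \<mu> A H" if A: "A \<in> sets borel" "A \<subseteq> K m" for A m
  proof -
    have dj: "disjoint_family_on (\<lambda>i. A \<inter> D i) {..m}" using Ddisj unfolding disjoint_family_on_def by blast
    have r0: "r {} = 0"
    proof -
      have "(\<lambda>i::nat. r {}) sums r (\<Union>i::nat. {})" by (rule rsums[of _ 0]) (auto simp: disjoint_family_on_def)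
      then have "(\<lambda>i::nat. r {}) \<longlonglongrightarrow> 0" by (intro summable_LIMSEQ_zero) (auto simp: sums_iff)
      then show ?thesis using LIMSEQ_unique tendsto_const by blast
    qed
    have e: "A \<inter> D i = {}" if "i \<notin> {..m}" for i using that A(2) by (auto simp: D_def disjointed_def)
    have "disjoint_family (\<lambda>i. A \<inter> D i)" using Ddisj unfolding disjoint_family_on_def by blast
    then have "(\<lambda>i. r (A \<inter> D i)) sums r (\<Union>i. A \<inter> D i)"
      using A D(1) by (intro rsums[of _ m]) auto
    moreover have "(\<Union>i. A \<inter> D i) = A" using cover[OF A(2)] by auto
    moreover have "(\<lambda>i. r (A \<inter> D i)) sums (\<Sum>i\<le>m. r (A \<inter> D i))"
      by (rule sums_finite) (auto simp: e r0)
    ultimately have "r A = (\<Sum>i\<le>m. r (A \<inter> D i))" using sums_unique2 by metis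
    also have "\<dots> = (\<Sum>i\<le>m. LINT x:A \<inter> D i|\<mu>. H x)"
    proof (rule sum.cong)
      fix i show "r (A \<inter> D i) = (LINT x:A \<inter> D i|\<mu>. H x)"
        using rH[of "A \<inter> D i" i] A D(1) unfolding set_lebesgue_integral_def HD by (simp add: Int_assoc)
    qed simp
    also have "(\<Sum>i\<le>m. LINT x:A \<inter> D i|\<mu>. H x) = (LINT x:A|\<mu>. H x)"
      by (subst (2) cover[OF A(2)], rule set_integral_finite_Union[symmetric])
         (use dj A D(1) int mu(2) in auto)
    finally show "r A = (LINT x:A|\<mu>. H x)" .
    show "set_integrable \<mu> A H" by (subst cover[OF A(2)], rule set_integrable_UN) (use A D int mu(2) in auto)
  qed
  have "represents I r \<mu> H" unfolding represents_def
  proof (intro conjI allI impI ballI)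
    fix L assume L: "compact L \<and> L \<subseteq> I"
    then obtain m where "L \<subseteq> K m" using ul(4) unfolding K_def by blast
    then show "set_integrable \<mu> L H" using L by (intro rep(2)[of _ m]) (auto intro: borel_compact)
    show "emeasure \<mu> L < \<infinity>" using finite_measure.emeasure_finite[OF mu(1)] by (simp add: less_top)
  next
    fix A assume "A \<in> local_borel I"
    then obtain L where L: "A \<in> sets borel" "compact L" "L \<subseteq> I" "A \<subseteq> L" by (auto simp: local_borel_def)
    then obtain m where "L \<subseteq> K m" using ul(4) unfolding K_def by blast
    then show "r A = (LINT x:A|\<mu>. H x)" using L by (intro rep(1)[of _ m]) auto
  qed (use mu Hmeas in auto)
  then show ?thesis by blast
qed

lemma represents_base_measure:
  assumes "a < b" "I = einterval a b" "order0_distr I r"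
  shows "represents I r (base_measure I r) (density_mat I r)"
  unfolding base_measure_def density_mat_def representation_def
  using order0_distr_represents[OF assms] by (intro someI_ex[of "\<lambda>p. represents I r (fst p) (snd p)"]) auto

section \<open>Functions of bounded variation\<close>

text \<open>The total variation over \<open>[c, x]\<close> dominates the oscillation of \<open>u\<close>, so one-sided limits and
  continuity of this monotone function carry over to \<open>u\<close>.\<close>

lemma bounded_variation_on_imp_monotone_majorant:
  fixes u :: "real \<Rightarrow> complex^'n"
  assumes bv: "bounded_variation_on {c..d} u"
  obtains V :: "real \<Rightarrow> real" where "mono_on {c..d} V"
    "\<And>x y. c \<le> x \<Longrightarrow> x \<le> y \<Longrightarrow> y \<le> d \<Longrightarrow> norm (u y - u x) \<le> V y - V x"
proof -
  obtain M where M: "\<And>t N. mono_on {..N} t \<Longrightarrow> t ` {..N} \<subseteq> {c..d} \<Longrightarrow> (\<Sum>i<N. norm (u (t (Suc i)) - u (t i))) \<le> M"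
    using bv unfolding bounded_variation_on_def by blast
  define S where "S x = {(\<Sum>i<N. norm (u (t (Suc i)) - u (t i))) | (t :: nat \<Rightarrow> real) N. mono_on {..N} t \<and> t ` {..N} \<subseteq> {c..x}}" for x
  define V where "V x = Sup (S x)" for x
  have bdd: "bdd_above (S x)" if "x \<le> d" for x
  proof (rule bdd_aboveI[of _ M])
    fix z assume "z \<in> S x"
    then obtain t N where t: "z = (\<Sum>i<N. norm (u (t (Suc i)) - u (t i)))" "mono_on {..N} t" "t ` {..N} \<subseteq> {c..x}"
      unfolding S_def by blast
    have "t ` {..N} \<subseteq> {c..d}" using t(3) that by force
    then show "z \<le> M" using M[OF t(2)] t(1) by simp
  qed
  have ne: "S x \<noteq> {}" if "c \<le> x" for x
  proof -
    have "(\<Sum>i<0. norm (u ((\<lambda>_. c) (Suc i)) - u ((\<lambda>_. c) i))) \<in> S x"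
      unfolding S_def using that by (intro CollectI exI[of _ "\<lambda>_. c"] exI[of _ 0]) (auto simp: mono_on_def)
    then show ?thesis by blast
  qed
  have key: "norm (u y - u x) \<le> V y - V x" if xy: "c \<le> x" "x \<le> y" "y \<le> d" for x y
  proof -
    have "V x \<le> V y - norm (u y - u x)" unfolding V_def[of x]
    proof (rule cSup_least[OF ne[OF xy(1)]])
      fix z assume "z \<in> S x"
      then obtain t N where t: "z = (\<Sum>i<N. norm (u (t (Suc i)) - u (t i)))" "mono_on {..N} t" "t ` {..N} \<subseteq> {c..x}"
        unfolding S_def by blast
      define t' where "t' i = (if i \<le> N then t i else if i = Suc N then x else y)" for i
      have tx: "c \<le> t i" "t i \<le> x" if "i \<le> N" for i using t(3) that by (auto simp: image_subset_iff)
      have ty: "t i \<le> y" if "i \<le> N" for i using tx(2)[OF that] xy(2) by linarith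
      have mono: "mono_on {..Suc (Suc N)} t'" using t(2) tx ty xy by (auto simp: mono_on_def t'_def intro: order_trans)
      have sub: "t' ` {..Suc (Suc N)} \<subseteq> {c..y}" using tx ty xy by (auto simp: t'_def intro: order_trans)
      have "(\<Sum>i<Suc (Suc N). norm (u (t' (Suc i)) - u (t' i)))
        = (\<Sum>i<N. norm (u (t' (Suc i)) - u (t' i))) + norm (u x - u (t N)) + norm (u y - u x)" by (simp add: t'_def)
      also have "(\<Sum>i<N. norm (u (t' (Suc i)) - u (t' i))) = z" unfolding t(1) by (intro sum.cong) (auto simp: t'_def)
      finally have "z + norm (u y - u x) \<le> (\<Sum>i<Suc (Suc N). norm (u (t' (Suc i)) - u (t' i)))" by simp
      moreover have "(\<Sum>i<Suc (Suc N). norm (u (t' (Suc i)) - u (t' i))) \<in> S y"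
        unfolding S_def using mono sub by blast
      then have "(\<Sum>i<Suc (Suc N). norm (u (t' (Suc i)) - u (t' i))) \<le> V y"
        unfolding V_def by (rule cSup_upper[OF _ bdd[OF xy(3)]])
      ultimately show "z \<le> V y - norm (u y - u x)" by linarith
    qed
    then show ?thesis by simp
  qed
  have "mono_on {c..d} V"
  proof (rule mono_onI)
    fix r s assume "r \<in> {c..d}" "s \<in> {c..d}" "r \<le> s"
    then have "norm (u s - u r) \<le> V s - V r" by (intro key) auto
    then show "V r \<le> V s" using norm_ge_zero[of "u s - u r"] by linarith
  qed
  then show thesis using key that by blast
qed

text \<open>The Cauchy criterion is inherited from the monotone majorant.\<close>

lemma bounded_variation_on_has_right_limit:
  fixes u :: "real \<Rightarrow> complex^'n"
  assumes bv: "bounded_variation_on {x..d} u" and "x < d"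
  shows "\<exists>l. (u \<longlongrightarrow> l) (at_right x)"
proof -
  obtain V where V: "mono_on {x..d} V"
    "\<And>y z. x \<le> y \<Longrightarrow> y \<le> z \<Longrightarrow> z \<le> d \<Longrightarrow> norm (u z - u y) \<le> V z - V y"
    using bounded_variation_on_imp_monotone_majorant[OF bv] by blast
  define L where "L = Inf (V ` {x<..d})"
  have bdd: "bdd_below (V ` {x<..d})"
    using V(1) \<open>x < d\<close> by (intro bdd_belowI[of _ "V x"]) (auto simp: mono_on_def)
  have L: "L \<le> V y" if "x < y" "y \<le> d" for y unfolding L_def using that bdd by (intro cInf_lower) auto
  have cau: "\<exists>e>x. \<forall>y z. x < y \<and> y < e \<and> x < z \<and> z < e \<longrightarrow> dist (u y) (u z) < eps" if eps: "eps > 0" for eps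
  proof -
    obtain e where e: "x < e" "e \<le> d" "V e < L + eps"
      using cInf_lessD[of "V ` {x<..d}" "L + eps"] eps \<open>x < d\<close> unfolding L_def by auto
    have *: "dist (u y) (u z) < eps" if yz: "x < y" "y \<le> z" "z < e" for y z
    proof -
      have "dist (u y) (u z) \<le> V z - V y" using V(2)[of y z] yz e by (auto simp: dist_norm norm_minus_commute)
      also have "\<dots> \<le> V e - L" using L[of y] V(1) yz e by (intro diff_mono) (auto simp: mono_on_def)
      finally show ?thesis using e by simp
    qed
    show ?thesis
    proof (intro exI[of _ e] conjI allI impI)
      fix y z assume "x < y \<and> y < e \<and> x < z \<and> z < e"
      then show "dist (u y) (u z) < eps" using *[of y z] *[of z y] by (cases "y \<le> z") (auto simp: dist_commute)
    qed (use e in auto)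
  qed
  have "cauchy_filter (filtermap u (at_right x))" unfolding cauchy_filter_metric_filtermap
  proof (intro allI impI)
    fix eps :: real assume "eps > 0"
    from cau[OF this] obtain e where e: "e > x" "\<And>y z. x < y \<and> y < e \<and> x < z \<and> z < e \<Longrightarrow> dist (u y) (u z) < eps" by blast
    have "eventually (\<lambda>y. x < y \<and> y < e) (at_right x)" using e(1) eventually_at_right_less by (auto simp: eventually_at_right)
    then show "\<exists>P. eventually P (at_right x) \<and> (\<forall>y z. P y \<and> P z \<longrightarrow> dist (u y) (u z) < eps)"
      using e(2) by (intro exI[of _ "\<lambda>y. x < y \<and> y < e"]) auto
  qed
  moreover have "filtermap u (at_right x) \<noteq> bot" by (simp add: filtermap_bot_iff)
  ultimately obtain l where "filtermap u (at_right x) \<le> nhds l"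
    using complete_UNIV[where 'a = "complex^'n"] unfolding complete_uniform by auto
  then show ?thesis by (auto simp: filterlim_def)
qed

lemma bounded_variation_on_reflect:
  fixes u :: "real \<Rightarrow> complex^'n"
  assumes bv: "bounded_variation_on {c..d} u"
  shows "bounded_variation_on {-d..-c} (\<lambda>x. u (- x))"
proof -
  obtain M where M: "\<And>t N. mono_on {..N} t \<Longrightarrow> t ` {..N} \<subseteq> {c..d} \<Longrightarrow> (\<Sum>i<N. norm (u (t (Suc i)) - u (t i))) \<le> M"
    using bv unfolding bounded_variation_on_def by blast
  show ?thesis unfolding bounded_variation_on_def
  proof (intro exI[of _ M] allI impI)
    fix t :: "nat \<Rightarrow> real" and N assume t: "mono_on {..N} t \<and> t ` {..N} \<subseteq> {-d..-c}"
    have tb: "- d \<le> t i" "t i \<le> - c" if "i \<le> N" for i using t that by (auto simp: image_subset_iff)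
    define s where "s i = - t (N - i)" for i
    have "(\<Sum>i<N. norm (u (s (Suc i)) - u (s i))) \<le> M"
      using t tb(1)[of "N - _"] tb(2)[of "N - _"] by (intro M) (auto simp: mono_on_def s_def minus_le_iff le_minus_iff)
    also have "(\<Sum>i<N. norm (u (s (Suc i)) - u (s i))) = (\<Sum>i<N. norm (u (- t (Suc i)) - u (- t i)))"
    proof (subst sum.nat_diff_reindex[symmetric], rule sum.cong)
      fix i assume "i \<in> {..<N}"
      then have "N - Suc (N - Suc i) = i" "N - (N - Suc i) = Suc i" by auto
      then show "norm (u (s (Suc (N - Suc i))) - u (s (N - Suc i))) = norm (u (- t (Suc i)) - u (- t i))"
        by (simp add: s_def norm_minus_commute)
    qed simp
    finally show "(\<Sum>i<N. norm (u (- t (Suc i)) - u (- t i))) \<le> M" .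
  qed
qed

lemma bounded_variation_on_has_left_limit:
  fixes u :: "real \<Rightarrow> complex^'n"
  assumes bv: "bounded_variation_on {c..x} u" and "c < x"
  shows "\<exists>l. (u \<longlongrightarrow> l) (at_left x)"
proof -
  obtain l where "((\<lambda>x. u (- x)) \<longlongrightarrow> l) (at_right (- x))"
    using bounded_variation_on_has_right_limit[OF bounded_variation_on_reflect[OF bv]] \<open>c < x\<close> by auto
  then show ?thesis by (auto simp: filterlim_at_left_to_right)
qed

lemma bounded_variation_on_bounded:
  fixes u :: "real \<Rightarrow> complex^'n"
  assumes bv: "bounded_variation_on {c..d} u"
  shows "bounded (u ` {c..d})"
proof -
  obtain V where V: "mono_on {c..d} V"
    "\<And>y z. c \<le> y \<Longrightarrow> y \<le> z \<Longrightarrow> z \<le> d \<Longrightarrow> norm (u z - u y) \<le> V z - V y"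
    using bounded_variation_on_imp_monotone_majorant[OF bv] by blast
  show ?thesis unfolding bounded_iff
  proof (intro exI ballI)
    fix z assume "z \<in> u ` {c..d}"
    then obtain y where y: "z = u y" "c \<le> y" "y \<le> d" by auto
    have "norm (u y - u c) \<le> V y - V c" using y by (intro V) auto
    also have "\<dots> \<le> V d - V c" using V(1) y by (auto simp: mono_on_def)
    finally show "norm z \<le> norm (u c) + (V d - V c)" using norm_triangle_ineq2[of "u y" "u c"] y by simp
  qed
qed

lemma bounded_variation_on_countable_discontinuities:
  fixes u :: "real \<Rightarrow> complex^'n"
  assumes bv: "bounded_variation_on {c..d} u"
  shows "countable {x \<in> {c<..<d}. \<not> isCont u x}"
proof -
  obtain V where V: "mono_on {c..d} V"
    "\<And>y z. c \<le> y \<Longrightarrow> y \<le> z \<Longrightarrow> z \<le> d \<Longrightarrow> norm (u z - u y) \<le> V z - V y"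
    using bounded_variation_on_imp_monotone_majorant[OF bv] by blast
  have "mono_on {c<..<d} V" using V(1) by (auto simp: mono_on_def)
  then have c: "countable {x \<in> {c<..<d}. \<not> isCont V x}" by (rule mono_on_ctble_discont_open[rotated]) simp
  have "isCont u x" if x: "x \<in> {c<..<d}" "isCont V x" for x unfolding isCont_def
  proof (rule Lim_null[THEN iffD2], rule Lim_null_comparison)
    have "eventually (\<lambda>y. y \<in> {c<..<d}) (at x)" using x by (intro eventually_at_in_open') auto
    then show "eventually (\<lambda>y. norm (u y - u x) \<le> \<bar>V y - V x\<bar>) (at x)"
    proof eventually_elim
      case (elim y)
      then show ?case using V(2)[of x y] V(2)[of y x] x by (cases "x \<le> y") (auto simp: norm_minus_commute)
    qed
    show "((\<lambda>y. \<bar>V y - V x\<bar>) \<longlongrightarrow> 0) (at x)"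
      using x(2) by (intro tendsto_rabs_zero) (simp add: isCont_def Lim_null[symmetric])
  qed
  then have "{x \<in> {c<..<d}. \<not> isCont u x} \<subseteq> {x \<in> {c<..<d}. \<not> isCont V x}" by auto
  then show ?thesis using c countable_subset by blast
qed

definition locally_bounded_on :: "real set \<Rightarrow> (real \<Rightarrow> 'a::real_normed_vector) \<Rightarrow> bool" where
  "locally_bounded_on I u \<longleftrightarrow> (\<forall>c d. {c..d} \<subseteq> I \<longrightarrow> bounded (u ` {c..d}))"

lemma einterval_Icc_around:
  assumes "x \<in> einterval a b"
  obtains c d where "c < x" "x < d" "{c..d} \<subseteq> einterval a b"
proof -
  have "open (einterval a b)" by simp
  then obtain e where e: "e > 0" "cball x e \<subseteq> einterval a b" using assms open_contains_cball_eq by blast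
  then show thesis by (intro that[of "x - e" "x + e"]) (auto simp: cball_def dist_real_def subset_iff)
qed

lemma BV_sharp_limits:
  assumes "u \<in> BV_sharp I" "x \<in> I" "I = einterval a b"
  shows "(u \<longlongrightarrow> right_lim u x) (at_right x)" "(u \<longlongrightarrow> left_lim u x) (at_left x)"
proof -
  obtain c d where cd: "c < x" "x < d" "{c..d} \<subseteq> I" using einterval_Icc_around assms(2,3) by metis
  have "{c..x} \<subseteq> I" "{x..d} \<subseteq> I" using cd by auto
  then have "bounded_variation_on {c..x} u" "bounded_variation_on {x..d} u"
    using assms(1) unfolding BV_sharp_def by blast+
  then obtain l m where "(u \<longlongrightarrow> l) (at_right x)" "(u \<longlongrightarrow> m) (at_left x)"
    using bounded_variation_on_has_right_limit bounded_variation_on_has_left_limit cd by metis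
  then show "(u \<longlongrightarrow> right_lim u x) (at_right x)" "(u \<longlongrightarrow> left_lim u x) (at_left x)"
    unfolding right_lim_def left_lim_def by (auto simp: tendsto_Lim)
qed

lemma right_lim_eq: "(u \<longlongrightarrow> l) (at_right x) \<Longrightarrow> right_lim u x = l"
  and left_lim_eq: "(u \<longlongrightarrow> l) (at_left x) \<Longrightarrow> left_lim u x = l"
  by (auto simp: right_lim_def left_lim_def tendsto_Lim)

lemma BV_sharp_locally_bounded: "u \<in> BV_sharp I \<Longrightarrow> locally_bounded_on I u"
  by (auto simp: BV_sharp_def locally_bounded_on_def intro: bounded_variation_on_bounded)

lemma BV_sharp_countable_discontinuities:
  assumes "u \<in> BV_sharp I" "I = einterval a b" "a < b"
  shows "countable {x \<in> I. \<not> isCont u x}"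
proof -
  obtain l v :: "nat \<Rightarrow> real" where lv: "einterval a b = (\<Union>i. {l i..v i})" "\<And>i. a < l i" "\<And>i. v i < b"
    using einterval_Icc_approximation[OF assms(3)] by metis
  have "{l i..v i} \<subseteq> I" for i using lv(1) assms(2) by blast
  then have bv: "bounded_variation_on {l i..v i} u" for i using assms(1) unfolding BV_sharp_def by blast
  have "countable (\<Union>i. {x \<in> {l i<..<v i}. \<not> isCont u x} \<union> {l i, v i})"
    by (intro countable_UN countable_Un bounded_variation_on_countable_discontinuities bv) auto
  moreover have "{x \<in> I. \<not> isCont u x} \<subseteq> (\<Union>i. {x \<in> {l i<..<v i}. \<not> isCont u x} \<union> {l i, v i})"
  proof
    fix x assume x: "x \<in> {x \<in> I. \<not> isCont u x}"
    then obtain i where "x \<in> {l i..v i}" using lv(1) assms(2) by blast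
    then have "x \<in> {x \<in> {l i<..<v i}. \<not> isCont u x} \<union> {l i, v i}" using x by auto
    then show "x \<in> (\<Union>i. {x \<in> {l i<..<v i}. \<not> isCont u x} \<union> {l i, v i})" by blast
  qed
  ultimately show ?thesis using countable_subset by blast
qed

text \<open>Only countably many discontinuities are possible inside \<open>I\<close>, and outside \<open>I\<close> the function vanishes.\<close>

lemma BV_sharp_measurable:
  assumes "u \<in> BV_sharp I" "I = einterval a b" "a < b"
  shows "u \<in> borel_measurable borel"
proof (rule borel_measurable_continuous_countable_exceptions)
  let ?X = "{x \<in> I. \<not> isCont u x} \<union> {real_of_ereal a, real_of_ereal b}"
  show "countable ?X" using BV_sharp_countable_discontinuities[OF assms] by simp
  have "isCont u x" if x: "x \<in> - ?X" for x
  proof (cases "x \<in> I")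
    case False
    then have "ereal x < a \<or> b < ereal x" using x assms(2) by (cases a; cases b) (auto simp: einterval_def)
    then have "\<exists>S. open S \<and> x \<in> S \<and> S \<inter> I = {}"
    proof
      assume "ereal x < a"
      then show ?thesis using assms(2)
        by (intro exI[of _ "einterval (-\<infinity>) a"] conjI open_einterval) (auto simp: einterval_def)
    next
      assume "b < ereal x"
      then show ?thesis using assms(2)
        by (intro exI[of _ "einterval b \<infinity>"] conjI open_einterval) (auto simp: einterval_def)
    qed
    then obtain S where S: "open S" "x \<in> S" "S \<inter> I = {}" by blast
    have "eventually (\<lambda>y. u y = 0) (nhds x)"
      unfolding eventually_nhds using S assms(1) by (intro exI[of _ S]) (auto simp: BV_sharp_def)
    then have "isCont u x \<longleftrightarrow> isCont (\<lambda>_. 0 :: complex^'a) x" by (rule isCont_cong)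
    then show ?thesis by simp
  qed (use x in auto)
  then show "continuous_on (- ?X) u" by (intro continuous_at_imp_continuous_on) auto
qed

section \<open>Smooth bump functions\<close>

text \<open>The functions \<open>bump_term s t k l\<close> vanish off \<open>(s, t)\<close>, and differentiation maps their linear span
  into itself; hence all their derivatives exist.\<close>

definition bump_term :: "real \<Rightarrow> real \<Rightarrow> nat \<Rightarrow> nat \<Rightarrow> real \<Rightarrow> real" where
  "bump_term s t k l x = (if s < x \<and> x < t
     then inverse (x - s) ^ k * inverse (t - x) ^ l * exp (- inverse (x - s) - inverse (t - x)) else 0)"

inductive_set bump_span :: "real \<Rightarrow> real \<Rightarrow> (real \<Rightarrow> real) set" for s t where
  bump: "bump_term s t k l \<in> bump_span s t"
| add: "f \<in> bump_span s t \<Longrightarrow> g \<in> bump_span s t \<Longrightarrow> (\<lambda>x. f x + g x) \<in> bump_span s t"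
| scale: "f \<in> bump_span s t \<Longrightarrow> (\<lambda>x. c * f x) \<in> bump_span s t"

lemma power_times_exp_minus_bounded:
  obtains C :: real where "\<And>z. z \<ge> 0 \<Longrightarrow> z ^ k * exp (- z) \<le> C"
proof
  fix z :: real assume z: "z \<ge> 0"
  have "(\<Sum>n\<in>{k}. z ^ n /\<^sub>R fact n) \<le> (\<Sum>n. z ^ n /\<^sub>R fact n)"
    by (rule sum_le_suminf) (use exp_converges[of z] z in \<open>auto simp: sums_iff\<close>)
  then have "z ^ k / fact k \<le> exp z" using exp_converges[of z] by (simp add: sums_iff divide_inverse mult.commute)
  then show "z ^ k * exp (- z) \<le> fact k" by (simp add: exp_minus field_simps)
qed

text \<open>The exponential beats the powers, so that the terms are flat at both end points: the derivative there
  is zero.\<close>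

lemma bump_term_le_quadratic:
  assumes "s < t"
  obtains C where "\<And>x. bump_term s t k l x \<le> C * (x - s)^2" "\<And>x. bump_term s t k l x \<le> C * (x - t)^2"
proof -
  obtain C1 where C1: "\<And>z::real. z \<ge> 0 \<Longrightarrow> z ^ (k+2) * exp (- z) \<le> C1" using power_times_exp_minus_bounded[of "k+2"] by auto
  obtain C2 where C2: "\<And>z::real. z \<ge> 0 \<Longrightarrow> z ^ (l+2) * exp (- z) \<le> C2" using power_times_exp_minus_bounded[of "l+2"] by auto
  obtain C3 where C3: "\<And>z::real. z \<ge> 0 \<Longrightarrow> z ^ k * exp (- z) \<le> C3" using power_times_exp_minus_bounded[of "k"] by auto
  obtain C4 where C4: "\<And>z::real. z \<ge> 0 \<Longrightarrow> z ^ l * exp (- z) \<le> C4" using power_times_exp_minus_bounded[of "l"] by auto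
  have pos: "0 \<le> C1" "0 \<le> C2" "0 \<le> C3" "0 \<le> C4"
    using C1[of 0] C2[of 0] C3[of 1] C4[of 1] by (auto intro: order_trans[OF _ C3[of 1]] order_trans[OF _ C4[of 1]])
  have eq: "bump_term s t k l x = (z ^ k * exp (- z)) * (y ^ l * exp (- y))"
    if "s < x" "x < t" "z = inverse (x - s)" "y = inverse (t - x)" for x y z
  proof -
    have "exp (- z - y) = exp (- z) * exp (- y)" by (simp add: exp_add[symmetric])
    then show ?thesis using that(1,2) by (simp add: bump_term_def that(3,4)[symmetric])
  qed
  have 1: "bump_term s t k l x \<le> (C1 * C4) * (x - s)^2" for x
  proof (cases "s < x \<and> x < t")
    case True
    define z y where "z = inverse (x - s)" and "y = inverse (t - x)"
    have zy: "z > 0" "y > 0" "(x - s)^2 * z^2 = 1" using True by (auto simp: z_def y_def power_mult_distrib[symmetric])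
    have "bump_term s t k l x = (z ^ k * exp (- z)) * (y ^ l * exp (- y))" using eq True z_def y_def by auto
    also have "\<dots> = (z ^ k * exp (- z)) * (y ^ l * exp (- y)) * ((x - s)^2 * z^2)" using zy(3) by simp
    also have "\<dots> = (z ^ (k+2) * exp (- z)) * (y ^ l * exp (- y)) * (x - s)^2" by (simp only: power_add mult_ac)
    also have "\<dots> \<le> (C1 * C4) * (x - s)^2" using zy pos by (intro mult_right_mono mult_mono C1 C4) auto
    finally show ?thesis .
  next
    case False then show ?thesis using pos by (auto simp: bump_term_def)
  qed
  have 2: "bump_term s t k l x \<le> (C3 * C2) * (x - t)^2" for x
  proof (cases "s < x \<and> x < t")
    case True
    define z y where "z = inverse (x - s)" and "y = inverse (t - x)"
    have zy: "z > 0" "y > 0" "(t - x)^2 * y^2 = 1" using True by (auto simp: z_def y_def power_mult_distrib[symmetric])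
    have "bump_term s t k l x = (z ^ k * exp (- z)) * (y ^ l * exp (- y))" using eq True z_def y_def by auto
    also have "\<dots> = (z ^ k * exp (- z)) * (y ^ l * exp (- y)) * ((t - x)^2 * y^2)" using zy(3) by simp
    also have "\<dots> = (z ^ k * exp (- z)) * (y ^ (l+2) * exp (- y)) * (t - x)^2" by (simp only: power_add mult_ac)
    also have "\<dots> \<le> (C3 * C2) * (t - x)^2" using zy pos by (intro mult_right_mono mult_mono C2 C3) auto
    finally show ?thesis by (simp add: power2_commute)
  next
    case False then show ?thesis using pos by (auto simp: bump_term_def)
  qed
  show thesis
  proof (rule that[of "max (C1 * C4) (C3 * C2)"])
    fix x
    show "bump_term s t k l x \<le> max (C1 * C4) (C3 * C2) * (x - s)^2"
      using 1[of x] by (rule order_trans) (intro mult_right_mono, auto)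
    show "bump_term s t k l x \<le> max (C1 * C4) (C3 * C2) * (x - t)^2"
      using 2[of x] by (rule order_trans) (intro mult_right_mono, auto)
  qed
qed

lemma bump_term_nonneg: "0 \<le> bump_term s t k l x"
  by (auto simp: bump_term_def intro!: mult_nonneg_nonneg)

lemma has_real_derivative_zero_quadratic:
  fixes f :: "real \<Rightarrow> real"
  assumes "f y = 0" "\<And>x. \<bar>f x\<bar> \<le> C * (x - y)^2"
  shows "(f has_real_derivative 0) (at y)"
proof -
  have "((\<lambda>x. (f x - f y) / (x - y)) \<longlongrightarrow> 0) (at y)"
  proof (rule Lim_null_comparison)
    show "\<forall>\<^sub>F x in at y. norm ((f x - f y) / (x - y)) \<le> \<bar>C\<bar> * \<bar>x - y\<bar>"
    proof (intro always_eventually allI)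
      fix x
      have "\<bar>f x\<bar> \<le> \<bar>C\<bar> * \<bar>x - y\<bar> * \<bar>x - y\<bar>"
        using assms(2)[of x] by (rule order_trans) (simp add: power2_eq_square mult_right_mono abs_mult[symmetric] mult.assoc)
      then show "norm ((f x - f y) / (x - y)) \<le> \<bar>C\<bar> * \<bar>x - y\<bar>"
        using assms(1) by (cases "x = y") (auto simp: divide_le_eq)
    qed
    have "((\<lambda>x. \<bar>C\<bar> * \<bar>x - y\<bar>) \<longlongrightarrow> \<bar>C\<bar> * \<bar>y - y\<bar>) (at y)" by (intro tendsto_intros)
    then show "((\<lambda>x. \<bar>C\<bar> * \<bar>x - y\<bar>) \<longlongrightarrow> 0) (at y)" by simp
  qed
  then show ?thesis by (simp add: has_field_derivative_iff)
qed

text \<open>Inside the interval this is the product rule; at the end points the quadratic bound gives derivative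
  \<open>0\<close>, in accordance with the value of the formula.\<close>

lemma bump_term_has_derivative:
  assumes "s < t"
  shows "(bump_term s t k l has_real_derivative
     ((- real k * bump_term s t (k+1) l x + real l * bump_term s t k (l+1) x)
      + (bump_term s t (k+2) l x + (- 1) * bump_term s t k (l+2) x))) (at x)"
proof -
  consider "s < x" "x < t" | "x = s" | "x = t" | "x < s \<or> t < x" by linarith
  then show ?thesis
  proof cases
    case 1
    have "((\<lambda>x. inverse (x - s) ^ k * inverse (t - x) ^ l * exp (- inverse (x - s) - inverse (t - x)))
       has_real_derivative ((- real k * bump_term s t (k+1) l x + real l * bump_term s t k (l+1) x)
      + (bump_term s t (k+2) l x + (- 1) * bump_term s t k (l+2) x))) (at x)"
    proof -
      define z y e where "z = inverse (x - s)" and "y = inverse (t - x)" and "e = exp (- z - y)"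
      have Dz: "((\<lambda>x. inverse (x - s)) has_real_derivative - (z * z)) (at x)"
        and Dy: "((\<lambda>x. inverse (t - x)) has_real_derivative y * y) (at x)"
        using 1 by (auto intro!: derivative_eq_intros simp: z_def y_def)
      have "((\<lambda>x. inverse (x - s) ^ k) has_real_derivative - real k * z ^ (k+1)) (at x)"
        using DERIV_power[OF Dz, of k] by (cases k) (auto simp: z_def[symmetric] algebra_simps)
      moreover have "((\<lambda>x. inverse (t - x) ^ l) has_real_derivative real l * y ^ (l+1)) (at x)"
        using DERIV_power[OF Dy, of l] by (cases l) (auto simp: y_def[symmetric] algebra_simps)
      moreover have "((\<lambda>x. exp (- inverse (x - s) - inverse (t - x))) has_real_derivative e * (z * z - y * y)) (at x)"
        by (rule DERIV_cong[OF DERIV_fun_exp[OF DERIV_diff[OF DERIV_minus[OF Dz] Dy]]])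
           (simp add: e_def z_def y_def)
      ultimately have "((\<lambda>x. inverse (x - s) ^ k * inverse (t - x) ^ l * exp (- inverse (x - s) - inverse (t - x)))
        has_real_derivative ((- real k * z ^ (k+1)) * y ^ l + (real l * y ^ (l+1)) * z ^ k) * e
          + e * (z * z - y * y) * (z ^ k * y ^ l)) (at x)" unfolding z_def y_def e_def by (intro DERIV_mult)
      moreover have "((- real k * z ^ (k+1)) * y ^ l + (real l * y ^ (l+1)) * z ^ k) * e
          + e * (z * z - y * y) * (z ^ k * y ^ l) = (- real k * (z ^ (k+1) * y ^ l * e) + real l * (z ^ k * y ^ (l+1) * e))
      + (z ^ (k+2) * y ^ l * e + (- 1) * (z ^ k * y ^ (l+2) * e))" by (simp add: algebra_simps)
      ultimately show ?thesis using 1 by (simp add: bump_term_def z_def y_def e_def)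
    qed
    moreover have "eventually (\<lambda>y. bump_term s t k l y = inverse (y - s) ^ k * inverse (t - y) ^ l * exp (- inverse (y - s) - inverse (t - y))) (nhds x)"
    proof -
      have "eventually (\<lambda>y. y \<in> {s<..<t}) (nhds x)" using 1 by (intro eventually_nhds_in_open) auto
      then show ?thesis by eventually_elim (auto simp: bump_term_def)
    qed
    ultimately show ?thesis by (subst DERIV_cong_ev) auto
  next
    case 2
    obtain C where C: "\<And>x. bump_term s t k l x \<le> C * (x - s)^2" using bump_term_le_quadratic[OF assms] by metis
    have "(bump_term s t k l has_real_derivative 0) (at s)"
      by (rule has_real_derivative_zero_quadratic[of _ _ C]) (auto simp: bump_term_nonneg C, simp add: bump_term_def)
    then show ?thesis using 2 by (simp add: bump_term_def)
  next
    case 3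
    obtain C where C: "\<And>x. bump_term s t k l x \<le> C * (x - t)^2" using bump_term_le_quadratic[OF assms] by metis
    have "(bump_term s t k l has_real_derivative 0) (at t)"
      by (rule has_real_derivative_zero_quadratic[of _ _ C]) (auto simp: bump_term_nonneg C, simp add: bump_term_def)
    then show ?thesis using 3 by (simp add: bump_term_def)
  next
    case 4
    have "eventually (\<lambda>y. y \<in> {..<s} \<union> {t<..}) (nhds x)" using 4 by (intro eventually_nhds_in_open) auto
    then have "eventually (\<lambda>y. bump_term s t k l y = 0) (nhds x)" by eventually_elim (auto simp: bump_term_def)
    then have "(bump_term s t k l has_real_derivative 0) (at x)"
      by (subst DERIV_cong_ev[of x x _ "\<lambda>_. 0" 0 0]) auto
    then show ?thesis using 4 by (auto simp: bump_term_def)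
  qed
qed

lemma bump_span_deriv:
  assumes "s < t" "f \<in> bump_span s t"
  shows "\<exists>g\<in>bump_span s t. \<forall>x. (f has_real_derivative g x) (at x)"
  using assms(2)
proof induction
  case (bump k l)
  have "(\<lambda>x. (- real k * bump_term s t (k+1) l x + real l * bump_term s t k (l+1) x)
      + (bump_term s t (k+2) l x + (- 1) * bump_term s t k (l+2) x)) \<in> bump_span s t" by (intro bump_span.intros)
  then show ?case by (rule rev_bexI) (use bump_term_has_derivative[OF assms(1)] in blast)
next
  case (add f g)
  then obtain f' g' where "f' \<in> bump_span s t" "g' \<in> bump_span s t"
    "\<forall>x. (f has_real_derivative f' x) (at x)" "\<forall>x. (g has_real_derivative g' x) (at x)" by blast
  then show ?case by (intro bexI[of _ "\<lambda>x. f' x + g' x"]) (auto intro!: derivative_intros bump_span.intros)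
next
  case (scale f c)
  then obtain f' where "f' \<in> bump_span s t" "\<forall>x. (f has_real_derivative f' x) (at x)" by blast
  then show ?case by (intro bexI[of _ "\<lambda>x. c * f' x"]) (auto intro!: derivative_eq_intros bump_span.intros)
qed

text \<open>All iterated derivatives stay in the set, so each of them is differentiable.\<close>

lemma smooth_if_closed_under_deriv:
  fixes F :: "(real \<Rightarrow> real) set"
  assumes F: "\<And>f. f \<in> F \<Longrightarrow> \<exists>g\<in>F. \<forall>x. (f has_real_derivative g x) (at x)" and f: "f \<in> F"
  shows "(deriv ^^ k) f differentiable_on UNIV"
proof -
  have "(deriv ^^ k) f \<in> F"
  proof (induction k)
    case (Suc k)
    then obtain g where "g \<in> F" "\<forall>x. ((deriv ^^ k) f has_real_derivative g x) (at x)" using F by blast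
    moreover have "deriv ((deriv ^^ k) f) = g" using calculation(2) by (auto simp: DERIV_imp_deriv fun_eq_iff)
    ultimately show ?case by simp
  qed (use f in simp)
  then obtain g where "\<forall>x. ((deriv ^^ k) f has_real_derivative g x) (at x)" using F by blast
  then show ?thesis unfolding differentiable_on_def by (metis UNIV_I differentiable_at_withinI real_differentiable_def)
qed

lemma bump_span_smooth_sum_antiderivative:
  assumes "s < t" "s' < t'" "f \<in> bump_span s t" "g \<in> bump_span s' t'"
    and \<phi>: "\<And>x. (\<phi> has_real_derivative (f x + g x)) (at x)"
  shows "(deriv ^^ k) \<phi> differentiable_on UNIV"
proof (rule smooth_if_closed_under_deriv)
  let ?F = "insert \<phi> {\<lambda>x. f x + g x | f g. f \<in> bump_span s t \<and> g \<in> bump_span s' t'}"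
  show "\<phi> \<in> ?F" by simp
  fix h assume "h \<in> ?F"
  then consider "h = \<phi>" | f g where "h = (\<lambda>x. f x + g x)" "f \<in> bump_span s t" "g \<in> bump_span s' t'" by blast
  then show "\<exists>g\<in>?F. \<forall>x. (h has_real_derivative g x) (at x)"
  proof cases
    case 1 then show ?thesis using \<phi> assms by (intro bexI[of _ "\<lambda>x. f x + g x"]) auto
  next
    case (2 f g)
    obtain f' where f': "f' \<in> bump_span s t" "\<forall>x. (f has_real_derivative f' x) (at x)" using bump_span_deriv 2 assms by blast
    obtain g' where g': "g' \<in> bump_span s' t'" "\<forall>x. (g has_real_derivative g' x) (at x)" using bump_span_deriv 2 assms by blast
    show ?thesis using f' g' unfolding 2(1) by (intro bexI[of _ "\<lambda>x. f' x + g' x"]) (auto intro!: derivative_intros)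
  qed
qed

definition bump :: "real \<Rightarrow> real \<Rightarrow> real \<Rightarrow> real" where
  "bump s t = bump_term s t 0 0"

lemma bump_properties:
  assumes "s < t"
  shows "bump s t \<in> bump_span s t" "\<And>x. 0 \<le> bump s t x" "\<And>x. x \<notin> {s<..<t} \<Longrightarrow> bump s t x = 0"
    "continuous_on A (bump s t)" "integral\<^sup>L lborel (bump s t) > 0" "integrable lborel (bump s t)"
proof -
  show "bump s t \<in> bump_span s t" unfolding bump_def by (rule bump_span.bump)
  show nn: "\<And>x. 0 \<le> bump s t x" by (simp add: bump_def bump_term_nonneg)
  show z: "\<And>x. x \<notin> {s<..<t} \<Longrightarrow> bump s t x = 0" by (auto simp: bump_def bump_term_def)
  have c: "continuous_on A (bump s t)" for A using bump_term_has_derivative[OF assms] unfolding bump_def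
    by (intro continuous_at_imp_continuous_on ballI DERIV_isCont) blast
  then show "continuous_on A (bump s t)" .
  have "bump s t = (\<lambda>x. indicator {s..t} x *\<^sub>R bump s t x)"
  proof
    fix x show "bump s t x = indicator {s..t} x *\<^sub>R bump s t x" by (cases "x \<in> {s<..<t}") (use z[of x] in auto)
  qed
  moreover have "integrable lborel (\<lambda>x. indicator {s..t} x *\<^sub>R bump s t x)"
    using borel_integrable_compact[of "{s..t}" "bump s t"] c by simp
  ultimately show int: "integrable lborel (bump s t)" by simp
  have "integral\<^sup>L lborel (bump s t) \<noteq> 0"
  proof
    assume "integral\<^sup>L lborel (bump s t) = 0"
    then have "AE x in lborel. bump s t x = 0" using integral_nonneg_eq_0_iff_AE[OF int] nn by auto
    then have "AE x in lborel. x \<notin> {s<..<t}" by eventually_elim (auto simp: bump_def bump_term_def)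
    then have "{s<..<t} \<in> null_sets lborel" by (subst AE_iff_null_sets) auto
    then have "emeasure lborel {s<..<t} = 0" by auto
    then show False using assms by simp
  qed
  moreover have "integral\<^sup>L lborel (bump s t) \<ge> 0" using nn by simp
  ultimately show "integral\<^sup>L lborel (bump s t) > 0" by simp
qed

text \<open>The primitive of a difference of two normalised bumps has compact support; the two one-sided
  mean values that it produces are what determines a function whose distributional derivative vanishes.\<close>

lemma bump_difference_primitive:
  assumes st: "s < t" "s' < t'" and I: "{c..d} \<subseteq> I" "c \<le> s" "t \<le> d" "c \<le> s'" "t' \<le> d"
  obtains \<phi> where "test_function I \<phi>"
    "deriv \<phi> = (\<lambda>x. bump s t x / integral\<^sup>L lborel (bump s t) - bump s' t' x / integral\<^sup>L lborel (bump s' t'))"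
proof -
  define m m' where "m = integral\<^sup>L lborel (bump s t)" and "m' = integral\<^sup>L lborel (bump s' t')"
  have m: "m > 0" "m' > 0" using bump_properties(5) st by (auto simp: m_def m'_def)
  define \<rho> where "\<rho> x = (1/m) * bump s t x + (- 1/m') * bump s' t' x" for x
  define \<phi> where "\<phi> x = (LBINT y:{c..x}. \<rho> y)" for x
  have \<rho>int: "integrable lborel \<rho>" unfolding \<rho>_def using bump_properties(6) st by auto
  have \<rho>c: "continuous_on A \<rho>" for A unfolding \<rho>_def using bump_properties(4) st by (intro continuous_intros) auto
  have \<rho>0: "\<rho> x = 0" if "x \<le> c \<or> d \<le> x" for x using that I bump_properties(3) st by (auto simp: \<rho>_def)
  have "integral\<^sup>L lborel \<rho> = 0"
    unfolding \<rho>_def using bump_properties(6) st m by (subst Bochner_Integration.integral_add) (auto simp: m_def[symmetric] m'_def[symmetric])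
  then have right: "\<phi> x = 0" if "d \<le> x" for x
  proof -
    have "indicator {c..x} y *\<^sub>R \<rho> y = \<rho> y" for y
      by (cases "c \<le> y \<and> y \<le> d") (use \<rho>0[of y] that in auto)
    then have "(\<lambda>y. indicator {c..x} y *\<^sub>R \<rho> y) = \<rho>" by (rule ext)
    then show ?thesis using \<open>integral\<^sup>L lborel \<rho> = 0\<close> by (simp add: \<phi>_def set_lebesgue_integral_def)
  qed
  have left: "\<phi> x = 0" if "x \<le> c" for x
  proof -
    have "(\<lambda>y. indicator {c..x} y *\<^sub>R \<rho> y) = (\<lambda>_. 0)" using \<rho>0 that by (auto simp: fun_eq_iff indicator_def)
    then show ?thesis by (simp add: \<phi>_def set_lebesgue_integral_def)
  qed
  have deriv: "(\<phi> has_real_derivative \<rho> x) (at x)" for x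
  proof (cases "x < c")
    case True
    have "eventually (\<lambda>y. y \<in> {..<c}) (nhds x)" using True by (intro eventually_nhds_in_open) auto
    then have "eventually (\<lambda>y. \<phi> y = 0) (nhds x)" by eventually_elim (auto intro: left)
    then have "(\<phi> has_real_derivative 0) (at x)" by (subst DERIV_cong_ev[of x x _ "\<lambda>_. 0" 0 0]) auto
    then show ?thesis using \<rho>0[of x] True by simp
  next
    case False
    define c' where "c' = c - 1"
    have e: "\<phi> y = integral {c'..y} \<rho>" for y
    proof -
      have "\<phi> y = (LBINT z:{c'..y}. \<rho> z)" unfolding \<phi>_def set_lebesgue_integral_def
        using \<rho>0 by (intro Bochner_Integration.integral_cong) (auto simp: indicator_def c'_def)
      also have "\<dots> = integral {c'..y} \<rho>" using \<rho>int unfolding set_lebesgue_integral_def[symmetric]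
        by (intro set_borel_integral_eq_integral(2)) (unfold set_integrable_def, intro integrable_mult_indicator, auto)
      finally show ?thesis .
    qed
    have "((\<lambda>y. integral {c'..y} \<rho>) has_vector_derivative \<rho> x) (at x within {c'..x+1})"
      using False \<rho>c by (intro integral_has_vector_derivative) (auto simp: c'_def)
    then have "((\<lambda>y. integral {c'..y} \<rho>) has_vector_derivative \<rho> x) (at x)"
      using False by (subst (asm) at_within_interior) (auto simp: c'_def)
    then show ?thesis unfolding e[abs_def] by (simp add: has_real_derivative_iff_has_vector_derivative)
  qed
  have supp: "closure {x. \<phi> x \<noteq> 0} \<subseteq> {c..d}"
  proof (rule closure_minimal)
    show "{x. \<phi> x \<noteq> 0} \<subseteq> {c..d}"
    proof
      fix x assume "x \<in> {x. \<phi> x \<noteq> 0}"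
      then show "x \<in> {c..d}" using left[of x] right[of x] by (cases "x \<le> c"; cases "d \<le> x") auto
    qed
  qed simp
  have "test_function I \<phi>" unfolding test_function_def
  proof (intro conjI allI)
    fix k
    show "(deriv ^^ k) \<phi> differentiable_on UNIV"
      by (rule bump_span_smooth_sum_antiderivative[OF st bump_span.scale[OF bump_properties(1)[OF st(1)], of "1/m"]
           bump_span.scale[OF bump_properties(1)[OF st(2)], of "- 1/m'"] deriv[unfolded \<rho>_def]])
    show "closure {x. \<phi> x \<noteq> 0} \<subseteq> I" using supp I by blast
    show "compact (closure {x. \<phi> x \<noteq> 0})" using supp by (meson bounded_closed_interval bounded_subset closed_closure compact_eq_bounded_closed)
  qed
  moreover have "deriv \<phi> = (\<lambda>x. bump s t x / m - bump s' t' x / m')"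
    using deriv by (auto simp: fun_eq_iff \<rho>_def DERIV_imp_deriv)
  ultimately show thesis using that by (simp add: m_def m'_def)
qed

section \<open>Complex vectors and the weight\<close>

lemma cdot_add_left: "cdot (x + y) z = cdot x z + cdot y z"
  and cdot_add_right: "cdot x (y + z) = cdot x y + cdot x z"
  and cdot_diff_left: "cdot (x - y) z = cdot x z - cdot y z"
  and cdot_diff_right: "cdot x (y - z) = cdot x y - cdot x z"
  and cdot_cscale_left: "cdot (c *s x) y = cnj c * cdot x y"
  and cdot_cscale_right: "cdot x (c *s y) = c * cdot x y"
  and cdot_zero_left [simp]: "cdot 0 y = 0" and cdot_zero_right [simp]: "cdot x 0 = 0"
  and cdot_minus_right: "cdot x (- y) = - cdot x y"
  by (simp_all add: cdot_def algebra_simps sum.distrib sum_subtractf sum_negf sum_distrib_left)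

lemma cdot_scaleR_left: "cdot (r *\<^sub>R x) y = r *\<^sub>R cdot x y"
  and cdot_scaleR_right: "cdot x (r *\<^sub>R y) = r *\<^sub>R cdot x y"
  by (simp_all add: cdot_def scaleR_sum_right)

lemma cdot_sum_right: "cdot x (\<Sum>i\<in>S. y i) = (\<Sum>i\<in>S. cdot x (y i))"
  by (induction S rule: infinite_finite_induct) (auto simp: cdot_add_right)

lemma Re_cdot: "Re (cdot x y) = inner x y"
  by (simp add: cdot_def inner_vec_def inner_complex_def)

text \<open>The norm of a matrix as a nested vector is its Hilbert-Schmidt norm.\<close>

lemma norm_matrix_vector_mult_le: "norm (A *v x) \<le> norm (A :: complex^'n^'m) * norm (x :: complex^'n)"
proof -
  have 1: "norm ((A *v x) $ i) \<le> norm (A $ i) * norm x" for i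
  proof -
    have "norm ((A *v x) $ i) \<le> (\<Sum>j\<in>UNIV. norm (A $ i $ j) * norm (x $ j))"
      unfolding matrix_vector_mult_def vec_lambda_beta by (rule order_trans[OF norm_sum]) (simp add: norm_mult)
    also have "\<dots> \<le> L2_set (\<lambda>j. norm (A $ i $ j)) UNIV * L2_set (\<lambda>j. norm (x $ j)) UNIV"
      using L2_set_mult_ineq[of "\<lambda>j. norm (A $ i $ j)" "\<lambda>j. norm (x $ j)" UNIV] by simp
    finally show ?thesis by (simp add: norm_vec_def)
  qed
  have "norm (A *v x) = L2_set (\<lambda>i. norm ((A *v x) $ i)) UNIV" by (simp add: norm_vec_def)
  also have "\<dots> \<le> L2_set (\<lambda>i. norm (A $ i) * norm x) UNIV" by (intro L2_set_mono 1) auto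
  also have "\<dots> = norm A * norm x" by (simp add: L2_set_left_distrib norm_vec_def[of A])
  finally show ?thesis .
qed

lemma bounded_bilinear_matrix_vector_mult:
  "bounded_bilinear (\<lambda>(A :: complex^'n^'m) (x :: complex^'n). A *v x)"
proof
  show "(A + A') *v x = A *v x + A' *v x" for A A' :: "complex^'n^'m" and x by (rule matrix_vector_mult_add_rdistrib)
  show "A *v (x + y) = A *v x + A *v y" for A :: "complex^'n^'m" and x y by (rule matrix_vector_right_distrib)
  show "(r *\<^sub>R A) *v x = r *\<^sub>R (A *v x)" "A *v (r *\<^sub>R x) = r *\<^sub>R (A *v x)" for r and A :: "complex^'n^'m" and x
    by (simp_all add: vec_eq_iff matrix_vector_mult_def scaleR_sum_right)
  show "\<exists>K. \<forall>(A :: complex^'n^'m) x. norm (A *v x) \<le> norm A * norm x * K"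
    using norm_matrix_vector_mult_le by (intro exI[of _ 1]) auto
qed

lemmas bounded_linear_matrix_vector_mult = bounded_bilinear.bounded_linear_right[OF bounded_bilinear_matrix_vector_mult]

lemma scaleR_eq_cscale: "r *\<^sub>R x = complex_of_real r *s (x :: complex^'n)"
  unfolding vec_eq_iff by (simp add: complex_eq_iff)

lemma norm_cscale: "norm (c *s z) = norm c * norm (z :: complex^'n)"
  by (simp add: norm_vec_def L2_set_def norm_mult power_mult_distrib sum_distrib_left[symmetric] real_sqrt_mult)

lemma bounded_linear_cscale: "bounded_linear (\<lambda>x :: complex^'n. c *s x)"
proof
  show "c *s (x + y) = c *s x + c *s y" for x y :: "complex^'n" by (simp add: vec_eq_iff algebra_simps)
  show "c *s (r *\<^sub>R x) = r *\<^sub>R (c *s x)" for r and x :: "complex^'n" by (simp add: vec_eq_iff)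
  show "\<exists>K. \<forall>x :: complex^'n. norm (c *s x) \<le> norm x * K" by (intro exI[of _ "norm c"]) (simp add: norm_cscale)
qed

lemma norm_cdot_le: "norm (cdot x y) \<le> norm x * norm (y :: complex^'n)"
proof -
  have "norm (cdot x y) \<le> (\<Sum>j\<in>UNIV. norm (x $ j) * norm (y $ j))"
    unfolding cdot_def by (rule order_trans[OF norm_sum]) (simp add: norm_mult)
  also have "\<dots> \<le> norm x * norm y"
    using L2_set_mult_ineq[of "\<lambda>j. norm (x $ j)" "\<lambda>j. norm (y $ j)" UNIV] by (simp add: norm_vec_def)
  finally show ?thesis .
qed

lemma bounded_bilinear_cdot: "bounded_bilinear (cdot :: complex^'n \<Rightarrow> complex^'n \<Rightarrow> complex)"
proof
  show "\<exists>K. \<forall>x y :: complex^'n. norm (cdot x y) \<le> norm x * norm y * K"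
    using norm_cdot_le by (intro exI[of _ 1]) auto
qed (simp_all add: cdot_add_left cdot_add_right cdot_scaleR_left cdot_scaleR_right)

lemma borel_measurable_matrix_vector_mult [measurable (raw)]:
  fixes A :: "'a \<Rightarrow> complex^'n^'m"
  assumes "A \<in> borel_measurable M" "x \<in> borel_measurable M"
  shows "(\<lambda>y. A y *v x y) \<in> borel_measurable M"
  using bounded_bilinear.continuous_on[OF bounded_bilinear_matrix_vector_mult]
  by (intro borel_measurable_continuous_Pair[OF assms] ) (intro bounded_bilinear.continuous_on[OF bounded_bilinear_matrix_vector_mult] continuous_intros)

lemma borel_measurable_cdot [measurable (raw)]:
  fixes x :: "'a \<Rightarrow> complex^'n"
  assumes "x \<in> borel_measurable M" "y \<in> borel_measurable M"
  shows "(\<lambda>t. cdot (x t) (y t)) \<in> borel_measurable M"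
  by (intro borel_measurable_continuous_Pair[OF assms] ) (intro bounded_bilinear.continuous_on[OF bounded_bilinear_cdot] continuous_intros)

lemma borel_measurable_cscale [measurable (raw)]:
  fixes x :: "'a \<Rightarrow> complex^'n"
  assumes "c \<in> borel_measurable M" "x \<in> borel_measurable M"
  shows "(\<lambda>t. c t *s x t) \<in> borel_measurable M"
proof -
  have "continuous_on UNIV (\<lambda>p::complex \<times> (complex^'n). fst p *s snd p)"
    unfolding vector_scalar_mult_def by (intro continuous_intros)
  then show ?thesis by (intro borel_measurable_continuous_Pair[OF assms])
qed

text \<open>Non-negativity of a Hermitian form on the plane spanned by two vectors already gives their
  Cauchy-Schwarz inequality: it suffices to minimise over the multiples of the second one.\<close>

lemma quadratic_nonneg_imp_cauchy_schwarz:
  fixes a b :: real and s :: complex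
  assumes q: "\<And>c :: complex. 0 \<le> a + 2 * Re (c * s) + norm c ^ 2 * b" and b: "0 \<le> b"
  shows "norm s ^ 2 \<le> a * b"
proof -
  have q': "0 \<le> a + 2 * t * norm s ^ 2 + t^2 * norm s ^ 2 * b" for t :: real
  proof -
    have 1: "of_real t * cnj s * s = of_real (t * norm s ^ 2)"
      by (simp add: complex_norm_square[symmetric] mult.assoc mult.commute[of "cnj s"] del: of_real_power)
    have 2: "norm (of_real t * cnj s) ^ 2 = t^2 * norm s ^ 2" by (simp add: norm_mult power_mult_distrib)
    show ?thesis using q[of "of_real t * cnj s"] unfolding 1 2 by simp
  qed
  have a: "0 \<le> a" using q[of 0] by simp
  show ?thesis
  proof (cases "b = 0")
    case True
    have "norm s ^ 2 = 0"
    proof (rule ccontr)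
      assume n: "norm s ^ 2 \<noteq> 0"
      have "0 \<le> a + 2 * (- (a + 1) / norm s ^ 2) * norm s ^ 2" using q'[of "- (a + 1) / norm s ^ 2"] True by simp
      then have "0 \<le> - a - 2" using n by simp
      then show False using a by linarith
    qed
    then show ?thesis using True by simp
  next
    case False
    then have p: "b > 0" using b by linarith
    have "0 \<le> a - norm s ^ 2 / b" using q'[of "- 1 / b"] p by (simp add: power2_eq_square field_simps)
    then show ?thesis using p by (simp add: field_simps)
  qed
qed

text \<open>A matrix with non-negative quadratic form is Hermitian and its form is a semi-inner product;
  this is the case for the density of \<open>w\<close> almost everywhere.\<close>

definition nonneg_matrix :: "complex^'n^'n \<Rightarrow> bool" where
  "nonneg_matrix A \<longleftrightarrow> (\<forall>z. cdot z (A *v z) \<in> \<real>\<^sub>\<ge>\<^sub>0)"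

lemma matrix_vector_mult_cscale: "(A :: complex^'n^'m) *v (c *s x) = c *s (A *v x)"
  by (simp add: vec_eq_iff matrix_vector_mult_def sum_distrib_left mult_ac)

lemma matrix_vector_mult_sum_right: "(A :: complex^'n^'m) *v (\<Sum>i\<in>S. y i) = (\<Sum>i\<in>S. A *v y i)"
  by (induction S rule: infinite_finite_induct) (auto simp: matrix_vector_right_distrib)

lemma matrix_vector_mult_linear [simp]:
  fixes A :: "complex^'n^'m"
  shows "A *v (x + y) = A *v x + A *v y" "A *v (x - y) = A *v x - A *v y" "A *v (- x) = - (A *v x)"
   "A *v (r *\<^sub>R x) = r *\<^sub>R (A *v x)" "(r *\<^sub>R A) *v x = r *\<^sub>R (A *v x)"
  by (simp_all add: vec_eq_iff matrix_vector_mult_def algebra_simps sum.distrib sum_subtractf sum_negf scaleR_sum_right)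

context
  fixes A :: "complex^'n^'n" assumes A: "nonneg_matrix A"
begin

lemma nonneg_matrix_form: "Re (cdot x (A *v x)) \<ge> 0" "Im (cdot x (A *v x)) = 0"
  using A[unfolded nonneg_matrix_def, rule_format, of x] by (auto simp: complex_nonneg_Reals_iff)

lemma nonneg_matrix_hermitian: "cdot x (A *v y) = cnj (cdot y (A *v x))"
proof -
  have 1: "Im (cdot x (A *v y)) + Im (cdot y (A *v x)) = 0"
    using nonneg_matrix_form(2)[of "x + y"] nonneg_matrix_form(2)[of x] nonneg_matrix_form(2)[of y]
    by (simp add: cdot_add_left cdot_add_right)
  have 2: "Re (cdot x (A *v y)) - Re (cdot y (A *v x)) = 0"
    using nonneg_matrix_form(2)[of "x + \<i> *s y"] nonneg_matrix_form(2)[of x] nonneg_matrix_form(2)[of y]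
    by (simp add: cdot_add_left cdot_add_right cdot_cscale_left cdot_cscale_right matrix_vector_mult_cscale)
  show ?thesis using 1 2 by (simp add: complex_eq_iff)
qed

lemma nonneg_matrix_cauchy_schwarz:
  "norm (cdot x (A *v y)) ^ 2 \<le> Re (cdot x (A *v x)) * Re (cdot y (A *v y))"
proof (rule quadratic_nonneg_imp_cauchy_schwarz)
  fix c
  have e: "cdot y (A *v x) = cnj (cdot x (A *v y))" by (rule nonneg_matrix_hermitian)
  have "0 \<le> Re (cdot (x + c *s y) (A *v (x + c *s y)))" by (rule nonneg_matrix_form)
  also have "\<dots> = Re (cdot x (A *v x)) + Re (c * cdot x (A *v y)) + Re (cnj (c * cdot x (A *v y)))
      + Re (c * cnj c * cdot y (A *v y))" by (simp add: cdot_add_left cdot_add_right cdot_cscale_left cdot_cscale_right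
       matrix_vector_mult_cscale e algebra_simps)
  also have "\<dots> = Re (cdot x (A *v x)) + 2 * Re (c * cdot x (A *v y)) + norm c ^ 2 * Re (cdot y (A *v y))"
    using nonneg_matrix_form(2)[of y] by (simp add: complex_norm_square[symmetric] del: of_real_power)
  finally show "0 \<le> Re (cdot x (A *v x)) + 2 * Re (c * cdot x (A *v y)) + norm c ^ 2 * Re (cdot y (A *v y))" .
qed (rule nonneg_matrix_form)

text \<open>The Cauchy-Schwarz inequality for the form, tested with the unit vectors, bounds \<open>A x\<close> by the form
  of \<open>x\<close> and the trace of \<open>A\<close>.\<close>

lemma nonneg_matrix_norm_mult:
  "norm (A *v y) ^ 2 \<le> (\<Sum>i\<in>UNIV. norm (A $ i $ i)) * Re (cdot y (A *v y))"
proof -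
  have comp: "z $ i = cdot (axis i 1) z" for z :: "complex^'n" and i
    by (simp add: cdot_def axis_def if_distrib[of cnj] if_distrib[of "\<lambda>x. x * _"] cong: if_cong)
  have ii: "cdot (axis i 1) (A *v axis i 1) = A $ i $ i" for i unfolding comp[symmetric]
    by (simp add: matrix_vector_mult_def axis_def if_distrib[of "\<lambda>x. _ * x"] cong: if_cong)
  have "norm (A *v y) ^ 2 = (\<Sum>i\<in>UNIV. norm ((A *v y) $ i) ^ 2)" by (simp add: norm_vec_def L2_set_def sum_nonneg)
  also have "\<dots> \<le> (\<Sum>i\<in>UNIV. norm (A $ i $ i) * Re (cdot y (A *v y)))"
  proof (rule sum_mono)
    fix i
    have "norm ((A *v y) $ i) ^ 2 \<le> Re (A $ i $ i) * Re (cdot y (A *v y))"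
      unfolding comp[of "A *v y"] using nonneg_matrix_cauchy_schwarz[of "axis i 1" y] ii by simp
    also have "\<dots> \<le> norm (A $ i $ i) * Re (cdot y (A *v y))"
      by (intro mult_right_mono nonneg_matrix_form) (auto intro: complex_Re_le_cmod)
    finally show "norm ((A *v y) $ i) ^ 2 \<le> norm (A $ i $ i) * Re (cdot y (A *v y))" .
  qed
  finally show ?thesis by (simp add: sum_distrib_right)
qed

end

section \<open>The space of square-integrable functions\<close>

locale weighted_interval =
  fixes a b :: ereal and I :: "real set" and w :: "real set \<Rightarrow> complex^'n^'n"
  assumes ab: "a < b" and I_eq: "I = einterval a b"
    and w_order0: "order0_distr I w" and w_nonneg: "nonneg_distr I w"
begin

abbreviation "M \<equiv> base_measure I w"
abbreviation "W \<equiv> density_mat I w"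
abbreviation "L2 \<equiv> L2_fun I w"
abbreviation "ip \<equiv> L2_inner I w"
abbreviation "cls \<equiv> L2_class I w"

lemma w_represents: "represents I w M W"
  by (rule represents_base_measure[OF ab I_eq w_order0])

lemma sets_M [simp, measurable_cong]: "sets M = sets borel"
  and W_measurable [measurable]: "W \<in> borel_measurable borel"
  and W_integrable: "compact K \<Longrightarrow> K \<subseteq> I \<Longrightarrow> set_integrable M K W"
  and M_finite: "compact K \<Longrightarrow> K \<subseteq> I \<Longrightarrow> emeasure M K < \<infinity>"
  and w_eq: "A \<in> local_borel I \<Longrightarrow> w A = (LINT x:A|M. W x)"
  using w_represents unfolding represents_def by auto

lemma space_M [simp]: "space M = UNIV"
  using sets_eq_imp_space_eq[OF sets_M] by simp

lemma I_borel [measurable]: "I \<in> sets borel"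
  unfolding I_eq by simp

lemma exhaustion:
  obtains K :: "nat \<Rightarrow> real set" where "\<And>i. compact (K i)" "\<And>i. K i \<subseteq> I" "I = (\<Union>i. K i)"
proof -
  obtain u l :: "nat \<Rightarrow> real" where "einterval a b = (\<Union>i. {l i..u i})"
    using einterval_Icc_approximation[OF ab] by metis
  then show thesis using that[of "\<lambda>i. {l i..u i}"] I_eq by auto
qed

lemma AE_I_if_compact:
  assumes "\<And>K. compact K \<Longrightarrow> K \<subseteq> I \<Longrightarrow> AE y in M. y \<in> K \<longrightarrow> P y"
  shows "AE y in M. y \<in> I \<longrightarrow> P y"
proof -
  obtain K :: "nat \<Rightarrow> real set" where K: "\<And>i. compact (K i)" "\<And>i. K i \<subseteq> I" "I = (\<Union>i. K i)"
    using exhaustion by blast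
  have "AE y in M. \<forall>i. y \<in> K i \<longrightarrow> P y" unfolding AE_all_countable using assms K(1,2) by blast
  then show ?thesis by eventually_elim (use K(3) in blast)
qed

text \<open>The integral over the set where \<open>g\<close> is negative is both non-positive and non-negative.\<close>

lemma AE_nonneg_if_set_integrals_nonneg:
  fixes g :: "real \<Rightarrow> real"
  assumes g: "set_integrable M K g" "g \<in> borel_measurable borel" "K \<in> sets borel"
    and pos: "\<And>A. A \<in> sets borel \<Longrightarrow> A \<subseteq> K \<Longrightarrow> 0 \<le> (LINT y:A|M. g y)"
  shows "AE y in M. y \<in> K \<longrightarrow> 0 \<le> g y"
proof -
  define A where "A = {y \<in> K. g y < 0}"
  have "{y. g y < 0} \<in> sets borel" using g(2) by (simp add: borel_measurable_iff_less)
  then have A: "A \<in> sets borel" "A \<subseteq> K" using g(3) by (auto simp: A_def Collect_conj_eq)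
  have "set_integrable M A g" by (rule set_integrable_subset[OF g(1)]) (use A in auto)
  then have int: "integrable M (\<lambda>y. indicator A y * - g y)"
    unfolding set_integrable_def by (auto dest: integrable_minus)
  have nn: "indicator A y * - g y \<ge> 0" for y by (auto simp: A_def indicator_def)
  have "(LINT y|M. indicator A y * - g y) = - (LINT y:A|M. g y)" unfolding set_lebesgue_integral_def by simp
  also have "\<dots> \<le> 0" using pos[OF A] by simp
  finally have "(LINT y|M. indicator A y * - g y) = 0"
    using Bochner_Integration.integral_nonneg[of M "\<lambda>y. indicator A y * - g y"] nn by (intro antisym) auto
  then have "AE y in M. indicator A y * - g y = 0" using integral_nonneg_eq_0_iff_AE[OF int] nn by simp
  then show ?thesis by eventually_elim (auto simp: A_def indicator_def split: if_splits)
qed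

text \<open>For a fixed vector the quadratic form of the density has non-negative integrals over all sets, so it
  is non-negative almost everywhere. The exceptional null set can be chosen independently of the vector
  because it suffices to test with a countable dense set.\<close>

lemma AE_nonneg_matrix: "AE y in M. y \<in> I \<longrightarrow> nonneg_matrix (W y)"
proof (rule AE_I_if_compact)
  fix K assume K: "compact K" "K \<subseteq> I"
  have Kb: "K \<in> sets borel" using K by (simp add: borel_compact)
  have gen: "AE y in M. y \<in> K \<longrightarrow> 0 \<le> L (W y)"
    if bl: "bounded_linear L" and pos: "\<And>A. A \<in> local_borel I \<Longrightarrow> 0 \<le> L (w A)" for L :: "complex^'n^'n \<Rightarrow> real"
  proof (rule AE_nonneg_if_set_integrals_nonneg[OF _ _ Kb])
    have ind: "indicator A y *\<^sub>R L (W y) = L (indicator A y *\<^sub>R W y)" for A y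
      using bounded_linear.linear[OF bl] by (simp add: linear_cmul)
    show "set_integrable M K (\<lambda>y. L (W y))"
      using integrable_bounded_linear[OF bl W_integrable[OF K, unfolded set_integrable_def]]
      unfolding set_integrable_def ind .
    show "(\<lambda>y. L (W y)) \<in> borel_measurable borel"
      by (rule measurable_compose[OF W_measurable borel_measurable_continuous_onI[OF bounded_linear.continuous_on[OF bl continuous_on_id]]])
    fix A assume A: "A \<in> sets borel" "A \<subseteq> K"
    have "set_integrable M A W" by (rule set_integrable_subset[OF W_integrable[OF K]]) (use A in auto)
    then have "(LINT y:A|M. L (W y)) = L (LINT y:A|M. W y)"
      unfolding set_lebesgue_integral_def set_integrable_def ind by (rule integral_bounded_linear[OF bl])
    moreover have "A \<in> local_borel I" using A K by (auto simp: local_borel_def)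
    ultimately show "0 \<le> (LINT y:A|M. L (W y))" using w_eq pos by metis
  qed
  have z: "AE y in M. y \<in> K \<longrightarrow> cdot z (W y *v z) \<in> \<real>\<^sub>\<ge>\<^sub>0" for z
  proof -
    have bl: "bounded_linear (\<lambda>A. cdot z (A *v z))"
      by (rule bounded_linear_compose[OF bounded_bilinear.bounded_linear_right[OF bounded_bilinear_cdot, of z]
        bounded_bilinear.bounded_linear_left[OF bounded_bilinear_matrix_vector_mult, of z]])
    note re = bounded_linear_compose[OF bounded_linear_Re bl] and im = bounded_linear_compose[OF bounded_linear_Im bl]
    have "cdot z (w A *v z) \<in> \<real>\<^sub>\<ge>\<^sub>0" if "A \<in> local_borel I" for A using w_nonneg that by (simp add: nonneg_distr_def)
    then have nn: "0 \<le> Re (cdot z (w A *v z))" "0 \<le> Im (cdot z (w A *v z))" "0 \<le> - Im (cdot z (w A *v z))"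
      if "A \<in> local_borel I" for A using that by (auto simp: complex_nonneg_Reals_iff)
    have "AE y in M. y \<in> K \<longrightarrow> 0 \<le> Re (cdot z (W y *v z))" by (rule gen[OF re]) (rule nn(1))
    moreover have "AE y in M. y \<in> K \<longrightarrow> 0 \<le> Im (cdot z (W y *v z))" by (rule gen[OF im]) (rule nn(2))
    moreover have "AE y in M. y \<in> K \<longrightarrow> 0 \<le> - Im (cdot z (W y *v z))"
      by (rule gen[OF bounded_linear_minus[OF im]]) (rule nn(3))
    ultimately show ?thesis by eventually_elim (auto simp: complex_nonneg_Reals_iff)
  qed
  obtain D :: "(complex^'n) set" where D: "countable D" "\<And>X. open X \<Longrightarrow> X \<noteq> {} \<Longrightarrow> \<exists>d\<in>D. d \<in> X"
    using countable_dense_exists[where 'a = "complex^'n"] by auto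
  have "AE y in M. \<forall>z\<in>D. y \<in> K \<longrightarrow> cdot z (W y *v z) \<in> \<real>\<^sub>\<ge>\<^sub>0"
    by (rule AE_ball_countable[OF D(1), THEN iffD2]) (use z in blast)
  then show "AE y in M. y \<in> K \<longrightarrow> nonneg_matrix (W y)"
  proof eventually_elim
    case (elim y)
    have "cdot z (W y *v z) \<in> \<real>\<^sub>\<ge>\<^sub>0" if "y \<in> K" for z
    proof -
      have cont: "continuous_on UNIV (\<lambda>z. cdot z (W y *v z))"
        by (intro bounded_bilinear.continuous_on[OF bounded_bilinear_cdot]
          bounded_bilinear.continuous_on[OF bounded_bilinear_matrix_vector_mult] continuous_intros)
      have "closed {z. cdot z (W y *v z) \<in> \<real>\<^sub>\<ge>\<^sub>0}"
        using closed_vimage[OF closed_nonneg_Reals_complex cont] by (simp add: vimage_def)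
      then have "open (- {z. cdot z (W y *v z) \<in> \<real>\<^sub>\<ge>\<^sub>0})" by (simp only: closed_def)
      then have "- {z. cdot z (W y *v z) \<in> \<real>\<^sub>\<ge>\<^sub>0} = {}" using D(2) elim that by blast
      then show ?thesis by auto
    qed
    then show ?case by (simp add: nonneg_matrix_def)
  qed
qed

definition form :: "(real \<Rightarrow> complex^'n) \<Rightarrow> (real \<Rightarrow> complex^'n) \<Rightarrow> real \<Rightarrow> complex" where
  "form f g y = cdot (f y) (W y *v g y)"

definition sq :: "(real \<Rightarrow> complex^'n) \<Rightarrow> real" where
  "sq f = Re (ip f f)"

lemma L2_inner_form: "ip f g = (LINT y:I|M. form f g y)"
  by (simp add: L2_inner_def form_def)

lemma form_measurable:
  assumes "set_borel_measurable borel I f" "set_borel_measurable borel I g"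
  shows "set_borel_measurable M I (form f g)"
proof -
  have "(\<lambda>y. cdot (indicator I y *\<^sub>R f y) (W y *v (indicator I y *\<^sub>R g y))) \<in> borel_measurable borel"
    using assms unfolding set_borel_measurable_def by measurable
  moreover have "cdot (indicator I y *\<^sub>R f y) (W y *v (indicator I y *\<^sub>R g y)) = indicator I y *\<^sub>R form f g y" for y
    by (simp add: form_def indicator_def)
  ultimately show ?thesis unfolding set_borel_measurable_def by (simp add: measurable_cong_sets[OF sets_M refl])
qed

text \<open>Pointwise Cauchy-Schwarz inequality; it makes the inner product of two square-integrable functions an
  integral of an integrable function.\<close>

lemma form_bound:
  "AE y in M. y \<in> I \<longrightarrow> norm (form f g y) \<le> Re (form f f y) + Re (form g g y) \<and> 0 \<le> Re (form f f y) \<and> Im (form f f y) = 0"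
  using AE_nonneg_matrix
proof eventually_elim
  case (elim y)
  show ?case
  proof
    assume "y \<in> I"
    then have A: "nonneg_matrix (W y)" using elim by simp
    define p q where "p = Re (form f f y)" and "q = Re (form g g y)"
    have pq: "p \<ge> 0" "q \<ge> 0" using nonneg_matrix_form[OF A] by (auto simp: form_def p_def q_def)
    have "norm (form f g y) ^ 2 \<le> p * q" using nonneg_matrix_cauchy_schwarz[OF A] by (simp add: form_def p_def q_def)
    also have "\<dots> \<le> (p + q) ^ 2" using pq by (simp add: power2_eq_square algebra_simps)
    finally have "norm (form f g y) \<le> p + q" by (rule power2_le_imp_le) (use pq in simp)
    then show "norm (form f g y) \<le> Re (form f f y) + Re (form g g y) \<and> 0 \<le> Re (form f f y) \<and> Im (form f f y) = 0"
      using pq nonneg_matrix_form[OF A] by (auto simp: form_def p_def q_def)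
  qed
qed

lemma L2_fun_iff: "f \<in> L2 \<longleftrightarrow> set_borel_measurable borel I f \<and> set_integrable M I (form f f)"
proof -
  have "L2_sqnorm I w f < \<infinity> \<longleftrightarrow> set_integrable M I (form f f)" if f: "set_borel_measurable borel I f"
  proof -
    have m: "(\<lambda>y. indicator I y *\<^sub>R form f f y) \<in> borel_measurable M"
      using form_measurable[OF f f] by (simp add: set_borel_measurable_def)
    have "L2_sqnorm I w f = (\<integral>\<^sup>+y. ennreal (norm (indicator I y *\<^sub>R form f f y)) \<partial>M)"
      unfolding L2_sqnorm_def
    proof (rule nn_integral_cong_AE)
      show "AE y in M. ennreal (Re (cdot (f y) (W y *v f y))) * indicator I y = ennreal (norm (indicator I y *\<^sub>R form f f y))"
        using form_bound[of f f]
      proof eventually_elim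
        case (elim y)
        then show ?case by (cases "y \<in> I") (auto simp: form_def cmod_eq_Re)
      qed
    qed
    then show ?thesis using m unfolding set_integrable_def integrable_iff_bounded by simp
  qed
  then show ?thesis by (auto simp: L2_fun_def)
qed

lemma form_integrable:
  assumes "f \<in> L2" "g \<in> L2"
  shows "set_integrable M I (form f g)"
  unfolding set_integrable_def
proof (rule Bochner_Integration.integrable_bound)
  show "integrable M (\<lambda>y. norm (indicator I y *\<^sub>R form f f y) + norm (indicator I y *\<^sub>R form g g y))"
    using assms unfolding L2_fun_iff set_integrable_def by (intro Bochner_Integration.integrable_add integrable_norm) auto
  show "(\<lambda>y. indicator I y *\<^sub>R form f g y) \<in> borel_measurable M"
    using form_measurable[of f g] assms by (auto simp: L2_fun_iff set_borel_measurable_def)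
  show "AE y in M. norm (indicator I y *\<^sub>R form f g y)
    \<le> norm (norm (indicator I y *\<^sub>R form f f y) + norm (indicator I y *\<^sub>R form g g y))"
    using form_bound[of f g] form_bound[of g g]
  proof eventually_elim
    case (elim y)
    show ?case using elim complex_Re_le_cmod[of "form f f y"] complex_Re_le_cmod[of "form g g y"]
      by (cases "y \<in> I") (auto simp: abs_of_nonneg)
  qed
qed

lemma sq_nonneg: "0 \<le> sq f"
proof (cases "set_integrable M I (form f f)")
  case True
  then have "sq f = (LINT y:I|M. Re (form f f y))"
    by (simp add: sq_def L2_inner_form set_lebesgue_integral_def set_integrable_def integral_Re[symmetric])
  also have "\<dots> \<ge> 0" unfolding set_lebesgue_integral_def
    by (rule integral_nonneg_AE) (use form_bound[of f f] in \<open>auto simp: indicator_def\<close>)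
  finally show ?thesis .
next
  case False
  then show ?thesis by (simp add: sq_def L2_inner_form set_lebesgue_integral_def set_integrable_def not_integrable_integral_eq)
qed

lemma sq_eq_integral: "f \<in> L2 \<Longrightarrow> sq f = (LINT y:I|M. Re (form f f y))"
  by (simp add: L2_fun_iff sq_def L2_inner_form set_lebesgue_integral_def set_integrable_def integral_Re[symmetric])

lemma L2_sqnorm_eq: "f \<in> L2 \<Longrightarrow> L2_sqnorm I w f = ennreal (sq f)"
proof -
  assume f: "f \<in> L2"
  have int: "integrable M (\<lambda>y. indicator I y * Re (form f f y))"
    using integrable_Re[OF form_integrable[OF f f, unfolded set_integrable_def]] by simp
  have "L2_sqnorm I w f = (\<integral>\<^sup>+y. ennreal (indicator I y * Re (form f f y)) \<partial>M)"
    unfolding L2_sqnorm_def by (intro nn_integral_cong) (auto simp: form_def indicator_def)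
  also have "\<dots> = ennreal (LINT y|M. indicator I y * Re (form f f y))"
    by (rule nn_integral_eq_integral[OF int]) (use form_bound[of f f] in \<open>auto simp: indicator_def\<close>)
  finally show ?thesis by (simp add: sq_eq_integral[OF f] set_lebesgue_integral_def)
qed

lemma L2_inner_self: "f \<in> L2 \<Longrightarrow> ip f f = of_real (sq f)"
proof -
  assume f: "f \<in> L2"
  have "Im (ip f f) = (LINT y:I|M. Im (form f f y))"
    using f by (simp add: L2_fun_iff L2_inner_form set_lebesgue_integral_def set_integrable_def integral_Im[symmetric])
  also have "\<dots> = (LINT y|M. 0)" unfolding set_lebesgue_integral_def
  proof (rule integral_cong_AE)
    show "(\<lambda>y. indicator I y *\<^sub>R Im (form f f y)) \<in> borel_measurable M"
      using borel_measurable_integrable[OF integrable_Im[OF form_integrable[OF f f, unfolded set_integrable_def]]] by simp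
    show "AE y in M. indicator I y *\<^sub>R Im (form f f y) = 0" using form_bound[of f f] by (auto simp: indicator_def)
  qed simp
  finally show ?thesis by (simp add: sq_def complex_eq_iff)
qed

lemma L2_fun_add: "f \<in> L2 \<Longrightarrow> g \<in> L2 \<Longrightarrow> (\<lambda>y. f y + g y) \<in> L2"
proof -
  assume fg: "f \<in> L2" "g \<in> L2"
  have "set_borel_measurable borel I (\<lambda>y. f y + g y)"
    using fg unfolding L2_fun_iff set_borel_measurable_def by (auto simp: scaleR_add_right intro!: borel_measurable_add)
  moreover have "form (\<lambda>y. f y + g y) (\<lambda>y. f y + g y) = (\<lambda>y. (form f f y + form g g y) + (form f g y + form g f y))"
    by (auto simp: form_def cdot_add_left cdot_add_right fun_eq_iff)
  ultimately show ?thesis using form_integrable fg unfolding L2_fun_iff by auto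
qed

lemma L2_fun_cscale: "f \<in> L2 \<Longrightarrow> (\<lambda>y. c *s f y) \<in> L2"
proof -
  assume f: "f \<in> L2"
  have "(\<lambda>y. c *s (indicator I y *\<^sub>R f y)) \<in> borel_measurable borel"
    using f unfolding L2_fun_iff set_borel_measurable_def by (intro borel_measurable_cscale) auto
  moreover have "c *s (indicator I y *\<^sub>R f y) = indicator I y *\<^sub>R (c *s f y)" for y by (simp add: indicator_def)
  moreover have "form (\<lambda>y. c *s f y) (\<lambda>y. c *s f y) = (\<lambda>y. (cnj c * c) * form f f y)"
    by (auto simp: form_def cdot_cscale_left cdot_cscale_right matrix_vector_mult_cscale fun_eq_iff)
  ultimately show ?thesis using f unfolding L2_fun_iff set_borel_measurable_def by auto
qed

lemma cscale_minus_one: "(- 1) *s x = - (x :: complex^'m)" by (simp add: vec_eq_iff)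

lemma L2_fun_minus: "f \<in> L2 \<Longrightarrow> (\<lambda>y. - f y) \<in> L2"
  using L2_fun_cscale[of f "-1"] by (simp add: cscale_minus_one)

lemma L2_fun_diff: "f \<in> L2 \<Longrightarrow> g \<in> L2 \<Longrightarrow> (\<lambda>y. f y - g y) \<in> L2"
  using L2_fun_add[of f "\<lambda>y. - g y"] L2_fun_minus by simp

lemma L2_fun_scaleR: "f \<in> L2 \<Longrightarrow> (\<lambda>y. r *\<^sub>R f y) \<in> L2"
  unfolding scaleR_eq_cscale by (rule L2_fun_cscale)

lemma L2_fun_zero: "(\<lambda>y. 0) \<in> L2"
  by (simp add: L2_fun_iff set_borel_measurable_def form_def set_integrable_def)

lemma L2_inner_add_left:
  assumes "f \<in> L2" "g \<in> L2" "h \<in> L2"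
  shows "ip (\<lambda>y. f y + g y) h = ip f h + ip g h"
proof -
  have "form (\<lambda>y. f y + g y) h = (\<lambda>y. form f h y + form g h y)"
    by (simp add: form_def cdot_add_left fun_eq_iff)
  then show ?thesis
    unfolding L2_inner_form using set_integral_add(2)[OF form_integrable[OF assms(1,3)] form_integrable[OF assms(2,3)]] by simp
qed

lemma L2_inner_add_right:
  assumes "f \<in> L2" "g \<in> L2" "h \<in> L2"
  shows "ip h (\<lambda>y. f y + g y) = ip h f + ip h g"
proof -
  have "form h (\<lambda>y. f y + g y) = (\<lambda>y. form h f y + form h g y)"
    by (simp add: form_def cdot_add_right fun_eq_iff)
  then show ?thesis
    unfolding L2_inner_form using set_integral_add(2)[OF form_integrable[OF assms(3,1)] form_integrable[OF assms(3,2)]] by simp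
qed

lemma L2_inner_cscale_left: "ip (\<lambda>y. c *s f y) h = cnj c * ip f h"
proof -
  have "indicator I y *\<^sub>R form (\<lambda>y. c *s f y) h y = cnj c * (indicator I y *\<^sub>R form f h y)" for y
    by (simp add: form_def cdot_cscale_left)
  then show ?thesis unfolding L2_inner_form set_lebesgue_integral_def by (simp only: integral_mult_right_zero)
qed

lemma L2_inner_cscale_right: "ip h (\<lambda>y. c *s f y) = c * ip h f"
proof -
  have "indicator I y *\<^sub>R form h (\<lambda>y. c *s f y) y = c * (indicator I y *\<^sub>R form h f y)" for y
    by (simp add: form_def cdot_cscale_right matrix_vector_mult_cscale)
  then show ?thesis unfolding L2_inner_form set_lebesgue_integral_def by (simp only: integral_mult_right_zero)
qed

lemma L2_inner_minus_left: "ip (\<lambda>y. - f y) h = - ip f h"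
  using L2_inner_cscale_left[of "-1" f h] by (simp add: cscale_minus_one)

lemma L2_inner_minus_right: "ip h (\<lambda>y. - f y) = - ip h f"
  using L2_inner_cscale_right[of h "-1" f] by (simp add: cscale_minus_one)

lemma L2_inner_diff_left:
  assumes "f \<in> L2" "g \<in> L2" "h \<in> L2"
  shows "ip (\<lambda>y. f y - g y) h = ip f h - ip g h"
  using L2_inner_add_left[OF assms(1) L2_fun_minus[OF assms(2)] assms(3)] by (simp add: L2_inner_minus_left)

lemma L2_inner_diff_right:
  assumes "f \<in> L2" "g \<in> L2" "h \<in> L2"
  shows "ip h (\<lambda>y. f y - g y) = ip h f - ip h g"
  using L2_inner_add_right[OF assms(1) L2_fun_minus[OF assms(2)] assms(3)] by (simp add: L2_inner_minus_right)

lemma L2_inner_cnj: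
  assumes "f \<in> L2" "g \<in> L2"
  shows "ip f g = cnj (ip g f)"
proof -
  have "cnj (ip g f) = (LINT y|M. cnj (indicator I y *\<^sub>R form g f y))"
    unfolding L2_inner_form set_lebesgue_integral_def by (rule Bochner_Integration.integral_cnj[symmetric])
  also have "\<dots> = (LINT y|M. indicator I y *\<^sub>R form f g y)"
  proof (rule integral_cong_AE)
    show "(\<lambda>y. cnj (indicator I y *\<^sub>R form g f y)) \<in> borel_measurable M" "(\<lambda>y. indicator I y *\<^sub>R form f g y) \<in> borel_measurable M"
      using borel_measurable_integrable[OF integrable_cnj[OF form_integrable[OF assms(2,1), unfolded set_integrable_def]]]
        borel_measurable_integrable[OF form_integrable[OF assms, unfolded set_integrable_def]] by simp_all
    show "AE y in M. cnj (indicator I y *\<^sub>R form g f y) = indicator I y *\<^sub>R form f g y" using AE_nonneg_matrix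
    proof eventually_elim
      case (elim y)
      then show ?case using nonneg_matrix_hermitian[of "W y" "f y" "g y"] by (cases "y \<in> I") (auto simp: form_def)
    qed
  qed
  finally show ?thesis by (simp add: L2_inner_form set_lebesgue_integral_def)
qed

lemma sq_add:
  assumes "f \<in> L2" "g \<in> L2"
  shows "sq (\<lambda>y. f y + g y) = sq f + 2 * Re (ip f g) + sq g"
  using L2_inner_cnj[OF assms] assms
  by (simp add: sq_def L2_inner_add_left L2_inner_add_right L2_fun_add)

lemma sq_cscale: "sq (\<lambda>y. c *s f y) = norm c ^ 2 * sq f"
proof -
  have "ip (\<lambda>y. c *s f y) (\<lambda>y. c *s f y) = of_real (norm c ^ 2) * ip f f"
    by (simp add: L2_inner_cscale_left L2_inner_cscale_right complex_norm_square mult_ac del: of_real_power)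
  then show ?thesis by (simp add: sq_def del: of_real_power)
qed

lemma sq_minus: "sq (\<lambda>y. - f y) = sq f"
  using sq_cscale[of "-1" f] by (simp add: cscale_minus_one)

lemma L2_cauchy_schwarz:
  assumes "f \<in> L2" "g \<in> L2"
  shows "norm (ip f g) ^ 2 \<le> sq f * sq g"
proof (rule quadratic_nonneg_imp_cauchy_schwarz)
  fix c
  have "0 \<le> sq (\<lambda>y. f y + c *s g y)" by (rule sq_nonneg)
  also have "\<dots> = sq f + 2 * Re (c * ip f g) + norm c ^ 2 * sq g"
    using assms by (simp add: sq_add L2_fun_cscale L2_inner_cscale_right sq_cscale)
  finally show "0 \<le> sq f + 2 * Re (c * ip f g) + norm c ^ 2 * sq g" .
qed (rule sq_nonneg)

definition nrm :: "(real \<Rightarrow> complex^'n) \<Rightarrow> real" where "nrm f = sqrt (sq f)"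

lemma nrm_nonneg [simp]: "0 \<le> nrm f" by (simp add: nrm_def sq_nonneg)
lemma nrm_square: "nrm f ^ 2 = sq f" by (simp add: nrm_def sq_nonneg)
lemma nrm_minus: "nrm (\<lambda>y. - f y) = nrm f" by (simp add: nrm_def sq_minus)
lemma nrm_cscale: "nrm (\<lambda>y. c *s f y) = norm c * nrm f" by (simp add: nrm_def sq_cscale real_sqrt_mult)
lemma nrm_scaleR: "nrm (\<lambda>y. r *\<^sub>R f y) = \<bar>r\<bar> * nrm f"
  unfolding scaleR_eq_cscale nrm_cscale by simp

lemma L2_cauchy_schwarz_nrm:
  assumes "f \<in> L2" "g \<in> L2"
  shows "norm (ip f g) \<le> nrm f * nrm g"
  by (rule power2_le_imp_le) (use L2_cauchy_schwarz[OF assms] in \<open>auto simp: power_mult_distrib nrm_square\<close>)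

lemma nrm_add: "f \<in> L2 \<Longrightarrow> g \<in> L2 \<Longrightarrow> nrm (\<lambda>y. f y + g y) \<le> nrm f + nrm g"
proof (rule power2_le_imp_le)
  assume fg: "f \<in> L2" "g \<in> L2"
  have "Re (ip f g) \<le> nrm f * nrm g" using L2_cauchy_schwarz_nrm[OF fg] complex_Re_le_cmod order_trans by blast
  then show "nrm (\<lambda>y. f y + g y) ^ 2 \<le> (nrm f + nrm g)^2"
    using sq_add[OF fg] by (simp add: nrm_square power2_sum)
qed simp

lemma nrm_diff: "f \<in> L2 \<Longrightarrow> g \<in> L2 \<Longrightarrow> nrm (\<lambda>y. f y - g y) \<le> nrm f + nrm g"
  using nrm_add[of f "\<lambda>y. - g y"] L2_fun_minus[of g] by (simp add: nrm_minus)

lemma nrm_triangle: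
  "f \<in> L2 \<Longrightarrow> g \<in> L2 \<Longrightarrow> h \<in> L2 \<Longrightarrow>
     nrm (\<lambda>y. f y - h y) \<le> nrm (\<lambda>y. f y - g y) + nrm (\<lambda>y. g y - h y)"
  using nrm_add[of "\<lambda>y. f y - g y" "\<lambda>y. g y - h y"] by (simp add: L2_fun_diff)

lemma nrm_diff_commute: "nrm (\<lambda>y. f y - g y) = nrm (\<lambda>y. g y - f y)"
  using nrm_minus[of "\<lambda>y. f y - g y"] by simp

lemma nrm_zero [simp]: "nrm (\<lambda>y. 0) = 0" by (simp add: nrm_def sq_def L2_inner_form form_def)

lemma L2_inner_null_right: "f \<in> L2 \<Longrightarrow> g \<in> L2 \<Longrightarrow> nrm g = 0 \<Longrightarrow> ip f g = 0"
  and L2_inner_null_left: "f \<in> L2 \<Longrightarrow> g \<in> L2 \<Longrightarrow> nrm f = 0 \<Longrightarrow> ip f g = 0"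
  using L2_cauchy_schwarz_nrm[of f g] by auto

text \<open>A non-negative form that vanishes at a vector has this vector in the kernel of its matrix.\<close>

lemma L2_sqnorm_eq_0_iff: "L2_sqnorm I w f = 0 \<longleftrightarrow> (AE y in M. y \<in> I \<longrightarrow> W y *v f y = 0)"
  if f: "set_borel_measurable borel I f"
proof -
  have m: "(\<lambda>y. ennreal (Re (cdot (f y) (W y *v f y))) * indicator I y) \<in> borel_measurable M"
  proof -
    have "(\<lambda>y. ennreal (Re (indicator I y *\<^sub>R form f f y))) \<in> borel_measurable M"
      using form_measurable[OF f f] unfolding set_borel_measurable_def by measurable
    moreover have "ennreal (Re (indicator I y *\<^sub>R form f f y)) = ennreal (Re (cdot (f y) (W y *v f y))) * indicator I y" for y
      by (auto simp: form_def indicator_def)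
    ultimately show ?thesis by simp
  qed
  have "L2_sqnorm I w f = 0 \<longleftrightarrow> (AE y in M. ennreal (Re (cdot (f y) (W y *v f y))) * indicator I y = 0)"
    unfolding L2_sqnorm_def by (rule nn_integral_0_iff_AE[OF m])
  also have "\<dots> \<longleftrightarrow> (AE y in M. y \<in> I \<longrightarrow> W y *v f y = 0)"
    proof
      assume "AE y in M. ennreal (Re (cdot (f y) (W y *v f y))) * indicator I y = 0"
      then show "AE y in M. y \<in> I \<longrightarrow> W y *v f y = 0" using AE_nonneg_matrix
      proof eventually_elim
        case (elim y)
        show ?case
        proof
          assume y: "y \<in> I"
          then have "Re (cdot (f y) (W y *v f y)) = 0"
            using elim nonneg_matrix_form[of "W y" "f y"] by (auto simp: ennreal_eq_0_iff)
          then have "norm (W y *v f y) ^ 2 \<le> 0" using nonneg_matrix_norm_mult[of "W y" "f y"] elim y by simp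
          then show "W y *v f y = 0" by simp
        qed
      qed
    next
      assume "AE y in M. y \<in> I \<longrightarrow> W y *v f y = 0"
      then show "AE y in M. ennreal (Re (cdot (f y) (W y *v f y))) * indicator I y = 0"
        by eventually_elim (auto simp: indicator_def)
    qed
  finally show ?thesis .
qed

lemma nrm_eq_0_iff: "f \<in> L2 \<Longrightarrow> nrm f = 0 \<longleftrightarrow> (AE y in M. y \<in> I \<longrightarrow> W y *v f y = 0)"
  using L2_sqnorm_eq[of f] L2_sqnorm_eq_0_iff[of f] sq_nonneg[of f]
  by (auto simp: nrm_def L2_fun_iff ennreal_eq_0_iff)

text \<open>Pointwise, \<open>W f\<close> is at most the geometric mean of the trace of \<open>W\<close> and the form of \<open>f\<close>. The weighted
  arithmetic mean bounds it, and the weight \<open>\<parallel>f\<parallel>\<close> gives an estimate that is linear in the norm.\<close>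

lemma compact_integral_W_bound:
  assumes K: "compact K" "K \<subseteq> I"
  obtains C where "0 \<le> C" "\<And>f. f \<in> L2 \<Longrightarrow> set_integrable M K (\<lambda>y. W y *v f y)"
    "\<And>f. f \<in> L2 \<Longrightarrow> (LINT y:K|M. norm (W y *v f y)) \<le> C * nrm f"
proof -
  have Kb: "K \<in> sets borel" using K by (simp add: borel_compact)
  define t where "t y = (\<Sum>i\<in>UNIV. norm (W y $ i $ i))" for y
  have t0: "0 \<le> t y" for y by (simp add: t_def sum_nonneg)
  have tint: "set_integrable M K t"
  proof -
    have "integrable M (\<lambda>y. norm ((indicator K y *\<^sub>R W y) $ i $ i))" for i
      by (intro integrable_norm integrable_bounded_linear[OF bounded_linear_compose[OF bounded_linear_vec_nth bounded_linear_vec_nth]])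
         (use W_integrable[OF K] in \<open>simp add: set_integrable_def\<close>)
    then have "integrable M (\<lambda>y. \<Sum>i\<in>UNIV. norm ((indicator K y *\<^sub>R W y) $ i $ i))"
      by (rule Bochner_Integration.integrable_sum)
    moreover have "(\<Sum>i\<in>UNIV. norm ((indicator K y *\<^sub>R W y) $ i $ i)) = indicator K y *\<^sub>R t y" for y
      by (cases "y \<in> K") (auto simp: t_def)
    ultimately show ?thesis by (simp only: set_integrable_def)
  qed
  \<comment> \<open>The bound \<open>(e t + form f f / e) / 2\<close> is integrated and \<open>e\<close> chosen as the norm of \<open>f\<close>.\<close>
  define C where "C = ((LINT y:K|M. t y) + 1) / 2"
  have pt: "AE y in M. y \<in> K \<longrightarrow> (\<forall>e>0. norm (W y *v f y) \<le> (e * t y + Re (form f f y) / e) / 2)" for f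
    using AE_nonneg_matrix
  proof eventually_elim
    case (elim y)
    show ?case
    proof (intro impI allI)
      fix e :: real assume y: "y \<in> K" and e: "e > 0"
      then have A: "nonneg_matrix (W y)" using elim K by blast
      define q where "q = Re (form f f y)"
      have q0: "q \<ge> 0" using nonneg_matrix_form[OF A] by (simp add: q_def form_def)
      have "norm (W y *v f y) ^ 2 \<le> t y * q"
        using nonneg_matrix_norm_mult[OF A, of "f y"] by (simp add: t_def q_def form_def)
      also have "\<dots> \<le> ((e * t y + q / e) / 2)^2"
      proof -
        have "((e * t y + q / e) / 2)^2 - t y * q = ((e * t y - q / e) / 2)^2"
          using e by (simp add: power2_eq_square field_simps)
        then show ?thesis using zero_le_power2[of "(e * t y - q / e) / 2"] by linarith
      qed
      finally show "norm (W y *v f y) \<le> (e * t y + Re (form f f y) / e) / 2" unfolding q_def[symmetric]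
        by (rule power2_le_imp_le) (use e q0 t0[of y] in simp)
    qed
  qed
  have fint: "set_integrable M K (\<lambda>y. Re (form f f y))" "(LINT y:K|M. Re (form f f y)) \<le> sq f" if f: "f \<in> L2" for f
  proof -
    have i: "set_integrable M I (\<lambda>y. Re (form f f y))"
      using integrable_Re[OF form_integrable[OF f f, unfolded set_integrable_def]] by (simp add: set_integrable_def)
    show 1: "set_integrable M K (\<lambda>y. Re (form f f y))" by (rule set_integrable_subset[OF i]) (use Kb K in auto)
    show "(LINT y:K|M. Re (form f f y)) \<le> sq f" unfolding sq_eq_integral[OF f] set_lebesgue_integral_def
    proof (rule integral_mono_AE)
      show "AE y in M. indicator K y *\<^sub>R Re (form f f y) \<le> indicator I y *\<^sub>R Re (form f f y)"
        using form_bound[of f f] by eventually_elim (use K in \<open>auto simp: indicator_def\<close>)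
    qed (use 1 i in \<open>auto simp: set_integrable_def\<close>)
  qed
  have mint: "set_integrable M K (\<lambda>y. W y *v f y)" if f: "f \<in> L2" for f unfolding set_integrable_def
  proof (rule Bochner_Integration.integrable_bound)
    show "integrable M (\<lambda>y. indicator K y *\<^sub>R ((1 * t y + Re (form f f y) / 1) / 2))"
      using set_integral_add(1)[OF tint fint(1)[OF f]] unfolding set_integrable_def by simp
    have "(\<lambda>y. W y *v (indicator I y *\<^sub>R f y)) \<in> borel_measurable borel"
      using f unfolding L2_fun_iff set_borel_measurable_def
      by (intro borel_measurable_matrix_vector_mult W_measurable) auto
    then have "(\<lambda>y. indicator K y *\<^sub>R (W y *v (indicator I y *\<^sub>R f y))) \<in> borel_measurable M"
      unfolding measurable_cong_sets[OF sets_M refl] using Kb by (intro borel_measurable_scaleR borel_measurable_indicator) auto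
    moreover have "indicator K y *\<^sub>R (W y *v (indicator I y *\<^sub>R f y)) = indicator K y *\<^sub>R (W y *v f y)" for y
      using K by (auto simp: indicator_def)
    ultimately show "(\<lambda>y. indicator K y *\<^sub>R (W y *v f y)) \<in> borel_measurable M" by (simp only:)
    show "AE y in M. norm (indicator K y *\<^sub>R (W y *v f y)) \<le> norm (indicator K y *\<^sub>R ((1 * t y + Re (form f f y) / 1) / 2))"
      using pt[of f]
    proof eventually_elim
      case (elim y)
      show ?case
      proof (cases "y \<in> K")
        case True
        then have "norm (W y *v f y) \<le> (1 * t y + Re (form f f y) / 1) / 2" using elim zero_less_one by blast
        then show ?thesis using True abs_ge_self[of "(1 * t y + Re (form f f y) / 1) / 2"] by simp
      qed simp
    qed
  qed
  have "(LINT y:K|M. norm (W y *v f y)) \<le> C * nrm f" if f: "f \<in> L2" for f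
  proof (cases "nrm f = 0")
    case True
    then have "AE y in M. y \<in> I \<longrightarrow> W y *v f y = 0" using nrm_eq_0_iff[OF f] by simp
    then have "AE y in M. indicator K y *\<^sub>R norm (W y *v f y) = 0"
      by eventually_elim (use K in \<open>auto simp: indicator_def\<close>)
    then have "(LINT y:K|M. norm (W y *v f y)) = 0" unfolding set_lebesgue_integral_def by (rule integral_eq_zero_AE)
    then show ?thesis using True by simp
  next
    case False
    then have N: "nrm f > 0" using nrm_nonneg[of f] by linarith
    have "(LINT y:K|M. norm (W y *v f y)) \<le> (LINT y:K|M. (nrm f * t y + Re (form f f y) / nrm f) / 2)"
      unfolding set_lebesgue_integral_def
    proof (rule integral_mono_AE)
      show "integrable M (\<lambda>y. indicator K y *\<^sub>R norm (W y *v f y))"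
        using integrable_norm[OF mint[OF f, unfolded set_integrable_def]] by simp
      show "integrable M (\<lambda>y. indicator K y *\<^sub>R ((nrm f * t y + Re (form f f y) / nrm f) / 2))"
        using tint fint(1)[OF f] unfolding set_integrable_def[symmetric] by (intro set_integrable_divide set_integral_add set_integrable_mult_right)
      show "AE y in M. indicator K y *\<^sub>R norm (W y *v f y) \<le> indicator K y *\<^sub>R ((nrm f * t y + Re (form f f y) / nrm f) / 2)"
        using pt[of f] N by (auto simp: indicator_def)
    qed
    also have "\<dots> = (nrm f * (LINT y:K|M. t y) + (LINT y:K|M. Re (form f f y)) / nrm f) / 2"
      using tint fint(1)[OF f] by (simp add: set_integral_add)
    also have "\<dots> \<le> (nrm f * (LINT y:K|M. t y) + nrm f ^ 2 / nrm f) / 2"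
      using fint(2)[OF f] N by (intro divide_right_mono add_left_mono) (auto simp: nrm_square)
    also have "\<dots> = C * nrm f" using N by (simp add: C_def power2_eq_square field_simps)
    finally show ?thesis .
  qed
  moreover have "0 \<le> C" unfolding C_def set_lebesgue_integral_def
    by (intro divide_nonneg_nonneg add_nonneg_nonneg Bochner_Integration.integral_nonneg) (auto simp: t0)
  ultimately show thesis using mint that by blast
qed

end

context weighted_interval
begin

lemma L2_class_iff: "f \<in> L2 \<Longrightarrow> v \<in> cls f \<longleftrightarrow> v \<in> L2 \<and> nrm (\<lambda>y. v y - f y) = 0"
  using L2_sqnorm_eq[of "\<lambda>y. v y - f y"] L2_fun_diff[of v f] sq_nonneg[of "\<lambda>y. v y - f y"]
  by (auto simp: L2_class_def nrm_def ennreal_eq_0_iff)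

lemma L2_class_self: "f \<in> L2 \<Longrightarrow> f \<in> cls f"
  by (simp add: L2_class_iff)

lemma L2_class_eq_iff:
  assumes f: "f \<in> L2" and g: "g \<in> L2"
  shows "cls f = cls g \<longleftrightarrow> nrm (\<lambda>y. f y - g y) = 0"
proof
  assume "cls f = cls g"
  then show "nrm (\<lambda>y. f y - g y) = 0" using L2_class_self[OF f] L2_class_iff[OF g] by auto
next
  assume fg: "nrm (\<lambda>y. f y - g y) = 0"
  have "nrm (\<lambda>y. v y - f y) = 0 \<longleftrightarrow> nrm (\<lambda>y. v y - g y) = 0" if v: "v \<in> L2" for v
    using nrm_triangle[OF v f g] nrm_triangle[OF v g f] nrm_nonneg[of "\<lambda>y. v y - g y"] nrm_nonneg[of "\<lambda>y. v y - f y"]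
      fg nrm_diff_commute[of f g] by linarith
  then show "cls f = cls g" using L2_class_iff[OF f] L2_class_iff[OF g] by blast
qed

lemma L2_rep_class:
  assumes "f \<in> L2"
  shows "L2_rep (cls f) \<in> L2" "nrm (\<lambda>y. L2_rep (cls f) y - f y) = 0"
proof -
  have "L2_rep (cls f) \<in> cls f"
    unfolding L2_rep_def using L2_class_self[OF assms] by (rule someI[where P = "\<lambda>u. u \<in> cls f"])
  then show "L2_rep (cls f) \<in> L2" "nrm (\<lambda>y. L2_rep (cls f) y - f y) = 0" using L2_class_iff[OF assms] by auto
qed

lemma L2_inner_cong:
  assumes "f \<in> L2" "g \<in> L2" "f' \<in> L2" "g' \<in> L2"
    and "nrm (\<lambda>y. f y - f' y) = 0" "nrm (\<lambda>y. g y - g' y) = 0"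
  shows "ip f g = ip f' g'"
proof -
  have "ip (\<lambda>y. f y - f' y) g = 0" "ip f' (\<lambda>y. g y - g' y) = 0"
    using assms L2_inner_null_left[of "\<lambda>y. f y - f' y" g] L2_inner_null_right[of f' "\<lambda>y. g y - g' y"]
    by (auto simp: L2_fun_diff)
  then show ?thesis using assms by (simp add: L2_inner_diff_left L2_inner_diff_right)
qed

lemma L2_cinner_class:
  assumes "f \<in> L2" "g \<in> L2"
  shows "L2_cinner I w (cls f) (cls g) = ip f g"
  unfolding L2_cinner_def using assms L2_rep_class by (intro L2_inner_cong) auto

lemma L2_add_class:
  assumes f: "f \<in> L2" and g: "g \<in> L2"
  shows "L2_add I w (cls f) (cls g) = cls (\<lambda>y. f y + g y)"
proof -
  let ?f = "L2_rep (cls f)" and ?g = "L2_rep (cls g)"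
  have "(\<lambda>y. ?f y + ?g y - (f y + g y)) = (\<lambda>y. (?f y - f y) + (?g y - g y))" by (auto simp: fun_eq_iff)
  moreover have "nrm (\<lambda>y. (?f y - f y) + (?g y - g y)) \<le> 0"
    using nrm_add[of "\<lambda>y. ?f y - f y" "\<lambda>y. ?g y - g y"] L2_rep_class[OF f] L2_rep_class[OF g] f g L2_fun_diff by simp
  ultimately have "nrm (\<lambda>y. ?f y + ?g y - (f y + g y)) \<le> 0" by (simp only:)
  then have "nrm (\<lambda>y. ?f y + ?g y - (f y + g y)) = 0" using nrm_nonneg by (rule antisym)
  then show ?thesis unfolding L2_add_def using L2_rep_class[OF f] L2_rep_class[OF g] f g
    by (subst L2_class_eq_iff) (auto intro: L2_fun_add)
qed

lemma L2_scale_class: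
  assumes f: "f \<in> L2"
  shows "L2_scale I w c (cls f) = cls (\<lambda>y. c *s f y)"
proof -
  let ?f = "L2_rep (cls f)"
  have "(\<lambda>y. c *s ?f y - c *s f y) = (\<lambda>y. c *s (?f y - f y))" by (simp add: vec_eq_iff fun_eq_iff algebra_simps)
  then have "nrm (\<lambda>y. c *s ?f y - c *s f y) = 0" by (simp only: nrm_cscale L2_rep_class(2)[OF f] mult_zero_right)
  then show ?thesis unfolding L2_scale_def using L2_rep_class[OF f] f
    by (subst L2_class_eq_iff) (auto intro: L2_fun_cscale)
qed

lemma L2_spaceE:
  assumes "U \<in> L2_space I w" obtains u where "u \<in> L2" "U = cls u"
  using assms by (auto simp: L2_space_def)

lemma L2_spaceI: "u \<in> L2 \<Longrightarrow> cls u \<in> L2_space I w" by (auto simp: L2_space_def)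

subsection \<open>Completeness\<close>

text \<open>Gram-Schmidt with respect to the form of \<open>W y\<close>, carried out simultaneously at all points \<open>y\<close>:
  the resulting vectors depend measurably on \<open>y\<close> and their coefficients determine a vector up to
  the kernel of \<open>W y\<close>.\<close>

definition wnorm :: "real \<Rightarrow> complex^'n \<Rightarrow> real" where
  "wnorm y z = sqrt (Re (cdot z (W y *v z)))"

lemma wnorm_nonneg: "nonneg_matrix (W y) \<Longrightarrow> 0 \<le> wnorm y z"
  by (simp add: wnorm_def nonneg_matrix_form)

lemma wnorm_square: "nonneg_matrix (W y) \<Longrightarrow> wnorm y z ^ 2 = Re (cdot z (W y *v z))"
  by (simp add: wnorm_def nonneg_matrix_form)

lemma wnorm_cauchy_schwarz:
  assumes "nonneg_matrix (W y)" shows "norm (cdot x (W y *v z)) \<le> wnorm y x * wnorm y z"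
  by (rule power2_le_imp_le)
     (use nonneg_matrix_cauchy_schwarz[OF assms] nonneg_matrix_form[OF assms] in \<open>auto simp: wnorm_def power_mult_distrib\<close>)

lemma wnorm_triangle:
  assumes A: "nonneg_matrix (W y)" shows "wnorm y (x + z) \<le> wnorm y x + wnorm y z"
proof (rule power2_le_imp_le)
  have h: "cdot z (W y *v x) = cnj (cdot x (W y *v z))" by (rule nonneg_matrix_hermitian[OF A])
  have "Re (cdot x (W y *v z)) \<le> wnorm y x * wnorm y z"
    using wnorm_cauchy_schwarz[OF A, of x z] complex_Re_le_cmod order_trans by blast
  then show "(wnorm y (x + z))\<^sup>2 \<le> (wnorm y x + wnorm y z)\<^sup>2"
    unfolding power2_sum wnorm_square[OF A] using h by (simp add: cdot_add_left cdot_add_right)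
qed (simp add: wnorm_nonneg[OF A])

lemma wnorm_cscale: "wnorm y (c *s z) = norm c * wnorm y z"
proof -
  have "cdot (c *s z) (W y *v (c *s z)) = of_real (norm c ^ 2) * cdot z (W y *v z)"
    by (simp add: cdot_cscale_left cdot_cscale_right matrix_vector_mult_cscale complex_norm_square mult_ac del: of_real_power)
  then show ?thesis by (simp add: wnorm_def real_sqrt_mult del: of_real_power)
qed

lemma wnorm_zero [simp]: "wnorm y 0 = 0" by (simp add: wnorm_def)

lemma wnorm_sum:
  assumes A: "nonneg_matrix (W y)" shows "finite S \<Longrightarrow> wnorm y (\<Sum>i\<in>S. x i) \<le> (\<Sum>i\<in>S. wnorm y (x i))"
proof (induction S rule: finite_induct)
  case (insert i S)
  then show ?case using wnorm_triangle[OF A, of "x i" "\<Sum>i\<in>S. x i"] by simp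
qed simp

text \<open>Induction over the coordinates: the next unit vector is orthogonalised against the previous vectors
  and normalised. If the result has seminorm \<open>0\<close>, the inverse of \<open>0\<close> being \<open>0\<close>, the new vector is \<open>0\<close>;
  this keeps the construction measurable without a choice of a rank.\<close>

lemma measurable_gram_schmidt_aux:
  fixes S :: "'n set"
  assumes "finite S"
  shows "\<exists>b :: 'n \<Rightarrow> real \<Rightarrow> complex^'n. (\<forall>i. b i \<in> borel_measurable borel) \<and>
     (\<forall>y. nonneg_matrix (W y) \<longrightarrow> (\<forall>i. wnorm y (b i y) \<le> 1) \<and> (\<forall>i\<in>S. wnorm y (b i y) \<in> {0, 1})
       \<and> (\<forall>i\<in>S. \<forall>j\<in>S. i \<noteq> j \<longrightarrow> cdot (b i y) (W y *v b j y) = 0)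
       \<and> (\<forall>z. (\<forall>k. k \<notin> S \<longrightarrow> z $ k = 0) \<longrightarrow> wnorm y (z - (\<Sum>i\<in>S. cdot (b i y) (W y *v z) *s b i y)) = 0))"
  using assms
proof induction
  case empty
  have "z = 0" if "\<forall>k. z $ k = 0" for z :: "complex^'n" using that by (simp add: vec_eq_iff)
  then show ?case by (intro exI[of _ "\<lambda>_ _. 0"]) (auto, metis wnorm_zero)
next
  case (insert k S)
  then obtain b where bm: "\<And>i. b i \<in> borel_measurable borel" and
    b: "\<And>y. nonneg_matrix (W y) \<Longrightarrow> (\<forall>i. wnorm y (b i y) \<le> 1) \<and> (\<forall>i\<in>S. wnorm y (b i y) \<in> {0, 1})
       \<and> (\<forall>i\<in>S. \<forall>j\<in>S. i \<noteq> j \<longrightarrow> cdot (b i y) (W y *v b j y) = 0)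
       \<and> (\<forall>z. (\<forall>k. k \<notin> S \<longrightarrow> z $ k = 0) \<longrightarrow> wnorm y (z - (\<Sum>i\<in>S. cdot (b i y) (W y *v z) *s b i y)) = 0)"
    by blast
  define e :: "complex^'n" where "e = axis k 1"
  define v where "v y = e - (\<Sum>i\<in>S. cdot (b i y) (W y *v e) *s b i y)" for y
  define bk where "bk y = complex_of_real (inverse (wnorm y (v y))) *s v y" for y
  define b' where "b' i = (if i = k then bk else b i)" for i
  have b'S: "b' i = b i" if "i \<in> S" for i using that insert by (auto simp: b'_def)
  have b'k: "b' k = bk" by (simp add: b'_def)
  have vm: "v \<in> borel_measurable borel" unfolding v_def[abs_def] using bm by measurable
  have bkm: "bk \<in> borel_measurable borel" unfolding bk_def[abs_def] wnorm_def using vm by measurable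
  have main: "(\<forall>i. wnorm y (b' i y) \<le> 1) \<and> (\<forall>i\<in>insert k S. wnorm y (b' i y) \<in> {0, 1})
       \<and> (\<forall>i\<in>insert k S. \<forall>j\<in>insert k S. i \<noteq> j \<longrightarrow> cdot (b' i y) (W y *v b' j y) = 0)
       \<and> (\<forall>z. (\<forall>l. l \<notin> insert k S \<longrightarrow> z $ l = 0) \<longrightarrow> wnorm y (z - (\<Sum>i\<in>insert k S. cdot (b' i y) (W y *v z) *s b' i y)) = 0)"
    if A: "nonneg_matrix (W y)" for y
  proof -
    note b = b[OF A]
    have null: "cdot x (W y *v z) = 0" if "wnorm y x = 0 \<or> wnorm y z = 0" for x z
      using wnorm_cauchy_schwarz[OF A, of x z] that by auto
    have self: "cdot x (W y *v x) = complex_of_real (wnorm y x ^ 2)" for x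
      using nonneg_matrix_form[OF A, of x] by (simp add: wnorm_def complex_eq_iff del: of_real_power)
    have bk01: "wnorm y (bk y) \<in> {0, 1}"
      using wnorm_nonneg[OF A, of "v y"] by (cases "wnorm y (v y) = 0") (auto simp: bk_def wnorm_cscale norm_inverse)
    have orth_v: "cdot (b j y) (W y *v v y) = 0" if j: "j \<in> S" for j
    proof -
      have "cdot (b j y) (W y *v v y) = cdot (b j y) (W y *v e)
         - (\<Sum>i\<in>S. cdot (b i y) (W y *v e) * cdot (b j y) (W y *v b i y))" unfolding v_def
        by (simp add: cdot_diff_right matrix_vector_mult_sum_right cdot_sum_right matrix_vector_mult_cscale cdot_cscale_right)
      also have "(\<Sum>i\<in>S. cdot (b i y) (W y *v e) * cdot (b j y) (W y *v b i y))
        = (\<Sum>i\<in>S. if i = j then cdot (b j y) (W y *v e) * cdot (b j y) (W y *v b j y) else 0)"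
        using b j by (intro sum.cong) auto
      also have "\<dots> = cdot (b j y) (W y *v e) * cdot (b j y) (W y *v b j y)"
        using j insert(1) by (simp add: sum.delta)
      also have "cdot (b j y) (W y *v e) * cdot (b j y) (W y *v b j y) = cdot (b j y) (W y *v e)"
        using b j self[of "b j y"] null[of "b j y" e] by (cases "wnorm y (b j y) = 0") auto
      finally show ?thesis by simp
    qed
    have orth: "cdot (b j y) (W y *v bk y) = 0" "cdot (bk y) (W y *v b j y) = 0" if j: "j \<in> S" for j
    proof -
      show 1: "cdot (b j y) (W y *v bk y) = 0"
        using orth_v[OF j] by (simp add: bk_def matrix_vector_mult_cscale cdot_cscale_right)
      show "cdot (bk y) (W y *v b j y) = 0" using nonneg_matrix_hermitian[OF A, of "bk y" "b j y"] 1 by simp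
    qed
    have bke: "cdot (bk y) (W y *v e) *s bk y = (if wnorm y (v y) = 0 then 0 else v y)"
    proof (cases "wnorm y (v y) = 0")
      case False
      have ve: "cdot (v y) (W y *v e) = cdot (v y) (W y *v v y)"
      proof -
        have "cdot (v y) (W y *v e) = cdot (v y) (W y *v v y) + (\<Sum>i\<in>S. cdot (b i y) (W y *v e) * cdot (v y) (W y *v b i y))"
          unfolding v_def[of y]
          by (simp add: cdot_diff_right matrix_vector_mult_sum_right cdot_sum_right matrix_vector_mult_cscale cdot_cscale_right)
        also have "(\<Sum>i\<in>S. cdot (b i y) (W y *v e) * cdot (v y) (W y *v b i y)) = 0"
          using orth_v nonneg_matrix_hermitian[OF A, of "v y"] by (intro sum.neutral) auto
        finally show ?thesis by simp
      qed
      have "cdot (bk y) (W y *v e) = complex_of_real (inverse (wnorm y (v y))) * complex_of_real (wnorm y (v y) ^ 2)"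
        unfolding bk_def cdot_cscale_left ve self by simp
      also have "\<dots> = complex_of_real (wnorm y (v y))" using False by (simp add: power2_eq_square)
      finally show ?thesis using False by (simp add: bk_def vector_smult_assoc)
    qed (simp add: bk_def)
    have dec: "wnorm y (z - (\<Sum>i\<in>insert k S. cdot (b' i y) (W y *v z) *s b' i y)) = 0"
      if z: "\<forall>l. l \<notin> insert k S \<longrightarrow> z $ l = 0" for z
    proof -
      define z' where "z' = z - z $ k *s e"
      have z': "\<forall>l. l \<notin> S \<longrightarrow> z' $ l = 0" using z by (auto simp: z'_def e_def axis_def)
      have "cdot (bk y) (W y *v z') = 0"
      proof -
        have "cdot (bk y) (W y *v (z' - (\<Sum>i\<in>S. cdot (b i y) (W y *v z') *s b i y))) = 0"
          using b z' by (intro null) auto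
        then have "cdot (bk y) (W y *v z') = (\<Sum>i\<in>S. cdot (b i y) (W y *v z') * cdot (bk y) (W y *v b i y))"
          by (simp add: cdot_diff_right matrix_vector_mult_sum_right cdot_sum_right matrix_vector_mult_cscale cdot_cscale_right)
        also have "\<dots> = 0" using orth by (intro sum.neutral) auto
        finally show ?thesis .
      qed
      then have kz: "cdot (bk y) (W y *v z) *s bk y = z $ k *s (if wnorm y (v y) = 0 then 0 else v y)"
        unfolding bke[symmetric] by (simp add: z'_def cdot_diff_right matrix_vector_mult_cscale cdot_cscale_right vector_smult_assoc)
      have "z - (\<Sum>i\<in>insert k S. cdot (b' i y) (W y *v z) *s b' i y)
        = z - cdot (bk y) (W y *v z) *s bk y - (\<Sum>i\<in>S. cdot (b i y) (W y *v z) *s b i y)"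
        using insert b'S b'k by (simp cong: sum.cong)
      also have "\<dots> = (z' - (\<Sum>i\<in>S. cdot (b i y) (W y *v z') *s b i y)) + z $ k *s (if wnorm y (v y) = 0 then v y else 0)"
      proof -
        have "(\<Sum>i\<in>S. cdot (b i y) (W y *v z') *s b i y)
          = (\<Sum>i\<in>S. cdot (b i y) (W y *v z) *s b i y) - z $ k *s (\<Sum>i\<in>S. cdot (b i y) (W y *v e) *s b i y)"
          by (simp add: z'_def vec_eq_iff cdot_diff_right matrix_vector_mult_cscale cdot_cscale_right sum_subtractf
              sum_distrib_left algebra_simps)
        then show ?thesis unfolding kz by (simp add: z'_def v_def vec_eq_iff algebra_simps)
      qed
      finally have "wnorm y (z - (\<Sum>i\<in>insert k S. cdot (b' i y) (W y *v z) *s b' i y))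
        \<le> wnorm y (z' - (\<Sum>i\<in>S. cdot (b i y) (W y *v z') *s b i y)) + wnorm y (z $ k *s (if wnorm y (v y) = 0 then v y else 0))"
        using wnorm_triangle[OF A] by simp
      also have "\<dots> = 0" using b z' by (simp add: wnorm_cscale)
      finally show ?thesis using wnorm_nonneg[OF A] antisym by blast
    qed
    show ?thesis
    proof (intro conjI allI impI ballI)
      fix i show "wnorm y (b' i y) \<le> 1" using b bk01 by (auto simp: b'_def)
    next
      fix i assume "i \<in> insert k S" then show "wnorm y (b' i y) \<in> {0, 1}" using b bk01 by (auto simp: b'_def)
    next
      fix i j assume "i \<in> insert k S" "j \<in> insert k S" "i \<noteq> j"
      then show "cdot (b' i y) (W y *v b' j y) = 0" using b orth by (auto simp: b'_def)
    next
      fix z :: "complex^'n" assume "\<forall>l. l \<notin> insert k S \<longrightarrow> z $ l = 0"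
      then show "wnorm y (z - (\<Sum>i\<in>insert k S. cdot (b' i y) (W y *v z) *s b' i y)) = 0" by (rule dec)
    qed
  qed
  show ?case using main bm bkm by (intro exI[of _ b']) (auto simp: b'_def)
qed

lemma measurable_gram_schmidt:
  obtains e :: "'n \<Rightarrow> real \<Rightarrow> complex^'n" where "\<And>i. e i \<in> borel_measurable borel"
    "\<And>y i. nonneg_matrix (W y) \<Longrightarrow> wnorm y (e i y) \<le> 1"
    "\<And>y z. nonneg_matrix (W y) \<Longrightarrow> wnorm y (z - (\<Sum>i\<in>UNIV. cdot (e i y) (W y *v z) *s e i y)) = 0"
proof -
  obtain e :: "'n \<Rightarrow> real \<Rightarrow> complex^'n" where e: "\<forall>i. e i \<in> borel_measurable borel"
    "\<forall>y. nonneg_matrix (W y) \<longrightarrow> (\<forall>i. wnorm y (e i y) \<le> 1) \<and> (\<forall>i\<in>UNIV. wnorm y (e i y) \<in> {0, 1})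
       \<and> (\<forall>i\<in>UNIV. \<forall>j\<in>UNIV. i \<noteq> j \<longrightarrow> cdot (e i y) (W y *v e j y) = 0)
       \<and> (\<forall>z. (\<forall>k. k \<notin> UNIV \<longrightarrow> z $ k = 0) \<longrightarrow> wnorm y (z - (\<Sum>i\<in>UNIV. cdot (e i y) (W y *v z) *s e i y)) = 0)"
    using measurable_gram_schmidt_aux[of UNIV] by auto
  show thesis by (rule that[of e]) (use e in auto)
qed

text \<open>The weighted sum of the squared increments is integrable, so almost everywhere the values form a
  Cauchy sequence in the seminorm of \<open>W y\<close>; the limits of their Gram-Schmidt coefficients give the
  limit function.\<close>

lemma L2_complete:
  fixes f :: "nat \<Rightarrow> real \<Rightarrow> complex^'n"
  assumes f: "\<And>j. f j \<in> L2" and fast: "\<And>j. sq (\<lambda>y. f j y - f (Suc j) y) \<le> (1/4) ^ j"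
  obtains g where "g \<in> L2" "(\<lambda>j. nrm (\<lambda>y. f j y - g y)) \<longlonglongrightarrow> 0"
proof -
  obtain b :: "'n \<Rightarrow> real \<Rightarrow> complex^'n" where bm: "\<And>i. b i \<in> borel_measurable borel"
    and b1: "\<And>y i. nonneg_matrix (W y) \<Longrightarrow> wnorm y (b i y) \<le> 1"
    and b2: "\<And>y z. nonneg_matrix (W y) \<Longrightarrow> wnorm y (z - (\<Sum>i\<in>UNIV. cdot (b i y) (W y *v z) *s b i y)) = 0"
    using measurable_gram_schmidt by blast
  define F where "F j y = indicator I y *\<^sub>R f j y" for j y
  have Fm: "F j \<in> borel_measurable borel" for j
    using f[of j] by (simp add: L2_fun_iff set_borel_measurable_def F_def[abs_def])
  define c where "c i j y = cdot (b i y) (W y *v F j y)" for i j y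
  have cm: "c i j \<in> borel_measurable borel" for i j unfolding c_def[abs_def] using bm Fm by measurable
  define g where "g y = (\<Sum>i\<in>UNIV. (if convergent (\<lambda>j. c i j y) then lim (\<lambda>j. c i j y) else 0) *s b i y)" for y
  have gm: "g \<in> borel_measurable borel"
  proof -
    have "(\<lambda>y. if Cauchy (\<lambda>j. c i j y) then lim (\<lambda>j. c i j y) else 0) \<in> borel_measurable borel" for i
      using cm by measurable
    then have "(\<lambda>y. if convergent (\<lambda>j. c i j y) then lim (\<lambda>j. c i j y) else 0) \<in> borel_measurable borel" for i
      by (simp add: Cauchy_convergent_iff)
    then show ?thesis unfolding g_def[abs_def] using bm by (intro borel_measurable_sum borel_measurable_cscale)
  qed
  define G where "G j k = form (\<lambda>y. f j y - f k y) (\<lambda>y. f j y - f k y)" for j k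
  define p where "p j k y = wnorm y (f j y - f k y) ^ 2" for j k y
  have p: "p j k y = Re (G j k y)" if "nonneg_matrix (W y)" for j k y
    by (simp add: p_def G_def form_def wnorm_square[OF that])
  let ?N = "\<lambda>j k. \<integral>\<^sup>+y\<in>I. ennreal (Re (G j k y)) \<partial>M"
  have N: "?N j k = ennreal (sq (\<lambda>y. f j y - f k y))" for j k
    using L2_sqnorm_eq[OF L2_fun_diff[OF f[of j] f[of k]]] unfolding L2_sqnorm_def G_def form_def .
  have Nm: "(\<lambda>y. ennreal (Re (G j k y)) * indicator I y) \<in> borel_measurable M" for j k
  proof -
    have Gm: "(\<lambda>y. indicator I y *\<^sub>R G j k y) \<in> borel_measurable M"
    proof -
      have d: "set_borel_measurable borel I (\<lambda>y. f j y - f k y)"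
        using L2_fun_diff[OF f[of j] f[of k]] unfolding L2_fun_iff by blast
      show ?thesis using form_measurable[OF d d] by (simp only: set_borel_measurable_def G_def)
    qed
    have R: "Re \<in> borel_measurable borel" by (rule borel_measurable_continuous_onI[OF continuous_on_Re[OF continuous_on_id]])
    have "(\<lambda>y. ennreal (Re (indicator I y *\<^sub>R G j k y))) \<in> borel_measurable M"
      by (rule measurable_compose[OF measurable_compose[OF Gm R] measurable_ennreal])
    moreover have "ennreal (Re (indicator I y *\<^sub>R G j k y))
       = ennreal (Re (G j k y)) * indicator I y" for y by (auto simp: indicator_def)
    ultimately show ?thesis by (simp only:)
  qed
  have "(\<integral>\<^sup>+y. (\<Sum>j. ennreal (2^j) * (ennreal (Re (G j (Suc j) y)) * indicator I y)) \<partial>M)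
     = (\<Sum>j. ennreal (2^j) * ?N j (Suc j))" using Nm by (subst nn_integral_suminf) (auto simp: nn_integral_cmult)
  also have "\<dots> \<le> (\<Sum>j. ennreal ((1/2)^j))"
  proof (rule suminf_le)
    fix j
    have "2^j * sq (\<lambda>y. f j y - f (Suc j) y) \<le> 2^j * (1/4)^j" using fast[of j] by (intro mult_left_mono) auto
    also have "\<dots> = (1/2)^j" by (simp add: power_mult_distrib[symmetric])
    finally show "ennreal (2^j) * ?N j (Suc j) \<le> ennreal ((1/2)^j)"
      unfolding N by (subst ennreal_mult[symmetric]) (auto simp: sq_nonneg intro: ennreal_leI)
  qed auto
  also have "\<dots> < \<infinity>" by (subst suminf_ennreal2) (auto intro: summable_geometric)
  finally have fin: "AE y in M. (\<Sum>j. ennreal (2^j) * (ennreal (Re (G j (Suc j) y)) * indicator I y)) \<noteq> \<infinity>"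
    using Nm by (intro nn_integral_PInf_AE) (auto simp: less_top)
  have lim: "AE y in M. y \<in> I \<longrightarrow> nonneg_matrix (W y) \<and> (\<lambda>k. wnorm y (f k y - g y)) \<longlonglongrightarrow> 0"
    using fin AE_nonneg_matrix
  proof eventually_elim
    case (elim y)
    show ?case
    proof
      assume y: "y \<in> I"
      then have A: "nonneg_matrix (W y)" using elim by blast
      have p0: "0 \<le> p j k y" for j k by (simp add: p_def)
      have "(\<Sum>j. ennreal (2^j * p j (Suc j) y)) \<noteq> \<infinity>"
        using elim(1) y by (simp add: ennreal_mult p0 p[OF A, symmetric])
      then have "summable (\<lambda>j. 2^j * p j (Suc j) y)" by (intro summable_suminf_not_top) (auto simp: p_def)
      then have "Bseq (\<lambda>j. 2^j * p j (Suc j) y)"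
        by (intro convergent_imp_Bseq) (auto dest: summable_LIMSEQ_zero simp: convergent_def)
      then obtain B where B: "B > 0" "\<And>j. norm (2^j * p j (Suc j) y) \<le> B" by (rule BseqE) auto
      define rr where "rr = sqrt (1/2)"
      have rr: "0 \<le> rr" "rr < 1" by (auto simp: rr_def real_sqrt_less_iff[of _ 1, simplified])
      have inc: "wnorm y (f j y - f (Suc j) y) \<le> sqrt B * rr ^ j" for j
      proof -
        have "p j (Suc j) y \<le> B * (1/2)^j" using B(2)[of j] by (simp add: p_def field_simps power_divide)
        then have "wnorm y (f j y - f (Suc j) y) \<le> sqrt (B * (1/2)^j)" unfolding p_def by (rule real_le_rsqrt)
        then show ?thesis by (simp add: real_sqrt_mult real_sqrt_power rr_def)
      qed
      have conv: "convergent (\<lambda>j. c i j y)" for i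
      proof -
        have "summable (\<lambda>j. c i (Suc j) y - c i j y)"
        proof (rule summable_comparison_test)
          have "norm (c i (Suc j) y - c i j y) \<le> sqrt B * rr ^ j" for j
          proof -
            have "c i (Suc j) y - c i j y = - cdot (b i y) (W y *v (f j y - f (Suc j) y))"
              using y by (simp add: c_def F_def cdot_diff_right)
            then have "norm (c i (Suc j) y - c i j y) \<le> wnorm y (b i y) * wnorm y (f j y - f (Suc j) y)"
              using wnorm_cauchy_schwarz[OF A, of "b i y" "f j y - f (Suc j) y"] by simp
            also have "\<dots> \<le> 1 * (sqrt B * rr ^ j)"
              using b1[OF A] inc[of j] wnorm_nonneg[OF A] by (intro mult_mono) auto
            finally show ?thesis by simp
          qed
          then show "\<exists>N. \<forall>n\<ge>N. norm (c i (Suc n) y - c i n y) \<le> sqrt B * rr ^ n" by blast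
          show "summable (\<lambda>n. sqrt B * rr ^ n)" using rr by (intro summable_mult summable_geometric) auto
        qed
        then have "convergent (\<lambda>n. \<Sum>j<n. c i (Suc j) y - c i j y)" by (simp add: summable_iff_convergent)
        then have "convergent (\<lambda>n. c i n y - c i 0 y)"
          by (simp only: sum_lessThan_telescope[of "\<lambda>j. c i j y"])
        from convergent_add[OF this convergent_const[of "c i 0 y"]] show ?thesis by simp
      qed
      define l where "l i = lim (\<lambda>j. c i j y)" for i
      have l: "(\<lambda>j. c i j y) \<longlonglongrightarrow> l i" for i using conv[of i] by (simp add: l_def convergent_LIMSEQ_iff)
      have gy: "g y = (\<Sum>i\<in>UNIV. l i *s b i y)" using conv by (simp add: g_def l_def)
      have "(\<lambda>k. wnorm y (f k y - g y)) \<longlonglongrightarrow> 0"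
      proof (rule Lim_null_comparison)
        show "eventually (\<lambda>k. norm (wnorm y (f k y - g y)) \<le> (\<Sum>i\<in>UNIV. norm (c i k y - l i))) sequentially"
        proof (intro always_eventually allI)
          fix k
          have "f k y - g y = (f k y - (\<Sum>i\<in>UNIV. cdot (b i y) (W y *v f k y) *s b i y)) + (\<Sum>i\<in>UNIV. (c i k y - l i) *s b i y)"
            using y by (simp add: gy c_def F_def vec_eq_iff sum_subtractf algebra_simps)
          then have "wnorm y (f k y - g y) \<le> 0 + wnorm y (\<Sum>i\<in>UNIV. (c i k y - l i) *s b i y)"
            using wnorm_triangle[OF A, of "f k y - (\<Sum>i\<in>UNIV. cdot (b i y) (W y *v f k y) *s b i y)" "\<Sum>i\<in>UNIV. (c i k y - l i) *s b i y"]
              b2[OF A, of "f k y"] by (simp only:)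
          also have "\<dots> \<le> 0 + (\<Sum>i\<in>UNIV. wnorm y ((c i k y - l i) *s b i y))"
            by (intro add_left_mono wnorm_sum[OF A]) simp
          also have "\<dots> \<le> (\<Sum>i\<in>UNIV. norm (c i k y - l i))"
          proof -
            have "wnorm y ((c i k y - l i) *s b i y) \<le> norm (c i k y - l i)" for i
              unfolding wnorm_cscale using b1[OF A, of i] by (intro mult_left_le) auto
            then show ?thesis by (simp only: add_0) (intro sum_mono)
          qed
          finally show "norm (wnorm y (f k y - g y)) \<le> (\<Sum>i\<in>UNIV. norm (c i k y - l i))"
            using wnorm_nonneg[OF A] by simp
        qed
        have "(\<lambda>k. \<Sum>i\<in>UNIV. norm (c i k y - l i)) \<longlonglongrightarrow> (\<Sum>i\<in>(UNIV::'n set). norm (l i - l i))"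
          by (intro tendsto_intros l)
        then show "(\<lambda>k. \<Sum>i\<in>UNIV. norm (c i k y - l i)) \<longlonglongrightarrow> 0" by simp
      qed
      then show "nonneg_matrix (W y) \<and> (\<lambda>k. wnorm y (f k y - g y)) \<longlonglongrightarrow> 0" using A by blast
    qed
  qed
  have nstep: "nrm (\<lambda>y. f j y - f (Suc j) y) \<le> (1/2)^j" for j
  proof (rule power2_le_imp_le)
    show "(nrm (\<lambda>y. f j y - f (Suc j) y))\<^sup>2 \<le> ((1/2)^j)\<^sup>2"
    proof -
      have "((1/2)^j)\<^sup>2 = (1/4 :: real)^j" by (simp add: power2_eq_square power_mult_distrib[symmetric])
      then show ?thesis using fast[of j] by (simp only: nrm_square)
    qed
  qed simp
  have ncauchy: "nrm (\<lambda>y. f j y - f (j + k) y) \<le> 2 * (1/2)^j * (1 - (1/2)^k)" for j k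
  proof (induction k)
    case (Suc k)
    have "nrm (\<lambda>y. f j y - f (j + Suc k) y) \<le> nrm (\<lambda>y. f j y - f (j + k) y) + nrm (\<lambda>y. f (j + k) y - f (j + Suc k) y)"
      using f by (intro nrm_triangle)
    also have "\<dots> \<le> 2 * (1/2)^j * (1 - (1/2)^k) + (1/2)^(j+k)" using Suc nstep[of "j + k"] by simp
    also have "\<dots> = 2 * (1/2)^j * (1 - (1/2)^(Suc k))" by (simp add: power_add field_simps)
    finally show ?case .
  qed simp
  have ncauchy': "nrm (\<lambda>y. f j y - f k y) \<le> 2 * (1/2)^j" if "j \<le> k" for j k
  proof -
    have "nrm (\<lambda>y. f j y - f k y) \<le> 2 * (1/2)^j * (1 - (1/2)^(k - j))" using ncauchy[of j "k - j"] that by simp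
    also have "\<dots> \<le> 2 * (1/2)^j * 1" by (intro mult_left_mono) auto
    finally show ?thesis by simp
  qed
  have gset: "set_borel_measurable borel I g" unfolding set_borel_measurable_def using gm by measurable
  have fatou: "(\<integral>\<^sup>+y\<in>I. ennreal (Re (cdot (f j y - g y) (W y *v (f j y - g y)))) \<partial>M) \<le> ennreal ((2 * (1/2)^j)^2)" for j
  proof -
    have "(\<integral>\<^sup>+y\<in>I. ennreal (Re (cdot (f j y - g y) (W y *v (f j y - g y)))) \<partial>M)
      \<le> (\<integral>\<^sup>+y. liminf (\<lambda>k. ennreal (Re (G j k y)) * indicator I y) \<partial>M)"
    proof (rule nn_integral_mono_AE)
      show "AE y in M. ennreal (Re (cdot (f j y - g y) (W y *v (f j y - g y)))) * indicator I y
         \<le> liminf (\<lambda>k. ennreal (Re (G j k y)) * indicator I y)" using lim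
      proof eventually_elim
        case (elim y)
        show ?case
        proof (cases "y \<in> I")
          case True
          then have A: "nonneg_matrix (W y)" and l: "(\<lambda>k. wnorm y (f k y - g y)) \<longlonglongrightarrow> 0" using elim by auto
          have tri: "\<bar>wnorm y (f j y - f k y) - wnorm y (f j y - g y)\<bar> \<le> wnorm y (f k y - g y)" for k
          proof -
            have "wnorm y (f j y - g y) \<le> wnorm y (f j y - f k y) + wnorm y (f k y - g y)"
              using wnorm_triangle[OF A, of "f j y - f k y" "f k y - g y"] by simp
            moreover have "wnorm y (g y - f k y) = wnorm y (f k y - g y)"
              using wnorm_cscale[of y "-1" "f k y - g y"] by (simp add: cscale_minus_one)
            then have "wnorm y (f j y - f k y) \<le> wnorm y (f j y - g y) + wnorm y (f k y - g y)"
              using wnorm_triangle[OF A, of "f j y - g y" "g y - f k y"] by simp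
            ultimately show ?thesis by linarith
          qed
          have "(\<lambda>k. wnorm y (f j y - f k y) - wnorm y (f j y - g y)) \<longlonglongrightarrow> 0"
            by (rule Lim_null_comparison[OF _ l]) (use tri in auto)
          then have "(\<lambda>k. wnorm y (f j y - f k y)) \<longlonglongrightarrow> wnorm y (f j y - g y)" by (simp add: LIM_zero_iff)
          then have "(\<lambda>k. ennreal (wnorm y (f j y - f k y) ^ 2)) \<longlonglongrightarrow> ennreal (wnorm y (f j y - g y) ^ 2)"
            by (intro tendsto_intros)
          then have "liminf (\<lambda>k. ennreal (wnorm y (f j y - f k y) ^ 2)) = ennreal (wnorm y (f j y - g y) ^ 2)"
            by (intro lim_imp_Liminf) auto
          then show ?thesis using True by (simp add: G_def form_def wnorm_square[OF A])
        qed simp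
      qed
    qed
    also have "\<dots> \<le> liminf (\<lambda>k. ?N j k)" using Nm by (rule nn_integral_liminf)
    also have "\<dots> \<le> ennreal ((2 * (1/2)^j)^2)"
    proof (rule Liminf_le)
      show "\<forall>\<^sub>F k in sequentially. ?N j k \<le> ennreal ((2 * (1/2)^j)^2)" using eventually_ge_at_top[of j]
      proof eventually_elim
        case (elim k)
        then show ?case unfolding N nrm_square[symmetric] using ncauchy'[of j k] by (intro ennreal_leI power_mono) auto
      qed
    qed simp
    finally show ?thesis .
  qed
  have dm: "set_borel_measurable borel I (\<lambda>y. f j y - g y)" for j
  proof -
    have "(\<lambda>y. indicator I y *\<^sub>R (f j y - g y)) = (\<lambda>y. F j y - indicator I y *\<^sub>R g y)"
      by (simp add: F_def fun_eq_iff scaleR_diff_right)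
    then show ?thesis using Fm[of j] gset unfolding set_borel_measurable_def by (simp add: borel_measurable_diff)
  qed
  have d2: "(\<lambda>y. f j y - g y) \<in> L2" for j
    using dm[of j] fatou[of j] unfolding L2_fun_def L2_sqnorm_def by (auto intro: le_less_trans)
  then have gL: "g \<in> L2" using L2_fun_diff[OF f[of 0] d2[of 0]] by simp
  moreover have "(\<lambda>j. nrm (\<lambda>y. f j y - g y)) \<longlonglongrightarrow> 0"
  proof (rule Lim_null_comparison)
    have "nrm (\<lambda>y. f j y - g y) \<le> 2 * (1/2)^j" for j
    proof (rule power2_le_imp_le)
      have "ennreal (sq (\<lambda>y. f j y - g y)) \<le> ennreal ((2 * (1/2)^j)^2)"
        using fatou[of j] L2_sqnorm_eq[OF d2[of j]] unfolding L2_sqnorm_def by simp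
      then show "(nrm (\<lambda>y. f j y - g y))\<^sup>2 \<le> (2 * (1/2)^j)\<^sup>2" by (simp add: nrm_square)
    qed simp
    then show "\<forall>\<^sub>F j in sequentially. norm (nrm (\<lambda>y. f j y - g y)) \<le> 2 * (1/2)^j" by simp
    have "(\<lambda>j. 2 * (1/2::real)^j) \<longlonglongrightarrow> 2 * 0" by (intro tendsto_intros LIMSEQ_power_zero) auto
    then show "(\<lambda>j. 2 * (1/2::real)^j) \<longlonglongrightarrow> 0" by simp
  qed
  ultimately show thesis using that by blast
qed

end

section \<open>Primitives of vector measures\<close>

text \<open>The value one half at the jump makes the primitives below balanced, and the differences
  \<open>step_kernel s t\<close> are additive in \<open>(s, t)\<close> without any case distinction on the order of \<open>s\<close> and \<open>t\<close>.\<close>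

definition heaviside :: "real \<Rightarrow> real" where
  "heaviside z = (if z < 0 then 0 else if z = 0 then 1/2 else 1)"

definition step_kernel :: "real \<Rightarrow> real \<Rightarrow> real \<Rightarrow> real" where
  "step_kernel s t y = heaviside (t - y) - heaviside (s - y)"

lemma heaviside_measurable [measurable]: "heaviside \<in> borel_measurable borel"
  unfolding heaviside_def[abs_def] by measurable

lemma step_kernel_measurable: "(\<lambda>y. step_kernel s t y) \<in> borel_measurable borel"
  and step_kernel_measurable_pair: "(\<lambda>p. step_kernel s (fst p) (snd p)) \<in> borel_measurable (borel \<Otimes>\<^sub>M borel)"
  unfolding step_kernel_def[abs_def] by measurable

lemma step_kernel_bound: "\<bar>step_kernel s t y\<bar> \<le> 1" by (auto simp: step_kernel_def heaviside_def)
lemma step_kernel_outside: "y \<notin> {min s t..max s t} \<Longrightarrow> step_kernel s t y = 0" by (auto simp: step_kernel_def heaviside_def)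
lemma step_kernel_diff: "step_kernel p t y - step_kernel p s y = step_kernel s t y" by (simp add: step_kernel_def)
lemma step_kernel_refl [simp]: "step_kernel s s y = 0" by (simp add: step_kernel_def)

lemma step_kernel_bound_indicator:
  assumes "is_interval A" "s \<in> A" "t \<in> A" shows "\<bar>step_kernel s t y\<bar> \<le> indicator A (y :: real)"
proof (cases "y \<in> A")
  case False
  have "min s t \<in> A" "max s t \<in> A" using assms by (auto simp: min_def max_def)
  from mem_is_interval_1_I[OF assms(1) this] have "y \<notin> {min s t..max s t}" using False by auto
  then show ?thesis by (simp add: step_kernel_outside)
qed (use step_kernel_bound[of s t y] in simp)

lemma step_kernel_restrict:
  fixes F :: "real \<Rightarrow> 'a :: real_vector"
  assumes "is_interval A" "s \<in> A" "t \<in> A"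
  shows "step_kernel s t y *\<^sub>R F y = step_kernel s t y *\<^sub>R (indicator A y *\<^sub>R F y)"
  using step_kernel_bound_indicator[OF assms, of y] by (cases "y \<in> A") auto

lemma norm_step_kernel_le: "norm (step_kernel s t y *\<^sub>R v) \<le> norm v"
  using step_kernel_bound[of s t y] by (simp add: mult_left_le_one_le)

lemma step_kernel_integrable:
  fixes F :: "real \<Rightarrow> 'a :: {banach, second_countable_topology}"
  assumes F: "set_integrable m A F" and m: "sets m = sets borel"
    and A: "is_interval A" "s \<in> A" "t \<in> A"
  shows "integrable m (\<lambda>y. step_kernel s t y *\<^sub>R F y)"
    "norm (LINT y|m. step_kernel s t y *\<^sub>R F y) \<le> (LINT y:A|m. norm (F y))"
proof -
  define G where "G y = indicator A y *\<^sub>R F y" for y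
  have k: "step_kernel s t y *\<^sub>R F y = step_kernel s t y *\<^sub>R G y" for y
    unfolding G_def by (rule step_kernel_restrict[OF A])
  have G: "integrable m G" using F by (simp add: set_integrable_def G_def[abs_def])
  have meas: "step_kernel s t \<in> borel_measurable m"
    using step_kernel_measurable[of s t] by (simp add: measurable_cong_sets[OF m refl])
  have int: "integrable m (\<lambda>y. step_kernel s t y *\<^sub>R G y)"
  proof (rule Bochner_Integration.integrable_bound[OF G])
    show "(\<lambda>y. step_kernel s t y *\<^sub>R G y) \<in> borel_measurable m"
      by (intro borel_measurable_scaleR meas borel_measurable_integrable[OF G])
    show "AE y in m. norm (step_kernel s t y *\<^sub>R G y) \<le> norm (G y)" by (intro AE_I2 norm_step_kernel_le)
  qed
  then show "integrable m (\<lambda>y. step_kernel s t y *\<^sub>R F y)" by (simp only: k)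
  have "norm (LINT y|m. step_kernel s t y *\<^sub>R G y) \<le> (LINT y|m. norm (step_kernel s t y *\<^sub>R G y))"
    by (rule integral_norm_bound)
  also have "\<dots> \<le> (LINT y|m. norm (G y))"
    by (rule integral_mono[OF integrable_norm[OF int] integrable_norm[OF G] norm_step_kernel_le])
  finally show "norm (LINT y|m. step_kernel s t y *\<^sub>R F y) \<le> (LINT y:A|m. norm (F y))"
    by (simp only: k) (simp add: set_lebesgue_integral_def G_def)
qed

text \<open>Dominated convergence: as \<open>S n\<close> approaches \<open>x\<close> from one side, the kernel tends to zero except at \<open>x\<close>
  itself, where half of the point mass remains.\<close>

lemma step_kernel_integral_seq_limit:
  fixes F :: "real \<Rightarrow> complex^'n"
  assumes F: "set_integrable m {c..d} F" and m: "sets m = sets borel" and x: "x \<in> {c..d}"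
    and S: "\<And>n. S n \<in> {c..d}" "S \<longlonglongrightarrow> x"
    and side: "(\<forall>n. x < S n) \<and> \<sigma> = 1/2 \<or> (\<forall>n. S n < x) \<and> \<sigma> = - 1/2"
  shows "(\<lambda>n. LINT y|m. step_kernel x (S n) y *\<^sub>R F y) \<longlonglongrightarrow> \<sigma> *\<^sub>R (LINT y:{x}|m. F y)"
proof -
  define G where "G y = indicator {c..d} y *\<^sub>R F y" for y
  have k: "step_kernel x (S n) y *\<^sub>R F y = step_kernel x (S n) y *\<^sub>R G y" for y n
    unfolding G_def using x S(1) by (intro step_kernel_restrict) (auto simp: is_interval_cc)
  have G: "integrable m G" using F by (simp add: set_integrable_def G_def[abs_def])
  have meas: "step_kernel s t \<in> borel_measurable m" for s t
    using step_kernel_measurable[of s t] by (simp add: measurable_cong_sets[OF m refl])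
  have ind: "indicator {x} y *\<^sub>R F y = indicator {x} y *\<^sub>R G y" for y
    using x by (auto simp: indicator_def G_def)
  have Gx: "integrable m (\<lambda>y. indicator {x} y *\<^sub>R G y)" using m by (intro integrable_mult_indicator G) auto
  have "(\<lambda>n. LINT y|m. step_kernel x (S n) y *\<^sub>R G y) \<longlonglongrightarrow> (LINT y|m. \<sigma> *\<^sub>R (indicator {x} y *\<^sub>R G y))"
  proof (rule integral_dominated_convergence[where w = "\<lambda>y. norm (G y)"])
    show "(\<lambda>y. \<sigma> *\<^sub>R (indicator {x} y *\<^sub>R G y)) \<in> borel_measurable m"
      by (intro borel_measurable_scaleR borel_measurable_const borel_measurable_integrable[OF Gx])
    show "(\<lambda>y. step_kernel x (S n) y *\<^sub>R G y) \<in> borel_measurable m" for n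
      by (intro borel_measurable_scaleR meas borel_measurable_integrable[OF G])
    show "integrable m (\<lambda>y. norm (G y))" using G by (rule integrable_norm)
    show "AE y in m. norm (step_kernel x (S n) y *\<^sub>R G y) \<le> norm (G y)" for n by (intro AE_I2 norm_step_kernel_le)
    show "AE y in m. (\<lambda>n. step_kernel x (S n) y *\<^sub>R G y) \<longlonglongrightarrow> \<sigma> *\<^sub>R (indicator {x} y *\<^sub>R G y)"
    proof (rule AE_I2, rule tendsto_eventually)
      fix y
      have "eventually (\<lambda>n. step_kernel x (S n) y = \<sigma> * indicator {x} y) sequentially"
      proof (cases y x rule: linorder_cases)
        case less
        then have "eventually (\<lambda>n. y < S n) sequentially" using S(2) by (intro order_tendstoD) auto
        then show ?thesis by eventually_elim (use less in \<open>auto simp: step_kernel_def heaviside_def\<close>)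
      next
        case equal
        have "step_kernel x (S n) y = \<sigma> * indicator {x} y" for n
          using side[THEN disj_forward, of "x < S n \<and> \<sigma> = 1/2" "S n < x \<and> \<sigma> = - 1/2"] equal
          by (auto simp: step_kernel_def heaviside_def)
        then show ?thesis by simp
      next
        case greater
        then have "eventually (\<lambda>n. S n < y) sequentially" using S(2) by (intro order_tendstoD) auto
        then show ?thesis by eventually_elim (use greater in \<open>auto simp: step_kernel_def heaviside_def\<close>)
      qed
      then show "eventually (\<lambda>n. step_kernel x (S n) y *\<^sub>R G y = \<sigma> *\<^sub>R (indicator {x} y *\<^sub>R G y)) sequentially"
        by eventually_elim simp
    qed
  qed
  also have "(LINT y|m. \<sigma> *\<^sub>R (indicator {x} y *\<^sub>R G y)) = \<sigma> *\<^sub>R (LINT y:{x}|m. F y)"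
    using Gx by (simp only: set_lebesgue_integral_def ind integral_scaleR_right)
  finally show ?thesis by (simp only: k)
qed

lemma step_kernel_integral_right_limit:
  fixes F :: "real \<Rightarrow> complex^'n"
  assumes F: "set_integrable m {c..d} F" and m: "sets m = sets borel" and x: "c \<le> x" "x < d"
  shows "((\<lambda>t. LINT y|m. step_kernel x t y *\<^sub>R F y) \<longlongrightarrow> (1/2) *\<^sub>R (LINT y:{x}|m. F y)) (at_right x)"
proof (rule tendsto_at_right_sequentially[OF x(2)])
  fix S :: "nat \<Rightarrow> real" assume S: "\<And>n. x < S n" "\<And>n. S n < d" "S \<longlonglongrightarrow> x"
  have "S n \<in> {c..d}" for n using S(1,2)[of n] x by auto
  then show "(\<lambda>n. LINT y|m. step_kernel x (S n) y *\<^sub>R F y) \<longlonglongrightarrow> (1/2) *\<^sub>R (LINT y:{x}|m. F y)"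
    using S x by (intro step_kernel_integral_seq_limit[OF F m]) auto
qed

lemma step_kernel_integral_left_limit:
  fixes F :: "real \<Rightarrow> complex^'n"
  assumes F: "set_integrable m {c..d} F" and m: "sets m = sets borel" and x: "c < x" "x \<le> d"
  shows "((\<lambda>t. LINT y|m. step_kernel x t y *\<^sub>R F y) \<longlongrightarrow> (- 1/2) *\<^sub>R (LINT y:{x}|m. F y)) (at_left x)"
proof (rule tendsto_at_left_sequentially[OF x(1)])
  fix S :: "nat \<Rightarrow> real" assume S: "\<And>n. S n < x" "\<And>n. c < S n" "S \<longlonglongrightarrow> x"
  have "S n \<in> {c..d}" for n using S(1,2)[of n] x by auto
  then show "(\<lambda>n. LINT y|m. step_kernel x (S n) y *\<^sub>R F y) \<longlonglongrightarrow> (- 1/2) *\<^sub>R (LINT y:{x}|m. F y)"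
    using S x by (intro step_kernel_integral_seq_limit[OF F m]) auto
qed

text \<open>Integration by parts: the distributional derivative of the primitive of a vector measure is
  that measure. Both assertions come from Fubini's theorem for the restriction to \<open>[c, d]\<close>.\<close>

lemma heaviside_integral:
  fixes \<phi> :: "real \<Rightarrow> real"
  assumes d: "\<And>x. (\<phi> has_real_derivative \<phi>' x) (at x)" and cont: "continuous_on UNIV \<phi>'"
    and supp: "\<And>x. x \<notin> {c..d} \<Longrightarrow> \<phi> x = 0" "\<And>x. x \<notin> {c..d} \<Longrightarrow> \<phi>' x = 0"
  shows "(LBINT t. \<phi>' t * heaviside (t - y)) = - \<phi> y" "(LBINT t. \<phi>' t) = 0" "integrable lborel \<phi>'"
proof -
  have FTC: "(LBINT t. indicator {r..s} t *\<^sub>R \<phi>' t) = \<phi> s - \<phi> r" if "r \<le> s" for r s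
    using d cont that by (intro integral_FTC_atLeastAtMost)
      (auto simp: has_real_derivative_iff_has_vector_derivative[symmetric] intro: DERIV_subset continuous_on_subset)
  define r s where "r = min c y - 1" and "s = max d y + 1"
  have "r \<notin> {c..d}" "s \<notin> {c..d}" by (auto simp: r_def s_def)
  then have 0: "\<phi> r = 0" "\<phi> s = 0" using supp(1) by blast+
  have ind: "indicator {r..s} t *\<^sub>R \<phi>' t = \<phi>' t" for t
    using supp(2)[of t] by (cases "t \<in> {c..d}") (auto simp: r_def s_def indicator_def)
  show "(LBINT t. \<phi>' t) = 0" using FTC[of r s] 0 unfolding ind by (auto simp: r_def s_def)
  have "integrable lborel (\<lambda>t. indicator {r..s} t *\<^sub>R \<phi>' t)"
    using borel_integrable_compact[of "{r..s}" \<phi>'] cont continuous_on_subset by blast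
  then show "integrable lborel \<phi>'" unfolding ind .
  have "(LBINT t. \<phi>' t * heaviside (t - y)) = (LBINT t. indicator {y..s} t *\<^sub>R \<phi>' t)"
  proof (rule integral_cong_AE)
    show "(\<lambda>t. \<phi>' t * heaviside (t - y)) \<in> borel_measurable lborel" "(\<lambda>t. indicator {y..s} t *\<^sub>R \<phi>' t) \<in> borel_measurable lborel"
      using borel_measurable_continuous_onI[OF cont] by measurable
    have "AE t in lborel. t \<noteq> y" by (rule AE_lborel_singleton)
    then show "AE t in lborel. \<phi>' t * heaviside (t - y) = indicator {y..s} t *\<^sub>R \<phi>' t"
    proof eventually_elim
      case (elim t)
      then show ?case using ind[of t] by (auto simp: heaviside_def indicator_def r_def)
    qed
  qed
  also have "\<dots> = \<phi> s - \<phi> y" by (rule FTC) (auto simp: s_def)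
  finally show "(LBINT t. \<phi>' t * heaviside (t - y)) = - \<phi> y" using 0 by simp
qed

lemma step_kernel_primitive_by_parts:
  fixes F :: "real \<Rightarrow> complex^'n"
  assumes F: "set_integrable m {c..d} F" and m: "sets m = sets borel" "emeasure m {c..d} < \<infinity>" and p: "p \<in> {c..d}"
    and d: "\<And>x. (\<phi> has_real_derivative \<phi>' x) (at x)" and cont: "continuous_on UNIV \<phi>'"
    and supp: "\<And>x. x \<notin> {c..d} \<Longrightarrow> \<phi> x = 0" "\<And>x. x \<notin> {c..d} \<Longrightarrow> \<phi>' x = 0"
  shows "(LBINT t. \<phi>' t *\<^sub>R (LINT y|m. step_kernel p t y *\<^sub>R F y)) = - (LINT y|m. \<phi> y *\<^sub>R F y)"
    "(\<lambda>t. indicator {c..d} t *\<^sub>R (LINT y|m. step_kernel p t y *\<^sub>R F y)) \<in> borel_measurable borel"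
proof -
  define mK where "mK = density m (\<lambda>x. ennreal (indicator {c..d} x))"
  have sK [measurable_cong]: "sets mK = sets borel" by (simp add: mK_def m)
  have "emeasure mK UNIV < \<infinity>"
    using m unfolding mK_def by (subst emeasure_density) (auto simp: sets_eq_imp_space_eq ennreal_indicator)
  then interpret mK: finite_measure mK using sets_eq_imp_space_eq[OF sK] by (intro finite_measureI) (auto simp: less_top)
  interpret pair_sigma_finite lborel mK ..
  define G where "G y = indicator {c..d} y *\<^sub>R F y" for y
  have G: "integrable m G" using F by (simp add: set_integrable_def G_def[abs_def])
  then have Gm: "G \<in> borel_measurable borel"
    using borel_measurable_integrable[OF G] by (simp add: measurable_cong_sets[OF m(1) refl])
  have dens: "(LINT y|mK. h y *\<^sub>R G y) = (LINT y|m. h y *\<^sub>R G y)"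
    if "h \<in> borel_measurable borel" for h :: "real \<Rightarrow> real"
  proof -
    have "(LINT y|mK. h y *\<^sub>R G y) = (LINT y|m. indicator {c..d} y *\<^sub>R (h y *\<^sub>R G y))"
      unfolding mK_def using that Gm m(1) by (subst integral_density)
         (auto simp: measurable_cong_sets[OF m(1) refl])
    also have "\<dots> = (LINT y|m. h y *\<^sub>R G y)"
    proof (rule Bochner_Integration.integral_cong)
      fix y show "indicator {c..d} y *\<^sub>R (h y *\<^sub>R G y) = h y *\<^sub>R G y" by (cases "y \<in> {c..d}") (auto simp: G_def)
    qed simp
    finally show ?thesis .
  qed
  have GK: "integrable mK G"
  proof -
    have "integrable m (\<lambda>x. indicator {c..d} x *\<^sub>R G x)" using m(1) by (intro integrable_mult_indicator G) auto
    moreover have "indicator {c..d} \<in> borel_measurable m" using m(1) by (intro borel_measurable_indicator) auto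
    ultimately show ?thesis unfolding mK_def using borel_measurable_integrable[OF G] by (subst integrable_density) auto
  qed
  have VK: "(LINT y|m. step_kernel p t y *\<^sub>R F y) = (LINT y|mK. step_kernel p t y *\<^sub>R G y)" if t: "t \<in> {c..d}" for t
  proof -
    have "step_kernel p t y *\<^sub>R F y = step_kernel p t y *\<^sub>R G y" for y
      unfolding G_def using p t by (intro step_kernel_restrict) (auto simp: is_interval_cc)
    then show ?thesis by (simp only: dens[OF step_kernel_measurable])
  qed
  have "(\<lambda>p'. G (snd p')) \<in> borel_measurable (borel \<Otimes>\<^sub>M borel)"
    by (rule measurable_compose[OF measurable_snd Gm])
  then have kG: "(\<lambda>p'. step_kernel p (fst p') (snd p') *\<^sub>R G (snd p')) \<in> borel_measurable (borel \<Otimes>\<^sub>M borel)"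
    by (rule borel_measurable_scaleR[OF step_kernel_measurable_pair])
  have s1: "sets (borel \<Otimes>\<^sub>M mK) = sets (borel \<Otimes>\<^sub>M borel)" "sets (lborel \<Otimes>\<^sub>M mK) = sets (borel \<Otimes>\<^sub>M borel)"
    by (intro sets_pair_measure_cong sK sets_lborel refl)+
  have "(\<lambda>p'. step_kernel p (fst p') (snd p') *\<^sub>R G (snd p')) \<in> borel_measurable (borel \<Otimes>\<^sub>M mK)"
    using kG measurable_cong_sets[OF s1(1) refl] by blast
  then have Vm: "(\<lambda>t. LINT y|mK. step_kernel p t y *\<^sub>R G y) \<in> borel_measurable borel"
    using mK.borel_measurable_lebesgue_integral[of "\<lambda>t y. step_kernel p t y *\<^sub>R G y" borel] by (simp add: case_prod_beta')
  have "(\<lambda>t. indicator {c..d} t *\<^sub>R (LINT y|m. step_kernel p t y *\<^sub>R F y)) = (\<lambda>t. indicator {c..d} t *\<^sub>R (LINT y|mK. step_kernel p t y *\<^sub>R G y))"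
    using VK by (auto simp: fun_eq_iff indicator_def)
  then show "(\<lambda>t. indicator {c..d} t *\<^sub>R (LINT y|m. step_kernel p t y *\<^sub>R F y)) \<in> borel_measurable borel"
    using Vm by simp
  note hi = heaviside_integral[OF d cont supp]
  have \<phi>'m: "\<phi>' \<in> borel_measurable borel" by (rule borel_measurable_continuous_onI[OF cont])
  have \<phi>m: "\<phi> \<in> borel_measurable borel"
    using d by (intro borel_measurable_continuous_onI continuous_at_imp_continuous_on) (auto intro: DERIV_isCont)
  have "(LBINT t. \<phi>' t *\<^sub>R (LINT y|m. step_kernel p t y *\<^sub>R F y)) = (LBINT t. (LINT y|mK. \<phi>' t *\<^sub>R (step_kernel p t y *\<^sub>R G y)))"
  proof (rule Bochner_Integration.integral_cong)
    fix t show "\<phi>' t *\<^sub>R (LINT y|m. step_kernel p t y *\<^sub>R F y) = (LINT y|mK. \<phi>' t *\<^sub>R (step_kernel p t y *\<^sub>R G y))"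
      by (cases "t \<in> {c..d}") (simp_all add: VK supp(2) del: scaleR_scaleR)
  qed simp
  also have "\<dots> = (LINT y|mK. (LBINT t. \<phi>' t *\<^sub>R (step_kernel p t y *\<^sub>R G y)))"
  proof (rule Fubini_integral[symmetric])
    have ik: "integrable mK (\<lambda>y. step_kernel p t y *\<^sub>R G y)" for t
      by (rule Bochner_Integration.integrable_bound[OF GK])
         (use step_kernel_measurable[of p t] Gm step_kernel_bound[of p t] in \<open>auto simp: measurable_cong_sets[OF sK refl] mult_left_le_one_le\<close>)
    show "integrable (lborel \<Otimes>\<^sub>M mK) (\<lambda>(t, y). \<phi>' t *\<^sub>R (step_kernel p t y *\<^sub>R G y))"
    proof (rule Fubini_integrable)
      show pm: "(\<lambda>(t, y). \<phi>' t *\<^sub>R (step_kernel p t y *\<^sub>R G y)) \<in> borel_measurable (lborel \<Otimes>\<^sub>M mK)"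
      proof -
        have "(\<lambda>p'. \<phi>' (fst p')) \<in> borel_measurable (borel \<Otimes>\<^sub>M borel)"
          by (rule measurable_compose[OF measurable_fst \<phi>'m])
        from borel_measurable_scaleR[OF this kG] show ?thesis
          unfolding case_prod_beta' using measurable_cong_sets[OF s1(2) refl] by blast
      qed
      show "AE t in lborel. integrable mK (\<lambda>y. case (t, y) of (t, y) \<Rightarrow> \<phi>' t *\<^sub>R (step_kernel p t y *\<^sub>R G y))"
        unfolding prod.case by (intro AE_I2 integrable_scaleR_right ik)
      show "integrable lborel (\<lambda>t. LINT y|mK. norm (case (t, y) of (t, y) \<Rightarrow> \<phi>' t *\<^sub>R (step_kernel p t y *\<^sub>R G y)))"
      proof (rule Bochner_Integration.integrable_bound)
        show "integrable lborel (\<lambda>t. \<bar>\<phi>' t\<bar> * (LINT y|mK. norm (G y)))" using hi(3) by auto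
        show "(\<lambda>t. LINT y|mK. norm (case (t, y) of (t, y) \<Rightarrow> \<phi>' t *\<^sub>R (step_kernel p t y *\<^sub>R G y))) \<in> borel_measurable lborel"
          using measurable_compose[OF pm borel_measurable_norm] by (intro mK.borel_measurable_lebesgue_integral) (simp add: case_prod_beta' del: scaleR_scaleR)
        show "AE t in lborel. norm (LINT y|mK. norm (case (t, y) of (t, y) \<Rightarrow> \<phi>' t *\<^sub>R (step_kernel p t y *\<^sub>R G y)))
          \<le> norm (\<bar>\<phi>' t\<bar> * (LINT y|mK. norm (G y)))"
        proof (rule AE_I2)
          fix t
          have "(LINT y|mK. norm (\<phi>' t *\<^sub>R (step_kernel p t y *\<^sub>R G y))) \<le> (LINT y|mK. \<bar>\<phi>' t\<bar> * norm (G y))"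
          proof (rule integral_mono)
            show "integrable mK (\<lambda>y. norm (\<phi>' t *\<^sub>R (step_kernel p t y *\<^sub>R G y)))"
              by (intro integrable_norm integrable_scaleR_right ik)
            show "integrable mK (\<lambda>y. \<bar>\<phi>' t\<bar> * norm (G y))" using integrable_norm[OF GK] by simp
            show "norm (\<phi>' t *\<^sub>R (step_kernel p t y *\<^sub>R G y)) \<le> \<bar>\<phi>' t\<bar> * norm (G y)" for y
              unfolding norm_scaleR[of "\<phi>' t"] by (intro mult_left_mono norm_step_kernel_le abs_ge_zero)
          qed
          then show "norm (LINT y|mK. norm (case (t, y) of (t, y) \<Rightarrow> \<phi>' t *\<^sub>R (step_kernel p t y *\<^sub>R G y)))
             \<le> norm (\<bar>\<phi>' t\<bar> * (LINT y|mK. norm (G y)))" by (auto simp: abs_of_nonneg)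
        qed
      qed
    qed
  qed
  also have "\<dots> = (LINT y|mK. (- \<phi> y) *\<^sub>R G y)"
  proof (rule Bochner_Integration.integral_cong)
    fix y
    have i1: "integrable lborel (\<lambda>t. \<phi>' t * heaviside (t - y))"
      by (rule Bochner_Integration.integrable_bound[OF hi(3)]) (use \<phi>'m in \<open>auto simp: heaviside_def\<close>)
    have "(LBINT t. \<phi>' t *\<^sub>R (step_kernel p t y *\<^sub>R G y)) = (LBINT t. (\<phi>' t * heaviside (t - y) - \<phi>' t * heaviside (p - y)) *\<^sub>R G y)"
      by (simp add: step_kernel_def algebra_simps)
    also have "\<dots> = (LBINT t. \<phi>' t * heaviside (t - y) - \<phi>' t * heaviside (p - y)) *\<^sub>R G y"
      using i1 hi(3) by (intro integral_scaleR_left) auto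
    also have "(LBINT t. \<phi>' t * heaviside (t - y) - \<phi>' t * heaviside (p - y)) = - \<phi> y"
      using i1 hi by (subst Bochner_Integration.integral_diff) auto
    finally show "(LBINT t. \<phi>' t *\<^sub>R (step_kernel p t y *\<^sub>R G y)) = (- \<phi> y) *\<^sub>R G y" .
  qed simp
  also have "\<dots> = (LINT y|m. (- \<phi> y) *\<^sub>R G y)" using \<phi>m by (intro dens) auto
  also have "\<dots> = - (LINT y|m. \<phi> y *\<^sub>R F y)"
  proof -
    have "(- \<phi> y) *\<^sub>R G y = - (\<phi> y *\<^sub>R F y)" for y using supp(1)[of y] by (cases "y \<in> {c..d}") (auto simp: G_def)
    then show ?thesis by (simp only: Bochner_Integration.integral_minus)
  qed
  finally show "(LBINT t. \<phi>' t *\<^sub>R (LINT y|m. step_kernel p t y *\<^sub>R F y)) = - (LINT y|m. \<phi> y *\<^sub>R F y)" .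
qed

text \<open>Du Bois-Reymond: a function with one-sided limits whose distributional derivative vanishes has
  all its one-sided limits equal.\<close>

lemma bump_mean_limit:
  fixes g :: "real \<Rightarrow> complex^'n"
  assumes near: "\<And>e. 0 < e \<Longrightarrow> \<exists>s t. s < t \<and> (\<forall>y\<in>{s<..<t}. dist (g y) L < e) \<and>
      integrable lborel (\<lambda>y. bump s t y *\<^sub>R g y) \<and> (LBINT y. bump s t y *\<^sub>R g y) = integral\<^sup>L lborel (bump s t) *\<^sub>R C"
  shows "C = L"
proof (rule ccontr)
  assume "C \<noteq> L"
  then obtain s t where t: "s < t" and g: "\<And>y. y \<in> {s<..<t} \<Longrightarrow> dist (g y) L < dist C L / 2"
    and i: "integrable lborel (\<lambda>y. bump s t y *\<^sub>R g y)" and v: "(LBINT y. bump s t y *\<^sub>R g y) = integral\<^sup>L lborel (bump s t) *\<^sub>R C"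
    using near[of "dist C L / 2"] by auto
  note b = bump_properties[OF t(1)]
  have i2: "integrable lborel (\<lambda>y. bump s t y *\<^sub>R L)" using b(6) by auto
  have "integral\<^sup>L lborel (bump s t) *\<^sub>R (C - L) = (LBINT y. bump s t y *\<^sub>R g y - bump s t y *\<^sub>R L)"
    using i i2 v b(6) by (simp add: scaleR_diff_right)
  then have "integral\<^sup>L lborel (bump s t) * norm (C - L) = norm (LBINT y. bump s t y *\<^sub>R g y - bump s t y *\<^sub>R L)"
    using b(5) by (metis abs_of_pos norm_scaleR)
  also have "\<dots> \<le> (LBINT y. norm (bump s t y *\<^sub>R g y - bump s t y *\<^sub>R L))" by (rule integral_norm_bound)
  also have "\<dots> \<le> (LBINT y. bump s t y * (dist C L / 2))"
  proof (rule integral_mono)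
    fix y
    show "norm (bump s t y *\<^sub>R g y - bump s t y *\<^sub>R L) \<le> bump s t y * (dist C L / 2)"
    proof (cases "y \<in> {s<..<t}")
      case True
      then have "bump s t y * norm (g y - L) \<le> bump s t y * (dist C L / 2)"
        using g[OF True] b(2)[of y] by (intro mult_left_mono) (simp_all add: dist_norm)
      then show ?thesis using b(2)[of y] by (simp add: scaleR_diff_right[symmetric])
    next
      case False then show ?thesis using b(3)[of y] by simp
    qed
  qed (use i i2 b(6) in auto)
  also have "\<dots> = integral\<^sup>L lborel (bump s t) * (norm (C - L) / 2)" by (simp add: dist_norm)
  finally show False using b(5) \<open>C \<noteq> L\<close> by simp
qed

lemma bump_mean_one_sided_limits:
  fixes g :: "real \<Rightarrow> complex^'n"
  assumes cd: "c < x" "x < d"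
    and mean: "\<And>s t. c \<le> s \<Longrightarrow> s < t \<Longrightarrow> t \<le> d \<Longrightarrow>
      integrable lborel (\<lambda>y. bump s t y *\<^sub>R g y) \<and> (LBINT y. bump s t y *\<^sub>R g y) = integral\<^sup>L lborel (bump s t) *\<^sub>R C"
  shows "(g \<longlongrightarrow> L) (at_right x) \<Longrightarrow> C = L" "(g \<longlongrightarrow> L) (at_left x) \<Longrightarrow> C = L"
proof -
  show "C = L" if "(g \<longlongrightarrow> L) (at_right x)"
  proof (rule bump_mean_limit)
    fix e :: real assume "0 < e"
    then have "eventually (\<lambda>y. dist (g y) L < e) (at_right x)" using that by (intro tendstoD)
    then obtain t where t: "t > x" "\<And>y. x < y \<Longrightarrow> y < t \<Longrightarrow> dist (g y) L < e"
      unfolding eventually_at_right_field by blast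
    then show "\<exists>s t. s < t \<and> (\<forall>y\<in>{s<..<t}. dist (g y) L < e) \<and>
      integrable lborel (\<lambda>y. bump s t y *\<^sub>R g y) \<and> (LBINT y. bump s t y *\<^sub>R g y) = integral\<^sup>L lborel (bump s t) *\<^sub>R C"
      using cd mean[of x "min t d"] by (intro exI[of _ x] exI[of _ "min t d"]) auto
  qed
  show "C = L" if "(g \<longlongrightarrow> L) (at_left x)"
  proof (rule bump_mean_limit)
    fix e :: real assume "0 < e"
    then have "eventually (\<lambda>y. dist (g y) L < e) (at_left x)" using that by (intro tendstoD)
    then obtain s where s: "s < x" "\<And>y. s < y \<Longrightarrow> y < x \<Longrightarrow> dist (g y) L < e"
      unfolding eventually_at_left_field by blast
    then show "\<exists>s t. s < t \<and> (\<forall>y\<in>{s<..<t}. dist (g y) L < e) \<and>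
      integrable lborel (\<lambda>y. bump s t y *\<^sub>R g y) \<and> (LBINT y. bump s t y *\<^sub>R g y) = integral\<^sup>L lborel (bump s t) *\<^sub>R C"
      using cd mean[of "max s c" x] by (intro exI[of _ "max s c"] exI[of _ x]) auto
  qed
qed

text \<open>The support is enclosed in a compact interval in whose interior it lies, so that the derivative also
  vanishes outside.\<close>

lemma test_function_facts:
  assumes \<phi>: "test_function (einterval a b) \<phi>" and ab: "a < b" and p: "p \<in> einterval a b"
  obtains c d where "p \<in> {c..d}" "{c..d} \<subseteq> einterval a b" "\<And>x. x \<notin> {c..d} \<Longrightarrow> \<phi> x = 0" "\<And>x. x \<notin> {c..d} \<Longrightarrow> deriv \<phi> x = 0"
    "\<And>x. (\<phi> has_real_derivative deriv \<phi> x) (at x)" "continuous_on UNIV (deriv \<phi>)"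
proof -
  have "((deriv ^^ 0) \<phi>) differentiable_on UNIV" "((deriv ^^ 1) \<phi>) differentiable_on UNIV"
    using \<phi> unfolding test_function_def by blast+
  then have "\<phi> differentiable_on UNIV" and d1: "deriv \<phi> differentiable_on UNIV" by auto
  then have d: "(\<phi> has_real_derivative deriv \<phi> x) (at x)" for x
    by (simp add: differentiable_on_def DERIV_deriv_iff_real_differentiable)
  have c: "continuous_on UNIV (deriv \<phi>)" using d1 by (rule differentiable_imp_continuous_on)
  let ?S = "closure {x. \<phi> x \<noteq> 0}"
  obtain l u :: "nat \<Rightarrow> real" where lu: "\<And>i. {l i..u i} \<subseteq> einterval a b"
    "\<And>K. compact K \<Longrightarrow> K \<subseteq> einterval a b \<Longrightarrow> \<exists>i. K \<subseteq> {l i..u i}"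
    using einterval_exhaustion[OF ab] by metis
  have "compact (insert p ?S)" "insert p ?S \<subseteq> einterval a b" using \<phi> p unfolding test_function_def by auto
  then obtain i where i: "insert p ?S \<subseteq> {l i..u i}" using lu(2) by blast
  then have li: "l i \<in> einterval a b" "u i \<in> einterval a b" using lu(1)[of i] by auto
  obtain c d' where c1: "c < l i" "l i < d'" "{c..d'} \<subseteq> einterval a b" using einterval_Icc_around[OF li(1)] by blast
  obtain c' d where d1: "c' < u i" "u i < d" "{c'..d} \<subseteq> einterval a b" using einterval_Icc_around[OF li(2)] by blast
  have "{c..d} \<subseteq> einterval a b"
  proof
    fix x assume "x \<in> {c..d}"
    then have "x \<in> {c..d'} \<or> x \<in> {l i..u i} \<or> x \<in> {c'..d}" using c1 d1 i by auto
    then show "x \<in> einterval a b" using c1(3) d1(3) lu(1)[of i] by blast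
  qed
  moreover have "\<phi> x = 0" if "x \<notin> {l i..u i}" for x using i that closure_subset[of "{x. \<phi> x \<noteq> 0}"] by blast
  moreover have "deriv \<phi> x = 0" if x: "x \<notin> {l i..u i}" for x
  proof -
    have "eventually (\<lambda>y. y \<in> - {l i..u i}) (nhds x)" using x by (intro eventually_nhds_in_open) auto
    then have "eventually (\<lambda>y. \<phi> y = 0) (nhds x)" by eventually_elim (use calculation(2) in auto)
    then have "(\<phi> has_real_derivative 0) (at x)" by (subst DERIV_cong_ev[of x x _ "\<lambda>_. 0" 0 0]) auto
    then show ?thesis by (rule DERIV_imp_deriv)
  qed
  ultimately show thesis using c1(1) d1(2) i d c by (intro that[of c d]) auto
qed

section \<open>The differential equation as an integral equation\<close>

locale ode_setting = weighted_interval a b I w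
  for a b :: ereal and I :: "real set" and w :: "real set \<Rightarrow> complex^'n^'n" +
  fixes J :: "complex^'n^'n" and q :: "real set \<Rightarrow> complex^'n^'n"
  assumes J_invertible: "invertible J" and q_order0: "order0_distr I q"
begin

abbreviation "Mq \<equiv> base_measure I q"
abbreviation "Q \<equiv> density_mat I q"

lemma q_represents: "represents I q Mq Q"
  by (rule represents_base_measure[OF ab I_eq q_order0])

lemma sets_Mq: "sets Mq = sets borel"
  and Q_measurable: "Q \<in> borel_measurable borel"
  and Q_integrable: "compact K \<Longrightarrow> K \<subseteq> I \<Longrightarrow> set_integrable Mq K Q"
  and Mq_finite: "compact K \<Longrightarrow> K \<subseteq> I \<Longrightarrow> emeasure Mq K < \<infinity>"
  and q_eq: "A \<in> local_borel I \<Longrightarrow> q A = (LINT x:A|Mq. Q x)"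
  using q_represents unfolding represents_def by auto

lemma Icc_subset_I: "s \<in> I \<Longrightarrow> t \<in> I \<Longrightarrow> {s..t} \<subseteq> I"
proof
  fix x assume "s \<in> I" "t \<in> I" "x \<in> {s..t}"
  then have "ereal s \<le> ereal x" "ereal x \<le> ereal t" "a < ereal s" "ereal t < b" by (auto simp: I_eq einterval_def)
  then have "a < ereal x" "ereal x < b" by (blast intro: less_le_trans le_less_trans)+
  then show "x \<in> I" by (simp add: I_eq einterval_def)
qed

definition admissible :: "(real \<Rightarrow> complex^'n) \<Rightarrow> bool" where
  "admissible u \<longleftrightarrow> u \<in> borel_measurable borel \<and> locally_bounded_on I u"

lemma admissible_add: "admissible u \<Longrightarrow> admissible v \<Longrightarrow> admissible (\<lambda>y. u y + v y)"
  unfolding admissible_def locally_bounded_on_def by (auto intro!: bounded_plus_comp borel_measurable_add)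

lemma admissible_cscale: "admissible u \<Longrightarrow> admissible (\<lambda>y. c *s u y)"
proof -
  assume u: "admissible u"
  have "bounded ((\<lambda>y. c *s u y) ` {s..t})" if "bounded (u ` {s..t})" for s t
  proof -
    obtain B where B: "\<And>y. y \<in> {s..t} \<Longrightarrow> norm (u y) \<le> B"
      using \<open>bounded (u ` {s..t})\<close> unfolding bounded_iff by blast
    then show ?thesis by (intro boundedI[of _ "norm c * B"]) (auto simp: norm_cscale intro!: mult_left_mono)
  qed
  then show ?thesis using u unfolding admissible_def locally_bounded_on_def by (auto intro: borel_measurable_cscale)
qed

lemma admissible_diff: "admissible u \<Longrightarrow> admissible v \<Longrightarrow> admissible (\<lambda>y. u y - v y)"
  unfolding admissible_def locally_bounded_on_def by (auto intro!: bounded_minus_comp borel_measurable_diff)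

lemma admissible_zero: "admissible (\<lambda>y. 0)"
  unfolding admissible_def locally_bounded_on_def by (auto simp: image_constant_conv)

lemma matrix_admissible_integrable:
  assumes A: "set_integrable m {s..t} A" "A \<in> borel_measurable borel" "sets m = sets borel"
    and u: "admissible u" and "{s..t} \<subseteq> I"
  shows "set_integrable m {s..t} (\<lambda>y. (A y :: complex^'n^'n) *v u y)"
proof -
  obtain B where B: "\<And>y. y \<in> {s..t} \<Longrightarrow> norm (u y) \<le> B"
    using u assms(5) unfolding admissible_def locally_bounded_on_def bounded_iff by blast
  show ?thesis unfolding set_integrable_def
  proof (rule Bochner_Integration.integrable_bound)
    show "integrable m (\<lambda>y. norm (indicator {s..t} y *\<^sub>R A y) * \<bar>B\<bar>)"
      using integrable_norm[OF A(1)[unfolded set_integrable_def]] by (rule integrable_mult_left)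
    have "(\<lambda>y. indicator {s..t} y *\<^sub>R (A y *v u y)) \<in> borel_measurable borel"
      using u unfolding admissible_def by (intro borel_measurable_scaleR borel_measurable_matrix_vector_mult A(2)) auto
    then show "(\<lambda>y. indicator {s..t} y *\<^sub>R (A y *v u y)) \<in> borel_measurable m"
      by (simp only: measurable_cong_sets[OF A(3) refl])
    have "norm (A y *v u y) \<le> norm (A y) * \<bar>B\<bar>" if "y \<in> {s..t}" for y
      using B[OF that] by (intro order_trans[OF norm_matrix_vector_mult_le] mult_left_mono) auto
    then show "AE y in m. norm (indicator {s..t} y *\<^sub>R (A y *v u y)) \<le> norm (norm (indicator {s..t} y *\<^sub>R A y) * \<bar>B\<bar>)"
      by (auto simp: indicator_def)
  qed
qed

lemma Qu_integrable: "admissible u \<Longrightarrow> {s..t} \<subseteq> I \<Longrightarrow> set_integrable Mq {s..t} (\<lambda>y. Q y *v u y)"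
  and W_admissible_integrable: "admissible u \<Longrightarrow> {s..t} \<subseteq> I \<Longrightarrow> set_integrable M {s..t} (\<lambda>y. W y *v u y)"
  using matrix_admissible_integrable[OF Q_integrable Q_measurable sets_Mq]
    matrix_admissible_integrable[OF W_integrable W_measurable sets_M] by simp_all

lemma Wf_integrable: "f \<in> L2 \<Longrightarrow> {s..t} \<subseteq> I \<Longrightarrow> set_integrable M {s..t} (\<lambda>y. W y *v f y)"
  using compact_integral_W_bound[of "{s..t}"] by (metis compact_Icc)

text \<open>The increment of \<open>J u\<close> prescribed by the equation \<open>J u' = w f - q u\<close>; at the end points half of the
  mass is counted, in accordance with \<open>u\<close> being balanced.\<close>

definition increment :: "(real \<Rightarrow> complex^'n) \<Rightarrow> (real \<Rightarrow> complex^'n) \<Rightarrow> real \<Rightarrow> real \<Rightarrow> complex^'n" where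
  "increment u f s t = (LINT y|M. step_kernel s t y *\<^sub>R (W y *v f y)) - (LINT y|Mq. step_kernel s t y *\<^sub>R (Q y *v u y))"

definition solves_integral :: "real set \<Rightarrow> (real \<Rightarrow> complex^'n) \<Rightarrow> (real \<Rightarrow> complex^'n) \<Rightarrow> bool" where
  "solves_integral S u f \<longleftrightarrow> (\<forall>s\<in>S. \<forall>t\<in>S. J *v (u t - u s) = increment u f s t)"

lemma kernel_integrals:
  assumes "s \<in> I" "t \<in> I"
  shows "f \<in> L2 \<Longrightarrow> integrable M (\<lambda>y. step_kernel s t y *\<^sub>R (W y *v f y))"
    "admissible u \<Longrightarrow> integrable Mq (\<lambda>y. step_kernel s t y *\<^sub>R (Q y *v u y))"
proof -
  have sub: "{min s t..max s t} \<subseteq> I" using assms by (intro Icc_subset_I) (auto simp: min_def max_def)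
  show "integrable M (\<lambda>y. step_kernel s t y *\<^sub>R (W y *v f y))" if "f \<in> L2"
    by (rule step_kernel_integrable(1)[OF Wf_integrable[OF that sub] sets_M]) (auto simp: is_interval_cc)
  show "integrable Mq (\<lambda>y. step_kernel s t y *\<^sub>R (Q y *v u y))" if "admissible u"
    by (rule step_kernel_integrable(1)[OF Qu_integrable[OF that sub] sets_Mq]) (auto simp: is_interval_cc)
qed

lemma increment_chain:
  assumes "p \<in> I" "s \<in> I" "t \<in> I" "f \<in> L2" "admissible u"
  shows "increment u f p t - increment u f p s = increment u f s t"
proof -
  have e: "step_kernel s t y *\<^sub>R v = step_kernel p t y *\<^sub>R v - step_kernel p s y *\<^sub>R v" for y and v :: "complex^'n"
    by (simp add: step_kernel_diff[of p t y s, symmetric] scaleR_diff_left)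
  show ?thesis unfolding increment_def e
    using kernel_integrals[OF assms(1,3)] kernel_integrals[OF assms(1,2)] assms(4,5) by simp
qed

lemma increment_add:
  assumes "s \<in> I" "t \<in> I" "f \<in> L2" "admissible u" "g \<in> L2" "admissible v"
  shows "increment (\<lambda>y. u y + v y) (\<lambda>y. f y + g y) s t = increment u f s t + increment v g s t"
  unfolding increment_def using kernel_integrals[OF assms(1,2)] assms(3-) by (simp add: scaleR_add_right)

lemma increment_cscale: "increment (\<lambda>y. c *s u y) (\<lambda>y. c *s f y) s t = c *s increment u f s t"
proof -
  have int: "(LINT y|m. c *s F y) = c *s (LINT y|m. F y)" for m :: "real measure" and F :: "real \<Rightarrow> complex^'n"
  proof (cases "c = 0")
    case False
    show ?thesis by (rule integral_bounded_linear'[OF bounded_linear_cscale bounded_linear_cscale[of "inverse c"]])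
         (use False in \<open>simp add: vector_smult_assoc\<close>)
  qed simp
  have e: "step_kernel s t y *\<^sub>R (A *v (c *s z)) = c *s (step_kernel s t y *\<^sub>R (A *v z))" for y A and z :: "complex^'n"
    by (simp add: matrix_vector_mult_cscale vec_eq_iff)
  show ?thesis unfolding increment_def e int by (simp add: vec_eq_iff algebra_simps)
qed

lemma increment_diff:
  assumes "s \<in> I" "t \<in> I" "f \<in> L2" "admissible u" "g \<in> L2" "admissible v"
  shows "increment (\<lambda>y. u y - v y) (\<lambda>y. f y - g y) s t = increment u f s t - increment v g s t"
  unfolding increment_def using kernel_integrals[OF assms(1,2)] assms(3-) by (simp add: scaleR_diff_right)

lemma solves_integral_add:
  assumes "S \<subseteq> I" "f \<in> L2" "admissible u" "g \<in> L2" "admissible v"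
    and "solves_integral S u f" "solves_integral S v g"
  shows "solves_integral S (\<lambda>y. u y + v y) (\<lambda>y. f y + g y)"
  unfolding solves_integral_def
proof (intro ballI)
  fix s t assume "s \<in> S" "t \<in> S"
  then have "J *v (u t - u s) = increment u f s t" "J *v (v t - v s) = increment v g s t" "s \<in> I" "t \<in> I"
    using assms unfolding solves_integral_def by auto
  moreover have "J *v (u t + v t - (u s + v s)) = J *v (u t - u s) + J *v (v t - v s)" by (simp add: algebra_simps)
  ultimately show "J *v (u t + v t - (u s + v s)) = increment (\<lambda>y. u y + v y) (\<lambda>y. f y + g y) s t"
    using increment_add assms(2-5) by simp
qed

lemma solves_integral_cscale:
  assumes "solves_integral S u f" shows "solves_integral S (\<lambda>y. c *s u y) (\<lambda>y. c *s f y)"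
  unfolding solves_integral_def
proof (intro ballI)
  fix s t assume "s \<in> S" "t \<in> S"
  then have e: "J *v (u t - u s) = increment u f s t" using assms by (simp only: solves_integral_def)
  have "c *s x - c *s y = c *s (x - y)" for x y :: "complex^'n" by (simp add: vec_eq_iff algebra_simps)
  then show "J *v (c *s u t - c *s u s) = increment (\<lambda>y. c *s u y) (\<lambda>y. c *s f y) s t"
    by (simp only: matrix_vector_mult_cscale e increment_cscale)
qed

lemma solves_integral_diff:
  assumes "S \<subseteq> I" "f \<in> L2" "admissible u" "g \<in> L2" "admissible v"
    and "solves_integral S u f" "solves_integral S v g"
  shows "solves_integral S (\<lambda>y. u y - v y) (\<lambda>y. f y - g y)"
  using solves_integral_add[OF assms(1-3) L2_fun_cscale[OF assms(4), of "-1"] admissible_cscale[OF assms(5), of "-1"] assms(6)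
    solves_integral_cscale[OF assms(7), of "-1"]] by (simp add: cscale_minus_one)

text \<open>Replacing \<open>f\<close> by another representative of its class does not affect the equation.\<close>

lemma increment_cong_Wf:
  assumes "AE y in M. y \<in> I \<longrightarrow> W y *v f y = W y *v g y" "f \<in> L2" "g \<in> L2" "s \<in> I" "t \<in> I"
  shows "increment u f s t = increment u g s t"
proof -
  have k0: "step_kernel s t y = 0" if "y \<notin> I" for y
  proof -
    have "{min s t..max s t} \<subseteq> I" using assms(4,5) by (intro Icc_subset_I) (auto simp: min_def max_def)
    then show ?thesis using that by (intro step_kernel_outside) blast
  qed
  have "(LINT y|M. step_kernel s t y *\<^sub>R (W y *v f y)) = (LINT y|M. step_kernel s t y *\<^sub>R (W y *v g y))"
  proof (rule integral_cong_AE)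
    show "AE y in M. step_kernel s t y *\<^sub>R (W y *v f y) = step_kernel s t y *\<^sub>R (W y *v g y)" using assms(1)
    proof eventually_elim
      case (elim y)
      then show ?case using k0[of y] by (cases "y \<in> I") auto
    qed
  qed (use kernel_integrals[OF assms(4,5)] assms(2,3) in \<open>auto dest: borel_measurable_integrable\<close>)
  then show ?thesis by (simp add: increment_def)
qed

lemma J_inv: "matrix_inv J *v (J *v x) = x" and J_inv_right: "J *v (matrix_inv J *v x) = x"
  and J_inv_bound: "norm x \<le> norm (matrix_inv J) * norm (J *v x)"
proof -
  have "J ** matrix_inv J = mat 1 \<and> matrix_inv J ** J = mat 1"
    unfolding matrix_inv_def using J_invertible unfolding invertible_def by (rule someI_ex)
  then show 1: "matrix_inv J *v (J *v x) = x" and "J *v (matrix_inv J *v x) = x" for x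
    by (simp_all add: matrix_vector_mul_assoc)
  show "norm x \<le> norm (matrix_inv J) * norm (J *v x)"
    using norm_matrix_vector_mult_le[of "matrix_inv J" "J *v x"] 1 by simp
qed

lemma point_mass_w: "f \<in> L2 \<Longrightarrow> x \<in> I \<Longrightarrow> (LINT y:{x}|M. W y *v f y) = jump w x *v f x"
  and point_mass_q: "x \<in> I \<Longrightarrow> (LINT y:{x}|Mq. Q y *v u y) = jump q x *v u x"
proof -
  have gen: "(LINT y:{x}|m. A y *v h y) = (LINT y:{x}|m. A y) *v h x"
    if "set_integrable m {x} A" for m :: "real measure" and A :: "real \<Rightarrow> complex^'n^'n" and h
  proof -
    have bl: "bounded_linear (\<lambda>B :: complex^'n^'n. B *v h x)"
      by (rule bounded_bilinear.bounded_linear_left[OF bounded_bilinear_matrix_vector_mult])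
    have "(LINT y:{x}|m. A y *v h y) = (LINT y|m. (indicator {x} y *\<^sub>R A y) *v h x)"
      unfolding set_lebesgue_integral_def by (intro Bochner_Integration.integral_cong) (auto simp: indicator_def)
    then show ?thesis using integral_bounded_linear[OF bl that[unfolded set_integrable_def]]
      by (simp add: set_lebesgue_integral_def)
  qed
  have lb: "{x} \<in> local_borel I" if "x \<in> I" using that by (auto simp: local_borel_def intro!: exI[of _ "{x}"])
  show "(LINT y:{x}|M. W y *v f y) = jump w x *v f x" if "x \<in> I"
    using gen[OF W_integrable[of "{x}"]] that w_eq[OF lb[OF that]] by (simp add: jump_def)
  show "(LINT y:{x}|Mq. Q y *v u y) = jump q x *v u x" if "x \<in> I"
    using gen[OF Q_integrable[of "{x}"]] that q_eq[OF lb[OF that]] by (simp add: jump_def)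
qed

lemma increment_right_limit:
  assumes f: "f \<in> L2" and u: "admissible u" and x: "x \<in> I"
  shows "((\<lambda>t. increment u f x t) \<longlongrightarrow> (1/2) *\<^sub>R (jump w x *v f x - jump q x *v u x)) (at_right x)"
    and "((\<lambda>t. increment u f x t) \<longlongrightarrow> - (1/2) *\<^sub>R (jump w x *v f x - jump q x *v u x)) (at_left x)"
proof -
  obtain c d where cd: "c < x" "x < d" "{c..d} \<subseteq> I" using einterval_Icc_around x unfolding I_eq by metis
  note i = Wf_integrable[OF f cd(3)] Qu_integrable[OF u cd(3)]
  have "((\<lambda>t. increment u f x t) \<longlongrightarrow> (1/2) *\<^sub>R (LINT y:{x}|M. W y *v f y) - (1/2) *\<^sub>R (LINT y:{x}|Mq. Q y *v u y)) (at_right x)"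
    unfolding increment_def using cd
    by (intro tendsto_diff step_kernel_integral_right_limit[OF i(1) sets_M] step_kernel_integral_right_limit[OF i(2) sets_Mq]) auto
  then show "((\<lambda>t. increment u f x t) \<longlongrightarrow> (1/2) *\<^sub>R (jump w x *v f x - jump q x *v u x)) (at_right x)"
    using point_mass_w[OF f x] point_mass_q[OF x, of u] by (simp add: scaleR_diff_right)
  have "((\<lambda>t. increment u f x t) \<longlongrightarrow> (- 1/2) *\<^sub>R (LINT y:{x}|M. W y *v f y) - (- 1/2) *\<^sub>R (LINT y:{x}|Mq. Q y *v u y)) (at_left x)"
    unfolding increment_def using cd
    by (intro tendsto_diff step_kernel_integral_left_limit[OF i(1) sets_M] step_kernel_integral_left_limit[OF i(2) sets_Mq]) auto
  then show "((\<lambda>t. increment u f x t) \<longlongrightarrow> - (1/2) *\<^sub>R (jump w x *v f x - jump q x *v u x)) (at_left x)"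
    using point_mass_w[OF f x] point_mass_q[OF x, of u] by (simp add: scaleR_diff_right)
qed

text \<open>A solution of the integral equation has one-sided limits, and its value is their mean; the
  jump is governed by the masses of \<open>w\<close> and \<open>q\<close>.\<close>

lemma solves_integral_limits:
  assumes f: "f \<in> L2" and u: "admissible u" and S: "open S" "S \<subseteq> I" "solves_integral S u f" and x: "x \<in> S"
  shows "(u \<longlongrightarrow> u x + matrix_inv J *v ((1/2) *\<^sub>R (jump w x *v f x - jump q x *v u x))) (at_right x)"
    and "(u \<longlongrightarrow> u x - matrix_inv J *v ((1/2) *\<^sub>R (jump w x *v f x - jump q x *v u x))) (at_left x)"
proof -
  have xI: "x \<in> I" using x S by auto
  define D where "D = (1/2) *\<^sub>R (jump w x *v f x - jump q x *v u x)"
  have ut: "u x + matrix_inv J *v increment u f x t = u t" if "t \<in> S" for t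
  proof -
    have "increment u f x t = J *v (u t - u x)" using S(3) x that by (simp add: solves_integral_def)
    then show ?thesis by (simp only: J_inv) simp
  qed
  have ev: "eventually (\<lambda>t. t \<in> S) (at x)" using S(1) x by (intro eventually_at_in_open') auto
  note bl = bounded_linear_matrix_vector_mult
  have "((\<lambda>t. u x + matrix_inv J *v increment u f x t) \<longlongrightarrow> u x + matrix_inv J *v D) (at_right x)"
    by (intro tendsto_add tendsto_const bounded_linear.tendsto[OF bl] increment_right_limit(1)[OF f u xI, folded D_def])
  moreover have "eventually (\<lambda>t. u x + matrix_inv J *v increment u f x t = u t) (at_right x)"
    using ev ut by (auto simp: eventually_at_split elim: eventually_mono)
  ultimately show "(u \<longlongrightarrow> u x + matrix_inv J *v ((1/2) *\<^sub>R (jump w x *v f x - jump q x *v u x))) (at_right x)"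
    unfolding D_def by (rule Lim_transform_eventually)
  have "((\<lambda>t. u x + matrix_inv J *v increment u f x t) \<longlongrightarrow> u x + matrix_inv J *v (- D)) (at_left x)"
    using increment_right_limit(2)[OF f u xI] by (intro tendsto_add tendsto_const bounded_linear.tendsto[OF bl]) (simp add: D_def)
  moreover have "eventually (\<lambda>t. u x + matrix_inv J *v increment u f x t = u t) (at_left x)"
    using ev ut by (auto simp: eventually_at_split elim: eventually_mono)
  ultimately have "(u \<longlongrightarrow> u x + matrix_inv J *v (- D)) (at_left x)" by (rule Lim_transform_eventually)
  then show "(u \<longlongrightarrow> u x - matrix_inv J *v ((1/2) *\<^sub>R (jump w x *v f x - jump q x *v u x))) (at_left x)"
    by (simp add: D_def)
qed

text \<open>Half of the increment of \<open>variation\<close> dominates the increments of \<open>J u\<close>, which gives bounded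
  variation.\<close>

lemma solves_integral_bounded_variation:
  assumes f: "f \<in> L2" and u: "admissible u" and S: "{c..d} \<subseteq> S" "S \<subseteq> I" "solves_integral S u f"
  shows "bounded_variation_on {c..d} u"
proof -
  have cd: "{c..d} \<subseteq> I" using S by blast
  define F1 where "F1 y = indicator {c..d} y *\<^sub>R (W y *v f y)" for y
  define F2 where "F2 y = indicator {c..d} y *\<^sub>R (Q y *v u y)" for y
  have F1: "integrable M F1" using Wf_integrable[OF f cd] by (simp add: set_integrable_def F1_def[abs_def])
  have F2: "integrable Mq F2" using Qu_integrable[OF u cd] by (simp add: set_integrable_def F2_def[abs_def])
  define \<Phi> where "\<Phi> t = (LINT y|M. step_kernel c t y *\<^sub>R norm (F1 y)) + (LINT y|Mq. step_kernel c t y *\<^sub>R norm (F2 y))" for t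
  have si: "set_integrable M UNIV (\<lambda>y. norm (F1 y))" "set_integrable Mq UNIV (\<lambda>y. norm (F2 y))"
    using F1 F2 by (auto simp: set_integrable_def)
  have ik: "integrable M (\<lambda>y. step_kernel s t y *\<^sub>R norm (F1 y))" "integrable Mq (\<lambda>y. step_kernel s t y *\<^sub>R norm (F2 y))" for s t
    using step_kernel_integrable(1)[OF si(1) sets_M] step_kernel_integrable(1)[OF si(2) sets_Mq] by (auto simp: is_interval_univ)
  have mono: "norm (J *v (u t - u s)) \<le> \<Phi> t - \<Phi> s" if st: "c \<le> s" "s \<le> t" "t \<le> d" for s t
  proof -
    have st': "s \<in> {c..d}" "t \<in> {c..d}" using st by auto
    have kpos: "0 \<le> step_kernel s t y" for y using st by (auto simp: step_kernel_def heaviside_def)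
    have "\<Phi> t - \<Phi> s = (LINT y|M. step_kernel c t y *\<^sub>R norm (F1 y) - step_kernel c s y *\<^sub>R norm (F1 y))
       + (LINT y|Mq. step_kernel c t y *\<^sub>R norm (F2 y) - step_kernel c s y *\<^sub>R norm (F2 y))"
      unfolding \<Phi>_def using ik by (simp del: real_scaleR_def)
    also have "\<dots> = (LINT y|M. step_kernel s t y *\<^sub>R norm (F1 y)) + (LINT y|Mq. step_kernel s t y *\<^sub>R norm (F2 y))"
      by (simp only: scaleR_diff_left[symmetric] step_kernel_diff)
    finally have e: "\<Phi> t - \<Phi> s = (LINT y|M. step_kernel s t y *\<^sub>R norm (F1 y)) + (LINT y|Mq. step_kernel s t y *\<^sub>R norm (F2 y))" .
    have "J *v (u t - u s) = increment u f s t" using S st' unfolding solves_integral_def by blast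
    also have "\<dots> = (LINT y|M. step_kernel s t y *\<^sub>R F1 y) - (LINT y|Mq. step_kernel s t y *\<^sub>R F2 y)"
    proof -
      have "step_kernel s t y *\<^sub>R (W y *v f y) = step_kernel s t y *\<^sub>R F1 y"
        "step_kernel s t y *\<^sub>R (Q y *v u y) = step_kernel s t y *\<^sub>R F2 y" for y
        unfolding F1_def F2_def by (rule step_kernel_restrict[OF is_interval_cc st'])+
      then show ?thesis unfolding increment_def by (simp only:)
    qed
    also have "norm \<dots> \<le> norm (LINT y|M. step_kernel s t y *\<^sub>R F1 y) + norm (LINT y|Mq. step_kernel s t y *\<^sub>R F2 y)"
      by (rule norm_triangle_ineq4)
    also have "\<dots> \<le> (LINT y|M. norm (step_kernel s t y *\<^sub>R F1 y)) + (LINT y|Mq. norm (step_kernel s t y *\<^sub>R F2 y))"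
      by (intro add_mono integral_norm_bound)
    also have "\<dots> = \<Phi> t - \<Phi> s" unfolding e using kpos by simp
    finally show ?thesis .
  qed
  define K where "K = norm (matrix_inv J)"
  show ?thesis unfolding bounded_variation_on_def
  proof (intro exI allI impI)
    fix t :: "nat \<Rightarrow> real" and n assume t: "mono_on {..n} t \<and> t ` {..n} \<subseteq> {c..d}"
    have tc: "t i \<in> {c..d}" if "i \<le> n" for i using t that by auto
    have tm: "t i \<le> t j" if "i \<le> j" "j \<le> n" for i j using t that by (auto simp: mono_on_def)
    have "(\<Sum>i<n. norm (u (t (Suc i)) - u (t i))) \<le> (\<Sum>i<n. K * (\<Phi> (t (Suc i)) - \<Phi> (t i)))"
    proof (rule sum_mono)
      fix i assume i: "i \<in> {..<n}"
      have "norm (u (t (Suc i)) - u (t i)) \<le> K * norm (J *v (u (t (Suc i)) - u (t i)))" unfolding K_def by (rule J_inv_bound)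
      also have "\<dots> \<le> K * (\<Phi> (t (Suc i)) - \<Phi> (t i))"
        using i tc[of i] tc[of "Suc i"] tm[of i "Suc i"] by (intro mult_left_mono mono) (auto simp: K_def)
      finally show "norm (u (t (Suc i)) - u (t i)) \<le> K * (\<Phi> (t (Suc i)) - \<Phi> (t i))" .
    qed
    also have "\<dots> = K * (\<Phi> (t n) - \<Phi> (t 0))"
      by (simp only: sum_distrib_left[symmetric] sum_lessThan_telescope[of "\<lambda>i. \<Phi> (t i)"])
    also have "\<dots> \<le> K * (\<Phi> d - \<Phi> c)"
    proof (rule mult_left_mono)
      have "0 \<le> \<Phi> d - \<Phi> (t n)" by (rule order_trans[OF norm_ge_zero mono]) (use tc[of n] in auto)
      moreover have "0 \<le> \<Phi> (t 0) - \<Phi> c" by (rule order_trans[OF norm_ge_zero mono]) (use tc[of 0] in auto)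
      ultimately show "\<Phi> (t n) - \<Phi> (t 0) \<le> \<Phi> d - \<Phi> c" by linarith
    qed (simp add: K_def)
    finally show "(\<Sum>i<n. norm (u (t (Suc i)) - u (t i))) \<le> K * (\<Phi> d - \<Phi> c)" .
  qed
qed

lemma I_open: "open I" by (simp add: I_eq)

lemma solves_integral_imp_BV_sharp:
  assumes f: "f \<in> L2" and u: "admissible u" and S: "solves_integral I u f" and 0: "\<And>y. y \<notin> I \<Longrightarrow> u y = 0"
  shows "u \<in> BV_sharp I"
  unfolding BV_sharp_def
proof (intro CollectI conjI allI ballI impI)
  fix c d assume "{c..d} \<subseteq> I"
  then show "bounded_variation_on {c..d} u" using solves_integral_bounded_variation[OF f u _ _ S] by blast
next
  fix x assume x: "x \<in> I"
  note l = solves_integral_limits[OF f u I_open order_refl S x]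
  show "u x = (1/2) *\<^sub>R (right_lim u x + left_lim u x)"
    unfolding right_lim_eq[OF l(1)] left_lim_eq[OF l(2)] by (simp add: scaleR_2[symmetric])
qed (rule 0)

lemma distr_mult_eq:
  assumes "{c..d} \<subseteq> I" "\<And>x. x \<notin> {c..d} \<Longrightarrow> \<phi> x = 0"
  shows "distr_mult I r u \<phi> = (LINT y|base_measure I r. \<phi> y *\<^sub>R (density_mat I r y *v u y))"
  unfolding distr_mult_def set_lebesgue_integral_def
proof (rule Bochner_Integration.integral_cong)
  fix y show "indicator I y *\<^sub>R \<phi> y *\<^sub>R (density_mat I r y *v u y) = \<phi> y *\<^sub>R (density_mat I r y *v u y)"
    using assms by (cases "y \<in> {c..d}") (auto simp: indicator_def)
qed simp

lemma increment_scaleR_integrable: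
  assumes f: "f \<in> L2" and u: "admissible u" and cd: "{c..d} \<subseteq> I" and p: "p \<in> {c..d}"
    and h: "integrable lborel h" "\<And>x. x \<notin> {c..d} \<Longrightarrow> h x = 0"
  shows "integrable lborel (\<lambda>t. h t *\<^sub>R increment u f p t)"
proof -
  note i = Wf_integrable[OF f cd] Qu_integrable[OF u cd]
  have fin: "emeasure M {c..d} < \<infinity>" "emeasure Mq {c..d} < \<infinity>" using M_finite Mq_finite cd by auto
  have int: "integrable lborel (\<lambda>t. h t *\<^sub>R (LINT y|m. step_kernel p t y *\<^sub>R F y))"
    if F: "set_integrable m {c..d} F" and m: "sets m = sets borel" "emeasure m {c..d} < \<infinity>"
    for m :: "real measure" and F :: "real \<Rightarrow> complex^'n"
  proof -
    define V where "V t = indicator {c..d} t *\<^sub>R (LINT y|m. step_kernel p t y *\<^sub>R F y)" for t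
    define B where "B = (LINT y:{c..d}|m. norm (F y))"
    have VB: "norm (V t) \<le> norm B" for t using step_kernel_integrable(2)[OF F m(1) is_interval_cc p, of t]
      by (cases "t \<in> {c..d}") (auto simp: V_def B_def)
    have Vm: "V \<in> borel_measurable borel"
      using step_kernel_primitive_by_parts(2)[OF F m p, of "\<lambda>_. 0" "\<lambda>_. 0"] by (simp add: V_def[abs_def])
    have "integrable lborel (\<lambda>t. h t *\<^sub>R V t)"
    proof (rule Bochner_Integration.integrable_bound)
      show "integrable lborel (\<lambda>t. h t * norm B)" using h(1) by (rule integrable_mult_left)
      show "(\<lambda>t. h t *\<^sub>R V t) \<in> borel_measurable lborel"
        using Vm borel_measurable_integrable[OF h(1)] by (intro borel_measurable_scaleR) simp_all
      show "AE t in lborel. norm (h t *\<^sub>R V t) \<le> norm (h t * norm B)"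
        using VB by (auto simp: abs_mult intro!: mult_left_mono)
    qed
    moreover have "h t *\<^sub>R V t = h t *\<^sub>R (LINT y|m. step_kernel p t y *\<^sub>R F y)" for t
      using h(2)[of t] by (cases "t \<in> {c..d}") (auto simp: V_def)
    ultimately show ?thesis by (simp only:)
  qed
  have e: "h t *\<^sub>R increment u f p t = h t *\<^sub>R (LINT y|M. step_kernel p t y *\<^sub>R (W y *v f y))
     - h t *\<^sub>R (LINT y|Mq. step_kernel p t y *\<^sub>R (Q y *v u y))" for t
    by (simp only: increment_def scaleR_diff_right)
  show ?thesis
    unfolding e by (rule Bochner_Integration.integrable_diff[OF int[OF i(1) sets_M fin(1)] int[OF i(2) sets_Mq fin(2)]])
qed

lemma primitive_by_parts:
  assumes f: "f \<in> L2" and u: "admissible u" and cd: "{c..d} \<subseteq> I" and p: "p \<in> {c..d}"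
    and d: "\<And>x. (\<phi> has_real_derivative \<phi>' x) (at x)" and cont: "continuous_on UNIV \<phi>'"
    and supp: "\<And>x. x \<notin> {c..d} \<Longrightarrow> \<phi> x = 0" "\<And>x. x \<notin> {c..d} \<Longrightarrow> \<phi>' x = 0"
  shows "(LBINT t. \<phi>' t *\<^sub>R increment u f p t) = distr_mult I q u \<phi> - distr_mult I w f \<phi>"
proof -
  note i = Wf_integrable[OF f cd] Qu_integrable[OF u cd]
  have fin: "emeasure M {c..d} < \<infinity>" "emeasure Mq {c..d} < \<infinity>" using M_finite Mq_finite cd by auto
  have hi: "integrable lborel \<phi>'" by (rule heaviside_integral(3)[where c = c and d = d, OF d cont supp])
  have p1: "(LBINT t. \<phi>' t *\<^sub>R (LINT y|M. step_kernel p t y *\<^sub>R (W y *v f y))) = - (LINT y|M. \<phi> y *\<^sub>R (W y *v f y))"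
    by (rule step_kernel_primitive_by_parts(1)[OF i(1) sets_M fin(1) p d cont supp])
  have p2: "(LBINT t. \<phi>' t *\<^sub>R (LINT y|Mq. step_kernel p t y *\<^sub>R (Q y *v u y))) = - (LINT y|Mq. \<phi> y *\<^sub>R (Q y *v u y))"
    by (rule step_kernel_primitive_by_parts(1)[OF i(2) sets_Mq fin(2) p d cont supp])
  have zero: "admissible (\<lambda>_. 0)" "(\<lambda>_. 0) \<in> L2" by (rule admissible_zero, rule L2_fun_zero)
  have i1: "integrable lborel (\<lambda>t. \<phi>' t *\<^sub>R (LINT y|M. step_kernel p t y *\<^sub>R (W y *v f y)))"
    using increment_scaleR_integrable[OF f zero(1) cd p hi supp(2)] by (simp add: increment_def)
  have "integrable lborel (\<lambda>t. \<phi>' t *\<^sub>R - (LINT y|Mq. step_kernel p t y *\<^sub>R (Q y *v u y)))"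
    using increment_scaleR_integrable[OF zero(2) u cd p hi supp(2)] by (simp add: increment_def)
  then have i2: "integrable lborel (\<lambda>t. \<phi>' t *\<^sub>R (LINT y|Mq. step_kernel p t y *\<^sub>R (Q y *v u y)))"
    by simp
  have e: "\<phi>' t *\<^sub>R increment u f p t = \<phi>' t *\<^sub>R (LINT y|M. step_kernel p t y *\<^sub>R (W y *v f y))
     - \<phi>' t *\<^sub>R (LINT y|Mq. step_kernel p t y *\<^sub>R (Q y *v u y))" for t
    by (simp only: increment_def scaleR_diff_right)
  have "(LBINT t. \<phi>' t *\<^sub>R increment u f p t) = - (LINT y|M. \<phi> y *\<^sub>R (W y *v f y)) - - (LINT y|Mq. \<phi> y *\<^sub>R (Q y *v u y))"
    unfolding e Bochner_Integration.integral_diff[OF i1 i2] p1 p2 ..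
  moreover have "distr_mult I q u \<phi> = (LINT y|Mq. \<phi> y *\<^sub>R (Q y *v u y))"
    by (rule distr_mult_eq[OF cd supp(1)])
  moreover have "distr_mult I w f \<phi> = (LINT y|M. \<phi> y *\<^sub>R (W y *v f y))"
    by (rule distr_mult_eq[OF cd supp(1)])
  ultimately show ?thesis by simp
qed

lemma admissible_scaleR_integrable:
  assumes u: "admissible u" and cd: "{c..d} \<subseteq> I" and h: "integrable lborel h" "\<And>x. x \<notin> {c..d} \<Longrightarrow> h x = 0"
  shows "integrable lborel (\<lambda>t. h t *\<^sub>R u t)"
proof -
  obtain B where B: "\<And>y. y \<in> {c..d} \<Longrightarrow> norm (u y) \<le> B"
    using u cd unfolding admissible_def locally_bounded_on_def bounded_iff by blast
  show ?thesis
  proof (rule Bochner_Integration.integrable_bound)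
    show "integrable lborel (\<lambda>t. h t * \<bar>B\<bar>)" using h(1) by (rule integrable_mult_left)
    show "(\<lambda>t. h t *\<^sub>R u t) \<in> borel_measurable lborel"
      using u borel_measurable_integrable[OF h(1)] unfolding admissible_def by (intro borel_measurable_scaleR) simp_all
    show "AE t in lborel. norm (h t *\<^sub>R u t) \<le> norm (h t * \<bar>B\<bar>)"
    proof (rule AE_I2)
      fix t show "norm (h t *\<^sub>R u t) \<le> norm (h t * \<bar>B\<bar>)"
        using B[of t] h(2)[of t] by (cases "t \<in> {c..d}") (auto simp: abs_mult intro!: mult_left_mono)
    qed
  qed
qed

lemma distr_deriv_eq:
  assumes "{c..d} \<subseteq> I" "\<And>x. x \<notin> {c..d} \<Longrightarrow> deriv \<phi> x = 0"
  shows "distr_deriv I u \<phi> = - (LBINT x. deriv \<phi> x *\<^sub>R u x)"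
proof -
  have "indicator I x *\<^sub>R deriv \<phi> x *\<^sub>R u x = deriv \<phi> x *\<^sub>R u x" for x
    using assms by (cases "x \<in> {c..d}") (auto simp: indicator_def)
  then show ?thesis unfolding distr_deriv_def set_lebesgue_integral_def by (simp only:)
qed

lemma test_function_support:
  assumes "test_function I \<phi>" "p \<in> I"
  shows "\<exists>c d. p \<in> {c..d} \<and> {c..d} \<subseteq> I \<and> (\<forall>x. x \<notin> {c..d} \<longrightarrow> \<phi> x = 0) \<and> (\<forall>x. x \<notin> {c..d} \<longrightarrow> deriv \<phi> x = 0)
    \<and> (\<forall>x. (\<phi> has_real_derivative deriv \<phi> x) (at x)) \<and> continuous_on UNIV (deriv \<phi>)"
  by (rule test_function_facts[OF assms(1)[unfolded I_eq] ab assms(2)[unfolded I_eq], folded I_eq]) blast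

text \<open>For a test function with support in \<open>[c, d]\<close>, the function \<open>J u\<close> is the constant \<open>J u(c)\<close> plus the
  primitive of \<open>w f - q u\<close>; the constant is annihilated, and integration by parts handles the primitive.\<close>

lemma solves_integral_imp_solves:
  assumes f: "f \<in> L2" and u: "admissible u" and S: "solves_integral I u f"
  shows "solves I J q w u f"
  unfolding solves_def
proof (intro allI impI)
  fix \<phi> assume \<phi>: "test_function I \<phi>"
  obtain p where p: "p \<in> I" using ereal_dense2[OF ab] by (auto simp: I_eq einterval_def)
  obtain c d where pcd: "p \<in> {c..d}" and cd: "{c..d} \<subseteq> I" and supp: "\<And>x. x \<notin> {c..d} \<Longrightarrow> \<phi> x = 0" "\<And>x. x \<notin> {c..d} \<Longrightarrow> deriv \<phi> x = 0"
    and d: "\<And>x. (\<phi> has_real_derivative deriv \<phi> x) (at x)" and cont: "continuous_on UNIV (deriv \<phi>)"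
    using test_function_support[OF \<phi> p] by blast
  have hi1: "(LBINT t. deriv \<phi> t) = 0" by (rule heaviside_integral(2)[OF d cont supp])
  have hi2: "integrable lborel (deriv \<phi>)" by (rule heaviside_integral(3)[OF d cont supp])
  note hi = hi1 hi2
  have pp: "(LBINT t. deriv \<phi> t *\<^sub>R increment u f p t) = distr_mult I q u \<phi> - distr_mult I w f \<phi>"
    by (rule primitive_by_parts[OF f u cd pcd d cont supp])
  have dd: "distr_deriv I u \<phi> = - (LBINT x. deriv \<phi> x *\<^sub>R u x)" by (rule distr_deriv_eq[OF cd supp(2)])
  note bl = bounded_linear_matrix_vector_mult[of J]
  have ui: "integrable lborel (\<lambda>t. deriv \<phi> t *\<^sub>R u t)"
    by (rule admissible_scaleR_integrable[OF u cd hi(2) supp(2)])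
  have ii: "integrable lborel (\<lambda>t. deriv \<phi> t *\<^sub>R increment u f p t)"
    by (rule increment_scaleR_integrable[OF f u cd pcd hi(2) supp(2)])
  have ci: "integrable lborel (\<lambda>t. deriv \<phi> t *\<^sub>R (J *v u p))" using hi(2) by (rule integrable_scaleR_left)
  have "J *v (LBINT t. deriv \<phi> t *\<^sub>R u t) = (LBINT t. J *v (deriv \<phi> t *\<^sub>R u t))"
    by (rule integral_bounded_linear[OF bl ui, symmetric])
  also have "\<dots> = (LBINT t. deriv \<phi> t *\<^sub>R (J *v u p) + deriv \<phi> t *\<^sub>R increment u f p t)"
  proof (rule Bochner_Integration.integral_cong)
    fix t
    show "J *v (deriv \<phi> t *\<^sub>R u t) = deriv \<phi> t *\<^sub>R (J *v u p) + deriv \<phi> t *\<^sub>R increment u f p t"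
    proof (cases "t \<in> {c..d}")
      case True
      then have "t \<in> I" using cd by auto
      then have "increment u f p t = J *v (u t - u p)" using S p by (simp add: solves_integral_def)
      then show ?thesis by (simp add: scaleR_add_right[symmetric])
    qed (simp add: supp(2))
  qed simp
  also have "\<dots> = distr_mult I q u \<phi> - distr_mult I w f \<phi>"
    unfolding Bochner_Integration.integral_add[OF ci ii] pp using hi by simp
  finally have fin: "J *v (LBINT t. deriv \<phi> t *\<^sub>R u t) = distr_mult I q u \<phi> - distr_mult I w f \<phi>" .
  show "J *v distr_deriv I u \<phi> + distr_mult I q u \<phi> = distr_mult I w f \<phi>"
    unfolding dd matrix_vector_mult_linear fin by simp
qed

text \<open>The difference \<open>g\<close> of \<open>J u\<close> and the primitive of \<open>w f - q u\<close> has vanishing distributional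
  derivative, so all its bump means agree, hence all its one-sided limits. Both functions are balanced,
  so that \<open>g\<close> is the mean of its one-sided limits and therefore constant everywhere.\<close>

lemma solves_imp_solves_integral:
  assumes f: "f \<in> L2" and uB: "u \<in> BV_sharp I" and sol: "solves I J q w u f"
  shows "admissible u" "solves_integral I u f"
proof -
  show u: "admissible u"
    using BV_sharp_measurable[OF uB I_eq ab] BV_sharp_locally_bounded[OF uB] by (simp add: admissible_def)
  obtain p where p: "p \<in> I" using ereal_dense2[OF ab] by (auto simp: I_eq einterval_def)
  define g where "g t = J *v u t - increment u f p t" for t
  note bl = bounded_linear_matrix_vector_mult[of J]
  define mean where "mean s t = inverse (integral\<^sup>L lborel (bump s t)) *\<^sub>R (LBINT y. bump s t y *\<^sub>R g y)" for s t
  have int: "integrable lborel (\<lambda>y. h y *\<^sub>R g y)"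
    if cd: "{c..d} \<subseteq> I" and h: "integrable lborel h" "\<And>x. x \<notin> {c..d} \<Longrightarrow> h x = 0" for h c d
  proof (cases "c \<le> d")
    case True
    define c' d' where "c' = min c p" and "d' = max d p"
    have cd': "{c'..d'} \<subseteq> I" using cd p True by (intro Icc_subset_I) (auto simp: c'_def d'_def min_def max_def)
    have pc: "p \<in> {c'..d'}" by (auto simp: c'_def d'_def)
    have h': "h x = 0" if "x \<notin> {c'..d'}" for x using h(2)[of x] that by (cases "x \<in> {c..d}") (auto simp: c'_def d'_def)
    have "integrable lborel (\<lambda>y. J *v (h y *\<^sub>R u y) - h y *\<^sub>R increment u f p y)"
      by (intro Bochner_Integration.integrable_diff integrable_bounded_linear[OF bl]
         admissible_scaleR_integrable[OF u cd' h(1) h'] increment_scaleR_integrable[OF f u cd' pc h(1) h'])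
    then show ?thesis by (simp add: g_def scaleR_diff_right)
  qed (use h(2) in simp)
  have mean_eq: "mean s t = mean s' t'"
    if st: "s < t" "{s..t} \<subseteq> I" and st': "s' < t'" "{s'..t'} \<subseteq> I" for s t s' t'
  proof -
    define c d where "c = min s s'" and "d = max t t'"
    have cI: "c \<in> I" "d \<in> I" using st st' by (auto simp: c_def d_def min_def max_def)
    then have cd: "{c..d} \<subseteq> I" by (rule Icc_subset_I)
    define m m' where "m = integral\<^sup>L lborel (bump s t)" and "m' = integral\<^sup>L lborel (bump s' t')"
    obtain \<phi> where \<phi>: "test_function I \<phi>" "deriv \<phi> = (\<lambda>x. bump s t x / m - bump s' t' x / m')"
      using bump_difference_primitive[OF st(1) st'(1) cd] by (auto simp: c_def d_def m_def m'_def)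
    obtain c1 d1 where p1: "p \<in> {c1..d1}" and cd1: "{c1..d1} \<subseteq> I" and supp: "\<And>x. x \<notin> {c1..d1} \<Longrightarrow> \<phi> x = 0" "\<And>x. x \<notin> {c1..d1} \<Longrightarrow> deriv \<phi> x = 0"
      and d: "\<And>x. (\<phi> has_real_derivative deriv \<phi> x) (at x)" and cont: "continuous_on UNIV (deriv \<phi>)"
      using test_function_support[OF \<phi>(1) p] by blast
    have pp: "(LBINT t. deriv \<phi> t *\<^sub>R increment u f p t) = distr_mult I q u \<phi> - distr_mult I w f \<phi>"
      by (rule primitive_by_parts[OF f u cd1 p1 d cont supp])
    have hi: "integrable lborel (deriv \<phi>)" by (rule heaviside_integral(3)[OF d cont supp])
    have dd: "distr_deriv I u \<phi> = - (LBINT x. deriv \<phi> x *\<^sub>R u x)" by (rule distr_deriv_eq[OF cd1 supp(2)])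
    have ui: "integrable lborel (\<lambda>y. deriv \<phi> y *\<^sub>R u y)"
      by (rule admissible_scaleR_integrable[OF u cd1 hi supp(2)])
    have ii: "integrable lborel (\<lambda>y. deriv \<phi> y *\<^sub>R increment u f p y)"
      by (rule increment_scaleR_integrable[OF f u cd1 p1 hi supp(2)])
    have "J *v distr_deriv I u \<phi> + distr_mult I q u \<phi> = distr_mult I w f \<phi>"
      using sol \<phi>(1) unfolding solves_def by blast
    then have "(LBINT y. deriv \<phi> y *\<^sub>R increment u f p y) = J *v (LBINT y. deriv \<phi> y *\<^sub>R u y)"
      unfolding pp dd by (simp add: algebra_simps)
    also have "\<dots> = (LBINT y. J *v (deriv \<phi> y *\<^sub>R u y))" by (rule integral_bounded_linear[OF bl ui, symmetric])
    finally have e0: "(LBINT y. J *v (deriv \<phi> y *\<^sub>R u y)) - (LBINT y. deriv \<phi> y *\<^sub>R increment u f p y) = 0" by simp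
    have "(LBINT y. deriv \<phi> y *\<^sub>R g y) = (LBINT y. J *v (deriv \<phi> y *\<^sub>R u y) - deriv \<phi> y *\<^sub>R increment u f p y)"
      by (simp add: g_def scaleR_diff_right)
    also have "\<dots> = 0"
      unfolding Bochner_Integration.integral_diff[OF integrable_bounded_linear[OF bl ui] ii] by (rule e0)
    finally have z: "(LBINT y. deriv \<phi> y *\<^sub>R g y) = 0" .
    have bi: "integrable lborel (\<lambda>y. bump s t y *\<^sub>R g y)"
      by (rule int[OF st(2) bump_properties(6)[OF st(1)]]) (use bump_properties(3)[OF st(1)] in auto)
    have bi': "integrable lborel (\<lambda>y. bump s' t' y *\<^sub>R g y)"
      by (rule int[OF st'(2) bump_properties(6)[OF st'(1)]]) (use bump_properties(3)[OF st'(1)] in auto)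
    have "deriv \<phi> y *\<^sub>R g y = inverse m *\<^sub>R (bump s t y *\<^sub>R g y) - inverse m' *\<^sub>R (bump s' t' y *\<^sub>R g y)" for y
      by (simp add: \<phi>(2) scaleR_diff_left divide_inverse mult.commute)
    then have "0 = inverse m *\<^sub>R (LBINT y. bump s t y *\<^sub>R g y) - inverse m' *\<^sub>R (LBINT y. bump s' t' y *\<^sub>R g y)"
      using z bi bi' by (simp del: scaleR_scaleR)
    then show ?thesis by (simp add: mean_def m_def m'_def)
  qed
  obtain s0 t0 where st0: "s0 < t0" "{s0..t0} \<subseteq> I"
    using einterval_Icc_around p unfolding I_eq by (metis less_trans)
  define C where "C = mean s0 t0"
  have gC: "g x = C" if x: "x \<in> I" for x
  proof -
    obtain c d where cd: "c < x" "x < d" "{c..d} \<subseteq> I" using einterval_Icc_around x unfolding I_eq by metis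
    have mean: "integrable lborel (\<lambda>y. bump s t y *\<^sub>R g y) \<and> (LBINT y. bump s t y *\<^sub>R g y) = integral\<^sup>L lborel (bump s t) *\<^sub>R C"
      if st: "c \<le> s" "s < t" "t \<le> d" for s t
    proof -
      have sub: "{s..t} \<subseteq> I" using st cd(3) by auto
      have "integral\<^sup>L lborel (bump s t) *\<^sub>R mean s t = (LBINT y. bump s t y *\<^sub>R g y)"
        using bump_properties(5)[OF st(2)] by (simp add: mean_def)
      moreover have "mean s t = C" unfolding C_def by (rule mean_eq[OF st(2) sub st0])
      moreover have "integrable lborel (\<lambda>y. bump s t y *\<^sub>R g y)"
        by (rule int[OF sub bump_properties(6)[OF st(2)]]) (use bump_properties(3)[OF st(2)] in auto)
      ultimately show ?thesis by simp
    qed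
    define D where "D = (1/2) *\<^sub>R (jump w x *v f x - jump q x *v u x)"
    note ul = BV_sharp_limits[OF uB x I_eq]
    have ge: "eventually (\<lambda>t. J *v u t - increment u f p x - increment u f x t = g t) (at x)"
    proof -
      have "eventually (\<lambda>t. t \<in> I) (at x)" using I_open x by (intro eventually_at_in_open') auto
      then show ?thesis
      proof eventually_elim
        case (elim t)
        then show ?case using increment_chain[OF p x elim f u] by (simp add: g_def algebra_simps)
      qed
    qed
    have "((\<lambda>t. J *v u t - increment u f p x - increment u f x t) \<longlongrightarrow> J *v right_lim u x - increment u f p x - D) (at_right x)"
      unfolding D_def by (intro tendsto_diff tendsto_const increment_right_limit(1)[OF f u x] bounded_linear.tendsto[OF bl ul(1)])
    moreover have "eventually (\<lambda>t. J *v u t - increment u f p x - increment u f x t = g t) (at_right x)"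
      using ge by (simp add: eventually_at_split)
    ultimately have "(g \<longlongrightarrow> J *v right_lim u x - increment u f p x - D) (at_right x)" by (rule Lim_transform_eventually)
    then have r: "C = J *v right_lim u x - increment u f p x - D"
      by (rule bump_mean_one_sided_limits(1)[OF cd(1,2), rotated]) (rule mean)
    have "((\<lambda>t. J *v u t - increment u f p x - increment u f x t) \<longlongrightarrow> J *v left_lim u x - increment u f p x - (- D)) (at_left x)"
      using increment_right_limit(2)[OF f u x]
      by (intro tendsto_diff tendsto_const bounded_linear.tendsto[OF bl ul(2)]) (simp add: D_def)
    moreover have "eventually (\<lambda>t. J *v u t - increment u f p x - increment u f x t = g t) (at_left x)"
      using ge by (simp add: eventually_at_split)
    ultimately have "(g \<longlongrightarrow> J *v left_lim u x - increment u f p x - (- D)) (at_left x)" by (rule Lim_transform_eventually)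
    then have l: "C = J *v left_lim u x - increment u f p x - (- D)"
      by (rule bump_mean_one_sided_limits(2)[OF cd(1,2), rotated]) (rule mean)
    have "u x = (1/2) *\<^sub>R (right_lim u x + left_lim u x)" using uB x by (simp add: BV_sharp_def)
    then have "J *v u x = (1/2) *\<^sub>R (J *v right_lim u x + J *v left_lim u x)" by simp
    also have "\<dots> = (1/2) *\<^sub>R ((C + increment u f p x + D) + (C + increment u f p x - D))"
      using r l by (simp add: algebra_simps)
    also have "(C + increment u f p x + D) + (C + increment u f p x - D) = 2 *\<^sub>R (C + increment u f p x)"
      by (simp add: scaleR_2)
    also have "(1/2) *\<^sub>R (2 *\<^sub>R (C + increment u f p x)) = C + increment u f p x" by simp
    finally show ?thesis by (simp add: g_def)
  qed
  show "solves_integral I u f" unfolding solves_integral_def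
  proof (intro ballI)
    fix s t assume st: "s \<in> I" "t \<in> I"
    have "J *v (u t - u s) = increment u f p t - increment u f p s"
      using gC[OF st(1)] gC[OF st(2)] by (simp add: g_def algebra_simps)
    then show "J *v (u t - u s) = increment u f s t" using increment_chain[OF p st f u] by simp
  qed
qed

end

section \<open>Compactness of families of solutions\<close>

lemma bounded_finite_convergent_subsequence:
  fixes x :: "nat \<Rightarrow> 'b \<Rightarrow> complex^'n"
  assumes "finite P" "\<And>p j. p \<in> P \<Longrightarrow> norm (x j p) \<le> B"
  shows "\<exists>r l. strict_mono (r :: nat \<Rightarrow> nat) \<and> (\<forall>p\<in>P. (\<lambda>j. x (r j) p) \<longlonglongrightarrow> l p)"
  using assms
proof (induction P rule: finite_induct)
  case empty
  then show ?case by (intro exI[of _ id]) (auto simp: strict_mono_def)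
next
  case (insert p P)
  then obtain r l where r: "strict_mono (r :: nat \<Rightarrow> nat)" "\<forall>p\<in>P. (\<lambda>j. x (r j) p) \<longlonglongrightarrow> l p" by auto
  have "bounded (range (\<lambda>j. x (r j) p))" using insert.prems by (intro boundedI[of _ B]) auto
  then obtain z s where s: "strict_mono (s :: nat \<Rightarrow> nat)" "((\<lambda>j. x (r j) p) \<circ> s) \<longlonglongrightarrow> z"
    using bounded_imp_convergent_subsequence by blast
  show ?case
  proof (intro exI[of _ "r \<circ> s"] exI[of _ "l(p := z)"] conjI ballI)
    show "strict_mono (r \<circ> s)" using r(1) s(1) by (rule strict_mono_o)
    fix p' assume p': "p' \<in> insert p P"
    show "(\<lambda>j. x ((r \<circ> s) j) p') \<longlonglongrightarrow> (l(p := z)) p'"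
    proof (cases "p' = p")
      case True then show ?thesis using s(2) by (simp add: o_def)
    next
      case False
      then show ?thesis using LIMSEQ_subseq_LIMSEQ[OF r(2)[rule_format, of p'] s(1)] p' by (simp add: o_def)
    qed
  qed
qed

context ode_setting
begin

text \<open>The members of the space \<open>L0\<close>, localised to \<open>S\<close>.\<close>

definition nullsol :: "real set \<Rightarrow> (real \<Rightarrow> complex^'n) \<Rightarrow> bool" where
  "nullsol S h \<longleftrightarrow> admissible h \<and> solves_integral S h (\<lambda>y. 0) \<and> (\<forall>y. y \<notin> S \<longrightarrow> h y = 0) \<and> (AE y in M. W y *v h y = 0)"

lemma nullsol_L2: "nullsol S h \<Longrightarrow> S \<subseteq> I \<Longrightarrow> h \<in> L2 \<and> nrm h = 0"
proof -
  assume h: "nullsol S h" "S \<subseteq> I"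
  have "form h h = (\<lambda>y. cdot (h y) (W y *v h y))" by (simp add: form_def fun_eq_iff)
  have m: "set_borel_measurable borel I h" unfolding set_borel_measurable_def using h(1)
    by (intro borel_measurable_scaleR borel_measurable_indicator I_borel) (simp add: nullsol_def admissible_def)
  have "AE y in M. y \<in> I \<longrightarrow> W y *v h y = 0" using h(1) unfolding nullsol_def by auto
  then have z: "L2_sqnorm I w h = 0" using L2_sqnorm_eq_0_iff[OF m] by simp
  then have L2: "h \<in> L2" using m by (simp add: L2_fun_def)
  then show ?thesis using z L2_sqnorm_eq[OF L2] sq_nonneg[of h] by (simp add: nrm_def ennreal_eq_0_iff)
qed

lemma nullsol_add: "S \<subseteq> I \<Longrightarrow> nullsol S h \<Longrightarrow> nullsol S k \<Longrightarrow> nullsol S (\<lambda>y. h y + k y)"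
  using solves_integral_add[of S "\<lambda>y. 0" h "\<lambda>y. 0" k] L2_fun_zero
  by (auto simp: nullsol_def admissible_add)

lemma nullsol_cscale: "nullsol S h \<Longrightarrow> nullsol S (\<lambda>y. c *s h y)"
  using solves_integral_cscale[of S h "\<lambda>y. 0" c]
  by (auto simp: nullsol_def admissible_cscale matrix_vector_mult_cscale)

lemma nullsol_scaleR: "nullsol S h \<Longrightarrow> nullsol S (\<lambda>y. r *\<^sub>R h y)"
  unfolding scaleR_eq_cscale by (rule nullsol_cscale)

lemma nullsol_diff: "S \<subseteq> I \<Longrightarrow> nullsol S h \<Longrightarrow> nullsol S k \<Longrightarrow> nullsol S (\<lambda>y. h y - k y)"
  using nullsol_add[of S h "\<lambda>y. (- 1) *s k y"] nullsol_cscale[of S k "-1"] by (simp add: cscale_minus_one)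

lemma nullsol_zero: "nullsol S (\<lambda>y. 0)"
  by (auto simp: nullsol_def admissible_zero solves_integral_def increment_def)

lemma increment_cong:
  assumes "\<And>y. y \<in> {min s t..max s t} \<Longrightarrow> u y = v y"
  shows "increment u f s t = increment v f s t"
proof -
  have "step_kernel s t y *\<^sub>R (Q y *v u y) = step_kernel s t y *\<^sub>R (Q y *v v y)" for y
    using assms[of y] step_kernel_outside[of y s t] by (cases "y \<in> {min s t..max s t}") auto
  then show ?thesis by (simp only: increment_def)
qed

lemma solves_integral_cong:
  assumes "is_interval S" "\<And>y. y \<in> S \<Longrightarrow> u y = v y"
  shows "solves_integral S u f \<longleftrightarrow> solves_integral S v f"
proof -
  have "increment u f s t = increment v f s t" if st: "s \<in> S" "t \<in> S" for s t
  proof (rule increment_cong)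
    fix y assume y: "y \<in> {min s t..max s t}"
    have "min s t \<in> S" "max s t \<in> S" using st by (auto simp: min_def max_def)
    then have "y \<in> S" using mem_is_interval_1_I[OF assms(1)] y by (meson atLeastAtMost_iff)
    then show "u y = v y" by (rule assms(2))
  qed
  then show ?thesis using assms(2) by (simp add: solves_integral_def)
qed

lemma admissible_restrict:
  assumes "admissible u" "S \<in> sets borel" shows "admissible (\<lambda>y. indicator S y *\<^sub>R u y)"
  unfolding admissible_def locally_bounded_on_def
proof (intro conjI allI impI)
  show "(\<lambda>y. indicator S y *\<^sub>R u y) \<in> borel_measurable borel"
    using assms by (intro borel_measurable_scaleR borel_measurable_indicator) (auto simp: admissible_def)
  fix c d assume "{c..d} \<subseteq> I"
  then have "bounded (u ` {c..d})" using assms(1) by (simp add: admissible_def locally_bounded_on_def)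
  then obtain B where "\<And>y. y \<in> {c..d} \<Longrightarrow> norm (u y) \<le> B" unfolding bounded_iff by blast
  then have "norm (indicator S y *\<^sub>R u y) \<le> \<bar>B\<bar>" if "y \<in> {c..d}" for y using that by (fastforce simp: indicator_def)
  then show "bounded ((\<lambda>y. indicator S y *\<^sub>R u y) ` {c..d})" by (intro boundedI[of _ "\<bar>B\<bar>"]) auto
qed

lemma nullsol_restrict:
  assumes "nullsol S h" "T \<subseteq> S" "is_interval T" "T \<in> sets borel"
  shows "nullsol T (\<lambda>y. indicator T y *\<^sub>R h y)"
proof -
  have "solves_integral T h (\<lambda>y. 0)" using assms(1,2) by (auto simp: nullsol_def solves_integral_def)
  then have "solves_integral T (\<lambda>y. indicator T y *\<^sub>R h y) (\<lambda>y. 0)"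
    by (subst solves_integral_cong[OF assms(3), of _ h]) auto
  moreover have "AE y in M. W y *v (indicator T y *\<^sub>R h y) = 0"
  proof -
    have "AE y in M. W y *v h y = 0" using assms(1) by (simp add: nullsol_def)
    then show ?thesis by eventually_elim simp
  qed
  ultimately show ?thesis using assms(1,4) admissible_restrict by (auto simp: nullsol_def)
qed

text \<open>Only the mass of \<open>q\<close> on the interval \<open>A\<close> enters, which may omit an end point with a large point
  mass; the mass of \<open>w f\<close> is controlled by the norm of \<open>f\<close> in any case.\<close>

lemma increment_norm_bound:
  assumes f: "f \<in> L2" and u: "admissible u" and cd: "{c..d} \<subseteq> I"
    and A: "is_interval A" "A \<in> sets borel" "A \<subseteq> {c..d}" "s \<in> A" "t \<in> A"
    and B: "\<And>y. y \<in> A \<Longrightarrow> norm (u y) \<le> B"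
  shows "norm (increment u f s t) \<le> (LINT y:{c..d}|M. norm (W y *v f y)) + B * (LINT y:A|Mq. norm (Q y))"
proof -
  have Wi: "set_integrable M {c..d} (\<lambda>y. W y *v f y)" by (rule Wf_integrable[OF f cd])
  have WA: "set_integrable M A (\<lambda>y. W y *v f y)" by (rule set_integrable_subset[OF Wi]) (use A in simp_all)
  have QA: "set_integrable Mq A (\<lambda>y. Q y *v u y)"
    by (rule set_integrable_subset[OF Qu_integrable[OF u cd]]) (use A sets_Mq in simp_all)
  have Qn: "set_integrable Mq A Q"
    by (rule set_integrable_subset[OF Q_integrable[of "{c..d}"]]) (use A sets_Mq cd in simp_all)
  have "norm (LINT y|M. step_kernel s t y *\<^sub>R (W y *v f y)) \<le> (LINT y:A|M. norm (W y *v f y))"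
    by (rule step_kernel_integrable(2)[OF WA sets_M A(1,4,5)])
  also have "\<dots> \<le> (LINT y:{c..d}|M. norm (W y *v f y))" unfolding set_lebesgue_integral_def
  proof (rule integral_mono)
    show "integrable M (\<lambda>y. indicator A y *\<^sub>R norm (W y *v f y))" using integrable_norm[OF WA[unfolded set_integrable_def]] by simp
    show "integrable M (\<lambda>y. indicator {c..d} y *\<^sub>R norm (W y *v f y))" using integrable_norm[OF Wi[unfolded set_integrable_def]] by simp
    fix y show "indicator A y *\<^sub>R norm (W y *v f y) \<le> indicator {c..d} y *\<^sub>R norm (W y *v f y)"
      using A(3) by (auto simp: indicator_def)
  qed
  finally have 1: "norm (LINT y|M. step_kernel s t y *\<^sub>R (W y *v f y)) \<le> (LINT y:{c..d}|M. norm (W y *v f y))" .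
  have "norm (LINT y|Mq. step_kernel s t y *\<^sub>R (Q y *v u y)) \<le> (LINT y:A|Mq. norm (Q y *v u y))"
    by (rule step_kernel_integrable(2)[OF QA sets_Mq A(1,4,5)])
  also have "\<dots> \<le> (LINT y|Mq. B * (indicator A y *\<^sub>R norm (Q y)))" unfolding set_lebesgue_integral_def
  proof (rule integral_mono)
    show "integrable Mq (\<lambda>y. indicator A y *\<^sub>R norm (Q y *v u y))" using integrable_norm[OF QA[unfolded set_integrable_def]] by simp
    show "integrable Mq (\<lambda>y. B * (indicator A y *\<^sub>R norm (Q y)))"
      using integrable_norm[OF Qn[unfolded set_integrable_def]] by (intro integrable_mult_right) simp
    fix y show "indicator A y *\<^sub>R norm (Q y *v u y) \<le> B * (indicator A y *\<^sub>R norm (Q y))"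
    proof (cases "y \<in> A")
      case True
      have "norm (Q y *v u y) \<le> norm (Q y) * norm (u y)" by (rule norm_matrix_vector_mult_le)
      also have "\<dots> \<le> norm (Q y) * B" using B[OF True] by (intro mult_left_mono) auto
      finally show ?thesis using True by (simp add: mult.commute)
    qed simp
  qed
  also have "\<dots> = B * (LINT y:A|Mq. norm (Q y))" by (simp add: set_lebesgue_integral_def)
  finally have 2: "norm (LINT y|Mq. step_kernel s t y *\<^sub>R (Q y *v u y)) \<le> B * (LINT y:A|Mq. norm (Q y))" .
  show ?thesis unfolding increment_def by (rule order_trans[OF norm_triangle_ineq4 add_mono[OF 1 2]])
qed

lemma vanishing_sets_integral:
  fixes g :: "real \<Rightarrow> real"
  assumes g: "set_integrable m {c..d} g" and m: "sets m = sets borel"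
    and A: "\<And>n :: nat. A n \<in> sets borel" "\<And>n. A n \<subseteq> {c..d}" "\<And>y. eventually (\<lambda>n. y \<notin> A n) sequentially"
  shows "(\<lambda>n. LINT y:A n|m. g y) \<longlonglongrightarrow> 0"
proof -
  define G where "G y = indicator {c..d} y *\<^sub>R g y" for y
  have G: "integrable m G" using g by (simp add: set_integrable_def G_def[abs_def])
  have e: "indicator (A n) y *\<^sub>R g y = indicator (A n) y *\<^sub>R G y" for n y
    using A(2)[of n] by (auto simp: G_def indicator_def)
  have "(\<lambda>n. LINT y|m. indicator (A n) y *\<^sub>R G y) \<longlonglongrightarrow> (LINT y|m. 0)"
  proof (rule integral_dominated_convergence[where w = "\<lambda>y. norm (G y)"])
    show "(\<lambda>y. indicator (A n) y *\<^sub>R G y) \<in> borel_measurable m" for n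
      using borel_measurable_integrable[OF G] m A(1) by (intro borel_measurable_scaleR borel_measurable_indicator) auto
    show "integrable m (\<lambda>y. norm (G y))" using G by (rule integrable_norm)
    show "AE y in m. norm (indicator (A n) y *\<^sub>R G y) \<le> norm (G y)" for n by (auto simp: indicator_def)
    have "eventually (\<lambda>n. indicator (A n) y *\<^sub>R G y = 0) sequentially" for y using A(3)[of y] by eventually_elim simp
    then show "AE y in m. (\<lambda>n. indicator (A n) y *\<^sub>R G y) \<longlonglongrightarrow> 0" by (intro AE_I2 tendsto_eventually)
  qed simp
  then show ?thesis by (simp add: set_lebesgue_integral_def e del: real_scaleR_def)
qed

lemma small_right_mass:
  fixes g :: "real \<Rightarrow> real"
  assumes g: "set_integrable m {c..d} g" and m: "sets m = sets borel" and x: "c \<le> x" "x < d" and e: "e > 0"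
  shows "eventually (\<lambda>t. (LINT y:{x<..<t}|m. g y) < e) (at_right x)"
proof -
  have "((\<lambda>t. LINT y:{x<..<t}|m. g y) \<longlongrightarrow> 0) (at_right x)"
  proof (rule tendsto_at_right_sequentially[OF x(2)], rule vanishing_sets_integral[OF g m])
    fix S :: "nat \<Rightarrow> real" and y assume S: "\<And>n. x < S n" "\<And>n. S n < d" "S \<longlonglongrightarrow> x"
    show "{x<..<S n} \<subseteq> {c..d}" for n using S(2)[of n] x by auto
    show "eventually (\<lambda>n. y \<notin> {x<..<S n}) sequentially"
    proof (cases "x < y")
      case True
      then have "eventually (\<lambda>n. S n < y) sequentially" using S(3) by (intro order_tendstoD) auto
      then show ?thesis by eventually_elim auto
    qed auto
  qed simp
  then show ?thesis using e by (rule order_tendstoD(2))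
qed

lemma small_left_mass:
  fixes g :: "real \<Rightarrow> real"
  assumes g: "set_integrable m {c..d} g" and m: "sets m = sets borel" and x: "c < x" "x \<le> d" and e: "e > 0"
  shows "eventually (\<lambda>t. (LINT y:{t<..<x}|m. g y) < e) (at_left x)"
proof -
  have "((\<lambda>t. LINT y:{t<..<x}|m. g y) \<longlongrightarrow> 0) (at_left x)"
  proof (rule tendsto_at_left_sequentially[OF x(1)], rule vanishing_sets_integral[OF g m])
    fix S :: "nat \<Rightarrow> real" and y assume S: "\<And>n. S n < x" "\<And>n. c < S n" "S \<longlonglongrightarrow> x"
    show "{S n<..<x} \<subseteq> {c..d}" for n using S(2)[of n] x by auto
    show "eventually (\<lambda>n. y \<notin> {S n<..<x}) sequentially"
    proof (cases "y < x")
      case True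
      then have "eventually (\<lambda>n. y < S n) sequentially" using S(3) by (intro order_tendstoD) auto
      then show ?thesis by eventually_elim auto
    qed auto
  qed simp
  then show ?thesis using e by (rule order_tendstoD(2))
qed

text \<open>Next to each point there are one-sided neighbourhoods on which \<open>q\<close>, apart from its mass at the
  point itself, is so small that a solution varies there by at most half of its supremum plus a
  multiple of the norm of the inhomogeneity.\<close>

definition small_gap :: "real \<Rightarrow> real \<Rightarrow> bool" where
  "small_gap c d \<longleftrightarrow> {c..d} \<subseteq> I \<and> norm (matrix_inv J) * (LINT y:{c<..<d}|Mq. norm (Q y)) \<le> 1/2"

lemma small_gaps:
  assumes x: "x \<in> I"
  obtains \<delta> where "\<delta> > 0" "small_gap x (x + \<delta>)" "small_gap (x - \<delta>) x"
proof -
  obtain c d where cd: "c < x" "x < d" "{c..d} \<subseteq> I" using einterval_Icc_around x unfolding I_eq by metis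
  define K where "K = norm (matrix_inv J)"
  define e where "e = 1 / (2 * (K + 1))"
  have K: "0 \<le> K" by (simp add: K_def)
  then have e: "e > 0" "K * e \<le> 1/2" by (auto simp: e_def field_simps)
  have Qn: "set_integrable Mq {c..d} (\<lambda>y. norm (Q y))"
    using integrable_norm[OF Q_integrable[of "{c..d}", unfolded set_integrable_def]] cd(3) by (simp add: set_integrable_def)
  have small: "K * z \<le> 1/2" if "z < e" for z using mult_left_mono[of z e K] that K e(2) by linarith
  have "eventually (\<lambda>t. (LINT y:{x<..<t}|Mq. norm (Q y)) < e) (at_right x)"
    using cd by (intro small_right_mass[OF Qn sets_Mq _ _ e(1)]) auto
  then obtain t1 where t1: "t1 > x" "\<And>t. x < t \<Longrightarrow> t < t1 \<Longrightarrow> (LINT y:{x<..<t}|Mq. norm (Q y)) < e"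
    unfolding eventually_at_right_field by blast
  have "eventually (\<lambda>t. (LINT y:{t<..<x}|Mq. norm (Q y)) < e) (at_left x)"
    using cd by (intro small_left_mass[OF Qn sets_Mq _ _ e(1)]) auto
  then obtain t2 where t2: "t2 < x" "\<And>t. t2 < t \<Longrightarrow> t < x \<Longrightarrow> (LINT y:{t<..<x}|Mq. norm (Q y)) < e"
    unfolding eventually_at_left_field by blast
  define \<delta> where "\<delta> = min (min (t1 - x) (x - t2)) (min (x - c) (d - x)) / 2"
  have \<delta>: "\<delta> > 0" "x + \<delta> < t1" "t2 < x - \<delta>" "c \<le> x - \<delta>" "x + \<delta> \<le> d"
    using cd t1(1) t2(1) by (auto simp: \<delta>_def min_def field_simps)
  have "{x..x + \<delta>} \<subseteq> {c..d}" "{x - \<delta>..x} \<subseteq> {c..d}" using \<delta> by auto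
  then show thesis using \<delta> cd(3) small[OF t1(2)[of "x + \<delta>"]] small[OF t2(2)[of "x - \<delta>"]]
    by (intro that[of \<delta>]) (auto simp: small_gap_def K_def)
qed

text \<open>The contribution of \<open>q\<close> to an increment inside the gap is at most half of the supremum of \<open>u\<close>, by the
  choice of the constant in \<open>small_gap\<close>.\<close>

lemma small_gap_oscillation:
  assumes gap: "small_gap c d"
  obtains C where "0 \<le> C" "\<And>S u f s t B. f \<in> L2 \<Longrightarrow> admissible u \<Longrightarrow> solves_integral S u f \<Longrightarrow> is_interval S \<Longrightarrow> S \<in> sets borel \<Longrightarrow>
      s \<in> S \<inter> {c<..<d} \<Longrightarrow> t \<in> S \<inter> {c<..<d} \<Longrightarrow> (\<And>y. y \<in> S \<inter> {c<..<d} \<Longrightarrow> norm (u y) \<le> B) \<Longrightarrow>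
      norm (u t - u s) \<le> B / 2 + C * nrm f"
proof -
  have cd: "{c..d} \<subseteq> I" using gap by (simp add: small_gap_def)
  obtain C where C: "0 \<le> C" "\<And>f. f \<in> L2 \<Longrightarrow> (LINT y:{c..d}|M. norm (W y *v f y)) \<le> C * nrm f"
    using compact_integral_W_bound[OF compact_Icc cd] by metis
  define K where "K = norm (matrix_inv J)"
  have K: "0 \<le> K" by (simp add: K_def)
  show thesis
  proof (rule that[of "K * C"])
    show "0 \<le> K * C" using K C(1) by simp
    fix S u f s t B
    assume f: "f \<in> L2" and u: "admissible u" and sol: "solves_integral S u f" and S: "is_interval S" "S \<in> sets borel"
      and s: "s \<in> S \<inter> {c<..<d}" and t: "t \<in> S \<inter> {c<..<d}" and B: "\<And>y. y \<in> S \<inter> {c<..<d} \<Longrightarrow> norm (u y) \<le> B"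
    let ?A = "S \<inter> {c<..<d}"
    have A: "is_interval ?A" "?A \<in> sets borel" "?A \<subseteq> {c..d}" using S by (auto intro: is_interval_Int simp: is_interval_oo)
    have B0: "0 \<le> B" using B[OF s] norm_ge_zero order_trans by blast
    have Qc: "set_integrable Mq {c..d} (\<lambda>y. norm (Q y))"
      using integrable_norm[OF Q_integrable[of "{c..d}", unfolded set_integrable_def]] cd by (simp add: set_integrable_def)
    have "set_integrable Mq ?A (\<lambda>y. norm (Q y))" by (rule set_integrable_subset[OF Qc]) (use A sets_Mq in simp_all)
    moreover have "set_integrable Mq {c<..<d} (\<lambda>y. norm (Q y))" by (rule set_integrable_subset[OF Qc]) (use sets_Mq in auto)
    ultimately have QA: "(LINT y:?A|Mq. norm (Q y)) \<le> (LINT y:{c<..<d}|Mq. norm (Q y))"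
      unfolding set_lebesgue_integral_def set_integrable_def by (intro integral_mono) (auto simp: indicator_def)
    have "norm (u t - u s) \<le> K * norm (J *v (u t - u s))" unfolding K_def by (rule J_inv_bound)
    also have "J *v (u t - u s) = increment u f s t" using sol s t unfolding solves_integral_def by blast
    also have "K * norm (increment u f s t) \<le> K * ((LINT y:{c..d}|M. norm (W y *v f y)) + B * (LINT y:?A|Mq. norm (Q y)))"
      by (intro mult_left_mono increment_norm_bound[OF f u cd A s t] K) (rule B)
    also have "\<dots> \<le> K * (C * nrm f + B * (LINT y:{c<..<d}|Mq. norm (Q y)))"
      using C(2)[OF f] QA B0 by (intro mult_left_mono add_mono K) auto
    also have "\<dots> = K * C * nrm f + B * (K * (LINT y:{c<..<d}|Mq. norm (Q y)))" by (simp add: algebra_simps)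
    also have "\<dots> \<le> K * C * nrm f + B * (1/2)"
      using gap B0 by (intro add_left_mono mult_left_mono) (auto simp: small_gap_def K_def)
    finally show "norm (u t - u s) \<le> B / 2 + K * C * nrm f" by simp
  qed
qed

text \<open>A solution is controlled by its values at finitely many points: on a small gap one point
  suffices, and finitely many gaps together with their end points cover a compact interval.\<close>

lemma solution_sampling:
  assumes cd: "{c..d} \<subseteq> I" and S: "S \<subseteq> {c..d}" "is_interval S" "S \<in> sets borel"
  obtains P C where "finite P" "P \<subseteq> S" "0 \<le> C"
    "\<And>u f y. f \<in> L2 \<Longrightarrow> admissible u \<Longrightarrow> solves_integral S u f \<Longrightarrow> y \<in> S \<Longrightarrow>
       norm (u y) \<le> C * ((\<Sum>p\<in>P. norm (u p)) + nrm f)"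
proof -
  define good where "good A \<longleftrightarrow> (\<exists>P C. finite P \<and> P \<subseteq> S \<and> 0 \<le> C \<and>
    (\<forall>u f y. f \<in> L2 \<longrightarrow> admissible u \<longrightarrow> solves_integral S u f \<longrightarrow> y \<in> A \<longrightarrow>
       norm (u y) \<le> C * ((\<Sum>p\<in>P. norm (u p)) + nrm f)))" for A
  have good_mono: "good A" if "good B" "A \<subseteq> B" for A B using that unfolding good_def by (meson subsetD)
  have good_empty: "good {}" unfolding good_def by (intro exI[of _ "{}"] exI[of _ 0]) auto
  have good_Un: "good (A \<union> B)" if "good A" "good B" for A B
  proof -
    obtain P C where P: "finite P" "P \<subseteq> S" "0 \<le> C"
      "\<And>u f y. f \<in> L2 \<Longrightarrow> admissible u \<Longrightarrow> solves_integral S u f \<Longrightarrow> y \<in> A \<Longrightarrow> norm (u y) \<le> C * ((\<Sum>p\<in>P. norm (u p)) + nrm f)"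
      using \<open>good A\<close> unfolding good_def by blast
    obtain P' C' where P': "finite P'" "P' \<subseteq> S" "0 \<le> C'"
      "\<And>u f y. f \<in> L2 \<Longrightarrow> admissible u \<Longrightarrow> solves_integral S u f \<Longrightarrow> y \<in> B \<Longrightarrow> norm (u y) \<le> C' * ((\<Sum>p\<in>P'. norm (u p)) + nrm f)"
      using \<open>good B\<close> unfolding good_def by blast
    have "norm (u y) \<le> (C + C') * ((\<Sum>p\<in>P \<union> P'. norm (u p)) + nrm f)"
      if h: "f \<in> L2" "admissible u" "solves_integral S u f" "y \<in> A \<union> B" for u f y
    proof -
      have le: "(\<Sum>p\<in>P. norm (u p)) \<le> (\<Sum>p\<in>P \<union> P'. norm (u p))" "(\<Sum>p\<in>P'. norm (u p)) \<le> (\<Sum>p\<in>P \<union> P'. norm (u p))"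
        using P(1) P'(1) by (auto intro!: sum_mono2)
      define X where "X = (\<Sum>p\<in>P \<union> P'. norm (u p)) + nrm f"
      have X: "0 \<le> X" by (auto simp: X_def intro!: add_nonneg_nonneg sum_nonneg)
      have "norm (u y) \<le> C * X \<or> norm (u y) \<le> C' * X"
      proof (cases "y \<in> A")
        case True
        have "norm (u y) \<le> C * ((\<Sum>p\<in>P. norm (u p)) + nrm f)" by (rule P(4)[OF h(1-3) True])
        also have "\<dots> \<le> C * X" using le P(3) by (intro mult_left_mono) (auto simp: X_def)
        finally show ?thesis ..
      next
        case False
        then have "norm (u y) \<le> C' * ((\<Sum>p\<in>P'. norm (u p)) + nrm f)" using h(4) by (intro P'(4)[OF h(1-3)]) auto
        also have "\<dots> \<le> C' * X" using le P'(3) by (intro mult_left_mono) (auto simp: X_def)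
        finally show ?thesis ..
      qed
      moreover have "C * X \<le> (C + C') * X" "C' * X \<le> (C + C') * X"
        using X P(3) P'(3) by (auto intro!: mult_right_mono)
      ultimately show ?thesis unfolding X_def[symmetric] by linarith
    qed
    then show ?thesis unfolding good_def using P(1-3) P'(1-3) by (intro exI[of _ "P \<union> P'"] exI[of _ "C + C'"]) auto
  qed
  have good_point: "good {x}" if "x \<in> S" for x
    unfolding good_def using that by (intro exI[of _ "{x}"] exI[of _ 1]) auto
  have good_gap: "good (S \<inter> {r<..<s})" if gap: "small_gap r s" for r s
  proof (cases "S \<inter> {r<..<s} = {}")
    case True then show ?thesis using good_empty by simp
  next
    case False
    then obtain p where p: "p \<in> S \<inter> {r<..<s}" by blast
    obtain C where C: "0 \<le> C" "\<And>S u f s' t B. f \<in> L2 \<Longrightarrow> admissible u \<Longrightarrow> solves_integral S u f \<Longrightarrow> is_interval S \<Longrightarrow> S \<in> sets borel \<Longrightarrow>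
      s' \<in> S \<inter> {r<..<s} \<Longrightarrow> t \<in> S \<inter> {r<..<s} \<Longrightarrow> (\<And>y. y \<in> S \<inter> {r<..<s} \<Longrightarrow> norm (u y) \<le> B) \<Longrightarrow>
      norm (u t - u s') \<le> B / 2 + C * nrm f" using small_gap_oscillation[OF gap] by metis
    have "norm (u y) \<le> (2 + 2 * C) * ((\<Sum>p\<in>{p}. norm (u p)) + nrm f)"
      if h: "f \<in> L2" "admissible u" "solves_integral S u f" and y: "y \<in> S \<inter> {r<..<s}" for u f y
    proof -
      define B where "B = Sup ((\<lambda>y. norm (u y)) ` (S \<inter> {r<..<s}))"
      have "bounded (u ` {r..s})" using h(2) gap unfolding admissible_def locally_bounded_on_def small_gap_def by blast
      then obtain B0 where "\<And>y. y \<in> {r..s} \<Longrightarrow> norm (u y) \<le> B0" unfolding bounded_iff by blast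
      then have bdd: "bdd_above ((\<lambda>y. norm (u y)) ` (S \<inter> {r<..<s}))" by (intro bdd_aboveI[of _ B0]) auto
      have uB: "norm (u y) \<le> B" if "y \<in> S \<inter> {r<..<s}" for y
        unfolding B_def using that bdd by (intro cSUP_upper) auto
      have "B \<le> norm (u p) + (B / 2 + C * nrm f)" unfolding B_def
      proof (rule cSUP_least)
        fix y assume y: "y \<in> S \<inter> {r<..<s}"
        have "norm (u y - u p) \<le> B / 2 + C * nrm f" by (rule C(2)[OF h S(2,3) p y uB])
        then show "norm (u y) \<le> norm (u p) + (Sup ((\<lambda>y. norm (u y)) ` (S \<inter> {r<..<s})) / 2 + C * nrm f)"
          using norm_triangle_ineq2[of "u y" "u p"] by (simp add: B_def)
      qed (use p in auto)
      then have "B \<le> 2 * norm (u p) + 2 * C * nrm f" by simp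
      also have "\<dots> \<le> (2 + 2 * C) * (norm (u p) + nrm f)" using C(1) by (simp add: algebra_simps)
      finally show ?thesis using uB[OF y] by simp
    qed
    then show ?thesis unfolding good_def using p C(1) by (intro exI[of _ "{p}"] exI[of _ "2 + 2 * C"]) auto
  qed
  have "\<exists>\<delta>>0. good (S \<inter> {x - \<delta><..<x + \<delta>})" if x: "x \<in> {c..d}" for x
  proof -
    have "x \<in> I" using x cd by blast
    then obtain \<delta> where \<delta>: "\<delta> > 0" "small_gap x (x + \<delta>)" "small_gap (x - \<delta>) x" using small_gaps by blast
    have "good (S \<inter> {x})" using good_point good_empty by (cases "x \<in> S") auto
    then have "good ((S \<inter> {x<..<x + \<delta>}) \<union> ((S \<inter> {x - \<delta><..<x}) \<union> (S \<inter> {x})))"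
      by (intro good_Un good_gap \<delta>)
    then have "good (S \<inter> {x - \<delta><..<x + \<delta>})" by (rule good_mono) auto
    then show ?thesis using \<delta>(1) by blast
  qed
  then obtain \<delta> where \<delta>: "\<And>x. x \<in> {c..d} \<Longrightarrow> 0 < \<delta> x" "\<And>x. x \<in> {c..d} \<Longrightarrow> good (S \<inter> {x - \<delta> x<..<x + \<delta> x})" by metis
  have cover: "{c..d} \<subseteq> (\<Union>x\<in>{c..d}. {x - \<delta> x<..<x + \<delta> x})"
  proof
    fix x assume x: "x \<in> {c..d}"
    then have "x \<in> {x - \<delta> x<..<x + \<delta> x}" using \<delta>(1)[OF x] by auto
    then show "x \<in> (\<Union>x\<in>{c..d}. {x - \<delta> x<..<x + \<delta> x})" using x by blast
  qed
  obtain X where X: "X \<subseteq> {c..d}" "finite X" "{c..d} \<subseteq> (\<Union>x\<in>X. {x - \<delta> x<..<x + \<delta> x})"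
    using compactE_image[OF compact_Icc _ cover] by auto
  have "good (\<Union>x\<in>X. S \<inter> {x - \<delta> x<..<x + \<delta> x})" using X(2,1)
  proof (induction X rule: finite_induct)
    case (insert x X)
    then have "good ((S \<inter> {x - \<delta> x<..<x + \<delta> x}) \<union> (\<Union>x\<in>X. S \<inter> {x - \<delta> x<..<x + \<delta> x}))" by (intro good_Un \<delta>) auto
    then show ?case by simp
  qed (simp add: good_empty)
  then have "good S" by (rule good_mono) (use X(3) S(1) in blast)
  then show thesis using that unfolding good_def by blast
qed

end

context ode_setting
begin

text \<open>The sampling estimate turns convergence at the sample points into uniform convergence on \<open>S\<close>, and
  the integral equation passes to uniform limits. Since the norms of the solutions tend to zero, the
  limit is annihilated by \<open>W\<close>.\<close>

lemma nullsol_limit: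
  fixes u f :: "nat \<Rightarrow> real \<Rightarrow> complex^'n"
  assumes cd: "{c..d} \<subseteq> I" and S: "S \<subseteq> {c..d}" "is_interval S" "S \<in> sets borel"
    and P: "finite P" "P \<subseteq> S" "0 \<le> C"
    and sample: "\<And>u f y. f \<in> L2 \<Longrightarrow> admissible u \<Longrightarrow> solves_integral S u f \<Longrightarrow> y \<in> S \<Longrightarrow>
       norm (u y) \<le> C * ((\<Sum>p\<in>P. norm (u p)) + nrm f)"
    and u: "\<And>j. u j \<in> L2" "\<And>j. admissible (u j)" and f: "\<And>j. f j \<in> L2"
    and sol: "\<And>j. solves_integral S (u j) (f j)"
    and u0: "(\<lambda>j. nrm (u j)) \<longlonglongrightarrow> 0" and f0: "(\<lambda>j. nrm (f j)) \<longlonglongrightarrow> 0"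
    and lim: "\<And>p. p \<in> P \<Longrightarrow> (\<lambda>j. u j p) \<longlonglongrightarrow> l p"
  obtains h where "nullsol S h" "\<And>p. p \<in> P \<Longrightarrow> h p = l p"
proof -
  have SI: "S \<subseteq> I" using S(1) cd by blast
  define \<epsilon> where "\<epsilon> j = C * ((\<Sum>p\<in>P. norm (u j p - l p)) + nrm (f j))" for j
  have "\<epsilon> \<longlonglongrightarrow> C * ((\<Sum>p\<in>P. norm (l p - l p)) + 0)" unfolding \<epsilon>_def[abs_def] by (intro tendsto_intros lim f0)
  then have \<epsilon>0: "\<epsilon> \<longlonglongrightarrow> 0" by simp
  have diffs: "norm (u i y - u j y) \<le> \<epsilon> i + \<epsilon> j" if y: "y \<in> S" for i j y
  proof -
    have "norm (u i y - u j y) \<le> C * ((\<Sum>p\<in>P. norm (u i p - u j p)) + nrm (\<lambda>y. f i y - f j y))"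
      using solves_integral_diff[OF SI f[of i] u(2)[of i] f[of j] u(2)[of j] sol[of i] sol[of j]] y
      by (intro sample[of "\<lambda>y. f i y - f j y" "\<lambda>y. u i y - u j y"] L2_fun_diff f admissible_diff u(2)) auto
    also have "\<dots> \<le> C * ((\<Sum>p\<in>P. norm (u i p - l p) + norm (u j p - l p)) + (nrm (f i) + nrm (f j)))"
    proof (intro mult_left_mono add_mono sum_mono nrm_diff f P(3))
      show "norm (u i p - u j p) \<le> norm (u i p - l p) + norm (u j p - l p)" for p
        using norm_triangle_ineq4[of "u i p - l p" "u j p - l p"] by simp
    qed
    also have "\<dots> = \<epsilon> i + \<epsilon> j" by (simp add: \<epsilon>_def sum.distrib algebra_simps)
    finally show ?thesis .
  qed
  have "uniformly_Cauchy_on S u" unfolding uniformly_Cauchy_on_def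
  proof (intro allI impI)
    fix e :: real assume "e > 0"
    then have "eventually (\<lambda>j. \<epsilon> j < e / 2) sequentially" using \<epsilon>0 by (intro order_tendstoD(2)) auto
    then obtain N where N: "\<And>j. j \<ge> N \<Longrightarrow> \<epsilon> j < e / 2" by (auto simp: eventually_sequentially)
    have "dist (u i x) (u j x) < e" if "x \<in> S" "i \<ge> N" "j \<ge> N" for x i j
      using diffs[OF that(1), of i j] N[OF that(2)] N[OF that(3)] unfolding dist_norm by linarith
    then show "\<exists>M. \<forall>x\<in>S. \<forall>m\<ge>M. \<forall>n\<ge>M. dist (u m x) (u n x) < e" by blast
  qed
  then have "uniformly_convergent_on S u" by (rule Cauchy_uniformly_convergent)
  then obtain h0 where h0: "uniform_limit S u h0 sequentially" by (auto simp: uniformly_convergent_on_def)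
  define h where "h y = (if y \<in> S then h0 y else 0)" for y
  have ul: "uniform_limit S u h sequentially"
    using h0 by (rule uniform_limit_cong'[THEN iffD1, rotated -1]) (auto simp: h_def)
  have pt: "(\<lambda>j. u j y) \<longlonglongrightarrow> h y" if "y \<in> S" for y using tendsto_uniform_limitI[OF ul that] .
  have near: "\<exists>j0. \<forall>j\<ge>j0. \<forall>y\<in>S. norm (u j y - h y) \<le> e" if "e > 0" for e
    using uniform_limitD[OF ul that] by (auto simp: eventually_sequentially dist_norm intro: less_imp_le)
  have hm: "h \<in> borel_measurable borel"
  proof (rule borel_measurable_LIMSEQ_metric)
    show "(\<lambda>y. indicator S y *\<^sub>R u j y) \<in> borel_measurable borel" for j
      using u(2)[of j] S(3) by (intro borel_measurable_scaleR borel_measurable_indicator) (auto simp: admissible_def)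
    show "(\<lambda>j. indicator S y *\<^sub>R u j y) \<longlonglongrightarrow> h y" for y
      using pt[of y] by (cases "y \<in> S") (auto simp: h_def)
  qed
  obtain B where B: "0 \<le> B" "\<And>y. norm (h y) \<le> B"
  proof -
    obtain j where j: "\<And>y. y \<in> S \<Longrightarrow> norm (u j y - h y) \<le> 1" using near[of 1] by auto
    have "bounded (u j ` {c..d})" using u(2)[of j] cd by (simp add: admissible_def locally_bounded_on_def)
    then obtain B0 where B0: "\<And>y. y \<in> {c..d} \<Longrightarrow> norm (u j y) \<le> B0" unfolding bounded_iff by blast
    have "norm (h y) \<le> \<bar>B0\<bar> + 1" for y
    proof (cases "y \<in> S")
      case True
      have "norm (h y) \<le> norm (u j y) + norm (u j y - h y)" by (metis norm_minus_commute norm_triangle_sub)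
      then show ?thesis using j[OF True] B0[of y] True S(1) by fastforce
    qed (simp add: h_def)
    then show thesis by (intro that[of "\<bar>B0\<bar> + 1"]) auto
  qed
  have ha: "admissible h" unfolding admissible_def locally_bounded_on_def using hm B(2) by (auto intro!: boundedI[of _ B])
  have hsol: "solves_integral S h (\<lambda>y. 0)" unfolding solves_integral_def
  proof (intro ballI)
    fix s t assume st: "s \<in> S" "t \<in> S"
    obtain D where D: "0 \<le> D" "\<And>f. f \<in> L2 \<Longrightarrow> (LINT y:{c..d}|M. norm (W y *v f y)) \<le> D * nrm f"
      using compact_integral_W_bound[OF compact_Icc cd] by metis
    define q0 where "q0 = (LINT y:S|Mq. norm (Q y))"
    have q0: "0 \<le> q0" unfolding q0_def set_lebesgue_integral_def by (intro Bochner_Integration.integral_nonneg) auto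
    have "(\<lambda>j. increment (u j) (f j) s t) \<longlonglongrightarrow> increment h (\<lambda>y. 0) s t"
    proof (rule Lim_null[THEN iffD2], rule tendstoI)
      fix e :: real assume e: "e > 0"
      define \<eta> where "\<eta> = e / (2 * (q0 + 1))"
      have \<eta>: "\<eta> > 0" "\<eta> * q0 < e / 2 \<or> q0 = 0"
      proof -
        show "\<eta> > 0" using e q0 by (auto simp: \<eta>_def intro!: divide_pos_pos mult_pos_pos)
        show "\<eta> * q0 < e / 2 \<or> q0 = 0" using e q0 by (auto simp: \<eta>_def field_simps)
      qed
      obtain j0 where j0: "\<And>j y. j \<ge> j0 \<Longrightarrow> y \<in> S \<Longrightarrow> norm (u j y - h y) \<le> \<eta>" using near[OF \<eta>(1)] by blast
      have "((\<lambda>j. D * nrm (f j)) \<longlongrightarrow> D * 0) sequentially" by (intro tendsto_intros f0)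
      then have "eventually (\<lambda>j. D * nrm (f j) < e / 2) sequentially" using e by (intro order_tendstoD(2)) auto
      then show "eventually (\<lambda>j. dist (increment (u j) (f j) s t - increment h (\<lambda>y. 0) s t) 0 < e) sequentially"
        using eventually_ge_at_top[of j0]
      proof eventually_elim
        case (elim j)
        have I: "s \<in> I" "t \<in> I" using st SI by auto
        have "increment (u j) (f j) s t - increment h (\<lambda>y. 0) s t = increment (\<lambda>y. u j y - h y) (\<lambda>y. f j y - 0) s t"
          by (rule increment_diff[OF I f u(2) L2_fun_zero ha, symmetric])
        also have "norm \<dots> \<le> (LINT y:{c..d}|M. norm (W y *v (f j y - 0))) + \<eta> * (LINT y:S|Mq. norm (Q y))"
          using f[of j] j0[OF elim(2)]
          by (intro increment_norm_bound[OF _ admissible_diff[OF u(2) ha] cd S(2,3,1) st]) auto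
        also have "\<dots> \<le> D * nrm (f j) + \<eta> * q0" using D(2)[OF f[of j]] by (simp add: q0_def)
        also have "\<dots> < e" using elim(1) \<eta>(2) e by auto
        finally show ?case by simp
      qed
    qed
    moreover have "(\<lambda>j. increment (u j) (f j) s t) \<longlonglongrightarrow> J *v (h t - h s)"
    proof -
      have "(\<lambda>j. J *v (u j t - u j s)) \<longlonglongrightarrow> J *v (h t - h s)"
        by (rule bounded_linear.tendsto[OF bounded_linear_matrix_vector_mult
            tendsto_diff[OF pt[OF st(2)] pt[OF st(1)]]])
      moreover have "J *v (u j t - u j s) = increment (u j) (f j) s t" for j using sol[of j] st unfolding solves_integral_def by blast
      ultimately show ?thesis by (simp only:)
    qed
    ultimately show "J *v (h t - h s) = increment h (\<lambda>y. 0) s t" using LIMSEQ_unique by blast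
  qed
  have "AE y in M. W y *v h y = 0"
  proof -
    obtain D where D: "0 \<le> D" "\<And>f. f \<in> L2 \<Longrightarrow> set_integrable M {c..d} (\<lambda>y. W y *v f y)"
      "\<And>f. f \<in> L2 \<Longrightarrow> (LINT y:{c..d}|M. norm (W y *v f y)) \<le> D * nrm f"
      by (rule compact_integral_W_bound[OF compact_Icc cd], rule that)
    define k where "k = (LINT y:{c..d}|M. norm (W y))"
    have k: "0 \<le> k" unfolding k_def set_lebesgue_integral_def by (intro Bochner_Integration.integral_nonneg) auto
    have norms: "integrable M (\<lambda>y. indicator {c..d} y *\<^sub>R norm (F y))" if "set_integrable M {c..d} F"
      for F :: "real \<Rightarrow> 'b :: {banach, second_countable_topology}"
      using integrable_norm[OF that[unfolded set_integrable_def]] by simp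
    note Wn = norms[OF W_integrable[OF compact_Icc cd]] and Wh = norms[OF W_admissible_integrable[OF ha cd]]
      and Wu = norms[OF D(2)[OF u(1)]]
    have le: "(LINT y:{c..d}|M. norm (W y *v h y)) \<le> e * (k + D)" if e: "e > 0" for e
    proof -
      obtain j0 where j0: "\<And>j y. j \<ge> j0 \<Longrightarrow> y \<in> S \<Longrightarrow> norm (u j y - h y) \<le> e" using near[OF e] by blast
      have "eventually (\<lambda>j. nrm (u j) < e) sequentially" using u0 e by (rule order_tendstoD(2))
      then have "eventually (\<lambda>j. j \<ge> j0 \<and> nrm (u j) < e) sequentially" by (rule eventually_conj[OF eventually_ge_at_top])
      then obtain j where j: "j \<ge> j0" "nrm (u j) < e" using eventually_happens'[OF sequentially_bot] by blast
      have "(LINT y:{c..d}|M. norm (W y *v h y))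
        \<le> (LINT y|M. e * (indicator {c..d} y *\<^sub>R norm (W y)) + indicator {c..d} y *\<^sub>R norm (W y *v u j y))"
        unfolding set_lebesgue_integral_def
      proof (rule integral_mono[OF Wh])
        show "integrable M (\<lambda>y. e * (indicator {c..d} y *\<^sub>R norm (W y)) + indicator {c..d} y *\<^sub>R norm (W y *v u j y))"
          by (intro Bochner_Integration.integrable_add integrable_mult_right Wn Wu)
        fix y
        show "indicator {c..d} y *\<^sub>R norm (W y *v h y)
          \<le> e * (indicator {c..d} y *\<^sub>R norm (W y)) + indicator {c..d} y *\<^sub>R norm (W y *v u j y)"
        proof (cases "y \<in> S")
          case True
          have "norm (W y *v h y) \<le> norm (W y *v (u j y - h y)) + norm (W y *v u j y)"
            using norm_triangle_ineq4[of "W y *v u j y" "W y *v (u j y - h y)"] by (simp add: add.commute)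
          also have "norm (W y *v (u j y - h y)) \<le> norm (W y) * norm (u j y - h y)" by (rule norm_matrix_vector_mult_le)
          also have "\<dots> \<le> norm (W y) * e" using j0[OF j(1) True] by (intro mult_left_mono) auto
          finally show ?thesis by (auto simp: indicator_def mult.commute)
        qed (use e in \<open>simp add: h_def\<close>)
      qed
      also have "\<dots> = e * k + (LINT y:{c..d}|M. norm (W y *v u j y))"
        unfolding k_def set_lebesgue_integral_def by (simp only: Bochner_Integration.integral_add[OF integrable_mult_right[OF Wn] Wu] integral_mult_right_zero)
      also have "\<dots> \<le> e * k + D * e"
        using D(3)[OF u(1)[of j]] mult_left_mono[OF less_imp_le[OF j(2)] D(1)] by linarith
      finally show ?thesis by (simp add: algebra_simps)
    qed
    have "(LINT y:{c..d}|M. norm (W y *v h y)) \<le> 0 + e" if e: "e > 0" for e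
    proof -
      have "e / (k + D + 1) * (k + D) \<le> e" using e k D(1) by (simp add: field_simps)
      then show ?thesis using le[of "e / (k + D + 1)"] e k D(1) by simp
    qed
    then have "(LINT y:{c..d}|M. norm (W y *v h y)) \<le> 0" by (rule field_le_epsilon)
    then have "(LINT y|M. indicator {c..d} y *\<^sub>R norm (W y *v h y)) = 0"
      unfolding set_lebesgue_integral_def by (intro antisym Bochner_Integration.integral_nonneg) auto
    then have "AE y in M. indicator {c..d} y *\<^sub>R norm (W y *v h y) = 0"
      by (subst (asm) integral_nonneg_eq_0_iff_AE[OF Wh]) auto
    then show ?thesis
    proof eventually_elim
      case (elim y)
      then show ?case using S(1) by (cases "y \<in> S") (auto simp: h_def)
    qed
  qed
  then have "nullsol S h" using ha hsol by (auto simp: nullsol_def h_def)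
  moreover have "h p = l p" if "p \<in> P" for p using LIMSEQ_unique[OF pt[of p] lim[OF that]] that P(2) by blast
  ultimately show thesis using that by blast
qed

text \<open>Otherwise, normalising and subtracting null solutions that are nearly optimal at the sample points
  would produce a sequence tending in norm to zero whose sample values stay away from those of all
  null solutions, although a limit of sample values belongs to a null solution.\<close>

lemma distance_to_nullsol:
  assumes cd: "{c..d} \<subseteq> I" and S: "S \<subseteq> {c..d}" "is_interval S" "S \<in> sets borel"
  obtains C where "0 \<le> C" "\<And>u f. u \<in> L2 \<Longrightarrow> f \<in> L2 \<Longrightarrow> admissible u \<Longrightarrow> solves_integral S u f \<Longrightarrow>
     \<exists>h. nullsol S h \<and> (\<forall>y\<in>S. norm (u y - h y) \<le> C * (nrm u + nrm f))"
proof -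
  have SI: "S \<subseteq> I" using S(1) cd by blast
  obtain P C0 where P: "finite P" "P \<subseteq> S" "0 \<le> C0" and
    sample: "\<And>u f y. f \<in> L2 \<Longrightarrow> admissible u \<Longrightarrow> solves_integral S u f \<Longrightarrow> y \<in> S \<Longrightarrow>
       norm (u y) \<le> C0 * ((\<Sum>p\<in>P. norm (u p)) + nrm f)" using solution_sampling[OF cd S] by metis
  have "\<exists>j::nat. \<forall>u f. u \<in> L2 \<longrightarrow> f \<in> L2 \<longrightarrow> admissible u \<longrightarrow> solves_integral S u f \<longrightarrow>
     (\<exists>h. nullsol S h \<and> (\<Sum>p\<in>P. norm (u p - h p)) \<le> real (Suc j) * (nrm u + nrm f))"
  proof (rule ccontr)
    assume contr: "\<not> ?thesis"
    \<comment> \<open>A counterexample for \<open>Suc j\<close>, after subtracting a null solution and dividing by its distance \<open>\<delta>\<close>.\<close>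
    define bad where "bad j v g \<longleftrightarrow> v \<in> L2 \<and> g \<in> L2 \<and> admissible v \<and> solves_integral S v g \<and>
       nrm v \<le> 1 / real (Suc j) \<and> nrm g \<le> 1 / real (Suc j) \<and> (\<Sum>p\<in>P. norm (v p)) \<le> 2 \<and>
       (\<forall>h. nullsol S h \<longrightarrow> 1 \<le> (\<Sum>p\<in>P. norm (v p - h p)))" for j :: nat and v g
    have "\<exists>v g. bad j v g" for j unfolding bad_def
    proof -
      obtain u f where uf: "u \<in> L2" "f \<in> L2" "admissible u" "solves_integral S u f"
        and far': "\<not> (\<exists>h. nullsol S h \<and> (\<Sum>p\<in>P. norm (u p - h p)) \<le> real (Suc j) * (nrm u + nrm f))"
        using contr by blast
      have far: "real (Suc j) * (nrm u + nrm f) < (\<Sum>p\<in>P. norm (u p - h p))" if "nullsol S h" for h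
        using far' that not_le by blast
      define N where "N = nrm u + nrm f"
      define A where "A = {\<Sum>p\<in>P. norm (u p - h p) | h. nullsol S h}"
      define \<delta> where "\<delta> = Inf A"
      have Ane: "A \<noteq> {}" using nullsol_zero by (auto simp: A_def)
      have Abdd: "bdd_below A" by (rule bdd_belowI[of _ 0]) (auto simp: A_def intro: sum_nonneg)
      have N: "N > 0"
      proof (rule ccontr)
        assume "\<not> N > 0"
        then have n0: "nrm u = 0" "nrm f = 0" using nrm_nonneg[of u] nrm_nonneg[of f] unfolding N_def by linarith+
        have "nullsol S (\<lambda>y. indicator S y *\<^sub>R u y)"
        proof -
          have "AE y in M. y \<in> I \<longrightarrow> W y *v f y = W y *v 0" using nrm_eq_0_iff[OF uf(2)] n0 by simp
          then have "increment u f s t = increment u (\<lambda>y. 0) s t" if "s \<in> S" "t \<in> S" for s t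
            using that SI by (intro increment_cong_Wf uf(2) L2_fun_zero) auto
          then have "solves_integral S u (\<lambda>y. 0)" using uf(4) by (simp add: solves_integral_def)
          then have "solves_integral S (\<lambda>y. indicator S y *\<^sub>R u y) (\<lambda>y. 0)"
            by (subst solves_integral_cong[OF S(2), of _ u]) auto
          moreover have "AE y in M. y \<in> I \<longrightarrow> W y *v u y = 0" using nrm_eq_0_iff[OF uf(1)] n0 by simp
          then have "AE y in M. W y *v (indicator S y *\<^sub>R u y) = 0"
            by eventually_elim (use SI in \<open>auto simp: indicator_def\<close>)
          ultimately show ?thesis using admissible_restrict[OF uf(3) S(3)] by (auto simp: nullsol_def)
        qed
        from far[OF this] show False using n0 P(2) by (auto simp: subset_iff sum_nonneg)
      qed
      have lower: "\<delta> \<le> (\<Sum>p\<in>P. norm (u p - h p))" if "nullsol S h" for h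
        unfolding \<delta>_def using that by (intro cInf_lower Abdd) (auto simp: A_def)
      have \<delta>N: "real (Suc j) * N \<le> \<delta>"
        unfolding \<delta>_def using Ane far by (intro cInf_greatest) (auto simp: A_def N_def intro: less_imp_le)
      then have \<delta>: "\<delta> > 0" using N by (meson less_le_trans mult_pos_pos of_nat_0_less_iff zero_less_Suc)
      obtain k where k: "nullsol S k" "(\<Sum>p\<in>P. norm (u p - k p)) < 2 * \<delta>"
      proof -
        have "\<exists>a\<in>A. a < 2 * \<delta>" using cInf_lessD[OF Ane, of "2 * \<delta>"] \<delta> by (auto simp: \<delta>_def)
        then show thesis using that by (auto simp: A_def)
      qed
      note kL = nullsol_L2[OF k(1) SI]
      define v where "v y = (1/\<delta>) *\<^sub>R (u y - k y)" for y
      define g where "g y = (1/\<delta>) *\<^sub>R f y" for y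
      have ukL: "(\<lambda>y. u y - k y) \<in> L2" using uf(1) kL by (intro L2_fun_diff) auto
      note r = scaleR_eq_cscale[of "1/\<delta>"]
      have "solves_integral S (\<lambda>y. u y - k y) (\<lambda>y. f y - 0)"
        using k(1) by (intro solves_integral_diff[OF SI uf(2,3) L2_fun_zero _ uf(4)]) (auto simp: nullsol_def)
      from solves_integral_cscale[OF this, of "complex_of_real (1/\<delta>)"]
      have sol: "solves_integral S v g" by (simp add: v_def[abs_def] g_def[abs_def] r)
      have va: "admissible v"
        using admissible_cscale[OF admissible_diff[OF uf(3), of k], of "complex_of_real (1/\<delta>)"] k(1)
        by (simp add: v_def[abs_def] r nullsol_def)
      have N\<delta>: "N / \<delta> \<le> 1 / real (Suc j)" using \<delta>N \<delta> by (simp add: field_simps)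
      have "nrm (\<lambda>y. u y - k y) \<le> nrm u" using nrm_diff[OF uf(1), of k] kL by simp
      then have "nrm (\<lambda>y. u y - k y) \<le> N" "nrm f \<le> N" using nrm_nonneg[of f] nrm_nonneg[of u] unfolding N_def by linarith+
      then have "nrm (\<lambda>y. u y - k y) / \<delta> \<le> N / \<delta>" "nrm f / \<delta> \<le> N / \<delta>" using \<delta> by (auto intro: divide_right_mono)
      moreover have "nrm v = nrm (\<lambda>y. u y - k y) / \<delta>" "nrm g = nrm f / \<delta>"
        unfolding v_def[abs_def] g_def[abs_def] nrm_scaleR using \<delta> by simp_all
      ultimately have nv: "nrm v \<le> 1 / real (Suc j)" "nrm g \<le> 1 / real (Suc j)" using N\<delta> by linarith+
      have "(\<Sum>p\<in>P. norm (v p)) = (1/\<delta>) * (\<Sum>p\<in>P. norm (u p - k p))"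
        using \<delta> by (simp add: v_def sum_distrib_left)
      also have "\<dots> \<le> 2" using k(2) \<delta> by (simp add: field_simps)
      finally have v2: "(\<Sum>p\<in>P. norm (v p)) \<le> 2" .
      have "1 \<le> (\<Sum>p\<in>P. norm (v p - h p))" if h: "nullsol S h" for h
      proof -
        have "nullsol S (\<lambda>y. k y + \<delta> *\<^sub>R h y)" by (intro nullsol_add[OF SI k(1)] nullsol_scaleR h)
        then have "\<delta> \<le> (\<Sum>p\<in>P. norm (u p - (k p + \<delta> *\<^sub>R h p)))" by (rule lower)
        also have "\<dots> = (\<Sum>p\<in>P. \<delta> * norm (v p - h p))"
        proof (rule sum.cong)
          fix p
          have "u p - (k p + \<delta> *\<^sub>R h p) = \<delta> *\<^sub>R (v p - h p)" using \<delta> by (simp add: v_def scaleR_diff_right)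
          then show "norm (u p - (k p + \<delta> *\<^sub>R h p)) = \<delta> * norm (v p - h p)" using \<delta> by simp
        qed simp
        finally have "\<delta> * 1 \<le> \<delta> * (\<Sum>p\<in>P. norm (v p - h p))" by (simp add: sum_distrib_left)
        then show ?thesis using \<delta> by (simp only: mult_le_cancel_left_pos)
      qed
      moreover have "v \<in> L2" "g \<in> L2"
        unfolding v_def[abs_def] g_def[abs_def] by (rule L2_fun_scaleR[OF ukL], rule L2_fun_scaleR[OF uf(2)])
      ultimately show "\<exists>v g. v \<in> L2 \<and> g \<in> L2 \<and> admissible v \<and> solves_integral S v g \<and>
        nrm v \<le> 1 / real (Suc j) \<and> nrm g \<le> 1 / real (Suc j) \<and> (\<Sum>p\<in>P. norm (v p)) \<le> 2 \<and>
        (\<forall>h. nullsol S h \<longrightarrow> 1 \<le> (\<Sum>p\<in>P. norm (v p - h p)))" using nv v2 sol va by blast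
    qed
    then obtain v g where "\<And>j. bad j (v j) (g j)" by metis
    then have v: "\<And>j. v j \<in> L2" "\<And>j. g j \<in> L2" "\<And>j. admissible (v j)" "\<And>j. solves_integral S (v j) (g j)"
       "\<And>j::nat. nrm (v j) \<le> 1 / real (Suc j)" "\<And>j. nrm (g j) \<le> 1 / real (Suc j)" "\<And>j. (\<Sum>p\<in>P. norm (v j p)) \<le> 2"
       "\<And>j h. nullsol S h \<Longrightarrow> 1 \<le> (\<Sum>p\<in>P. norm (v j p - h p))" unfolding bad_def by blast+
    have "norm (v j p) \<le> 2" if "p \<in> P" for j p
      using member_le_sum[of p P "\<lambda>p. norm (v j p)"] that P(1) v(7)[of j] by simp
    then obtain r l where r: "strict_mono (r :: nat \<Rightarrow> nat)" "\<And>p. p \<in> P \<Longrightarrow> (\<lambda>j. v (r j) p) \<longlonglongrightarrow> l p"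
      using bounded_finite_convergent_subsequence[OF P(1), of v 2] by metis
    have inv: "(\<lambda>j. 1 / real (Suc (r j))) \<longlonglongrightarrow> 0"
      using LIMSEQ_subseq_LIMSEQ[OF LIMSEQ_inverse_real_of_nat r(1)] by (simp add: o_def inverse_eq_divide)
    have n0: "(\<lambda>j. nrm (v (r j))) \<longlonglongrightarrow> 0" "(\<lambda>j. nrm (g (r j))) \<longlonglongrightarrow> 0"
      by (rule Lim_null_comparison[OF _ inv], use v(5,6) in simp)+
    have "\<exists>h. nullsol S h \<and> (\<forall>p\<in>P. h p = l p)"
      by (rule nullsol_limit[OF cd S P sample v(1) v(3) v(2) v(4) n0 r(2)]) auto
    then obtain h where h: "nullsol S h" "\<And>p. p \<in> P \<Longrightarrow> h p = l p" by blast
    have "(\<lambda>j. \<Sum>p\<in>P. norm (v (r j) p - h p)) \<longlonglongrightarrow> (\<Sum>p\<in>P. norm (l p - l p))"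
      using h(2) r(2) by (intro tendsto_sum tendsto_norm tendsto_diff) auto
    then have "(\<lambda>j. \<Sum>p\<in>P. norm (v (r j) p - h p)) \<longlonglongrightarrow> 0" by simp
    then have "eventually (\<lambda>j. (\<Sum>p\<in>P. norm (v (r j) p - h p)) < 1) sequentially" by (rule order_tendstoD(2)) simp
    then obtain j where "(\<Sum>p\<in>P. norm (v (r j) p - h p)) < 1" by (auto simp: eventually_sequentially)
    then show False using v(8)[OF h(1), of "r j"] by simp
  qed
  then obtain j :: nat where j: "\<And>u f. u \<in> L2 \<Longrightarrow> f \<in> L2 \<Longrightarrow> admissible u \<Longrightarrow> solves_integral S u f \<Longrightarrow>
     \<exists>h. nullsol S h \<and> (\<Sum>p\<in>P. norm (u p - h p)) \<le> real (Suc j) * (nrm u + nrm f)" by blast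
  show thesis
  proof (rule that[of "C0 * (real (Suc j) + 1)"])
    show "0 \<le> C0 * (real (Suc j) + 1)" using P(3) by simp
    fix u f assume uf: "u \<in> L2" "f \<in> L2" "admissible u" "solves_integral S u f"
    obtain h where h: "nullsol S h" "(\<Sum>p\<in>P. norm (u p - h p)) \<le> real (Suc j) * (nrm u + nrm f)" using j[OF uf] by blast
    have ha: "admissible h" using h(1) by (simp add: nullsol_def)
    have sol: "solves_integral S (\<lambda>y. u y - h y) (\<lambda>y. f y - 0)"
      using h(1) by (intro solves_integral_diff[OF SI uf(2,3) L2_fun_zero ha uf(4)]) (auto simp: nullsol_def)
    have "norm (u y - h y) \<le> C0 * (real (Suc j) + 1) * (nrm u + nrm f)" if y: "y \<in> S" for y
    proof -
      have "norm (u y - h y) \<le> C0 * ((\<Sum>p\<in>P. norm (u p - h p)) + nrm f)"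
        using sample[OF _ admissible_diff[OF uf(3) ha] sol y] uf(2) by simp
      also have "\<dots> \<le> C0 * (real (Suc j) * (nrm u + nrm f) + (nrm u + nrm f))"
        using h(2) P(3) by (intro mult_left_mono add_mono) auto
      finally show ?thesis by (simp add: algebra_simps)
    qed
    then show "\<exists>h. nullsol S h \<and> (\<forall>y\<in>S. norm (u y - h y) \<le> C0 * (real (Suc j) + 1) * (nrm u + nrm f))" using h(1) by blast
  qed
qed

end

text \<open>Restricted to finitely many points, the members of a decreasing sequence of linear spaces of
  functions form a decreasing sequence of subspaces of a finite-dimensional space.\<close>

lemma decreasing_subspaces_stabilise:
  fixes E :: "nat \<Rightarrow> (complex^'n) set"
  assumes E: "\<And>m. subspace (E m)" and dec: "\<And>m. E (Suc m) \<subseteq> E m"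
  shows "\<exists>N. \<forall>m\<ge>N. E m = E N"
proof -
  obtain N where N: "\<And>m. dim (E N) \<le> dim (E m)"
    using ex_has_least_nat[of "\<lambda>_. True" 0 "\<lambda>m. dim (E m)"] by auto
  have "E m = E N" if "N \<le> m" for m
    using N[of m] lift_Suc_antimono_le[of E, OF dec that] by (intro subspace_dim_equal E) auto
  then show ?thesis by blast
qed

lemma decreasing_function_spaces_stabilise:
  fixes R :: "nat \<Rightarrow> ('b \<Rightarrow> complex^'n) set"
  assumes "finite P" and zero: "\<And>m. (\<lambda>_. 0) \<in> R m" and add: "\<And>m u v. u \<in> R m \<Longrightarrow> v \<in> R m \<Longrightarrow> (\<lambda>y. u y + v y) \<in> R m"
    and scale: "\<And>m u r. u \<in> R m \<Longrightarrow> (\<lambda>y. r *\<^sub>R u y) \<in> R m" and dec: "\<And>m. R (Suc m) \<subseteq> R m"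
  shows "\<exists>N. \<forall>m\<ge>N. \<forall>v\<in>R N. \<exists>v'\<in>R m. \<forall>p\<in>P. v p = v' p"
  using assms
proof (induction P arbitrary: R rule: finite_induct)
  case empty
  then show ?case by blast
next
  case (insert p P)
  note ax = insert.prems
  have decR: "R m \<subseteq> R n" if "n \<le> m" for m n by (rule lift_Suc_antimono_le[of R, OF ax(4) that])
  have "subspace ((\<lambda>u. u p) ` R m)" for m unfolding subspace_def
  proof (intro conjI ballI allI)
    show "0 \<in> (\<lambda>u. u p) ` R m" using ax(1)[of m] by force
    fix x assume x: "x \<in> (\<lambda>u. u p) ` R m"
    then obtain u where u: "u \<in> R m" "x = u p" by blast
    show "c *\<^sub>R x \<in> (\<lambda>u. u p) ` R m" for c using ax(3)[OF u(1), of c] u(2) by force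
    fix y assume "y \<in> (\<lambda>u. u p) ` R m"
    then obtain v where v: "v \<in> R m" "y = v p" by blast
    show "x + y \<in> (\<lambda>u. u p) ` R m" using ax(2)[OF u(1) v(1)] u(2) v(2) by force
  qed
  moreover have "(\<lambda>u. u p) ` R (Suc m) \<subseteq> (\<lambda>u. u p) ` R m" for m using ax(4) by blast
  ultimately obtain N1 where N1: "\<And>m. N1 \<le> m \<Longrightarrow> (\<lambda>u. u p) ` R m = (\<lambda>u. u p) ` R N1"
    using decreasing_subspaces_stabilise[of "\<lambda>m. (\<lambda>u. u p) ` R m"] by blast
  have "\<exists>N. \<forall>m\<ge>N. \<forall>v\<in>{u \<in> R N. u p = 0}. \<exists>v'\<in>{u \<in> R m. u p = 0}. \<forall>p\<in>P. v p = v' p"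
    by (intro insert.IH) (use ax(1-3) in \<open>auto dest: ax(4)[THEN subsetD]\<close>)
  then obtain N2 where N2': "\<forall>m\<ge>N2. \<forall>v\<in>{u \<in> R N2. u p = 0}. \<exists>v'\<in>{u \<in> R m. u p = 0}. \<forall>p\<in>P. v p = v' p"
    by blast
  have N2: "\<And>m v. N2 \<le> m \<Longrightarrow> v \<in> R N2 \<Longrightarrow> v p = 0 \<Longrightarrow> \<exists>v'\<in>R m. v' p = 0 \<and> (\<forall>p\<in>P. v p = v' p)"
    using N2' by blast
  show ?case
  proof (intro exI[of _ "max N1 N2"] allI impI ballI)
    fix m v assume m: "max N1 N2 \<le> m" and v: "v \<in> R (max N1 N2)"
    have "v p \<in> (\<lambda>u. u p) ` R m" using v N1[of m] N1[of "max N1 N2"] m by auto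
    then obtain u where u: "u \<in> R m" "u p = v p" by force
    have "v \<in> R N2" "u \<in> R N2" using v u m decR[of N2 m] decR[of N2 "max N1 N2"] by auto
    then have "(\<lambda>y. v y + (-1) *\<^sub>R u y) \<in> R N2" by (intro ax(2) ax(3))
    then obtain u' where u': "u' \<in> R m" "u' p = 0" "\<forall>p\<in>P. v p + (-1) *\<^sub>R u p = u' p"
      using N2[of m "\<lambda>y. v y + (-1) *\<^sub>R u y"] m u(2) by auto
    have "v q = u q + u' q" if "q \<in> insert p P" for q
      using that u(2) u'(2,3) by (cases "q = p") (auto simp: algebra_simps)
    then show "\<exists>v'\<in>R m. \<forall>p\<in>insert p P. v p = v' p" using ax(2)[OF u(1) u'(1)] by (intro bexI) auto
  qed
qed

section \<open>Null solutions and the choice of representatives\<close>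

locale representatives = ode_setting a b I w J q
  for a b :: ereal and I :: "real set" and w :: "real set \<Rightarrow> complex^'n^'n"
    and J :: "complex^'n^'n" and q :: "real set \<Rightarrow> complex^'n^'n" +
  fixes \<tau> :: "int \<Rightarrow> real"
  assumes \<tau>_mono: "strict_mono \<tau>" and \<tau>_I: "range \<tau> \<subseteq> I"
    and \<tau>_lim: "{z. z islimpt range (\<lambda>k. ereal (\<tau> k))} = {a, b}"
    and Xi0: "Xi0 I J q w \<subseteq> range \<tau>"
    and B0: "B_plus J q w (\<tau> 0) 0 = J" "jump w (\<tau> 0) = 0"
begin

abbreviation "Tmax_pairs \<equiv> Tmax_fun I J q w"
abbreviation "rep_cond \<equiv> rep_condition I J q w \<tau>"
abbreviation "NS \<equiv> Nspace I J q w \<tau>"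

text \<open>Intervals between two points of the sequence \<open>\<tau>\<close>, which increase to \<open>I\<close>.\<close>

definition window :: "nat \<Rightarrow> real set" where
  "window m = {\<tau> (- int m - 1)<..<\<tau> (int m + 1)}"

lemma tau_in_I: "\<tau> k \<in> I" using \<tau>_I by auto

lemma tau_less_iff: "\<tau> j < \<tau> k \<longleftrightarrow> j < k" and tau_le_iff: "\<tau> j \<le> \<tau> k \<longleftrightarrow> j \<le> k"
  using \<tau>_mono by (auto simp: strict_mono_less strict_mono_less_eq)

lemma window_closure: "{\<tau> (- int m - 1)..\<tau> (int m + 1)} \<subseteq> I" by (intro Icc_subset_I tau_in_I)

lemma window_facts: "window m \<subseteq> {\<tau> (- int m - 1)..\<tau> (int m + 1)}" "is_interval (window m)" "window m \<in> sets borel" "open (window m)" "window m \<subseteq> I"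
  using window_closure[of m] by (auto simp: window_def is_interval_oo)

lemma window_mono: "m \<le> n \<Longrightarrow> window m \<subseteq> window n"
proof -
  assume "m \<le> n"
  then have "\<tau> (- int n - 1) \<le> \<tau> (- int m - 1)" "\<tau> (int m + 1) \<le> \<tau> (int n + 1)" by (auto simp: tau_le_iff)
  then show ?thesis by (auto simp: window_def)
qed

lemma tau_in_window: "\<bar>k\<bar> \<le> int m \<Longrightarrow> \<tau> k \<in> window m"
  by (auto simp: window_def tau_less_iff)

text \<open>A bounded infinite set has a limit point, but the points \<open>\<tau> k\<close> accumulate at \<open>a\<close> and \<open>b\<close> only.\<close>

lemma tau_not_bounded:
  assumes f: "inj f" "range f \<subseteq> range \<tau>" and pq: "s \<in> I" "t \<in> I" "\<And>m :: nat. f m \<in> {s..t}"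
  shows False
proof -
  have "infinite (range f)" using f(1) by (simp add: finite_image_iff)
  then obtain L where L: "L \<in> {s..t}" "L islimpt range f"
    using Heine_Borel_imp_Bolzano_Weierstrass[OF compact_Icc, of "range f" s t] pq(3) by blast
  then obtain S where S: "\<And>n :: nat. S n \<in> range f - {L}" "S \<longlonglongrightarrow> L" unfolding islimpt_sequential by blast
  have "ereal L islimpt range (\<lambda>k. ereal (\<tau> k))" unfolding islimpt_sequential
  proof (intro exI conjI allI)
    show "ereal (S n) \<in> range (\<lambda>k. ereal (\<tau> k)) - {ereal L}" for n using S(1)[of n] f(2) by auto
    show "(\<lambda>n. ereal (S n)) \<longlonglongrightarrow> ereal L" using S(2) by simp
  qed
  then have "ereal L = a \<or> ereal L = b" using \<tau>_lim by blast
  moreover have "L \<in> I" using L(1) Icc_subset_I[OF pq(1,2)] by blast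
  ultimately show False by (auto simp: I_eq einterval_def)
qed

lemma tau_unbounded:
  assumes x: "x \<in> I"
  shows "\<exists>m. x < \<tau> (int m + 1)" "\<exists>m. \<tau> (- int m - 1) < x"
proof -
  have inj: "inj (\<lambda>m. \<tau> (int m + 1))" "inj (\<lambda>m. \<tau> (- int m - 1))"
    using strict_mono_eq[OF \<tau>_mono] by (auto intro!: injI)
  show "\<exists>m. x < \<tau> (int m + 1)"
  proof (rule ccontr)
    assume "\<not> ?thesis"
    then have up: "\<tau> (int m + 1) \<in> {\<tau> 0..x}" for m by (auto simp: not_less tau_le_iff)
    show False by (rule tau_not_bounded[OF inj(1) _ tau_in_I x up]) auto
  qed
  show "\<exists>m. \<tau> (- int m - 1) < x"
  proof (rule ccontr)
    assume "\<not> ?thesis"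
    then have lo: "\<tau> (- int m - 1) \<in> {x..\<tau> 0}" for m by (auto simp: not_less tau_le_iff)
    show False by (rule tau_not_bounded[OF inj(2) _ x tau_in_I lo]) auto
  qed
qed

lemma window_exhausts:
  assumes "x \<in> I" "y \<in> I" obtains m where "{x..y} \<subseteq> window m" "x \<in> window m" "y \<in> window m"
proof -
  obtain m1 m2 where m: "max x y < \<tau> (int m1 + 1)" "\<tau> (- int m2 - 1) < min x y"
    using tau_unbounded(1)[of "max x y"] tau_unbounded(2)[of "min x y"] assms unfolding max_def min_def by presburger
  have "\<tau> (int m1 + 1) \<le> \<tau> (int (max m1 m2) + 1)" "\<tau> (- int (max m1 m2) - 1) \<le> \<tau> (- int m2 - 1)"
    by (auto simp: tau_le_iff)
  then show thesis using m by (intro that[of "max m1 m2"]) (auto simp: window_def)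
qed

lemma nullsol_glue:
  assumes H: "\<And>i. nullsol (S i) (H i)" and S: "\<And>i. window (m + i) \<subseteq> S i"
    and ext: "\<And>i y. y \<in> window (m + i) \<Longrightarrow> H (Suc i) y = H i y"
  shows "\<exists>g. nullsol I g \<and> (\<forall>i. \<forall>y\<in>window (m + i). g y = H i y)"
proof -
  define h where "h i y = indicator (window (m + i)) y *\<^sub>R H i y" for i y
  have h: "nullsol (window (m + i)) (h i)" for i
    unfolding h_def[abs_def] by (rule nullsol_restrict[OF H S window_facts(2,3)])
  have ext': "h j y = h i y" if "i \<le> j" "y \<in> window (m + i)" for i j y using that
  proof (induction j rule: dec_induct)
    case (step n)
    then have "y \<in> window (m + n)" "y \<in> window (m + Suc n)"
      using window_mono[of "m + i" "m + n"] window_mono[of "m + i" "m + Suc n"] by auto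
    then show ?case using ext step by (simp add: h_def)
  qed simp
  have I_window: "\<exists>i. y \<in> window (m + i)" if y: "y \<in> I" for y
  proof -
    obtain i where "y \<in> window i" using window_exhausts[OF y y] by blast
    then show ?thesis using window_mono[of i "m + i"] by (intro exI[of _ i]) auto
  qed
  define g where "g y = lim (\<lambda>i. h i y)" for y
  have conv: "(\<lambda>j. h j y) \<longlonglongrightarrow> h i y" if "y \<in> window (m + i)" for i y
    using ext' that by (intro tendsto_eventually) (auto simp: eventually_sequentially)
  have g: "g y = h i y" if "y \<in> window (m + i)" for i y unfolding g_def using conv[OF that] by (rule limI)
  have g0: "g y = 0" if "y \<notin> I" for y
  proof -
    have "h i y = 0" for i using h[of i] window_facts(5)[of "m + i"] that by (auto simp: nullsol_def)
    then show ?thesis by (simp add: g_def)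
  qed
  have lims: "(\<lambda>j. h j y) \<longlonglongrightarrow> g y" for y
  proof (cases "y \<in> I")
    case True
    then obtain i where "y \<in> window (m + i)" using I_window by blast
    then show ?thesis using conv g by simp
  next
    case False
    have "h i y = 0" for i using h[of i] window_facts(5)[of "m + i"] False by (auto simp: nullsol_def)
    then show ?thesis using g0[OF False] by simp
  qed
  have gm: "g \<in> borel_measurable borel"
    by (rule borel_measurable_LIMSEQ_metric[OF _ lims]) (use h in \<open>simp add: nullsol_def admissible_def\<close>)
  have ga: "admissible g" unfolding admissible_def locally_bounded_on_def
  proof (intro conjI gm allI impI)
    fix c d assume cd: "{c..d} \<subseteq> I"
    show "bounded (g ` {c..d})"
    proof (cases "c \<le> d")
      case True
      then have "c \<in> I" "d \<in> I" using cd by auto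
      then obtain n where n: "{c..d} \<subseteq> window n" using window_exhausts by blast
      then have "{c..d} \<subseteq> window (m + n)" using window_mono[of n "m + n"] by auto
      then have "g ` {c..d} = h n ` {c..d}" using g by (intro image_cong) auto
      then show ?thesis using h[of n] cd by (simp add: nullsol_def admissible_def locally_bounded_on_def)
    qed simp
  qed
  have gs: "solves_integral I g (\<lambda>y. 0)" unfolding solves_integral_def
  proof (intro ballI)
    fix s t assume "s \<in> I" "t \<in> I"
    then obtain n where "s \<in> window n" "t \<in> window n" using window_exhausts by blast
    then have st: "s \<in> window (m + n)" "t \<in> window (m + n)" using window_mono[of n "m + n"] by auto
    have "solves_integral (window (m + n)) g (\<lambda>y. 0)"
      using h[of n] g by (subst solves_integral_cong[OF window_facts(2), of "m + n" g "h n"]) (auto simp: nullsol_def)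
    then show "J *v (g t - g s) = increment g (\<lambda>y. 0) s t" using st by (simp only: solves_integral_def)
  qed
  have "AE y in M. \<forall>i. W y *v h i y = 0" using h unfolding AE_all_countable nullsol_def by blast
  then have "AE y in M. W y *v g y = 0"
  proof eventually_elim
    case (elim y)
    show ?case
    proof (cases "y \<in> I")
      case True
      then obtain i where "y \<in> window (m + i)" using I_window by blast
      then show ?thesis using elim g by simp
    qed (simp add: g0)
  qed
  then have "nullsol I g" using ga gs g0 by (simp add: nullsol_def)
  moreover have "g y = H i y" if "y \<in> window (m + i)" for i y using g[OF that] that by (simp add: h_def)
  ultimately show ?thesis by blast
qed

lemma nullsol_window_restrict:
  "nullsol (window n) h \<Longrightarrow> m \<le> n \<Longrightarrow> nullsol (window m) (\<lambda>y. indicator (window m) y *\<^sub>R h y)"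
  by (rule nullsol_restrict[OF _ window_mono window_facts(2,3)])

text \<open>Which null solutions on a window extend to a larger window is decided, for all larger windows at once, by a
  sufficiently large one: the restrictions form a decreasing sequence of finite-dimensional spaces.\<close>

lemma nullsol_extension_stage:
  "\<exists>N\<ge>m. \<forall>j\<ge>N. \<forall>h. nullsol (window N) h \<longrightarrow> (\<exists>k. nullsol (window j) k \<and> (\<forall>y\<in>window m. h y = k y))"
proof -
  obtain P C where P: "finite P" "P \<subseteq> window m" "0 \<le> C"
    "\<And>u f y. f \<in> L2 \<Longrightarrow> admissible u \<Longrightarrow> solves_integral (window m) u f \<Longrightarrow> y \<in> window m \<Longrightarrow>
       norm (u y) \<le> C * ((\<Sum>p\<in>P. norm (u p)) + nrm f)"
    using solution_sampling[OF window_closure window_facts(1-3)] by metis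
  \<comment> \<open>Functions in \<open>R j\<close> are determined by their values on \<open>P\<close>, by the sampling estimate.\<close>
  define R where "R j = {\<lambda>y. indicator (window m) y *\<^sub>R k y | k. nullsol (window (m + j)) k}" for j
  have "\<exists>N. \<forall>j\<ge>N. \<forall>v\<in>R N. \<exists>v'\<in>R j. \<forall>p\<in>P. v p = v' p"
  proof (rule decreasing_function_spaces_stabilise[OF P(1)])
    fix j
    show "(\<lambda>_. 0) \<in> R j" unfolding R_def using nullsol_zero by (intro CollectI exI[of _ "\<lambda>_. 0"]) auto
    fix u v assume "u \<in> R j" "v \<in> R j"
    then obtain k l where kl: "nullsol (window (m + j)) k" "nullsol (window (m + j)) l"
      "u = (\<lambda>y. indicator (window m) y *\<^sub>R k y)" "v = (\<lambda>y. indicator (window m) y *\<^sub>R l y)" by (auto simp: R_def)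
    show "(\<lambda>y. u y + v y) \<in> R j" unfolding R_def using nullsol_add[OF window_facts(5) kl(1,2)]
      by (intro CollectI exI[of _ "\<lambda>y. k y + l y"]) (auto simp: kl scaleR_add_right)
  next
    fix j u r assume "u \<in> R j"
    then obtain k where k: "nullsol (window (m + j)) k" "u = (\<lambda>y. indicator (window m) y *\<^sub>R k y)" by (auto simp: R_def)
    show "(\<lambda>y. r *\<^sub>R u y) \<in> R j" unfolding R_def using nullsol_scaleR[OF k(1), of r]
      by (intro CollectI exI[of _ "\<lambda>y. r *\<^sub>R k y"]) (auto simp: k mult.commute)
  next
    fix j show "R (Suc j) \<subseteq> R j"
    proof
      fix u assume "u \<in> R (Suc j)"
      then obtain k where k: "nullsol (window (m + Suc j)) k" "u = (\<lambda>y. indicator (window m) y *\<^sub>R k y)" by (auto simp: R_def)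
      have "u = (\<lambda>y. indicator (window m) y *\<^sub>R (indicator (window (m + j)) y *\<^sub>R k y))"
        using window_mono[of m "m + j"] by (auto simp: k fun_eq_iff indicator_def)
      moreover have "nullsol (window (m + j)) (\<lambda>y. indicator (window (m + j)) y *\<^sub>R k y)"
        by (rule nullsol_window_restrict[OF k(1)]) simp
      ultimately show "u \<in> R j" unfolding R_def
        by (intro CollectI exI[of _ "\<lambda>y. indicator (window (m + j)) y *\<^sub>R k y"] conjI)
    qed
  qed
  then obtain N where N: "\<And>j v. N \<le> j \<Longrightarrow> v \<in> R N \<Longrightarrow> \<exists>v'\<in>R j. \<forall>p\<in>P. v p = v' p" by blast
  show ?thesis
  proof (intro exI[of _ "m + N"] conjI allI impI)
    fix j h assume j: "m + N \<le> j" and h: "nullsol (window (m + N)) h"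
    have "(\<lambda>y. indicator (window m) y *\<^sub>R h y) \<in> R N" using h by (auto simp: R_def)
    then obtain v' where v': "v' \<in> R (j - m)" "\<forall>p\<in>P. indicator (window m) p *\<^sub>R h p = v' p"
      using N[of "j - m"] j by fastforce
    then obtain k where k: "nullsol (window j) k" "v' = (\<lambda>y. indicator (window m) y *\<^sub>R k y)" using j by (auto simp: R_def)
    have hk: "h p = k p" if "p \<in> P" for p using v'(2) that P(2) k(2) by (auto simp: indicator_def)
    have hm: "nullsol (window m) (\<lambda>y. indicator (window m) y *\<^sub>R h y)" "nullsol (window m) (\<lambda>y. indicator (window m) y *\<^sub>R k y)"
      using nullsol_window_restrict[OF h] nullsol_window_restrict[OF k(1)] j by auto
    note d = nullsol_diff[OF window_facts(5) hm]
    have "h y = k y" if y: "y \<in> window m" for y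
    proof -
      have "norm (indicator (window m) y *\<^sub>R h y - indicator (window m) y *\<^sub>R k y)
        \<le> C * ((\<Sum>p\<in>P. norm (indicator (window m) p *\<^sub>R h p - indicator (window m) p *\<^sub>R k p)) + nrm (\<lambda>y. 0))"
        using d by (intro P(4)[OF L2_fun_zero _ _ y]) (auto simp: nullsol_def)
      also have "(\<Sum>p\<in>P. norm (indicator (window m) p *\<^sub>R h p - indicator (window m) p *\<^sub>R k p)) = 0"
        using hk by (intro sum.neutral) auto
      finally show ?thesis using y by simp
    qed
    then show "\<exists>k. nullsol (window j) k \<and> (\<forall>y\<in>window m. h y = k y)" using k(1) by blast
  qed simp
qed

text \<open>By the preceding lemma a null solution on the window \<open>N\<close> can be replaced, step by step, by null
  solutions on larger and larger windows, each of which agrees with its predecessor on a window that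
  exhausts \<open>I\<close>.\<close>

lemma nullsol_extension:
  "\<exists>N\<ge>m. \<forall>h. nullsol (window N) h \<longrightarrow> (\<exists>g. nullsol I g \<and> (\<forall>y\<in>window m. g y = h y))"
proof -
  obtain N where N: "\<And>m. m \<le> N m" "\<And>m j h. N m \<le> j \<Longrightarrow> nullsol (window (N m)) h \<Longrightarrow> \<exists>k. nullsol (window j) k \<and> (\<forall>y\<in>window m. h y = k y)"
    using nullsol_extension_stage by metis
  have "\<exists>g. nullsol I g \<and> (\<forall>y\<in>window m. g y = h y)" if h: "nullsol (window (N m)) h" for h
  proof -
    have "\<exists>k. \<forall>i. (nullsol (window (N (m + i))) (k i) \<and> (i = 0 \<longrightarrow> k i = h)) \<and> (\<forall>y\<in>window (m + i). k (Suc i) y = k i y)"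
    proof (rule dependent_nat_choice)
      show "\<exists>k. nullsol (window (N (m + 0))) k \<and> (0 = (0::nat) \<longrightarrow> k = h)" using h by auto
      fix k i assume k: "nullsol (window (N (m + i))) k \<and> (i = 0 \<longrightarrow> k = h)"
      define j where "j = max (N (m + i)) (N (m + Suc i))"
      obtain l where l: "nullsol (window j) l" "\<forall>y\<in>window (m + i). k y = l y"
        using N(2)[of "m + i" j k] k by (auto simp: j_def)
      have "nullsol (window (N (m + Suc i))) (\<lambda>y. indicator (window (N (m + Suc i))) y *\<^sub>R l y)"
        by (rule nullsol_window_restrict[OF l(1)]) (simp add: j_def)
      moreover have "window (m + i) \<subseteq> window (N (m + Suc i))" using N(1)[of "m + Suc i"] by (intro window_mono) simp
      then have "\<forall>y\<in>window (m + i). indicator (window (N (m + Suc i))) y *\<^sub>R l y = k y" using l(2) by (auto simp: indicator_def)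
      ultimately show "\<exists>l. (nullsol (window (N (m + Suc i))) l \<and> (Suc i = 0 \<longrightarrow> l = h)) \<and> (\<forall>y\<in>window (m + i). l y = k y)" by auto
    qed
    then obtain k where k: "\<And>i. nullsol (window (N (m + i))) (k i)" "k 0 = h" "\<And>i y. y \<in> window (m + i) \<Longrightarrow> k (Suc i) y = k i y"
      by blast
    have "\<exists>g. nullsol I g \<and> (\<forall>i. \<forall>y\<in>window (m + i). g y = k i y)"
      by (rule nullsol_glue[OF k(1) window_mono[OF N(1)]]) (rule k(3))
    then obtain g where g: "nullsol I g" "\<forall>i. \<forall>y\<in>window (m + i). g y = k i y" by blast
    then have "\<forall>y\<in>window (m + 0). g y = k 0 y" by blast
    then show ?thesis using g(1) k(2) by auto
  qed
  then show ?thesis using N(1)[of m] by blast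
qed

text \<open>The nearest null solution on a larger window is exchanged for one on all of \<open>I\<close> that coincides with it
  on the window in question.\<close>

lemma distance_to_global_nullsol:
  obtains C where "0 \<le> C" "\<And>u f. u \<in> L2 \<Longrightarrow> f \<in> L2 \<Longrightarrow> admissible u \<Longrightarrow> solves_integral I u f \<Longrightarrow>
     \<exists>g. nullsol I g \<and> (\<forall>y\<in>window m. norm (u y - g y) \<le> C * (nrm u + nrm f))"
proof -
  obtain N where N: "m \<le> N" "\<And>h. nullsol (window N) h \<Longrightarrow> \<exists>g. nullsol I g \<and> (\<forall>y\<in>window m. g y = h y)"
    using nullsol_extension[of m] by blast
  obtain C where C: "0 \<le> C" "\<And>u f. u \<in> L2 \<Longrightarrow> f \<in> L2 \<Longrightarrow> admissible u \<Longrightarrow> solves_integral (window N) u f \<Longrightarrow>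
     \<exists>h. nullsol (window N) h \<and> (\<forall>y\<in>window N. norm (u y - h y) \<le> C * (nrm u + nrm f))"
    using distance_to_nullsol[OF window_closure window_facts(1-3)] by metis
  show thesis
  proof (rule that[OF C(1)])
    fix u f assume uf: "u \<in> L2" "f \<in> L2" "admissible u" "solves_integral I u f"
    have "solves_integral (window N) u f" using uf(4) window_facts(5)[of N] by (auto simp: solves_integral_def)
    then obtain h where h: "nullsol (window N) h" "\<And>y. y \<in> window N \<Longrightarrow> norm (u y - h y) \<le> C * (nrm u + nrm f)"
      using C(2)[OF uf(1-3)] by blast
    obtain g where "nullsol I g" "\<And>y. y \<in> window m \<Longrightarrow> g y = h y" using N(2)[OF h(1)] by blast
    then show "\<exists>g. nullsol I g \<and> (\<forall>y\<in>window m. norm (u y - g y) \<le> C * (nrm u + nrm f))"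
      using h(2) window_mono[OF N(1)] by (intro exI[of _ g]) auto
  qed
qed

end

section \<open>Uniqueness and existence of representatives\<close>

context representatives
begin

lemma Tmax_fun_iff: "(u, f) \<in> Tmax_pairs \<longleftrightarrow>
    u \<in> L2 \<and> f \<in> L2 \<and> admissible u \<and> solves_integral I u f \<and> (\<forall>y. y \<notin> I \<longrightarrow> u y = 0)"
proof -
  have "u \<in> BV_sharp I \<and> solves I J q w u f \<longleftrightarrow> admissible u \<and> solves_integral I u f \<and> (\<forall>y. y \<notin> I \<longrightarrow> u y = 0)"
    if f: "f \<in> L2"
  proof
    assume A: "u \<in> BV_sharp I \<and> solves I J q w u f"
    then have "\<forall>y. y \<notin> I \<longrightarrow> u y = 0" by (auto simp: BV_sharp_def)
    then show "admissible u \<and> solves_integral I u f \<and> (\<forall>y. y \<notin> I \<longrightarrow> u y = 0)"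
      using solves_imp_solves_integral[OF f] A by simp
  next
    assume A: "admissible u \<and> solves_integral I u f \<and> (\<forall>y. y \<notin> I \<longrightarrow> u y = 0)"
    then show "u \<in> BV_sharp I \<and> solves I J q w u f"
      using solves_integral_imp_BV_sharp[OF f] solves_integral_imp_solves[OF f] by blast
  qed
  then show ?thesis by (auto simp: Tmax_fun_def)
qed

lemma L0_iff: "h \<in> L0 I J q w \<longleftrightarrow> nullsol I h"
proof
  assume h: "h \<in> L0 I J q w"
  then have hs: "admissible h" "solves_integral I h (\<lambda>y. 0)" and h0: "\<And>y. y \<notin> I \<Longrightarrow> h y = 0"
    using solves_imp_solves_integral[OF L2_fun_zero, of h] by (auto simp: L0_def BV_sharp_def)
  have "set_borel_measurable borel I h" unfolding set_borel_measurable_def using hs(1)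
    by (intro borel_measurable_scaleR borel_measurable_indicator I_borel) (simp add: admissible_def)
  then have "AE y in M. y \<in> I \<longrightarrow> W y *v h y = 0" using h L2_sqnorm_eq_0_iff by (simp add: L0_def)
  then have "AE y in M. W y *v h y = 0" by eventually_elim (use h0 in \<open>metis matrix_vector_mult_0_right\<close>)
  then show "nullsol I h" using hs h0 by (simp add: nullsol_def)
next
  assume h: "nullsol I h"
  then have "h \<in> BV_sharp I" "solves I J q w h (\<lambda>y. 0)"
    using solves_integral_imp_BV_sharp[OF L2_fun_zero] solves_integral_imp_solves[OF L2_fun_zero]
    by (auto simp: nullsol_def)
  then show "h \<in> L0 I J q w" using nullsol_L2[OF h] L2_sqnorm_eq[of h] by (simp add: L0_def nrm_def)
qed

lemma nullsol_Tmax: "nullsol I h \<Longrightarrow> (h, \<lambda>y. 0) \<in> Tmax_pairs"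
  using nullsol_L2[of I h] L2_fun_zero by (auto simp: Tmax_fun_iff nullsol_def)

lemma Tmax_fun_diff_nullsol:
  assumes u: "(u, f) \<in> Tmax_pairs" and h: "nullsol I h"
  shows "(\<lambda>y. u y - h y, f) \<in> Tmax_pairs"
proof -
  have "solves_integral I (\<lambda>y. u y - h y) (\<lambda>y. f y - 0)"
    using u h by (intro solves_integral_diff L2_fun_zero) (auto simp: Tmax_fun_iff nullsol_def)
  then show ?thesis
    using u h L2_fun_diff[of u h] admissible_diff[of u h] nullsol_L2[OF h] by (auto simp: Tmax_fun_iff nullsol_def)
qed

definition side :: "int \<Rightarrow> real filter" where
  "side k = (if 0 \<le> k then at_right (\<tau> k) else at_left (\<tau> k))"

definition limit_at :: "int \<Rightarrow> (real \<Rightarrow> complex^'n) \<Rightarrow> complex^'n" where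
  "limit_at k u = (if 0 \<le> k then right_lim u (\<tau> k) else left_lim u (\<tau> k))"

definition vanishes_before :: "int \<Rightarrow> (real \<Rightarrow> complex^'n) \<Rightarrow> bool" where
  "vanishes_before k h \<longleftrightarrow> (0 < k \<longrightarrow> (\<forall>y<\<tau> k. h y = 0)) \<and> (k < 0 \<longrightarrow> (\<forall>y>\<tau> k. h y = 0))"

lemma Tmax_limits:
  assumes u: "(u, f) \<in> Tmax_pairs" and x: "x \<in> I"
  shows "(u \<longlongrightarrow> right_lim u x) (at_right x)" "(u \<longlongrightarrow> left_lim u x) (at_left x)"
    and "right_lim u x = u x + matrix_inv J *v ((1/2) *\<^sub>R (jump w x *v f x - jump q x *v u x))"
    and "left_lim u x = u x - matrix_inv J *v ((1/2) *\<^sub>R (jump w x *v f x - jump q x *v u x))"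
proof -
  have u': "f \<in> L2" "admissible u" "solves_integral I u f" using u by (auto simp: Tmax_fun_iff)
  note l = solves_integral_limits[OF u'(1,2) I_open subset_refl u'(3) x]
  show "right_lim u x = u x + matrix_inv J *v ((1/2) *\<^sub>R (jump w x *v f x - jump q x *v u x))"
    "left_lim u x = u x - matrix_inv J *v ((1/2) *\<^sub>R (jump w x *v f x - jump q x *v u x))"
    by (rule right_lim_eq[OF l(1)], rule left_lim_eq[OF l(2)])
  then show "(u \<longlongrightarrow> right_lim u x) (at_right x)" "(u \<longlongrightarrow> left_lim u x) (at_left x)" using l by simp_all
qed

lemma jump_q_tau0: "jump q (\<tau> 0) = 0"
  using B0 by (simp add: B_plus_def)

lemma Tmax_continuous_at_tau0:
  assumes u: "(u, f) \<in> Tmax_pairs"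
  shows "right_lim u (\<tau> 0) = u (\<tau> 0)" "left_lim u (\<tau> 0) = u (\<tau> 0)"
  using Tmax_limits(3,4)[OF u tau_in_I, of 0] by (simp_all add: jump_q_tau0 B0)

lemma Tmax_tendsto_limit_at: "(u, f) \<in> Tmax_pairs \<Longrightarrow> (u \<longlongrightarrow> limit_at k u) (side k)"
  using Tmax_limits(1,2)[OF _ tau_in_I, of u f k] by (simp add: limit_at_def side_def)

lemma limit_at_eq: "(u \<longlongrightarrow> l) (side k) \<Longrightarrow> limit_at k u = l"
  by (auto simp: limit_at_def side_def right_lim_eq left_lim_eq split: if_splits)

lemma side_bot: "side k \<noteq> bot"
  by (simp add: side_def)

lemma side_in_open: "open S \<Longrightarrow> \<tau> k \<in> S \<Longrightarrow> eventually (\<lambda>y. y \<in> S) (side k)"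
  using eventually_at_in_open'[of S "\<tau> k"] by (auto simp: side_def eventually_at_split)

lemma supp_in_vanishes:
  assumes "\<And>y. y \<notin> I \<Longrightarrow> h y = 0" and "closed A"
  shows "supp_in I h \<subseteq> I \<inter> A \<longleftrightarrow> (\<forall>y. y \<notin> A \<longrightarrow> h y = 0)"
proof
  assume s: "supp_in I h \<subseteq> I \<inter> A"
  show "\<forall>y. y \<notin> A \<longrightarrow> h y = 0"
  proof (intro allI impI)
    fix y assume y: "y \<notin> A"
    show "h y = 0"
    proof (rule ccontr)
      assume ne: "h y \<noteq> 0"
      then have "y \<in> I" using assms(1) by blast
      then have "y \<in> supp_in I h" using ne closure_subset[of "{x \<in> I. h x \<noteq> 0}"] by (auto simp: supp_in_def)
      then show False using s y by blast
    qed
  qed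
next
  assume "\<forall>y. y \<notin> A \<longrightarrow> h y = 0"
  then have "{x \<in> I. h x \<noteq> 0} \<subseteq> A" by blast
  then show "supp_in I h \<subseteq> I \<inter> A" using closure_minimal[OF _ assms(2)] by (auto simp: supp_in_def)
qed

text \<open>This form makes the three cases of the definition uniform. At \<open>\<tau> 0\<close> the value and the one-sided
  limits coincide.\<close>

lemma Nspace_eq: "NS k = {limit_at k h | h. nullsol I h \<and> vanishes_before k h}"
proof -
  have z: "y \<notin> I \<Longrightarrow> h y = 0" if "nullsol I h" for h y using that by (simp add: nullsol_def)
  have r: "supp_in I h \<subseteq> I \<inter> {\<tau> k..} \<longleftrightarrow> (\<forall>y<\<tau> k. h y = 0)" if "nullsol I h" for h
    using supp_in_vanishes[of h "{\<tau> k..}"] z[OF that] by (auto simp: not_le)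
  have l: "supp_in I h \<subseteq> I \<inter> {..\<tau> k} \<longleftrightarrow> (\<forall>y>\<tau> k. h y = 0)" if "nullsol I h" for h
    using supp_in_vanishes[of h "{..\<tau> k}"] z[OF that] by (auto simp: not_le)
  consider "k = 0" | "0 < k" | "k < 0" by linarith
  then show ?thesis
  proof cases
    case 1
    have "h (\<tau> 0) = limit_at 0 h" if "nullsol I h" for h
      using Tmax_continuous_at_tau0(1)[OF nullsol_Tmax[OF that]] by (simp add: limit_at_def)
    then show ?thesis using 1 by (auto simp: Nspace_def L0_iff vanishes_before_def)
  next
    case 2
    have eq: "(nullsol I h \<and> supp_in I h \<subseteq> I \<inter> {\<tau> k..}) \<longleftrightarrow> (nullsol I h \<and> (\<forall>y<\<tau> k. h y = 0))" for h using r by blast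
    show ?thesis unfolding Nspace_def L0_iff eq vanishes_before_def limit_at_def using 2 by simp
  next
    case 3
    have eq: "(nullsol I h \<and> supp_in I h \<subseteq> I \<inter> {..\<tau> k}) \<longleftrightarrow> (nullsol I h \<and> (\<forall>y>\<tau> k. h y = 0))" for h using l by blast
    show ?thesis unfolding Nspace_def L0_iff eq vanishes_before_def limit_at_def using 3 by simp
  qed
qed

lemma rep_condition_iff:
  assumes "(u, f) \<in> Tmax_pairs"
  shows "rep_cond k u \<longleftrightarrow> (\<forall>z\<in>NS k. cdot z (limit_at k u) = 0)"
  using Tmax_continuous_at_tau0[OF assms] by (cases "k = 0") (auto simp: rep_condition_def limit_at_def)

lemma cdot_self_eq_0: "cdot z z = 0 \<Longrightarrow> z = 0" for z :: "complex^'n"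
  using Re_cdot[of z z] by simp

text \<open>Halving: on a small gap the oscillation of a null solution is at most half its supremum, so a null
  solution that tends to zero at an end vanishes throughout.\<close>

lemma nullsol_vanishes_on_small_gap:
  assumes gap: "small_gap c d" and v: "nullsol I v"
    and F: "(v \<longlongrightarrow> 0) F" "F \<noteq> bot" "eventually (\<lambda>s. s \<in> {c<..<d}) F" and y: "y \<in> {c<..<d}"
  shows "v y = 0"
proof -
  have cd: "{c..d} \<subseteq> I" using gap by (simp add: small_gap_def)
  define A where "A = (\<lambda>y. norm (v y)) ` {c<..<d}"
  have "bounded (v ` {c..d})" using v cd by (simp add: nullsol_def admissible_def locally_bounded_on_def)
  then obtain K where "\<And>y. y \<in> {c..d} \<Longrightarrow> norm (v y) \<le> K" unfolding bounded_iff by blast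
  then have bdd: "bdd_above A" by (intro bdd_aboveI[of _ K]) (auto simp: A_def)
  obtain C where C: "\<And>S u f s t B. f \<in> L2 \<Longrightarrow> admissible u \<Longrightarrow> solves_integral S u f \<Longrightarrow> is_interval S \<Longrightarrow> S \<in> sets borel \<Longrightarrow>
      s \<in> S \<inter> {c<..<d} \<Longrightarrow> t \<in> S \<inter> {c<..<d} \<Longrightarrow> (\<And>y. y \<in> S \<inter> {c<..<d} \<Longrightarrow> norm (u y) \<le> B) \<Longrightarrow>
      norm (u t - u s) \<le> B / 2 + C * nrm f" using small_gap_oscillation[OF gap] by metis
  have "{c<..<d} \<subseteq> {c..d}" by auto
  then have "{c<..<d} \<subseteq> I" using cd by (rule subset_trans)
  then have vs: "admissible v" "solves_integral {c<..<d} v (\<lambda>y. 0)" using v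
    unfolding nullsol_def solves_integral_def by blast+
  have half: "norm (v t) \<le> Sup A / 2" if t: "t \<in> {c<..<d}" for t
  proof (rule tendsto_upperbound[OF _ _ F(2)])
    have "((\<lambda>s. norm (v t - v s)) \<longlongrightarrow> norm (v t - 0)) F" by (intro tendsto_intros F(1))
    then show "((\<lambda>s. norm (v t - v s)) \<longlongrightarrow> norm (v t)) F" by simp
    show "eventually (\<lambda>s. norm (v t - v s) \<le> Sup A / 2) F" using F(3)
    proof eventually_elim
      case (elim s)
      have "norm (v t - v s) \<le> Sup A / 2 + C * nrm (\<lambda>y. 0)"
        by (rule C[OF L2_fun_zero vs]) (use elim t in \<open>auto simp: A_def is_interval_oo intro!: cSup_upper bdd[unfolded A_def]\<close>)
      then show ?case by simp
    qed
  qed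
  have "Sup A \<le> Sup A / 2" using half y by (intro cSup_least) (auto simp: A_def)
  then show ?thesis using half[OF y] norm_ge_zero[of "v y"] by (metis field_sum_of_halves le_add_same_cancel1 norm_le_zero_iff order_trans linorder_not_le add_le_same_cancel1)
qed

lemma nullsol_vanishes_nearby:
  assumes v: "nullsol I v" and x: "x \<in> I"
  shows "right_lim v x = 0 \<Longrightarrow> eventually (\<lambda>y. v y = 0) (at_right x)"
    and "left_lim v x = 0 \<Longrightarrow> eventually (\<lambda>y. v y = 0) (at_left x)"
proof -
  obtain \<delta> where \<delta>: "\<delta> > 0" "small_gap x (x + \<delta>)" "small_gap (x - \<delta>) x" using small_gaps[OF x] by blast
  have ev: "eventually (\<lambda>y. y \<in> {x<..<x + \<delta>}) (at_right x)" "eventually (\<lambda>y. y \<in> {x - \<delta><..<x}) (at_left x)"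
    using \<delta>(1) by (auto intro!: eventually_at_rightI eventually_at_leftI)
  note l = Tmax_limits(1,2)[OF nullsol_Tmax[OF v] x]
  show "eventually (\<lambda>y. v y = 0) (at_right x)" if z: "right_lim v x = 0" using ev(1)
  proof eventually_elim
    case (elim y)
    show ?case by (rule nullsol_vanishes_on_small_gap[OF \<delta>(2) v l(1)[unfolded z] _ ev(1) elim]) simp
  qed
  show "eventually (\<lambda>y. v y = 0) (at_left x)" if z: "left_lim v x = 0" using ev(2)
  proof eventually_elim
    case (elim y)
    show ?case by (rule nullsol_vanishes_on_small_gap[OF \<delta>(3) v l(2)[unfolded z] _ ev(2) elim]) simp
  qed
qed

lemma nullsol_limits_B:
  assumes v: "nullsol I v" and x: "x \<in> I"
  shows "J *v right_lim v x = B_minus J q w x 0 *v v x" "J *v left_lim v x = B_plus J q w x 0 *v v x"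
proof -
  have s: "((1/2) *\<^sub>R A) *v z = (1/2) *\<^sub>R (A *v z)" for A :: "complex^'n^'n" and z
    by (rule bounded_bilinear.scaleR_left[OF bounded_bilinear_matrix_vector_mult])
  note l = Tmax_limits(3,4)[OF nullsol_Tmax[OF v] x]
  show "J *v right_lim v x = B_minus J q w x 0 *v v x" unfolding l(1) matrix_vector_right_distrib J_inv_right B_minus_def
    by (simp add: matrix_vector_mult_diff_rdistrib s)
  show "J *v left_lim v x = B_plus J q w x 0 *v v x" unfolding l(2) matrix_vector_mult_diff_distrib J_inv_right B_plus_def
    by (simp add: matrix_vector_mult_add_rdistrib s)
qed

text \<open>Away from the points \<open>\<tau> k\<close> the matrices \<open>B_plus\<close> and \<open>B_minus\<close> are invertible, so that a
  null solution vanishes at a point as soon as one of its one-sided limits does.\<close>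

lemma nullsol_limit_eq_0_iff:
  assumes v: "nullsol I v" and x: "x \<in> I" "x \<notin> range \<tau>"
  shows "right_lim v x = 0 \<longleftrightarrow> v x = 0" "left_lim v x = 0 \<longleftrightarrow> v x = 0"
proof -
  have "det (B_plus J q w x 0) \<noteq> 0" "det (B_minus J q w x 0) \<noteq> 0" using x Xi0 by (auto simp: Xi0_def)
  then have inv: "invertible (B_plus J q w x 0)" "invertible (B_minus J q w x 0)" by (simp_all add: invertible_det_nz)
  have inj: "A *v z = 0 \<longleftrightarrow> z = 0" if inv: "invertible A" for A :: "complex^'n^'n" and z
  proof -
    obtain A' where "A' ** A = mat 1" using inv unfolding invertible_def by blast
    then have "A' *v (A *v z) = z" by (simp add: matrix_vector_mul_assoc)
    then have "z = 0" if "A *v z = 0" using that by simp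
    then show ?thesis by auto
  qed
  show "right_lim v x = 0 \<longleftrightarrow> v x = 0"
    using nullsol_limits_B(1)[OF v x(1)] inj[OF J_invertible, of "right_lim v x"] inj[OF inv(2), of "v x"] by simp
  show "left_lim v x = 0 \<longleftrightarrow> v x = 0"
    using nullsol_limits_B(2)[OF v x(1)] inj[OF J_invertible, of "left_lim v x"] inj[OF inv(1), of "v x"] by simp
qed

text \<open>The zeros of a null solution between consecutive points \<open>\<tau> k\<close> form a set that is open and whose
  complement is open, by the equivalence of the vanishing of the value and of the one-sided limits.\<close>

lemma nullsol_vanishes_between:
  assumes v: "nullsol I v" and cd: "c < d" "{c..d} \<subseteq> I" "{c<..<d} \<inter> range \<tau> = {}"
    and z: "right_lim v c = 0 \<or> left_lim v d = 0" and y: "y \<in> {c<..<d}"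
  shows "v y = 0"
proof -
  define Z N where "Z = {x \<in> {c<..<d}. v x = 0}" and "N = {x \<in> {c<..<d}. v x \<noteq> 0}"
  have ev_open: "open {x \<in> {c<..<d}. P (v x)}"
    if "\<And>x. x \<in> {c<..<d} \<Longrightarrow> P (v x) \<Longrightarrow> eventually (\<lambda>y. P (v y)) (at_left x) \<and> eventually (\<lambda>y. P (v y)) (at_right x)" for P
    unfolding open_subopen[of "{x \<in> {c<..<d}. P (v x)}"]
  proof
    fix x assume x: "x \<in> {x \<in> {c<..<d}. P (v x)}"
    then have "eventually (\<lambda>y. P (v y)) (at x)" using that[of x] by (simp add: eventually_at_split)
    then have "eventually (\<lambda>y. P (v y)) (nhds x)" using x by (auto simp: eventually_at_filter elim: eventually_mono)
    then obtain T where T: "open T" "x \<in> T" "\<And>y. y \<in> T \<Longrightarrow> P (v y)" unfolding eventually_nhds by blast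
    show "\<exists>T. open T \<and> x \<in> T \<and> T \<subseteq> {x \<in> {c<..<d}. P (v x)}"
      by (rule exI[of _ "T \<inter> {c<..<d}"]) (use T x in auto)
  qed
  have lim0: "right_lim v x = 0 \<longleftrightarrow> v x = 0" "left_lim v x = 0 \<longleftrightarrow> v x = 0" if "x \<in> {c<..<d}" for x
  proof -
    have "x \<in> I" "x \<notin> range \<tau>" using that cd(2) subsetD[OF cd(2), of x] cd(3) by auto
    then show "right_lim v x = 0 \<longleftrightarrow> v x = 0" "left_lim v x = 0 \<longleftrightarrow> v x = 0" by (rule nullsol_limit_eq_0_iff[OF v])+
  qed
  have xI: "x \<in> I" if "x \<in> {c<..<d}" for x using that cd(2) by auto
  have "open Z" unfolding Z_def by (rule ev_open) (use lim0 xI nullsol_vanishes_nearby[OF v] in blast)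
  moreover have "open N" unfolding N_def
  proof (rule ev_open)
    fix x assume x: "x \<in> {c<..<d}" "v x \<noteq> 0"
    note l = Tmax_limits(1,2)[OF nullsol_Tmax[OF v] xI[OF x(1)]]
    show "eventually (\<lambda>y. v y \<noteq> 0) (at_left x) \<and> eventually (\<lambda>y. v y \<noteq> 0) (at_right x)"
      using tendsto_imp_eventually_ne[OF l(1), of 0] tendsto_imp_eventually_ne[OF l(2), of 0] lim0[OF x(1)] x(2) by simp
  qed
  moreover have "Z \<inter> N \<inter> {c<..<d} = {}" "{c<..<d} \<subseteq> Z \<union> N" by (auto simp: Z_def N_def)
  ultimately have "Z \<inter> {c<..<d} = {} \<or> N \<inter> {c<..<d} = {}" by (intro connectedD[OF connected_Ioo])
  moreover have "Z \<inter> {c<..<d} \<noteq> {}"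
  proof -
    have ends: "c \<in> I" "d \<in> I" using cd by auto
    have "\<exists>x. v x = 0 \<and> x \<in> {c<..<d}" using z
    proof
      assume "right_lim v c = 0"
      then have "eventually (\<lambda>y. v y = 0) (at_right c)" by (rule nullsol_vanishes_nearby(1)[OF v ends(1)])
      moreover have "eventually (\<lambda>y. y \<in> {c<..<d}) (at_right c)" using cd(1) by (auto intro!: eventually_at_rightI)
      ultimately have "eventually (\<lambda>y. v y = 0 \<and> y \<in> {c<..<d}) (at_right c)" by (rule eventually_conj)
      then show ?thesis by (rule eventually_happens'[rotated]) simp
    next
      assume "left_lim v d = 0"
      then have "eventually (\<lambda>y. v y = 0) (at_left d)" by (rule nullsol_vanishes_nearby(2)[OF v ends(2)])
      moreover have "eventually (\<lambda>y. y \<in> {c<..<d}) (at_left d)" using cd(1) by (auto intro!: eventually_at_leftI)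
      ultimately have "eventually (\<lambda>y. v y = 0 \<and> y \<in> {c<..<d}) (at_left d)" by (rule eventually_conj)
      then show ?thesis by (rule eventually_happens'[rotated]) simp
    qed
    then show ?thesis by (auto simp: Z_def)
  qed
  ultimately have "N \<inter> {c<..<d} = {}" by blast
  then show ?thesis using y by (auto simp: N_def)
qed

text \<open>At a zero of the solution the mass of \<open>q v\<close> vanishes, so that no half mass is lost by cutting off there.\<close>

lemma nullsol_truncate:
  assumes v: "nullsol I v" and p: "p \<in> I" "v p = 0"
  shows "nullsol I (\<lambda>y. indicator {p..} y *\<^sub>R v y)" "nullsol I (\<lambda>y. indicator {..p} y *\<^sub>R v y)"
proof -
  define h where "h y = indicator {p..} y *\<^sub>R v y" for y
  have va: "admissible v" and vs: "solves_integral I v (\<lambda>y. 0)" using v by (auto simp: nullsol_def)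
  have ha: "admissible h" unfolding h_def[abs_def] by (rule admissible_restrict[OF va]) simp
  have base: "J *v (h t - h p) = increment h (\<lambda>y. 0) p t" if t: "t \<in> I" for t
  proof (cases "p \<le> t")
    case True
    have "increment h (\<lambda>y. 0) p t = increment v (\<lambda>y. 0) p t"
      using True by (intro increment_cong) (auto simp: h_def)
    then show ?thesis using vs t p True by (auto simp: solves_integral_def h_def)
  next
    case False
    have "increment h (\<lambda>y. 0) p t = increment (\<lambda>y. 0) (\<lambda>y. 0) p t"
      using False p(2) by (intro increment_cong) (auto simp: h_def indicator_def)
    then show ?thesis using False p(2) by (simp add: h_def increment_def)
  qed
  have "solves_integral I h (\<lambda>y. 0)" unfolding solves_integral_def
  proof (intro ballI)
    fix s t assume st: "s \<in> I" "t \<in> I"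
    have "increment h (\<lambda>y. 0) s t = J *v (h t - h p) - J *v (h s - h p)"
      using increment_chain[OF p(1) st L2_fun_zero ha] base st by simp
    then show "J *v (h t - h s) = increment h (\<lambda>y. 0) s t" by (simp add: algebra_simps)
  qed
  moreover have "AE y in M. W y *v v y = 0" using v by (simp add: nullsol_def)
  then have "AE y in M. W y *v h y = 0" by eventually_elim (simp add: h_def)
  ultimately have h: "nullsol I h" using ha v by (auto simp: nullsol_def h_def)
  then show "nullsol I (\<lambda>y. indicator {p..} y *\<^sub>R v y)" by (simp add: h_def[abs_def])
  have "indicator {..p} y *\<^sub>R v y = v y - h y" for y using p(2) by (cases "y = p") (auto simp: h_def indicator_def)
  then show "nullsol I (\<lambda>y. indicator {..p} y *\<^sub>R v y)" using nullsol_diff[OF subset_refl v h] by simp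
qed

lemma limit_at_in_Nspace:
  assumes v: "nullsol I v" and v0: "v (\<tau> 0) = 0"
    and z: "0 < k \<and> (\<forall>x. \<tau> 0 \<le> x \<longrightarrow> x < \<tau> k \<longrightarrow> v x = 0) \<or> k < 0 \<and> (\<forall>x. \<tau> k < x \<longrightarrow> x \<le> \<tau> 0 \<longrightarrow> v x = 0)"
  shows "limit_at k v \<in> NS k"
proof -
  define A where "A = (if 0 < k then {\<tau> 0..} else {..\<tau> 0})"
  let ?h = "\<lambda>x. indicator A x *\<^sub>R v x"
  have h: "nullsol I ?h" using nullsol_truncate[OF v tau_in_I v0] by (simp add: A_def)
  have "eventually (\<lambda>x. x \<in> (if 0 < k then {\<tau> 0<..} else {..<\<tau> 0})) (side k)"
    using z by (intro side_in_open) (auto simp: tau_less_iff)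
  then have "eventually (\<lambda>x. v x = ?h x) (side k)" by eventually_elim (auto simp: A_def split: if_splits)
  then have "limit_at k ?h = limit_at k v"
    by (intro limit_at_eq Lim_transform_eventually[OF Tmax_tendsto_limit_at[OF nullsol_Tmax[OF v]]])
  moreover have "vanishes_before k ?h" using z by (auto simp: vanishes_before_def indicator_def A_def)
  ultimately show ?thesis unfolding Nspace_eq using h by (intro CollectI exI[of _ ?h]) simp
qed

text \<open>A representative satisfying all conditions is unique: the difference of two of them vanishes at
  \<open>\<tau> 0\<close>, hence is the sum of two null solutions supported on either side of it, and the conditions force
  these to vanish on one interval between consecutive points \<open>\<tau> k\<close> after the other.\<close>

lemma nullsol_eq_0:
  assumes v: "nullsol I v" and rep: "\<And>k. rep_cond k v"
  shows "v y = 0"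
proof -
  note vT = nullsol_Tmax[OF v]
  have perp: "cdot z (limit_at k v) = 0" if "z \<in> NS k" for z k using rep[of k] that rep_condition_iff[OF vT] by blast
  have "limit_at 0 v \<in> NS 0" unfolding Nspace_eq vanishes_before_def using v by auto
  then have "limit_at 0 v = 0" using perp cdot_self_eq_0 by blast
  then have v0: "v (\<tau> 0) = 0" using Tmax_continuous_at_tau0[OF vT] by (simp add: limit_at_def)
  have gap: "\<tau> k < \<tau> (k + 1)" "{\<tau> k..\<tau> (k + 1)} \<subseteq> I" "{\<tau> k<..<\<tau> (k + 1)} \<inter> range \<tau> = {}" for k
    by (simp add: tau_less_iff, intro Icc_subset_I tau_in_I, auto simp: tau_less_iff)
  have between: "x \<in> {\<tau> k<..<\<tau> (k + 1)} \<Longrightarrow> v x = 0" if "right_lim v (\<tau> k) = 0 \<or> left_lim v (\<tau> (k + 1)) = 0" for k x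
    by (rule nullsol_vanishes_between[OF v gap that])
  have mean: "v x = (1/2) *\<^sub>R (right_lim v x + left_lim v x)" if "x \<in> I" for x
    using Tmax_limits(3,4)[OF vT that] by (simp add: scaleR_2[symmetric])
  have up: "right_lim v (\<tau> (int k)) = 0 \<and> (\<forall>x\<in>{\<tau> 0..\<tau> (int k)}. v x = 0)" for k
  proof (induction k)
    case 0
    then show ?case using Tmax_continuous_at_tau0[OF vT] v0 by auto
  next
    case (Suc k)
    have b: "v x = 0" if "x \<in> {\<tau> (int k)<..<\<tau> (int k + 1)}" for x using between[of "int k" x] Suc that by blast
    then have z: "v x = 0" if "\<tau> 0 \<le> x" "x < \<tau> (int k + 1)" for x using Suc that by (cases "x \<le> \<tau> (int k)") auto
    have "eventually (\<lambda>x. x \<in> {\<tau> (int k)<..<\<tau> (int k + 1)}) (at_left (\<tau> (int k + 1)))"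
      using gap(1)[of "int k"] by (auto intro!: eventually_at_leftI)
    then have "eventually (\<lambda>x. v x = 0) (at_left (\<tau> (int k + 1)))" by eventually_elim (rule b)
    then have "left_lim v (\<tau> (int k + 1)) = 0" by (intro left_lim_eq tendsto_eventually)
    moreover have "limit_at (int k + 1) v \<in> NS (int k + 1)" using z by (intro limit_at_in_Nspace[OF v v0]) auto
    then have "limit_at (int k + 1) v = 0" using perp cdot_self_eq_0 by blast
    then have "right_lim v (\<tau> (int k + 1)) = 0" by (simp add: limit_at_def)
    ultimately show ?case using z mean[OF tau_in_I, of "int k + 1"] by (force simp: add.commute le_less)
  qed
  have down: "left_lim v (\<tau> (- int k)) = 0 \<and> (\<forall>x\<in>{\<tau> (- int k)..\<tau> 0}. v x = 0)" for k
  proof (induction k)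
    case 0
    then show ?case using Tmax_continuous_at_tau0[OF vT] v0 by auto
  next
    case (Suc k)
    define j where "j = - int k - 1"
    have jk: "- int k = j + 1" "- int (Suc k) = j" by (simp_all add: j_def)
    note IH = Suc[unfolded jk]
    have j0: "j < 0" by (simp add: j_def)
    have b: "v x = 0" if "x \<in> {\<tau> j<..<\<tau> (j + 1)}" for x using between[of j x] IH that by blast
    then have z: "v x = 0" if "\<tau> j < x" "x \<le> \<tau> 0" for x using IH that by (cases "x < \<tau> (j + 1)") auto
    have "eventually (\<lambda>x. x \<in> {\<tau> j<..<\<tau> (j + 1)}) (at_right (\<tau> j))"
      using gap(1)[of j] by (auto intro!: eventually_at_rightI)
    then have "eventually (\<lambda>x. v x = 0) (at_right (\<tau> j))" by eventually_elim (rule b)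
    then have "right_lim v (\<tau> j) = 0" by (intro right_lim_eq tendsto_eventually)
    moreover have "limit_at j v \<in> NS j" using z j0 by (intro limit_at_in_Nspace[OF v v0]) auto
    then have "limit_at j v = 0" using perp cdot_self_eq_0 by blast
    then have "left_lim v (\<tau> j) = 0" using j0 by (simp add: limit_at_def)
    ultimately show ?case unfolding jk using z mean[OF tau_in_I, of j] by (force simp: le_less)
  qed
  show ?thesis
  proof (cases "y \<in> I")
    case True
    obtain m where "\<tau> (- int m - 1) < y" "y < \<tau> (int m + 1)"
      using window_exhausts[OF True True] by (auto simp: window_def)
    moreover have e: "int (Suc m) = int m + 1" "- int (Suc m) = - int m - 1" by simp_all
    ultimately show ?thesis using up[of "Suc m"] down[of "Suc m"] unfolding e by (cases "y \<le> \<tau> 0") auto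
  next
    case False
    then show ?thesis using v by (simp add: nullsol_def)
  qed
qed

end

context representatives
begin

lemma nullsol_limit_at: "nullsol I h \<Longrightarrow> (h \<longlongrightarrow> limit_at k h) (side k)"
  by (rule Tmax_tendsto_limit_at[OF nullsol_Tmax])

lemma limit_at_cong: "eventually (\<lambda>y. u y = v y) (side k) \<Longrightarrow> limit_at k u = limit_at k v" if "(u \<longlongrightarrow> l) (side k)"
  using limit_at_eq[OF that] limit_at_eq[OF Lim_transform_eventually[OF that]] by simp

lemma nullsol_sum:
  "finite A \<Longrightarrow> (\<And>e. e \<in> A \<Longrightarrow> nullsol I (H e)) \<Longrightarrow> nullsol I (\<lambda>y. \<Sum>e\<in>A. r e *\<^sub>R H e y)"
proof (induction A rule: finite_induct)
  case empty
  then show ?case using nullsol_zero by simp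
next
  case (insert e A)
  then show ?case using nullsol_add[OF subset_refl nullsol_scaleR, of "H e" "\<lambda>y. \<Sum>e\<in>A. r e *\<^sub>R H e y" "r e"] by simp
qed

lemma subspace_Nspace: "subspace (NS k)"
  and Nspace_cscale: "z \<in> NS k \<Longrightarrow> c *s z \<in> NS k"
proof -
  have add: "x + y \<in> NS k" if xy: "x \<in> NS k" "y \<in> NS k" for x y
  proof -
    obtain g h where gh: "nullsol I g" "vanishes_before k g" "x = limit_at k g"
      "nullsol I h" "vanishes_before k h" "y = limit_at k h" using xy unfolding Nspace_eq by blast
    have "limit_at k (\<lambda>t. g t + h t) = x + y"
      unfolding gh(3,6) by (intro limit_at_eq tendsto_add nullsol_limit_at gh)
    moreover have "vanishes_before k (\<lambda>t. g t + h t)" using gh(2,5) by (simp add: vanishes_before_def)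
    ultimately show ?thesis unfolding Nspace_eq using nullsol_add[OF subset_refl gh(1,4)]
      by (intro CollectI exI[of _ "\<lambda>t. g t + h t"]) simp
  qed
  have scale: "c *s x \<in> NS k" if x: "x \<in> NS k" for x c
  proof -
    obtain g where g: "nullsol I g" "vanishes_before k g" "x = limit_at k g" using x unfolding Nspace_eq by blast
    have "((\<lambda>t. c *s g t) \<longlongrightarrow> c *s x) (side k)"
      unfolding g(3) by (rule bounded_linear.tendsto[OF bounded_linear_cscale nullsol_limit_at[OF g(1)]])
    then have "limit_at k (\<lambda>t. c *s g t) = c *s x" by (rule limit_at_eq)
    moreover have "vanishes_before k (\<lambda>t. c *s g t)" using g(2) by (simp add: vanishes_before_def)
    ultimately show ?thesis unfolding Nspace_eq using nullsol_cscale[OF g(1)]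
      by (intro CollectI exI[of _ "\<lambda>t. c *s g t"]) simp
  qed
  show "z \<in> NS k \<Longrightarrow> c *s z \<in> NS k" by (rule scale)
  have "limit_at k (\<lambda>_. 0) = 0" by (rule limit_at_eq) simp
  then have zero: "0 \<in> NS k"
    unfolding Nspace_eq using nullsol_zero by (intro CollectI exI[of _ "\<lambda>_. 0"]) (simp add: vanishes_before_def)
  show "subspace (NS k)" unfolding subspace_def scaleR_eq_cscale using zero add scale by blast
qed

text \<open>Orthogonality for the real inner product gives orthogonality for \<open>cdot\<close>, as \<open>N\<^sub>k\<close> is closed under
  multiplication by \<open>\<i>\<close>.\<close>

lemma Nspace_projection:
  "\<exists>z\<in>NS k. (\<forall>y\<in>NS k. cdot y (x - z) = 0) \<and> norm z \<le> norm x"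
proof -
  have sp: "span (NS k) = NS k" using subspace_Nspace by (simp add: span_eq_iff)
  obtain z y where zy: "z \<in> NS k" "\<And>v. v \<in> NS k \<Longrightarrow> orthogonal y v" "x = z + y"
    using orthogonal_subspace_decomp_exists[of "NS k" x] unfolding sp by metis
  have re: "Re (cdot v y) = 0" if "v \<in> NS k" for v
    using zy(2)[OF that] by (simp add: Re_cdot orthogonal_def inner_commute)
  have "cdot v y = 0" if "v \<in> NS k" for v
  proof -
    have "Re (cdot (\<i> *s v) y) = Im (cdot v y)" by (simp add: cdot_cscale_left)
    then show ?thesis using re[OF that] re[OF Nspace_cscale[OF that, of \<i>]] by (simp add: complex_eq_iff)
  qed
  moreover have "(norm x)\<^sup>2 = (norm z)\<^sup>2 + (norm y)\<^sup>2"
    unfolding zy(3) using zy(2)[OF zy(1)] by (intro norm_add_Pythagorean) (simp add: orthogonal_commute)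
  then have "(norm z)\<^sup>2 \<le> (norm x)\<^sup>2" by simp
  then have "norm z \<le> norm x" by (rule power2_le_imp_le) simp
  ultimately show ?thesis using zy(1,3) by (intro bexI[of _ z]) auto
qed

lemma nullsol_bounded_on_window:
  assumes "nullsol I h" shows "\<exists>K\<ge>0. \<forall>y\<in>window m. norm (h y) \<le> K"
proof -
  have "bounded (h ` {\<tau> (- int m - 1)..\<tau> (int m + 1)})"
    using assms window_closure[of m] by (simp add: nullsol_def admissible_def locally_bounded_on_def)
  then obtain K where K: "\<And>y. y \<in> {\<tau> (- int m - 1)..\<tau> (int m + 1)} \<Longrightarrow> norm (h y) \<le> K" unfolding bounded_iff by blast
  then have "norm (h y) \<le> \<bar>K\<bar>" if "y \<in> window m" for y using that window_facts(1)[of m] by (meson abs_ge_self order_trans subsetD)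
  then show ?thesis by (intro exI[of _ "\<bar>K\<bar>"]) simp
qed

text \<open>The limits in \<open>N\<^sub>k\<close> are lifted linearly to null solutions by choosing lifts of an orthonormal basis.\<close>

lemma Nspace_lift:
  "\<exists>D\<ge>0. \<forall>c\<in>NS k. \<exists>h. nullsol I h \<and> vanishes_before k h \<and> limit_at k h = c \<and>
     (\<forall>y\<in>window m. norm (h y) \<le> D * norm c)"
proof -
  obtain A where A: "A \<subseteq> NS k" "pairwise orthogonal A" "\<And>x. x \<in> A \<Longrightarrow> norm x = 1"
    "independent A" "span A = NS k" using orthonormal_basis_subspace[OF subspace_Nspace] by metis
  have fin: "finite A" using A(4) by (rule independent_imp_finite)
  have "\<forall>e\<in>A. \<exists>h. nullsol I h \<and> vanishes_before k h \<and> limit_at k h = e" using A(1) unfolding Nspace_eq by blast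
  then obtain H where H: "\<And>e. e \<in> A \<Longrightarrow> nullsol I (H e)" "\<And>e. e \<in> A \<Longrightarrow> vanishes_before k (H e)"
    "\<And>e. e \<in> A \<Longrightarrow> limit_at k (H e) = e" by metis
  have "\<forall>e\<in>A. \<exists>K\<ge>0. \<forall>y\<in>window m. norm (H e y) \<le> K" using nullsol_bounded_on_window H(1) by blast
  then obtain K where K: "\<And>e. e \<in> A \<Longrightarrow> 0 \<le> K e" "\<And>e y. e \<in> A \<Longrightarrow> y \<in> window m \<Longrightarrow> norm (H e y) \<le> K e" by metis
  have "\<exists>h. nullsol I h \<and> vanishes_before k h \<and> limit_at k h = c \<and> (\<forall>y\<in>window m. norm (h y) \<le> (\<Sum>e\<in>A. K e) * norm c)"
    if c: "c \<in> NS k" for c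
  proof (intro exI conjI ballI)
    let ?h = "\<lambda>y. \<Sum>e\<in>A. (c \<bullet> e) *\<^sub>R H e y"
    show "nullsol I ?h" by (rule nullsol_sum[OF fin H(1)])
    show "vanishes_before k ?h" using H(2) unfolding vanishes_before_def by (auto intro!: sum.neutral)
    have "(?h \<longlongrightarrow> (\<Sum>e\<in>A. (c \<bullet> e) *\<^sub>R e)) (side k)"
      using nullsol_limit_at[OF H(1), of _ k] H(3) by (intro tendsto_sum tendsto_scaleR tendsto_const) auto
    also have "(\<Sum>e\<in>A. (c \<bullet> e) *\<^sub>R e) = c"
      by (rule orthonormal_basis_expand[OF A(2,3)]) (use c A(5) fin in auto)
    finally show "limit_at k ?h = c" by (rule limit_at_eq)
    fix y assume y: "y \<in> window m"
    have "norm (?h y) \<le> (\<Sum>e\<in>A. norm c * K e)"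
    proof (rule sum_norm_le)
      fix e assume e: "e \<in> A"
      have "\<bar>c \<bullet> e\<bar> \<le> norm c * norm e" by (rule Cauchy_Schwarz_ineq2)
      then show "norm ((c \<bullet> e) *\<^sub>R H e y) \<le> norm c * K e"
        using K(2)[OF e y] A(3)[OF e] K(1)[OF e] by (auto intro!: mult_mono)
    qed
    then show "norm (?h y) \<le> (\<Sum>e\<in>A. K e) * norm c" by (simp add: sum_distrib_left mult.commute)
  qed
  then show ?thesis using K(1) by (intro exI[of _ "\<Sum>e\<in>A. K e"]) (auto intro: sum_nonneg)
qed

lemma limit_at_bound:
  assumes u: "(u, f) \<in> Tmax_pairs" and k: "\<tau> k \<in> window m" and e: "\<And>y. y \<in> window m \<Longrightarrow> norm (u y) \<le> e"
  shows "norm (limit_at k u) \<le> e"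
proof (rule tendsto_upperbound[OF tendsto_norm[OF Tmax_tendsto_limit_at[OF u]] _ side_bot])
  show "eventually (\<lambda>y. norm (u y) \<le> e) (side k)"
    using side_in_open[OF window_facts(4) k] by eventually_elim (rule e)
qed

lemma vanishes_before_limit_at:
  assumes "vanishes_before k h" "(0 < k \<and> i < k) \<or> (k < 0 \<and> k < i)"
  shows "limit_at i h = 0"
proof (rule limit_at_eq, rule tendsto_eventually)
  show "eventually (\<lambda>y. h y = 0) (side i)"
  proof (cases "0 < k")
    case True
    then have "eventually (\<lambda>y. y \<in> {..<\<tau> k}) (side i)" using assms by (intro side_in_open) (auto simp: tau_less_iff)
    then show ?thesis by eventually_elim (use assms(1) True in \<open>auto simp: vanishes_before_def\<close>)
  next
    case False
    then have "eventually (\<lambda>y. y \<in> {\<tau> k<..}) (side i)" using assms by (intro side_in_open) (auto simp: tau_less_iff)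
    then show ?thesis by eventually_elim (use assms False in \<open>auto simp: vanishes_before_def\<close>)
  qed
qed

lemma limit_at_diff:
  assumes "(u, f) \<in> Tmax_pairs" "nullsol I h"
  shows "limit_at k (\<lambda>y. u y - h y) = limit_at k u - limit_at k h"
  by (intro limit_at_eq tendsto_diff Tmax_tendsto_limit_at[OF assms(1)] nullsol_limit_at assms(2))

text \<open>Linear control of the correction \<open>h\<close> by the corrected function \<open>u\<close> on a window.\<close>

definition controls :: "nat \<Rightarrow> real \<Rightarrow> (real \<Rightarrow> complex^'n) \<Rightarrow> (real \<Rightarrow> complex^'n) \<Rightarrow> bool" where
  "controls m D u h \<longleftrightarrow> (\<forall>e. (\<forall>y\<in>window m. norm (u y) \<le> e) \<longrightarrow> (\<forall>y\<in>window m. norm (h y) \<le> D * e))"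

lemma controls_add:
  assumes h: "controls m C u h" and k: "controls m D (\<lambda>y. u y - h y) k"
  shows "controls m (C + D * (1 + C)) u (\<lambda>y. h y + k y)"
  unfolding controls_def
proof (intro allI impI ballI)
  fix e y assume e: "\<forall>y\<in>window m. norm (u y) \<le> e" and y: "y \<in> window m"
  have b: "norm (h y) \<le> C * e" if "y \<in> window m" for y using h e that unfolding controls_def by blast
  have "norm (u y - h y) \<le> e + C * e" if "y \<in> window m" for y
    using norm_triangle_ineq4[of "u y" "h y"] b[OF that] e that by force
  then have "norm (k y) \<le> D * (e + C * e)" using k y unfolding controls_def by blast
  then show "norm (h y + k y) \<le> (C + D * (1 + C)) * e"
    using b[OF y] norm_triangle_ineq[of "h y" "k y"] by (simp add: algebra_simps)
qed

text \<open>Subtracting a null solution that vanishes before \<open>\<tau> k\<close> establishes the condition at \<open>\<tau> k\<close> without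
  disturbing the conditions closer to \<open>\<tau> 0\<close>.\<close>

lemma correct_one:
  "\<exists>D\<ge>0. \<forall>u f. (u, f) \<in> Tmax_pairs \<longrightarrow> (\<exists>h. nullsol I h \<and> vanishes_before k h \<and>
     rep_cond k (\<lambda>y. u y - h y) \<and>
     (\<tau> k \<in> window m \<longrightarrow> controls m D u h))"
proof -
  obtain D where D: "0 \<le> D" "\<And>c. c \<in> NS k \<Longrightarrow> \<exists>h. nullsol I h \<and> vanishes_before k h \<and> limit_at k h = c \<and>
     (\<forall>y\<in>window m. norm (h y) \<le> D * norm c)" using Nspace_lift[of k m] by blast
  show ?thesis
  proof (intro exI[of _ D] conjI D(1) allI impI)
    fix u f assume u: "(u, f) \<in> Tmax_pairs"
    obtain z where z: "z \<in> NS k" "\<And>y. y \<in> NS k \<Longrightarrow> cdot y (limit_at k u - z) = 0"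
      "norm z \<le> norm (limit_at k u)" using Nspace_projection by blast
    obtain h where h: "nullsol I h" "vanishes_before k h" "limit_at k h = z" "\<And>y. y \<in> window m \<Longrightarrow> norm (h y) \<le> D * norm z"
      using D(2)[OF z(1)] by blast
    have "rep_cond k (\<lambda>y. u y - h y)"
      unfolding rep_condition_iff[OF Tmax_fun_diff_nullsol[OF u h(1)]] limit_at_diff[OF u h(1)] h(3) using z(2) by blast
    moreover have "controls m D u h" if k: "\<tau> k \<in> window m" unfolding controls_def
    proof (intro allI impI ballI)
      fix e y assume e: "\<forall>y\<in>window m. norm (u y) \<le> e" and y: "y \<in> window m"
      have "norm (limit_at k u) \<le> e" using limit_at_bound[OF u k] e by blast
      then have "D * norm z \<le> D * e" using z(3) D(1) by (intro mult_left_mono) auto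
      then show "norm (h y) \<le> D * e" using h(4)[OF y] by simp
    qed
    ultimately show "\<exists>h. nullsol I h \<and> vanishes_before k h \<and> rep_cond k (\<lambda>y. u y - h y) \<and>
     (\<tau> k \<in> window m \<longrightarrow> controls m D u h)" using h(1,2) by blast
  qed
qed

definition corrects :: "nat \<Rightarrow> (real \<Rightarrow> complex^'n) \<Rightarrow> bool" where
  "corrects j u \<longleftrightarrow> (\<forall>k. \<bar>k\<bar> \<le> int j \<longrightarrow> rep_cond k u)"

text \<open>The corrections at \<open>\<tau> j\<close> and at \<open>\<tau> (- j)\<close> act on disjoint sets for positive \<open>j\<close>. For \<open>j = 0\<close> the second
  one is made for a function that satisfies the condition already, and preserves it.\<close>

lemma correct_pair:
  "\<exists>D\<ge>0. \<forall>u f. (u, f) \<in> Tmax_pairs \<longrightarrow> (j = 0 \<or> corrects (j - 1) u) \<longrightarrow> (\<exists>h. nullsol I h \<and>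
     corrects j (\<lambda>y. u y - h y) \<and> (\<forall>y. \<tau> (- int j) < y \<longrightarrow> y < \<tau> (int j) \<longrightarrow> h y = 0) \<and>
     (j \<le> m \<longrightarrow> controls m D u h))"
proof -
  obtain D1 where D1: "0 \<le> D1" "\<And>u f. (u, f) \<in> Tmax_pairs \<Longrightarrow> \<exists>h. nullsol I h \<and> vanishes_before (int j) h \<and>
     rep_cond (int j) (\<lambda>y. u y - h y) \<and>
     (\<tau> (int j) \<in> window m \<longrightarrow> controls m D1 u h)" using correct_one[of "int j" m] by blast
  obtain D2 where D2: "0 \<le> D2" "\<And>u f. (u, f) \<in> Tmax_pairs \<Longrightarrow> \<exists>h. nullsol I h \<and> vanishes_before (- int j) h \<and>
     rep_cond (- int j) (\<lambda>y. u y - h y) \<and>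
     (\<tau> (- int j) \<in> window m \<longrightarrow> controls m D2 u h)" using correct_one[of "- int j" m] by blast
  show ?thesis
  proof (intro exI[of _ "D1 + D2 * (1 + D1)"] conjI allI impI)
    show "0 \<le> D1 + D2 * (1 + D1)" using D1(1) D2(1) by simp
    fix u f assume u: "(u, f) \<in> Tmax_pairs" and prev: "j = 0 \<or> corrects (j - 1) u"
    obtain h1 where h1: "nullsol I h1" "vanishes_before (int j) h1" "rep_cond (int j) (\<lambda>y. u y - h1 y)"
      "\<tau> (int j) \<in> window m \<Longrightarrow> controls m D1 u h1" using D1(2)[OF u] by blast
    note u1 = Tmax_fun_diff_nullsol[OF u h1(1)]
    obtain h2 where h2: "nullsol I h2" "vanishes_before (- int j) h2" "rep_cond (- int j) (\<lambda>y. u y - h1 y - h2 y)"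
      "\<tau> (- int j) \<in> window m \<Longrightarrow> controls m D2 (\<lambda>y. u y - h1 y) h2"
      using D2(2)[OF u1] by blast
    note u2 = Tmax_fun_diff_nullsol[OF u1 h2(1)]
    define h where "h y = h1 y + h2 y" for y
    have h: "nullsol I h" unfolding h_def[abs_def] by (rule nullsol_add[OF subset_refl h1(1) h2(1)])
    have uh: "(\<lambda>y. u y - h y) = (\<lambda>y. u y - h1 y - h2 y)" by (simp add: h_def fun_eq_iff)
    have lim: "limit_at k (\<lambda>y. u y - h1 y - h2 y) = limit_at k (\<lambda>y. u y - h1 y) - limit_at k h2"
      "limit_at k (\<lambda>y. u y - h1 y) = limit_at k u - limit_at k h1" for k
      by (rule limit_at_diff[OF u1 h2(1)], rule limit_at_diff[OF u h1(1)])
    have "rep_cond k (\<lambda>y. u y - h y)" if k: "\<bar>k\<bar> \<le> int j" for k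
    proof (cases "k = - int j")
      case True
      then show ?thesis using h2(3) by (simp add: uh)
    next
      case False
      then have j: "0 < j" using k by (cases j) auto
      have z2: "limit_at k h2 = 0" using False k j by (intro vanishes_before_limit_at[OF h2(2)]) auto
      show ?thesis
      proof (cases "k = int j")
        case True
        then show ?thesis using h1(3) unfolding uh rep_condition_iff[OF u2] rep_condition_iff[OF u1] lim(1) z2 by simp
      next
        case ne: False
        have z1: "limit_at k h1 = 0" using ne k j by (intro vanishes_before_limit_at[OF h1(2)]) auto
        have "rep_cond k u" using prev j False ne k by (auto simp: corrects_def)
        then show ?thesis unfolding uh rep_condition_iff[OF u2] rep_condition_iff[OF u] lim z1 z2 by simp
      qed
    qed
    then have "corrects j (\<lambda>y. u y - h y)" by (simp add: corrects_def)
    moreover have "h y = 0" if "\<tau> (- int j) < y" "y < \<tau> (int j)" for y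
    proof -
      have "\<tau> (- int j) < \<tau> (int j)" using that by simp
      then have "0 < j" by (simp add: tau_less_iff)
      then show ?thesis using h1(2) h2(2) that by (auto simp: vanishes_before_def h_def)
    qed
    moreover have "controls m (D1 + D2 * (1 + D1)) u h" if "j \<le> m"
      unfolding h_def[abs_def] using that by (intro controls_add h1(4) h2(4) tau_in_window) auto
    ultimately show "\<exists>h. nullsol I h \<and> corrects j (\<lambda>y. u y - h y) \<and> (\<forall>y. \<tau> (- int j) < y \<longrightarrow> y < \<tau> (int j) \<longrightarrow> h y = 0) \<and>
     (j \<le> m \<longrightarrow> controls m (D1 + D2 * (1 + D1)) u h)" using h by blast
  qed
qed

lemma correct_window:
  assumes "j \<le> m"
  shows "\<exists>C\<ge>0. \<forall>u f. (u, f) \<in> Tmax_pairs \<longrightarrow> (\<exists>h. nullsol I h \<and> corrects j (\<lambda>y. u y - h y) \<and>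
     controls m C u h)"
  using assms
proof (induction j)
  case 0
  show ?case using correct_pair[of 0 m] by auto
next
  case (Suc j)
  obtain C where C: "0 \<le> C" "\<And>u f. (u, f) \<in> Tmax_pairs \<Longrightarrow> \<exists>h. nullsol I h \<and> corrects j (\<lambda>y. u y - h y) \<and>
     controls m C u h" using Suc.IH[OF Suc_leD[OF Suc.prems]] by blast
  obtain D where D: "0 \<le> D" "\<And>u f. (u, f) \<in> Tmax_pairs \<Longrightarrow> Suc j = 0 \<or> corrects (Suc j - 1) u \<Longrightarrow> \<exists>h. nullsol I h \<and> corrects (Suc j) (\<lambda>y. u y - h y) \<and>
     controls m D u h" using correct_pair[of "Suc j" m] Suc.prems by blast
  show ?case
  proof (intro exI[of _ "C + D * (1 + C)"] conjI allI impI)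
    show "0 \<le> C + D * (1 + C)" using C(1) D(1) by simp
    fix u f assume u: "(u, f) \<in> Tmax_pairs"
    obtain h where h: "nullsol I h" "corrects j (\<lambda>y. u y - h y)"
      "controls m C u h" using C(2)[OF u] by blast
    obtain k where k: "nullsol I k" "corrects (Suc j) (\<lambda>y. u y - h y - k y)"
      "controls m D (\<lambda>y. u y - h y) k" using D(2)[OF Tmax_fun_diff_nullsol[OF u h(1)]] h(2) by auto
    note controls_add[OF h(3) k(3)]
    moreover have "corrects (Suc j) (\<lambda>y. u y - (h y + k y))" using k(2) by (simp add: algebra_simps)
    ultimately show "\<exists>h. nullsol I h \<and> corrects (Suc j) (\<lambda>y. u y - h y) \<and>
     controls m (C + D * (1 + C)) u h"
      using nullsol_add[OF subset_refl h(1) k(1)] by (intro exI[of _ "\<lambda>y. h y + k y"]) simp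
  qed
qed

text \<open>The corrections beyond a window no longer change the function on it, so that they can be carried out
  for all \<open>\<tau> k\<close>.\<close>

lemma exists_representative:
  "\<exists>C\<ge>0. \<forall>u f. (u, f) \<in> Tmax_pairs \<longrightarrow> (\<exists>h. nullsol I h \<and> (\<forall>k. rep_cond k (\<lambda>y. u y - h y)) \<and>
     controls m C u h)"
proof -
  obtain C where C: "0 \<le> C" "\<And>u f. (u, f) \<in> Tmax_pairs \<Longrightarrow> \<exists>h. nullsol I h \<and> corrects m (\<lambda>y. u y - h y) \<and>
     controls m C u h" using correct_window[OF order_refl, of m] by blast
  show ?thesis
  proof (intro exI[of _ C] conjI C(1) allI impI)
    fix u f assume u: "(u, f) \<in> Tmax_pairs"
    obtain h where h: "nullsol I h" "corrects m (\<lambda>y. u y - h y)"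
      "controls m C u h" using C(2)[OF u] by blast
    have "\<exists>H. \<forall>i. (nullsol I (H i) \<and> corrects (m + i) (\<lambda>y. u y - H i y) \<and> (i = 0 \<longrightarrow> H i = h)) \<and>
        (\<forall>y\<in>window (m + i). H (Suc i) y = H i y)"
    proof (rule dependent_nat_choice)
      show "\<exists>k. nullsol I k \<and> corrects (m + 0) (\<lambda>y. u y - k y) \<and> (0 = (0::nat) \<longrightarrow> k = h)" using h by auto
      fix g i assume g: "nullsol I g \<and> corrects (m + i) (\<lambda>y. u y - g y) \<and> (i = 0 \<longrightarrow> g = h)"
      then have gT: "(\<lambda>y. u y - g y, f) \<in> Tmax_pairs" using Tmax_fun_diff_nullsol[OF u] by blast
      obtain k where k: "nullsol I k" "corrects (Suc (m + i)) (\<lambda>y. u y - g y - k y)"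
        "\<And>y. \<tau> (- int (Suc (m + i))) < y \<Longrightarrow> y < \<tau> (int (Suc (m + i))) \<Longrightarrow> k y = 0"
        using correct_pair[of "Suc (m + i)" m] gT g by auto
      have "k y = 0" if "y \<in> window (m + i)" for y using that by (intro k(3)) (auto simp: window_def add.commute)
      moreover have "corrects (m + Suc i) (\<lambda>y. u y - (g y + k y))" using k(2) by (simp add: algebra_simps)
      ultimately show "\<exists>k. (nullsol I k \<and> corrects (m + Suc i) (\<lambda>y. u y - k y) \<and> (Suc i = 0 \<longrightarrow> k = h)) \<and> (\<forall>y\<in>window (m + i). k y = g y)"
        using nullsol_add[OF subset_refl _ k(1), of g] g by (intro exI[of _ "\<lambda>y. g y + k y"]) simp
    qed
    then obtain H where H: "\<And>i. nullsol I (H i)" "\<And>i. corrects (m + i) (\<lambda>y. u y - H i y)" "H 0 = h"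
      "\<And>i y. y \<in> window (m + i) \<Longrightarrow> H (Suc i) y = H i y" by blast
    have "\<exists>g. nullsol I g \<and> (\<forall>i. \<forall>y\<in>window (m + i). g y = H i y)"
      by (rule nullsol_glue[OF H(1) window_facts(5)]) (rule H(4))
    then obtain g where g: "nullsol I g" and gH: "\<And>i y. y \<in> window (m + i) \<Longrightarrow> g y = H i y" by blast
    have gh: "g y = h y" if "y \<in> window m" for y using gH[of y 0] that H(3) by simp
    have "rep_cond k (\<lambda>y. u y - g y)" for k
    proof -
      define i where "i = nat \<bar>k\<bar>"
      have i: "\<bar>k\<bar> \<le> int (m + i)" by (simp_all add: i_def)
      have "eventually (\<lambda>y. y \<in> window (m + i)) (side k)" by (intro side_in_open window_facts(4) tau_in_window i)
      then have "eventually (\<lambda>y. H i y = g y) (side k)" by eventually_elim (simp add: gH)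
      then have "limit_at k (H i) = limit_at k g" by (rule limit_at_cong[OF nullsol_limit_at[OF H(1)]])
      then have "limit_at k (\<lambda>y. u y - H i y) = limit_at k (\<lambda>y. u y - g y)"
        using limit_at_diff[OF u] H(1) g by simp
      moreover have "rep_cond k (\<lambda>y. u y - H i y)" using H(2)[of i] i by (simp add: corrects_def)
      ultimately show ?thesis using rep_condition_iff[OF Tmax_fun_diff_nullsol[OF u]] H(1) g by simp
    qed
    then show "\<exists>h. nullsol I h \<and> (\<forall>k. rep_cond k (\<lambda>y. u y - h y)) \<and>
      controls m C u h" using g gh h(3) by (intro exI[of _ g]) (simp add: controls_def)
  qed
qed

lemma rep_condition_diff:
  assumes "(u, f) \<in> Tmax_pairs" "nullsol I h"
    and "rep_cond k (\<lambda>y. u y - h y)" "rep_cond k u"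
  shows "rep_cond k h"
proof -
  have "cdot z (limit_at k h) = 0" if z: "z \<in> NS k" for z
  proof -
    have "cdot z (limit_at k u) = 0" "cdot z (limit_at k u - limit_at k h) = 0"
      using assms(3,4) z unfolding rep_condition_iff[OF assms(1)] rep_condition_iff[OF Tmax_fun_diff_nullsol[OF assms(1,2)]]
        limit_at_diff[OF assms(1,2)] by blast+
    then show ?thesis by (simp add: cdot_diff_right)
  qed
  then show ?thesis unfolding rep_condition_iff[OF nullsol_Tmax[OF assms(2)]] by blast
qed

text \<open>Some null solution \<open>g\<close> is close to \<open>v\<close>, and a null solution \<open>h\<close> with a bound corrects \<open>v - g\<close>. By
  uniqueness the corrected function is \<open>v\<close> itself, so that \<open>g + h = 0\<close> and \<open>v = (v - g) - h\<close> is bounded.\<close>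

lemma representative_bound:
  assumes x: "x \<in> I"
  obtains C where "0 \<le> C" "\<And>v f. (v, f) \<in> Tmax_pairs \<Longrightarrow> (\<And>k. rep_cond k v) \<Longrightarrow>
     norm (v x) \<le> C * (nrm v + nrm f)"
proof -
  obtain m where m: "x \<in> window m" using window_exhausts[OF x x] by blast
  obtain C1 where C1: "0 \<le> C1" "\<And>u f. u \<in> L2 \<Longrightarrow> f \<in> L2 \<Longrightarrow> admissible u \<Longrightarrow> solves_integral I u f \<Longrightarrow>
     \<exists>g. nullsol I g \<and> (\<forall>y\<in>window m. norm (u y - g y) \<le> C1 * (nrm u + nrm f))" using distance_to_global_nullsol[of m] by metis
  obtain C2 where C2: "0 \<le> C2" "\<And>u f. (u, f) \<in> Tmax_pairs \<Longrightarrow> \<exists>h. nullsol I h \<and> (\<forall>k. rep_cond k (\<lambda>y. u y - h y)) \<and>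
     controls m C2 u h" using exists_representative[of m] by blast
  show thesis
  proof (rule that[of "C1 + C2 * C1"])
    show "0 \<le> C1 + C2 * C1" using C1(1) C2(1) by simp
    fix v f assume v: "(v, f) \<in> Tmax_pairs" and rep: "\<And>k. rep_cond k v"
    define e where "e = C1 * (nrm v + nrm f)"
    obtain g where g: "nullsol I g" "\<And>y. y \<in> window m \<Longrightarrow> norm (v y - g y) \<le> e"
      using C1(2)[of v f] v unfolding Tmax_fun_iff e_def by blast
    obtain h where h: "nullsol I h" "\<And>k. rep_cond k (\<lambda>y. v y - g y - h y)"
      "controls m C2 (\<lambda>y. v y - g y) h" using C2(2)[OF Tmax_fun_diff_nullsol[OF v g(1)]] by blast
    note gh = nullsol_add[OF subset_refl g(1) h(1)]
    \<comment> \<open>Both \<open>v\<close> and \<open>v - g - h\<close> satisfy all the conditions.\<close>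
    have "g x + h x = 0"
      by (rule nullsol_eq_0[OF gh rep_condition_diff[OF v gh _ rep]]) (use h(2) in \<open>simp add: algebra_simps\<close>)
    then have "v x = (v x - g x) - h x" by (simp add: algebra_simps)
    then have "norm (v x) \<le> norm (v x - g x) + norm (h x)" by (metis norm_triangle_ineq4)
    also have "\<dots> \<le> e + C2 * e" using g(2) h(3) m unfolding controls_def by (intro add_mono) blast+
    finally show "norm (v x) \<le> (C1 + C2 * C1) * (nrm v + nrm f)" by (simp add: e_def algebra_simps)
  qed
qed

end

section \<open>Riesz representation and the Green's function\<close>

context weighted_interval
begin

lemma L2_inner_tendsto_left:
  assumes "\<And>j. F j \<in> L2" "f \<in> L2" "g \<in> L2" "(\<lambda>j. nrm (\<lambda>y. F j y - f y)) \<longlonglongrightarrow> 0"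
  shows "(\<lambda>j. ip (F j) g) \<longlonglongrightarrow> ip f g"
proof (rule LIM_zero_cancel, rule Lim_null_comparison)
  show "eventually (\<lambda>j. norm (ip (F j) g - ip f g) \<le> nrm (\<lambda>y. F j y - f y) * nrm g) sequentially"
    using L2_cauchy_schwarz_nrm[OF L2_fun_diff[OF assms(1,2)] assms(3)] L2_inner_diff_left[OF assms(1-3)] by simp
  show "(\<lambda>j. nrm (\<lambda>y. F j y - f y) * nrm g) \<longlonglongrightarrow> 0" using tendsto_mult_left_zero[OF assms(4)] .
qed

lemma sq_add_cscale:
  assumes "f \<in> L2" "g \<in> L2"
  shows "sq (\<lambda>y. f y + c *s g y) = sq f + 2 * Re (c * ip f g) + (norm c)\<^sup>2 * sq g"
  using sq_add[OF assms(1) L2_fun_cscale[OF assms(2)]] by (simp add: L2_inner_cscale_right sq_cscale)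

text \<open>Closed subspaces of \<open>L\<^sup>2(w) \<times> L\<^sup>2(w)\<close>, on the level of functions. Working with pairs serves both the
  graph of a relation and, with the second component ignored, the space itself.\<close>

definition pairs_subspace :: "((real \<Rightarrow> complex^'n) \<times> (real \<Rightarrow> complex^'n)) set \<Rightarrow> bool" where
  "pairs_subspace D \<longleftrightarrow> D \<subseteq> L2 \<times> L2 \<and> (\<lambda>y. 0, \<lambda>y. 0) \<in> D \<and>
     (\<forall>u f v g c. (u, f) \<in> D \<longrightarrow> (v, g) \<in> D \<longrightarrow> (\<lambda>y. u y + c *s v y, \<lambda>y. f y + c *s g y) \<in> D) \<and>
     (\<forall>U F u f. (\<forall>j::nat. (U j, F j) \<in> D) \<longrightarrow> u \<in> L2 \<longrightarrow> f \<in> L2 \<longrightarrow>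
        (\<lambda>j. nrm (\<lambda>y. U j y - u y)) \<longlonglongrightarrow> 0 \<longrightarrow> (\<lambda>j. nrm (\<lambda>y. F j y - f y)) \<longlonglongrightarrow> 0 \<longrightarrow> (u, f) \<in> D)"

text \<open>The Riesz representation theorem for a closed space of pairs: a minimising sequence of
  \<open>\<parallel>s\<parallel>\<^sup>2 - 2 Re l(s)\<close> is a Cauchy sequence by the parallelogram law, and its limit represents \<open>l\<close>.\<close>

lemma riesz_representation:
  assumes D: "pairs_subspace D"
    and lin: "\<And>u f v g c. (u, f) \<in> D \<Longrightarrow> (v, g) \<in> D \<Longrightarrow> l (\<lambda>y. u y + c *s v y) (\<lambda>y. f y + c *s g y) = l u f + c * l v g"
    and bound: "\<And>u f. (u, f) \<in> D \<Longrightarrow> norm (l u f :: complex) \<le> C * (nrm u + nrm f)" and C: "0 \<le> C"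
  obtains p r where "(p, r) \<in> D" "\<And>u f. (u, f) \<in> D \<Longrightarrow> l u f = ip p u + ip r f"
proof -
  have DL: "u \<in> L2" "f \<in> L2" if "(u, f) \<in> D" for u f using D that by (auto simp: pairs_subspace_def)
  have comb: "(\<lambda>y. u y + c *s v y, \<lambda>y. f y + c *s g y) \<in> D" if "(u, f) \<in> D" "(v, g) \<in> D" for u f v g c
    using D that by (simp add: pairs_subspace_def)
  define \<phi> where "\<phi> u f = sq u + sq f - 2 * Re (l u f)" for u f
  have expand: "\<phi> (\<lambda>y. u y + c *s v y) (\<lambda>y. f y + c *s g y) =
      \<phi> u f + 2 * Re (c * (ip u v + ip f g - l v g)) + (norm c)\<^sup>2 * (sq v + sq g)"
    if "(u, f) \<in> D" "(v, g) \<in> D" for u f v g c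
    using DL[OF that(1)] DL[OF that(2)] unfolding \<phi>_def lin[OF that] by (simp add: sq_add_cscale algebra_simps)
  have "- 2 * C\<^sup>2 \<le> \<phi> u f" if "(u, f) \<in> D" for u f
  proof -
    have "Re (l u f) \<le> C * (nrm u + nrm f)" using bound[OF that] complex_Re_le_cmod order_trans by blast
    moreover have "0 \<le> (nrm u - C)\<^sup>2" "0 \<le> (nrm f - C)\<^sup>2" by simp_all
    ultimately show ?thesis unfolding \<phi>_def nrm_square[symmetric] by (simp add: power2_eq_square algebra_simps)
  qed
  then have bdd: "bdd_below ((\<lambda>(u, f). \<phi> u f) ` D)" by (intro bdd_belowI[of _ "- 2 * C\<^sup>2"]) auto
  define m where "m = Inf ((\<lambda>(u, f). \<phi> u f) ` D)"
  have m: "m \<le> \<phi> u f" if "(u, f) \<in> D" for u f unfolding m_def using that by (intro cInf_lower bdd) force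
  \<comment> \<open>Fast enough for \<open>L2_complete\<close>, since \<open>2 (e j + e (j + 1)) \<le> (1/4) ^ j\<close>.\<close>
  define e :: "nat \<Rightarrow> real" where "e j = (1/4) ^ j / 4" for j
  have e: "0 < e j" for j by (simp add: e_def)
  have "\<exists>s. (fst s, snd s) \<in> D \<and> \<phi> (fst s) (snd s) < m + e j" for j
  proof -
    have "(\<lambda>(u, f). \<phi> u f) ` D \<noteq> {}" using D by (auto simp: pairs_subspace_def)
    then obtain z where "z \<in> (\<lambda>(u, f). \<phi> u f) ` D" "z < m + e j"
      using cInf_lessD[of "(\<lambda>(u, f). \<phi> u f) ` D" "m + e j"] e[of j] unfolding m_def by auto
    then show ?thesis by auto
  qed
  then have "\<exists>S. \<forall>j. (fst (S j), snd (S j)) \<in> D \<and> \<phi> (fst (S j)) (snd (S j)) < m + e j" by (intro choice allI)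
  then obtain S where S': "\<And>j. (fst (S j), snd (S j)) \<in> D \<and> \<phi> (fst (S j)) (snd (S j)) < m + e j" by blast
  define U F where "U j = fst (S j)" and "F j = snd (S j)" for j
  have S: "(U j, F j) \<in> D" "\<phi> (U j) (F j) < m + e j" for j using S'[of j] by (simp_all add: U_def F_def)
  note UL = DL[OF S(1)]
  have fast: "sq (\<lambda>y. U i y - U j y) + sq (\<lambda>y. F i y - F j y) \<le> 2 * (e i + e j)" for i j
  proof -
    define d g where "d y = U i y - U j y" and "g y = F i y - F j y" for y
    have dg: "(d, g) \<in> D" using comb[OF S(1)[of i] S(1)[of j], of "-1"] by (simp add: d_def[abs_def] g_def[abs_def] cscale_minus_one)
    define X where "X = Re (ip (U j) d + ip (F j) g - l d g)"
    have A: "\<phi> (U i) (F i) = \<phi> (U j) (F j) + 2 * X + (sq d + sq g)"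
      using expand[OF S(1)[of j] dg, of 1] by (simp add: d_def g_def X_def)
    \<comment> \<open>At the midpoint \<open>\<phi>\<close> is at least its infimum.\<close>
    have "\<phi> (\<lambda>y. U j y + (1/2) *s d y) (\<lambda>y. F j y + (1/2) *s g y) = \<phi> (U j) (F j) + X + (sq d + sq g) / 4"
      using expand[OF S(1)[of j] dg, of "1/2"] by (simp add: X_def power2_eq_square)
    then have B: "m \<le> \<phi> (U j) (F j) + X + (sq d + sq g) / 4"
      using m[OF comb[OF S(1)[of j] dg, of "1/2"]] by linarith
    have "sq d + sq g \<le> 2 * (e i + e j)" using A B S(2)[of i] S(2)[of j] by argo
    then show ?thesis by (simp add: d_def[abs_def] g_def[abs_def])
  qed
  have ee: "2 * (e j + e (Suc j)) \<le> (1/4)^j" for j by (simp add: e_def)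
  have fU: "sq (\<lambda>y. U j y - U (Suc j) y) \<le> (1/4)^j" and fF: "sq (\<lambda>y. F j y - F (Suc j) y) \<le> (1/4)^j" for j
    using fast[of j "Suc j"] ee[of j] sq_nonneg[of "\<lambda>y. U j y - U (Suc j) y"] sq_nonneg[of "\<lambda>y. F j y - F (Suc j) y"] by linarith+
  obtain p where p: "p \<in> L2" "(\<lambda>j. nrm (\<lambda>y. U j y - p y)) \<longlonglongrightarrow> 0" using L2_complete[OF UL(1) fU] by blast
  obtain r where r: "r \<in> L2" "(\<lambda>j. nrm (\<lambda>y. F j y - r y)) \<longlonglongrightarrow> 0" using L2_complete[OF UL(2) fF] by blast
  have "(p, r) \<in> D" using D S(1) p r unfolding pairs_subspace_def by blast
  moreover have "l u f = ip p u + ip r f" if uf: "(u, f) \<in> D" for u f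
  proof -
    define X where "X = ip p u + ip r f - l u f"
    \<comment> \<open>The first variation at the minimiser, as a limit along the minimising sequence.\<close>
    have "0 \<le> 2 * Re (c * X) + (norm c)\<^sup>2 * (sq u + sq f)" for c
    proof (rule LIMSEQ_le)
      have "e \<longlonglongrightarrow> 0" unfolding e_def[abs_def] by (intro tendsto_divide_zero LIMSEQ_power_zero) simp
      then have "(\<lambda>j. - e j) \<longlonglongrightarrow> - 0" by (rule tendsto_minus)
      then show "(\<lambda>j. - e j) \<longlonglongrightarrow> 0" by simp
      show "(\<lambda>j. 2 * Re (c * (ip (U j) u + ip (F j) f - l u f)) + (norm c)\<^sup>2 * (sq u + sq f))
          \<longlonglongrightarrow> 2 * Re (c * X) + (norm c)\<^sup>2 * (sq u + sq f)"
        unfolding X_def using DL[OF uf] by (intro tendsto_intros L2_inner_tendsto_left UL p r)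
      have "- e j \<le> 2 * Re (c * (ip (U j) u + ip (F j) f - l u f)) + (norm c)\<^sup>2 * (sq u + sq f)" for j
        using m[OF comb[OF S(1)[of j] uf, of c]] S(2)[of j] unfolding expand[OF S(1) uf] by linarith
      then show "\<exists>N. \<forall>j\<ge>N. - e j \<le> 2 * Re (c * (ip (U j) u + ip (F j) f - l u f)) + (norm c)\<^sup>2 * (sq u + sq f)"
        by blast
    qed
    then have "(norm X)\<^sup>2 \<le> 0 * (sq u + sq f)"
      by (intro quadratic_nonneg_imp_cauchy_schwarz) (simp_all add: sq_nonneg)
    then have "X = 0" by simp
    then show ?thesis by (simp add: X_def)
  qed
  ultimately show thesis by (rule that)
qed

lemma nrm_eq_if_null_diff:
  assumes "u \<in> L2" "v \<in> L2" "nrm (\<lambda>y. v y - u y) = 0"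
  shows "nrm v = nrm u"
  using nrm_add[OF L2_fun_diff[OF assms(2,1)] assms(1)] nrm_add[OF L2_fun_diff[OF assms(1,2)] assms(2)] assms(3)
  by (simp add: nrm_diff_commute[of u v])

text \<open>The functions \<open>g i\<close> that represent the components are the conjugated rows of the Green's function.\<close>

lemma green_matrix:
  assumes g: "\<And>i. g i \<in> L2" and z: "\<And>f i. f \<in> L2 \<Longrightarrow> (Z f :: complex^'n) $ i = ip (g i) f"
  shows "\<exists>G. (\<forall>j. (\<lambda>y. column j (adj (G y))) \<in> L2) \<and>
     (\<forall>f\<in>L2. Z f = (LINT y:I|M. G y *v (W y *v f y)))"
proof (intro exI conjI allI ballI)
  let ?G = "\<lambda>y. \<chi> i j. cnj (g i y $ j)"
  have "(\<lambda>y. column j (adj (?G y))) = g j" for j by (auto simp: column_def adj_def vec_eq_iff fun_eq_iff)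
  then show "(\<lambda>y. column j (adj (?G y))) \<in> L2" for j using g by simp
  fix f assume f: "f \<in> L2"
  have Gv: "?G y *v (W y *v f y) = (\<Sum>i\<in>UNIV. axis i (form (g i) f y))" for y
    by (simp add: vec_eq_iff matrix_vector_mult_def[of "?G y"] form_def cdot_def axis_def if_distrib sum.delta cong: if_cong)
  have bl: "bounded_linear (\<lambda>z. axis i z :: complex^'n)" for i
    unfolding linear_conv_bounded_linear[symmetric] by (rule linearI) (simp_all add: vec_eq_iff axis_def)
  have sc: "indicator I y *\<^sub>R axis i (form (g i) f y) = (axis i (indicator I y *\<^sub>R form (g i) f y) :: complex^'n)" for i y
    by (simp add: vec_eq_iff axis_def)
  have int: "integrable M (\<lambda>y. indicator I y *\<^sub>R form (g i) f y)" for i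
    using form_integrable[OF g f] by (simp add: set_integrable_def)
  have "(LINT y:I|M. ?G y *v (W y *v f y)) = (LINT y|M. (\<Sum>i\<in>UNIV. axis i (indicator I y *\<^sub>R form (g i) f y)))"
    unfolding set_lebesgue_integral_def Gv by (simp only: scaleR_sum_right sc)
  also have "\<dots> = (\<Sum>i\<in>UNIV. LINT y|M. axis i (indicator I y *\<^sub>R form (g i) f y))"
    by (intro Bochner_Integration.integral_sum integrable_bounded_linear[OF bl] int)
  also have "\<dots> = (\<Sum>i\<in>UNIV. axis i (ip (g i) f))"
    by (simp add: integral_bounded_linear[OF bl int] L2_inner_form set_lebesgue_integral_def)
  also have "\<dots> = Z f" by (simp add: vec_eq_iff axis_def z[OF f] if_distrib sum.delta cong: if_cong)
  finally show "Z f = (LINT y:I|M. ?G y *v (W y *v f y))" ..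
qed

end

context representatives
begin

lemma Tmax_fun_comb:
  assumes u: "(u, f) \<in> Tmax_pairs" and v: "(v, g) \<in> Tmax_pairs"
  shows "(\<lambda>y. u y + c *s v y, \<lambda>y. f y + c *s g y) \<in> Tmax_pairs"
  using u v solves_integral_cscale[of I v g c] unfolding Tmax_fun_iff
  by (auto intro!: solves_integral_add L2_fun_add L2_fun_cscale admissible_add admissible_cscale)

lemma rep_condition_comb:
  assumes u: "(u, f) \<in> Tmax_pairs" and v: "(v, g) \<in> Tmax_pairs"
    and "rep_cond k u" "rep_cond k v"
  shows "rep_cond k (\<lambda>y. u y + c *s v y)"
proof -
  have "((\<lambda>y. c *s v y) \<longlongrightarrow> c *s limit_at k v) (side k)"
    by (rule bounded_linear.tendsto[OF bounded_linear_cscale Tmax_tendsto_limit_at[OF v]])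
  then have "limit_at k (\<lambda>y. u y + c *s v y) = limit_at k u + c *s limit_at k v"
    by (intro limit_at_eq tendsto_add Tmax_tendsto_limit_at[OF u])
  then show ?thesis
    using assms(3,4) unfolding rep_condition_iff[OF Tmax_fun_comb[OF u v]] rep_condition_iff[OF u] rep_condition_iff[OF v]
    by (simp add: cdot_add_right cdot_cscale_right)
qed

text \<open>The description inside the definition of \<open>Erep\<close>.\<close>

definition is_rep :: "(real \<Rightarrow> complex^'n) \<Rightarrow> (real \<Rightarrow> complex^'n) \<Rightarrow> (real \<Rightarrow> complex^'n) \<Rightarrow> bool" where
  "is_rep v u f \<longleftrightarrow> v \<in> cls u \<and> (\<exists>f'\<in>cls f. (v, f') \<in> Tmax_pairs) \<and>
     (\<forall>k. rep_cond k v)"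

lemma is_rep_comb:
  assumes L: "u \<in> L2" "f \<in> L2" "u' \<in> L2" "f' \<in> L2"
    and v: "is_rep v u f" and v': "is_rep v' u' f'"
  shows "is_rep (\<lambda>y. v y + c *s v' y) (\<lambda>y. u y + c *s u' y) (\<lambda>y. f y + c *s f' y)"
proof -
  have cls: "(\<lambda>y. x y + c *s x' y) \<in> cls (\<lambda>y. z y + c *s z' y)"
    if z: "z \<in> L2" "z' \<in> L2" and x: "x \<in> cls z" "x' \<in> cls z'" for x x' z z'
  proof -
    have xL: "x \<in> L2" "nrm (\<lambda>y. x y - z y) = 0" "x' \<in> L2" "nrm (\<lambda>y. x' y - z' y) = 0"
      using x z L2_class_iff by blast+
    have "(\<lambda>y. (x y + c *s x' y) - (z y + c *s z' y)) = (\<lambda>y. (x y - z y) + c *s (x' y - z' y))"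
      by (auto simp: fun_eq_iff vec_eq_iff algebra_simps)
    moreover have "nrm (\<lambda>y. (x y - z y) + c *s (x' y - z' y)) \<le> 0"
      using nrm_add[OF L2_fun_diff[OF xL(1) z(1)] L2_fun_cscale[OF L2_fun_diff[OF xL(3) z(2)], of c]] xL(2,4)
      unfolding nrm_cscale[of c "\<lambda>y. x' y - z' y"] by simp
    ultimately have "nrm (\<lambda>y. (x y + c *s x' y) - (z y + c *s z' y)) = 0" by (simp add: order_antisym)
    then show ?thesis using z xL by (subst L2_class_iff) (auto intro!: L2_fun_add L2_fun_cscale)
  qed
  obtain g g' where g: "g \<in> cls f" "(v, g) \<in> Tmax_pairs" "g' \<in> cls f'" "(v', g') \<in> Tmax_pairs"
    using v v' by (auto simp: is_rep_def)
  have vv: "v \<in> cls u" "v' \<in> cls u'" "\<And>k. rep_cond k v" "\<And>k. rep_cond k v'"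
    using v v' by (auto simp: is_rep_def)
  show ?thesis unfolding is_rep_def
    using cls[OF L(1,3) vv(1,2)] cls[OF L(2,4) g(1,3)] Tmax_fun_comb[OF g(2,4)] rep_condition_comb[OF g(2,4) vv(3,4)]
    by blast
qed

text \<open>The difference of two such representatives solves the homogeneous equation, has norm \<open>0\<close> and
  satisfies all conditions.\<close>

lemma is_rep_unique:
  assumes L: "u \<in> L2" "f \<in> L2" and v: "is_rep v u f" and v': "is_rep v' u f"
  shows "v = v'"
proof -
  let ?d = "\<lambda>y. v y + (- 1) *s v' y"
  have "is_rep ?d (\<lambda>y. u y + (- 1) *s u y) (\<lambda>y. f y + (- 1) *s f y)" by (rule is_rep_comb[OF L L v v'])
  then have d: "is_rep ?d (\<lambda>y. 0) (\<lambda>y. 0)" by (simp add: cscale_minus_one)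
  then obtain g where g: "g \<in> cls (\<lambda>y. 0)" "(?d, g) \<in> Tmax_pairs" by (auto simp: is_rep_def)
  have gL: "g \<in> L2" "nrm g = 0" using g(1) L2_class_iff[OF L2_fun_zero] by auto
  have dL: "?d \<in> L2" "nrm ?d = 0" using d L2_class_iff[OF L2_fun_zero, of ?d] by (auto simp: is_rep_def)
  have d': "admissible ?d" "solves_integral I ?d g" "\<And>y. y \<notin> I \<Longrightarrow> ?d y = 0" using g(2) by (auto simp: Tmax_fun_iff)
  have "AE y in M. y \<in> I \<longrightarrow> W y *v g y = W y *v 0" using nrm_eq_0_iff[OF gL(1)] gL(2) by simp
  then have "solves_integral I ?d (\<lambda>y. 0)"
    using d'(2) increment_cong_Wf[of g "\<lambda>y. 0"] gL(1) L2_fun_zero by (simp add: solves_integral_def)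
  moreover have "AE y in M. y \<in> I \<longrightarrow> W y *v ?d y = 0" using nrm_eq_0_iff[OF dL(1)] dL(2) by simp
  then have "AE y in M. W y *v ?d y = 0" by eventually_elim (use d'(3) in \<open>metis matrix_vector_mult_0_right\<close>)
  ultimately have "nullsol I ?d" using d'(1,3) by (simp add: nullsol_def)
  then have "?d y = 0" for y by (rule nullsol_eq_0) (use d in \<open>simp add: is_rep_def\<close>)
  then show ?thesis by (simp add: fun_eq_iff cscale_minus_one)
qed

lemma is_rep_Erep:
  assumes L: "u \<in> L2" "f \<in> L2" and T: "(cls u, cls f) \<in> Tmax I J q w"
  shows "is_rep (Erep I J q w \<tau> (cls u) (cls f)) u f"
proof -
  obtain u0 f0 where u0: "(u0, f0) \<in> Tmax_pairs" "cls u0 = cls u" "cls f0 = cls f" using T by (auto simp: Tmax_def)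
  obtain h where h: "nullsol I h" "\<And>k. rep_cond k (\<lambda>y. u0 y - h y)"
    using exists_representative[of 0] u0(1) by blast
  have u0L: "u0 \<in> L2" "f0 \<in> L2" using u0(1) by (auto simp: Tmax_fun_iff)
  have hL: "h \<in> L2" "nrm h = 0" using nullsol_L2[OF h(1)] by auto
  have "nrm (\<lambda>y. (u0 y - h y) - u0 y) = nrm h" by (simp add: nrm_minus)
  then have "(\<lambda>y. u0 y - h y) \<in> cls u0" using hL u0L by (simp add: L2_class_iff L2_fun_diff)
  moreover have "f0 \<in> cls f" using L2_class_self[OF u0L(2)] u0(3) by simp
  ultimately have "is_rep (\<lambda>y. u0 y - h y) u f"
    using Tmax_fun_diff_nullsol[OF u0(1) h(1)] h(2) u0(2) unfolding is_rep_def by blast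
  then have "\<exists>!v. is_rep v u f" using is_rep_unique[OF L] by blast
  then have "is_rep (THE v. is_rep v u f) u f" by (rule theI')
  then show ?thesis by (simp add: Erep_def is_rep_def)
qed

end

locale self_adjoint_restriction = representatives a b I w J q \<tau>
  for a b :: ereal and I :: "real set" and w :: "real set \<Rightarrow> complex^'n^'n"
    and J :: "complex^'n^'n" and q :: "real set \<Rightarrow> complex^'n^'n" and \<tau> :: "int \<Rightarrow> real" +
  fixes T :: "('n l2 \<times> 'n l2) set"
  assumes T_Tmax: "T \<subseteq> Tmax I J q w" and T_adj: "adjoint_rel I w T = T"
begin

text \<open>The relation \<open>T\<close> on the level of functions instead of classes.\<close>

definition graph :: "((real \<Rightarrow> complex^'n) \<times> (real \<Rightarrow> complex^'n)) set" where
  "graph = {(u, f). u \<in> L2 \<and> f \<in> L2 \<and> (cls u, cls f) \<in> T}"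

lemma graph_L2: "(u, f) \<in> graph \<Longrightarrow> u \<in> L2" "(u, f) \<in> graph \<Longrightarrow> f \<in> L2"
  by (auto simp: graph_def)

lemma T_graphE:
  assumes "(U, F) \<in> T"
  obtains u f where "(u, f) \<in> graph" "U = cls u" "F = cls f"
proof -
  have "(U, F) \<in> adjoint_rel I w T" using assms T_adj by simp
  then have "U \<in> L2_space I w" "F \<in> L2_space I w" by (auto simp: adjoint_rel_def)
  then obtain u f where uf: "u \<in> L2" "U = cls u" "f \<in> L2" "F = cls f" using L2_spaceE by metis
  then have "(u, f) \<in> graph" using assms by (simp add: graph_def)
  then show thesis using uf that by blast
qed

lemma graph_iff:
  "(v, g) \<in> graph \<longleftrightarrow> v \<in> L2 \<and> g \<in> L2 \<and> (\<forall>(u, f)\<in>graph. ip v f = ip g u)"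
proof -
  have "(cls v, cls g) \<in> T \<longleftrightarrow> (\<forall>(u, f)\<in>graph. ip v f = ip g u)"
    if vg: "v \<in> L2" "g \<in> L2"
  proof -
    have "(cls v, cls g) \<in> T \<longleftrightarrow>
      (\<forall>(U, F)\<in>T. L2_cinner I w (cls v) F = L2_cinner I w (cls g) U)"
      unfolding T_adj[symmetric, THEN eqset_imp_iff, of "(cls v, cls g)"]
      using L2_spaceI[OF vg(1)] L2_spaceI[OF vg(2)] by (simp add: adjoint_rel_def)
    also have "\<dots> \<longleftrightarrow> (\<forall>(u, f)\<in>graph. L2_cinner I w (cls v) (cls f) = L2_cinner I w (cls g) (cls u))"
    proof (intro iffI ballI; clarify)
      fix u f assume "\<forall>(U, F)\<in>T. L2_cinner I w (cls v) F = L2_cinner I w (cls g) U" "(u, f) \<in> graph"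
      then show "L2_cinner I w (cls v) (cls f) = L2_cinner I w (cls g) (cls u)" by (auto simp: graph_def)
    next
      fix U F assume *: "\<forall>(u, f)\<in>graph. L2_cinner I w (cls v) (cls f) = L2_cinner I w (cls g) (cls u)"
        and "(U, F) \<in> T"
      from T_graphE[OF this(2)] obtain u f where uf: "(u, f) \<in> graph" "U = cls u" "F = cls f" by blast
      show "L2_cinner I w (cls v) F = L2_cinner I w (cls g) U" unfolding uf(2,3) using * uf(1) by fast
    qed
    also have "\<dots> \<longleftrightarrow> (\<forall>(u, f)\<in>graph. ip v f = ip g u)"
      by (rule ball_cong) (use vg graph_L2 L2_cinner_class in auto)
    finally show ?thesis .
  qed
  then show ?thesis by (auto simp: graph_def)
qed

lemma graph_symmetric: "(v, g) \<in> graph \<Longrightarrow> (u, f) \<in> graph \<Longrightarrow> ip v f = ip g u"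
  using graph_iff[of v g] by blast

text \<open>An adjoint is always a closed linear relation.\<close>

lemma graph_subspace: "pairs_subspace graph"
  unfolding pairs_subspace_def
proof (intro conjI allI impI)
  show "graph \<subseteq> L2 \<times> L2" by (auto simp: graph_def)
  have "ip (\<lambda>y. 0) f = 0" if "f \<in> L2" for f using L2_inner_null_left[OF L2_fun_zero that] by simp
  then show "(\<lambda>y. 0, \<lambda>y. 0) \<in> graph" unfolding graph_iff using L2_fun_zero graph_L2 by auto
next
  fix u f v g c assume uv: "(u, f) \<in> graph" "(v, g) \<in> graph"
  show "(\<lambda>y. u y + c *s v y, \<lambda>y. f y + c *s g y) \<in> graph"
    unfolding graph_iff[of "\<lambda>y. u y + c *s v y"]
  proof (intro conjI ballI; clarify?)
    show "(\<lambda>y. u y + c *s v y) \<in> L2" "(\<lambda>y. f y + c *s g y) \<in> L2"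
      using graph_L2 uv by (intro L2_fun_add L2_fun_cscale; blast)+
    fix p r assume pr: "(p, r) \<in> graph"
    show "ip (\<lambda>y. u y + c *s v y) r = ip (\<lambda>y. f y + c *s g y) p"
      using graph_symmetric[OF uv(1) pr] graph_symmetric[OF uv(2) pr] graph_L2[OF uv(1)] graph_L2[OF uv(2)] graph_L2[OF pr]
      by (simp add: L2_inner_add_left L2_inner_cscale_left L2_fun_cscale)
  qed
next
  fix U F u f assume UF: "\<forall>j::nat. (U j, F j) \<in> graph" and L: "u \<in> L2" "f \<in> L2"
    and lim: "(\<lambda>j. nrm (\<lambda>y. U j y - u y)) \<longlonglongrightarrow> 0" "(\<lambda>j. nrm (\<lambda>y. F j y - f y)) \<longlonglongrightarrow> 0"
  have UL: "U j \<in> L2" "F j \<in> L2" for j using UF graph_L2 by blast+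
  have "ip u r = ip f p" if pr: "(p, r) \<in> graph" for p r
  proof (rule LIMSEQ_unique)
    show "(\<lambda>j. ip (U j) r) \<longlonglongrightarrow> ip u r" by (rule L2_inner_tendsto_left[OF UL(1) L(1) graph_L2(2)[OF pr] lim(1)])
    have "ip (U j) r = ip (F j) p" for j using UF graph_symmetric pr by blast
    then show "(\<lambda>j. ip (U j) r) \<longlonglongrightarrow> ip f p"
      using L2_inner_tendsto_left[OF UL(2) L(2) graph_L2(1)[OF pr] lim(2)] by simp
  qed
  then show "(u, f) \<in> graph" unfolding graph_iff[of u f] using L by blast
qed

lemma graph_comb: "(u, f) \<in> graph \<Longrightarrow> (v, g) \<in> graph \<Longrightarrow> (\<lambda>y. u y + c *s v y, \<lambda>y. f y + c *s g y) \<in> graph"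
  using graph_subspace by (simp add: pairs_subspace_def)

definition rep :: "(real \<Rightarrow> complex^'n) \<Rightarrow> (real \<Rightarrow> complex^'n) \<Rightarrow> real \<Rightarrow> complex^'n" where
  "rep u f = Erep I J q w \<tau> (cls u) (cls f)"

lemma rep_is_rep: "(u, f) \<in> graph \<Longrightarrow> is_rep (rep u f) u f"
  unfolding rep_def using T_Tmax by (intro is_rep_Erep) (auto simp: graph_def)

lemma rep_comb:
  assumes "(u, f) \<in> graph" "(v, g) \<in> graph"
  shows "rep (\<lambda>y. u y + c *s v y) (\<lambda>y. f y + c *s g y) = (\<lambda>y. rep u f y + c *s rep v g y)"
proof (rule is_rep_unique)
  note g = graph_comb[OF assms, of c]
  show "(\<lambda>y. u y + c *s v y) \<in> L2" "(\<lambda>y. f y + c *s g y) \<in> L2" using graph_L2[OF g] .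
  show "is_rep (rep (\<lambda>y. u y + c *s v y) (\<lambda>y. f y + c *s g y)) (\<lambda>y. u y + c *s v y) (\<lambda>y. f y + c *s g y)" by (rule rep_is_rep[OF g])
  show "is_rep (\<lambda>y. rep u f y + c *s rep v g y) (\<lambda>y. u y + c *s v y) (\<lambda>y. f y + c *s g y)"
    using graph_L2[OF assms(1)] graph_L2[OF assms(2)] assms by (intro is_rep_comb rep_is_rep)
qed

lemma rep_bound:
  assumes x: "x \<in> I"
  obtains C where "0 \<le> C" "\<And>u f. (u, f) \<in> graph \<Longrightarrow> norm (rep u f x) \<le> C * (nrm u + nrm f)"
proof -
  obtain C where C: "0 \<le> C" "\<And>v f. (v, f) \<in> Tmax_pairs \<Longrightarrow> (\<And>k. rep_cond k v) \<Longrightarrow>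
     norm (v x) \<le> C * (nrm v + nrm f)" using representative_bound[OF x] by blast
  have "norm (rep u f x) \<le> C * (nrm u + nrm f)" if uf: "(u, f) \<in> graph" for u f
  proof -
    note L = graph_L2[OF uf]
    obtain g where g: "rep u f \<in> cls u" "g \<in> cls f" "(rep u f, g) \<in> Tmax_pairs"
      "\<And>k. rep_cond k (rep u f)" using rep_is_rep[OF uf] unfolding is_rep_def by blast
    have "nrm (rep u f) = nrm u" "nrm g = nrm f" using g(1,2) L by (auto simp: L2_class_iff intro!: nrm_eq_if_null_diff)
    then show ?thesis using C(2)[OF g(3,4)] by simp
  qed
  then show thesis using C(1) that by blast
qed

lemma L2_add_scale_class:
  "u \<in> L2 \<Longrightarrow> g \<in> L2 \<Longrightarrow>
     L2_add I w (cls g) (L2_scale I w c (cls u)) = cls (\<lambda>y. g y + c *s u y)"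
  using L2_add_class[OF _ L2_fun_cscale] by (simp add: L2_scale_class)

lemma L2_fun_add_cscale: "u \<in> L2 \<Longrightarrow> g \<in> L2 \<Longrightarrow> (\<lambda>y. g y + c *s u y) \<in> L2"
  by (rule L2_fun_add[OF _ L2_fun_cscale])

lemma shift_rel_iff:
  assumes f: "f \<in> L2"
  shows "(U, cls f) \<in> shift_rel I w T \<zeta> \<longleftrightarrow> (\<exists>u. U = cls u \<and> (u, \<lambda>y. \<zeta> *s u y + f y) \<in> graph)"
proof
  assume "(U, cls f) \<in> shift_rel I w T \<zeta>"
  then obtain F where UF: "(U, F) \<in> T" "cls f = L2_add I w F (L2_scale I w (- \<zeta>) U)"
    by (auto simp: shift_rel_def)
  obtain u g where g: "(u, g) \<in> graph" "U = cls u" "F = cls g" using T_graphE[OF UF(1)] by blast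
  note L = graph_L2[OF g(1)]
  have sL: "(\<lambda>y. \<zeta> *s u y + f y) \<in> L2" using L f by (intro L2_fun_add L2_fun_cscale)
  have "cls f = cls (\<lambda>y. g y + (- \<zeta>) *s u y)" using UF(2) unfolding g(2,3) L2_add_scale_class[OF L] .
  then have "nrm (\<lambda>y. f y - (g y + (- \<zeta>) *s u y)) = 0" unfolding L2_class_eq_iff[OF f L2_fun_add_cscale[OF L]] .
  moreover have "(\<lambda>y. f y - (g y + (- \<zeta>) *s u y)) = (\<lambda>y. (\<zeta> *s u y + f y) - g y)" by (simp add: vec_eq_iff fun_eq_iff)
  ultimately have "cls (\<lambda>y. \<zeta> *s u y + f y) = cls g" using sL L by (simp add: L2_class_eq_iff)
  then show "\<exists>u. U = cls u \<and> (u, \<lambda>y. \<zeta> *s u y + f y) \<in> graph"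
    using g(1,2) sL by (intro exI[of _ u]) (simp add: graph_def)
next
  assume "\<exists>u. U = cls u \<and> (u, \<lambda>y. \<zeta> *s u y + f y) \<in> graph"
  then obtain u where u: "U = cls u" "(u, \<lambda>y. \<zeta> *s u y + f y) \<in> graph" by blast
  have "(\<lambda>y. (\<zeta> *s u y + f y) + (- \<zeta>) *s u y) = f" by (simp add: vec_eq_iff fun_eq_iff)
  then have "L2_add I w (cls (\<lambda>y. \<zeta> *s u y + f y)) (L2_scale I w (- \<zeta>) U) = cls f"
    unfolding u(1) L2_add_scale_class[OF graph_L2[OF u(2)]] by simp
  moreover have "(U, cls (\<lambda>y. \<zeta> *s u y + f y)) \<in> T" using u by (simp add: graph_def)
  ultimately show "(U, cls f) \<in> shift_rel I w T \<zeta>" unfolding shift_rel_def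
    by (intro image_eqI[of _ _ "(U, cls (\<lambda>y. \<zeta> *s u y + f y))"]) simp_all
qed

lemma resolvent_solution:
  assumes z: "\<zeta> \<in> resolvent_set I w T" and f: "f \<in> L2"
  shows "\<exists>u. (u, \<lambda>y. \<zeta> *s u y + f y) \<in> graph"
proof -
  have "cls f \<in> Range (shift_rel I w T \<zeta>)" using z L2_spaceI[OF f] by (simp add: resolvent_set_def)
  then show ?thesis using shift_rel_iff[OF f] by auto
qed

text \<open>Injectivity of \<open>T - \<zeta>\<close> makes the value of the resolvent unique.\<close>

lemma resolvent_rep_eq:
  assumes z: "\<zeta> \<in> resolvent_set I w T" and f: "f \<in> L2" and u: "(u, \<lambda>y. \<zeta> *s u y + f y) \<in> graph"
  shows "resolvent_rep I J q w \<tau> T \<zeta> (cls f) = rep u (\<lambda>y. \<zeta> *s u y + f y)"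
proof -
  note L = graph_L2[OF u]
  have "resolvent I w T \<zeta> (cls f) = cls u" unfolding resolvent_def
  proof (rule the_equality)
    show "(cls u, cls f) \<in> shift_rel I w T \<zeta>" using shift_rel_iff[OF f] u by blast
  next
    fix V assume "(V, cls f) \<in> shift_rel I w T \<zeta>"
    then obtain v where v: "V = cls v" "(v, \<lambda>y. \<zeta> *s v y + f y) \<in> graph" using shift_rel_iff[OF f] by blast
    let ?d = "\<lambda>y. v y + (- 1) *s u y"
    note d = graph_comb[OF v(2) u, of "-1"]
    moreover have "(\<lambda>y. (\<zeta> *s v y + f y) + (- 1) *s (\<zeta> *s u y + f y)) = (\<lambda>y. \<zeta> *s ?d y + 0)"
      by (simp add: vec_eq_iff fun_eq_iff algebra_simps)
    ultimately have "(?d, \<lambda>y. \<zeta> *s ?d y + 0) \<in> graph" by simp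
    then have "(cls ?d, L2_zero I w) \<in> shift_rel I w T \<zeta>"
      unfolding L2_zero_def shift_rel_iff[OF L2_fun_zero] by blast
    then have "cls ?d \<in> {U. (U, L2_zero I w) \<in> shift_rel I w T \<zeta>}" by simp
    also have "\<dots> = {L2_zero I w}" using z by (simp add: resolvent_set_def)
    finally have "cls ?d = cls (\<lambda>y. 0)" by (simp add: L2_zero_def)
    then have "nrm (\<lambda>y. ?d y - 0) = 0" using graph_L2(1)[OF d] L2_fun_zero by (subst (asm) L2_class_eq_iff) auto
    then show "V = cls u" unfolding v(1) using graph_L2(1)[OF v(2)] L(1) by (simp add: L2_class_eq_iff cscale_minus_one)
  qed
  then show ?thesis using L f by (simp add: resolvent_rep_def rep_def L2_scale_class L2_add_class L2_fun_cscale)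
qed

text \<open>For non-real \<open>\<zeta>\<close> the resolvent is bounded because the relation is symmetric.\<close>

lemma resolvent_norm_bound:
  assumes u: "(u, \<lambda>y. \<zeta> *s u y + f y) \<in> graph" and f: "f \<in> L2"
  shows "\<bar>Im \<zeta>\<bar> * nrm u \<le> nrm f"
proof -
  note L = graph_L2(1)[OF u]
  have "ip u (\<lambda>y. \<zeta> *s u y + f y) = ip (\<lambda>y. \<zeta> *s u y + f y) u" by (rule graph_symmetric[OF u u])
  then have "\<zeta> * of_real (sq u) + ip u f = cnj \<zeta> * of_real (sq u) + cnj (ip u f)"
    using L f L2_inner_cnj[OF f L]
    by (simp add: L2_inner_add_left L2_inner_add_right L2_inner_cscale_left L2_inner_cscale_right L2_fun_cscale L2_inner_self)
  then have "Im (\<zeta> * of_real (sq u) + ip u f) = Im (cnj \<zeta> * of_real (sq u) + cnj (ip u f))" by simp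
  then have "Im \<zeta> * sq u = - Im (ip u f)" by simp
  then have "\<bar>Im \<zeta>\<bar> * sq u = \<bar>Im (ip u f)\<bar>" using sq_nonneg[of u] by (metis abs_minus_cancel abs_mult abs_of_nonneg)
  also have "\<dots> \<le> norm (ip u f)" by (rule abs_Im_le_cmod)
  also have "\<dots> \<le> nrm u * nrm f" by (rule L2_cauchy_schwarz_nrm[OF L f])
  finally have "nrm u * (\<bar>Im \<zeta>\<bar> * nrm u) \<le> nrm u * nrm f" by (simp add: nrm_square[symmetric] power2_eq_square algebra_simps)
  then show ?thesis by (cases "nrm u = 0") (auto simp: mult_le_cancel_left_pos less_le)
qed

text \<open>For real \<open>\<zeta>\<close> the point evaluation is represented in the graph, and the symmetry of the resolvent
  moves the resolvent to the representing element.  For non-real \<open>\<zeta>\<close> the composition of the bounded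
  resolvent with the point evaluation is represented directly.\<close>

lemma resolvent_functional:
  assumes x: "x \<in> I" and z: "\<zeta> \<in> resolvent_set I w T"
  shows "\<exists>g\<in>L2. \<forall>f\<in>L2. resolvent_rep I J q w \<tau> T \<zeta> (cls f) x $ i = ip g f"
proof -
  obtain C where C: "0 \<le> C" "\<And>u f. (u, f) \<in> graph \<Longrightarrow> norm (rep u f x) \<le> C * (nrm u + nrm f)" using rep_bound[OF x] by blast
  obtain R where R: "\<And>f. f \<in> L2 \<Longrightarrow> (R f, \<lambda>y. \<zeta> *s R f y + f y) \<in> graph" using resolvent_solution[OF z] by metis
  have rr: "resolvent_rep I J q w \<tau> T \<zeta> (cls f) = rep (R f) (\<lambda>y. \<zeta> *s R f y + f y)" if "f \<in> L2" for f
    by (rule resolvent_rep_eq[OF z that R[OF that]])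
  show ?thesis
  proof (cases "Im \<zeta> = 0")
    case True
    then have cz: "cnj \<zeta> = \<zeta>" by (simp add: complex_eq_iff)
    obtain p r where pr: "(p, r) \<in> graph" "\<And>u f. (u, f) \<in> graph \<Longrightarrow> rep u f x $ i = ip p u + ip r f"
    proof (rule riesz_representation[OF graph_subspace, of "\<lambda>u f. rep u f x $ i" C])
      show "rep (\<lambda>y. u y + c *s v y) (\<lambda>y. f y + c *s g y) x $ i = rep u f x $ i + c * rep v g x $ i"
        if "(u, f) \<in> graph" "(v, g) \<in> graph" for u f v g c using rep_comb[OF that] by simp
      show "norm (rep u f x $ i) \<le> C * (nrm u + nrm f)" if "(u, f) \<in> graph" for u f
        by (rule order_trans[OF Finite_Cartesian_Product.norm_nth_le C(2)[OF that]])
    qed (use C(1) in auto)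
    note pL = graph_L2[OF pr(1)]
    define h where "h y = p y + \<zeta> *s r y" for y
    have hL: "h \<in> L2" unfolding h_def[abs_def] using pL by (intro L2_fun_add L2_fun_cscale)
    have "rep (R f) (\<lambda>y. \<zeta> *s R f y + f y) x $ i = ip (\<lambda>y. R h y + r y) f" if f: "f \<in> L2" for f
    proof -
      note RL = graph_L2(1)[OF R[OF f]] graph_L2(1)[OF R[OF hL]]
      have "ip (R h) (\<lambda>y. \<zeta> *s R f y + f y) = ip (\<lambda>y. \<zeta> *s R h y + h y) (R f)"
        by (rule graph_symmetric[OF R[OF hL] R[OF f]])
      then have "ip (R h) f = ip h (R f)"
        using RL f hL by (simp add: L2_inner_add_left L2_inner_add_right L2_inner_cscale_left L2_inner_cscale_right L2_fun_cscale cz)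
      also have "\<dots> = ip p (R f) + \<zeta> * ip r (R f)"
        unfolding h_def[abs_def] using RL pL by (simp add: L2_inner_add_left L2_inner_cscale_left L2_fun_cscale cz)
      finally show ?thesis unfolding pr(2)[OF R[OF f]] using RL pL f
        by (simp add: L2_inner_add_left L2_inner_add_right L2_inner_cscale_right L2_fun_cscale)
    qed
    moreover have "(\<lambda>y. R h y + r y) \<in> L2" using graph_L2(1)[OF R[OF hL]] pL by (intro L2_fun_add)
    ultimately show ?thesis using rr by (intro bexI[of _ "\<lambda>y. R h y + r y"]) auto
  next
    case False
    define l where "l f g = rep (R f) (\<lambda>y. \<zeta> *s R f y + f y) x $ i" for f and g :: "real \<Rightarrow> complex^'n"
    define K where "K = 1 / \<bar>Im \<zeta>\<bar>"
    have K: "0 \<le> K" by (simp add: K_def)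
    have lz: "pairs_subspace {(f, g). f \<in> L2 \<and> g \<in> L2}"
      unfolding pairs_subspace_def using L2_fun_zero by (auto intro!: L2_fun_add L2_fun_cscale)
    obtain p r where pr: "p \<in> L2" "r \<in> L2"
      "\<And>f g. f \<in> L2 \<Longrightarrow> g \<in> L2 \<Longrightarrow> l f g = ip p f + ip r g"
    proof (rule riesz_representation[OF lz, of l "C * (K + (norm \<zeta> * K + 1))"])
      show "l (\<lambda>y. f y + c *s f' y) (\<lambda>y. g y + c *s g' y) = l f g + c * l f' g'"
        if "(f, g) \<in> {(f, g). f \<in> L2 \<and> g \<in> L2}" "(f', g') \<in> {(f, g). f \<in> L2 \<and> g \<in> L2}" for f g f' g' c
      proof -
        have f: "f \<in> L2" "f' \<in> L2" using that by auto
        let ?u = "\<lambda>y. R f y + c *s R f' y" and ?f = "\<lambda>y. f y + c *s f' y"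
        have e: "(\<lambda>y. \<zeta> *s R f y + f y + c *s (\<zeta> *s R f' y + f' y)) = (\<lambda>y. \<zeta> *s ?u y + ?f y)"
          by (simp add: vec_eq_iff fun_eq_iff algebra_simps)
        have fL: "?f \<in> L2" using f by (intro L2_fun_add L2_fun_cscale)
        have "rep (R ?f) (\<lambda>y. \<zeta> *s R ?f y + ?f y) = rep ?u (\<lambda>y. \<zeta> *s ?u y + ?f y)"
          using resolvent_rep_eq[OF z fL, of ?u] graph_comb[OF R[OF f(1)] R[OF f(2)], of c] rr[OF fL] unfolding e by simp
        also have "\<dots> = (\<lambda>y. rep (R f) (\<lambda>y. \<zeta> *s R f y + f y) y + c *s rep (R f') (\<lambda>y. \<zeta> *s R f' y + f' y) y)"
          using rep_comb[OF R[OF f(1)] R[OF f(2)], of c] unfolding e .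
        finally show ?thesis by (simp add: l_def)
      qed
      show "norm (l f g) \<le> C * (K + (norm \<zeta> * K + 1)) * (nrm f + nrm g)"
        if "(f, g) \<in> {(f, g). f \<in> L2 \<and> g \<in> L2}" for f g
      proof -
        have f: "f \<in> L2" using that by auto
        note RL = graph_L2(1)[OF R[OF f]]
        have u: "nrm (R f) \<le> K * nrm f" using resolvent_norm_bound[OF R[OF f] f] False by (simp add: K_def field_simps)
        have "nrm (\<lambda>y. \<zeta> *s R f y + f y) \<le> norm \<zeta> * nrm (R f) + nrm f"
          using nrm_add[OF L2_fun_cscale[OF RL] f, of \<zeta>] by (simp add: nrm_cscale)
        also have "\<dots> \<le> norm \<zeta> * (K * nrm f) + nrm f" using u by (intro add_mono mult_left_mono) auto
        finally have "C * (nrm (R f) + nrm (\<lambda>y. \<zeta> *s R f y + f y)) \<le> C * (K * nrm f + (norm \<zeta> * (K * nrm f) + nrm f))"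
          using u C(1) by (intro mult_left_mono add_mono) auto
        moreover have "norm (l f g) \<le> C * (nrm (R f) + nrm (\<lambda>y. \<zeta> *s R f y + f y))"
          unfolding l_def by (rule order_trans[OF Finite_Cartesian_Product.norm_nth_le C(2)[OF R[OF f]]])
        moreover have "0 \<le> C * (K + (norm \<zeta> * K + 1)) * nrm g" using C(1) K by (intro mult_nonneg_nonneg add_nonneg_nonneg) auto
        ultimately show ?thesis by (simp add: algebra_simps)
      qed
      show "0 \<le> C * (K + (norm \<zeta> * K + 1))" using C(1) K by (intro mult_nonneg_nonneg add_nonneg_nonneg) auto
    qed auto
    have "l f (\<lambda>y. 0) = ip p f" if "f \<in> L2" for f
      using pr(3)[OF that L2_fun_zero] L2_inner_null_right[OF pr(2) L2_fun_zero] by simp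
    then show ?thesis using pr(1) rr unfolding l_def by (intro bexI[of _ p]) auto
  qed
qed

lemma green_function:
  assumes x: "x \<in> I" and z: "\<zeta> \<in> resolvent_set I w T"
  shows "\<exists>G :: real \<Rightarrow> complex^'n^'n. (\<forall>j. (\<lambda>y. column j (adj (G y))) \<in> L2) \<and>
      (\<forall>f\<in>L2. resolvent_rep I J q w \<tau> T \<zeta> (cls f) x =
         (LINT y:I|base_measure I w. G y *v (density_mat I w y *v f y)))"
proof -
  obtain g where "\<And>i. g i \<in> L2"
    "\<And>i f. f \<in> L2 \<Longrightarrow> resolvent_rep I J q w \<tau> T \<zeta> (cls f) x $ i = ip (g i) f"
    using resolvent_functional[OF x z] by metis
  then show ?thesis by (rule green_matrix)
qed

end

theorem theorem6p1:
  fixes a b :: ereal and I :: "real set"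
    and J :: "complex^'n^'n"
    and q w :: "real set \<Rightarrow> complex^'n^'n"
    and \<tau> :: "int \<Rightarrow> real"
    and T :: "('n l2 \<times> 'n l2) set"
  assumes "a < b" and "I = einterval a b"
    and "invertible J" and "adj J = - J"
    and "order0_distr I q" and "hermitian_distr I q"
    and "order0_distr I w" and "nonneg_distr I w"
    and "strict_mono \<tau>" and "range \<tau> \<subseteq> I"
    and "{z. z islimpt range (\<lambda>k. ereal (\<tau> k))} = {a, b}"
    and "Xi0 I J q w \<subseteq> range \<tau>"
    and "B_plus J q w (\<tau> 0) 0 = J" and "B_minus J q w (\<tau> 0) 0 = J"
    and "jump w (\<tau> 0) = 0"
    and "T \<subseteq> Tmax I J q w" and "adjoint_rel I w T = T"
  shows "\<forall>x\<in>I. \<forall>\<zeta>\<in>resolvent_set I w T.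
    \<exists>G :: real \<Rightarrow> complex^'n^'n.
      (\<forall>j. (\<lambda>y. column j (adj (G y))) \<in> L2_fun I w) \<and>
      (\<forall>f\<in>L2_fun I w.
         resolvent_rep I J q w \<tau> T \<zeta> (L2_class I w f) x =
           (LINT y:I|base_measure I w. G y *v (density_mat I w y *v f y)))"
proof -
  interpret self_adjoint_restriction a b I w J q \<tau> T by unfold_locales (fact assms)+
  show ?thesis using green_function by blast
qed

end
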